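(* Suppose $\phi:\mathbb{R}^d\to\mathbb{R}$ satisfies Assumption 2 (stated in the context) with parameters $s$ and $L$. Let $\Omega\subset\mathbb{R}^d$ be a bounded open set with Lipschitz boundary, let $K,\Gamma>0$, and let $\sigma\ge0$ satisfy $\lceil\sigma\rceil<s+d/2$. Then there are constants $C>0$ and $h_0>0$, such that for every finite $\Xi\subset\Omega$ with fill distance $h=h_{\Xi,\Omega}\le h_0$, every local polynomial reproduction $a:\Xi\times\Omega\to\mathbb{R}$ of order $L$ with constants $K,\Gamma$, and every $f=\phi*\nu+p$ with $p$ a polynomial and $\nu\in L_2(\mathbb{R}^d)$ supported in $\Omega$, the approximant $$T_\Xi f(x)=\sum_{\xi\in\Xi}\Bigl(\int_\Omega a(\xi,z)\nu(z)\,dz\Bigr)\phi(x-\xi)+p(x)$$ satisfies $$\|f-T_\Xi f\|_{W_2^{\sigma}(\mathbb{R}^d)}\le C\,h^{s+d-\sigma}\,\|\nu\|_{L_2(\mathbb{R}^d)} .$$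
   Context: Fill distance: $h_{\Xi,\Omega}=\sup_{x\in\Omega}\mathrm{dist}(x,\Xi)$. $W_2^\sigma(\mathbb{R}^d)$ is the usual $L_2$-Sobolev space (Sobolev–Slobodeckij for fractional $\sigma$, with norm equivalent to $(\int|\mathcal{F}u|^2(1+|\omega|^2)^\sigma d\omega)^{1/2}$). For $s\ge0$ let $\mathsf{h}_s(x)=|x|^s$ if $s\notin2\mathbb{N}$ and $\mathsf{h}_s(x)=|x|^s\log|x|$ if $s\in2\mathbb{N}$. Assumption 2: $s>d/2$, $L$ is a positive integer with $L>s+d$, $\phi\in C(\mathbb{R}^d)\cap C^{s+d-1}(\mathbb{R}^d\setminus\{0\})$ is radially symmetric (here $C^{s+d-1}$ means that $D^\beta\phi$ is continuous for all $|\beta|\le s+d-1$), and there is $r_0>0$ such that (1) there is a constant $C$ with $|D^\beta\phi(x)|\le C|x|^{s-|\beta|}$ for all multi-indices $|\beta|=L$ and all $|x|>r_0$ (in particular $\phi$ is $L$ times continuously differentiable there); (2) there are $u,v\in C^L(\overline{B(0,r_0)})$ with $\phi(x)=u(x)+\mathsf{h}_s(x)v(x)$ for $|x|<r_0$. Local polynomial reproduction of order $L$ with constants $K,\Gamma$ (relative to $\Xi\subset\Omega$, $h=h_{\Xi,\Omega}$): a map $a:\Xi\times\Omega\to\mathbb{R}$ such that for every $z\in\Omega$: $a(\xi,z)=0$ whenever $\mathrm{dist}(\xi,z)>Kh$; $\sum_{\xi\in\Xi}|a(\xi,z)|\le\Gamma$; $\sum_{\xi\in\Xi}a(\xi,z)p(\xi)=p(z)$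 for every polynomial $p$ of degree at most $L$; and for every $\xi\in\Xi$ the function $a(\xi,\cdot)$ is measurable. *)

theory Defs
  imports "HOL-Analysis.Analysis"
begin

section \<open>Classical partial derivatives\<close>

text \<open>A multi-index is a function \<open>\<beta> :: 'n \<Rightarrow> nat\<close> on the coordinates of \<open>real^'n\<close>.\<close>

definition mdeg :: "('n::finite \<Rightarrow> nat) \<Rightarrow> nat" where
  "mdeg \<beta> = (\<Sum>i\<in>UNIV. \<beta> i)"

definition partial :: "'n::finite \<Rightarrow> (real^'n \<Rightarrow> real) \<Rightarrow> real^'n \<Rightarrow> real" where
  "partial i f x = deriv (\<lambda>t. f (x + t *\<^sub>R axis i 1)) 0"

text \<open>The derivative \<open>D\<^sup>\<beta> f\<close>. The order in which the partial derivatives are taken is an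
  arbitrary choice; it is irrelevant on open sets where \<open>f\<close> is \<open>mdeg \<beta>\<close> times continuously
  differentiable, the only place where \<open>mderiv\<close> is used.\<close>

definition mderiv :: "('n::finite \<Rightarrow> nat) \<Rightarrow> (real^'n \<Rightarrow> real) \<Rightarrow> real^'n \<Rightarrow> real" where
  "mderiv \<beta> f = foldr partial (SOME js. \<forall>i. count_list js i = \<beta> i) f"

text \<open>\<open>C\<^sup>k(S)\<close> for open \<open>S\<close>: all iterated partial derivatives of order at most \<open>k\<close>, in any order
  of differentiation, exist and are continuous on \<open>S\<close>.\<close>

primrec Ck_on :: "nat \<Rightarrow> (real^'n::finite) set \<Rightarrow> (real^'n \<Rightarrow> real) \<Rightarrow> bool" where
  "Ck_on 0 S f \<longleftrightarrow> continuous_on S f"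
| "Ck_on (Suc k) S f \<longleftrightarrow> continuous_on S f \<and>
     (\<forall>i. (\<forall>x\<in>S. (\<lambda>t. f (x + t *\<^sub>R axis i 1)) differentiable (at 0)) \<and> Ck_on k S (partial i f))"

text \<open>\<open>C\<^sup>k\<close> on the closure of an open set \<open>S\<close>: the derivatives of order at most \<open>k\<close> exist in \<open>S\<close> and
  extend continuously to the closure.\<close>

definition Ck_on_closure :: "nat \<Rightarrow> (real^'n::finite) set \<Rightarrow> (real^'n \<Rightarrow> real) \<Rightarrow> bool" where
  "Ck_on_closure k S f \<longleftrightarrow> Ck_on k S f \<and> continuous_on (closure S) f \<and>
     (\<forall>\<beta>. mdeg \<beta> \<le> k \<longrightarrow> (\<exists>g. continuous_on (closure S) g \<and> (\<forall>x\<in>S. g x = mderiv \<beta> f x)))"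

section \<open>The kernel\<close>

text \<open>At the origin both branches take the value \<open>0\<close>, because \<open>0 powr s = 0\<close>.\<close>

definition h_fun :: "real \<Rightarrow> real^'n::finite \<Rightarrow> real" where
  "h_fun s x = (if \<exists>k::nat. s = 2 * real k then norm x powr s * ln (norm x) else norm x powr s)"

text \<open>Since only integer orders of differentiation occur, \<open>C\<close> of class \<open>s + d - 1\<close> means class
  \<open>\<lfloor>s + d - 1\<rfloor>\<close>; this number is nonnegative because \<open>s > d/2\<close>.\<close>

definition kernel_assumption :: "(real^'n::finite \<Rightarrow> real) \<Rightarrow> real \<Rightarrow> nat \<Rightarrow> bool" where
  "kernel_assumption \<phi> s L \<longleftrightarrow>
     s > real CARD('n) / 2 \<and> L > 0 \<and> real L > s + real CARD('n) \<and>
     continuous_on UNIV \<phi> \<and>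
     Ck_on (nat \<lfloor>s + real CARD('n) - 1\<rfloor>) (UNIV - {0}) \<phi> \<and>
     (\<forall>x y. norm x = norm y \<longrightarrow> \<phi> x = \<phi> y) \<and>
     (\<exists>r0>0.
        Ck_on L {x. norm x > r0} \<phi> \<and>
        (\<exists>C. \<forall>\<beta> x. mdeg \<beta> = L \<longrightarrow> norm x > r0 \<longrightarrow>
               \<bar>mderiv \<beta> \<phi> x\<bar> \<le> C * norm x powr (s - real (mdeg \<beta>))) \<and>
        (\<exists>u v. Ck_on_closure L (ball 0 r0) u \<and> Ck_on_closure L (ball 0 r0) v \<and>
               (\<forall>x. norm x < r0 \<longrightarrow> \<phi> x = u x + h_fun s x * v x)))"

section \<open>Domains, point sets and local polynomial reproductions\<close>

text \<open>Near every boundary point \<open>x\<close> the set lies strictly on one side of the graph of a Lipschitz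
  function \<open>\<gamma>\<close> over the hyperplane orthogonal to a unit vector \<open>e\<close>.\<close>

definition lipschitz_boundary :: "(real^'n::finite) set \<Rightarrow> bool" where
  "lipschitz_boundary \<Omega> \<longleftrightarrow>
     (\<forall>x\<in>frontier \<Omega>. \<exists>r>0. \<exists>e M \<gamma>. norm e = 1 \<and> M-lipschitz_on {w. w \<bullet> e = 0} \<gamma> \<and>
        \<Omega> \<inter> ball x r = {y \<in> ball x r. y \<bullet> e > \<gamma> (y - (y \<bullet> e) *\<^sub>R e)})"

text \<open>Meaningful for nonempty \<open>\<Xi>\<close> only, since \<open>infdist x {} = 0\<close>.\<close>

definition fill_distance :: "(real^'n::finite) set \<Rightarrow> (real^'n) set \<Rightarrow> real" where
  "fill_distance \<Xi> \<Omega> = (SUP x\<in>\<Omega>. infdist x \<Xi>)"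

definition polynomial_deg_le :: "nat \<Rightarrow> (real^'n::finite \<Rightarrow> real) \<Rightarrow> bool" where
  "polynomial_deg_le m p \<longleftrightarrow>
     (\<exists>c. \<forall>x. p x = (\<Sum>\<beta> | mdeg \<beta> \<le> m. c \<beta> * (\<Prod>i\<in>UNIV. (x $ i) ^ \<beta> i)))"

definition local_polynomial_reproduction ::
    "nat \<Rightarrow> real \<Rightarrow> real \<Rightarrow> (real^'n::finite) set \<Rightarrow> (real^'n) set \<Rightarrow> (real^'n \<Rightarrow> real^'n \<Rightarrow> real) \<Rightarrow> bool"
  where
  "local_polynomial_reproduction L K \<Gamma> \<Xi> \<Omega> a \<longleftrightarrow>
     (\<forall>z\<in>\<Omega>.
        (\<forall>\<xi>\<in>\<Xi>. dist \<xi> z > K * fill_distance \<Xi> \<Omega> \<longrightarrow> a \<xi> z = 0) \<and>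
        (\<Sum>\<xi>\<in>\<Xi>. \<bar>a \<xi> z\<bar>) \<le> \<Gamma> \<and>
        (\<forall>p. polynomial_deg_le L p \<longrightarrow> (\<Sum>\<xi>\<in>\<Xi>. a \<xi> z * p \<xi>) = p z)) \<and>
     (\<forall>\<xi>\<in>\<Xi>. a \<xi> \<in> borel_measurable (lebesgue_on \<Omega>))"

section \<open>\<open>L\<^sub>2\<close> and Sobolev spaces\<close>

definition square_integrable :: "(real^'n::finite \<Rightarrow> real) \<Rightarrow> bool" where
  "square_integrable g \<longleftrightarrow>
     g \<in> borel_measurable lebesgue \<and> integrable lebesgue (\<lambda>x. (g x)\<^sup>2)"

definition L2_norm :: "(real^'n::finite \<Rightarrow> real) \<Rightarrow> real" where
  "L2_norm g = sqrt (LINT x|lebesgue. (g x)\<^sup>2)"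

definition locally_integrable :: "(real^'n::finite \<Rightarrow> real) \<Rightarrow> bool" where
  "locally_integrable g \<longleftrightarrow> (\<forall>A. compact A \<longrightarrow> set_integrable lebesgue A g)"

definition test_function :: "(real^'n::finite \<Rightarrow> real) \<Rightarrow> bool" where
  "test_function \<psi> \<longleftrightarrow> (\<forall>k. Ck_on k UNIV \<psi>) \<and> compact (closure {x. \<psi> x \<noteq> 0})"

definition is_weak_deriv ::
    "('n::finite \<Rightarrow> nat) \<Rightarrow> (real^'n \<Rightarrow> real) \<Rightarrow> (real^'n \<Rightarrow> real) \<Rightarrow> bool" where
  "is_weak_deriv \<beta> u g \<longleftrightarrow> locally_integrable u \<and> locally_integrable g \<and>
     (\<forall>\<psi>. test_function \<psi> \<longrightarrow>
        (LINT x|lebesgue. u x * mderiv \<beta> \<psi> x) = (-1) ^ mdeg \<beta> * (LINT x|lebesgue. g x * \<psi> x))"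

text \<open>Weak derivatives are unique up to null sets, and everything below is insensitive to null sets.\<close>

definition weak_deriv :: "('n::finite \<Rightarrow> nat) \<Rightarrow> (real^'n \<Rightarrow> real) \<Rightarrow> real^'n \<Rightarrow> real" where
  "weak_deriv \<beta> u = (SOME g. is_weak_deriv \<beta> u g)"

text \<open>The square of the Sobolev--Slobodeckij seminorm of order \<open>r\<close>, \<open>0 < r < 1\<close>.\<close>

definition slobodeckij :: "real \<Rightarrow> (real^'n::finite \<Rightarrow> real) \<Rightarrow> ennreal" where
  "slobodeckij r g =
     (\<integral>\<^sup>+x. \<integral>\<^sup>+y. ennreal ((g x - g y)\<^sup>2 / norm (x - y) powr (real CARD('n) + 2 * r))
        \<partial>lebesgue \<partial>lebesgue)"

text \<open>\<open>W\<^sub>2\<^sup>\<sigma>\<close> on the whole space, \<open>\<sigma> \<ge> 0\<close>; the seminorm of order \<open>frac \<sigma> = \<sigma> - \<lfloor>\<sigma>\<rfloor>\<close> enters for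
  fractional \<open>\<sigma>\<close> only.\<close>

definition sobolev_space :: "real \<Rightarrow> (real^'n::finite \<Rightarrow> real) set" where
  "sobolev_space \<sigma> = {u.
     (\<forall>\<beta>. mdeg \<beta> \<le> nat \<lfloor>\<sigma>\<rfloor> \<longrightarrow>
        (\<exists>g. is_weak_deriv \<beta> u g) \<and> square_integrable (weak_deriv \<beta> u)) \<and>
     (\<sigma> \<notin> \<int> \<longrightarrow> (\<forall>\<beta>. mdeg \<beta> = nat \<lfloor>\<sigma>\<rfloor> \<longrightarrow> slobodeckij (frac \<sigma>) (weak_deriv \<beta> u) < \<infinity>))}"

definition sobolev_norm :: "real \<Rightarrow> (real^'n::finite \<Rightarrow> real) \<Rightarrow> real" where
  "sobolev_norm \<sigma> u = sqrt (
     (\<Sum>\<beta> | mdeg \<beta> \<le> nat \<lfloor>\<sigma>\<rfloor>. (L2_norm (weak_deriv \<beta> u))\<^sup>2) +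
     (if \<sigma> \<in> \<int> then 0
      else (\<Sum>\<beta> | mdeg \<beta> = nat \<lfloor>\<sigma>\<rfloor>. enn2real (slobodeckij (frac \<sigma>) (weak_deriv \<beta> u)))))"

section \<open>The approximation scheme\<close>

definition convolution :: "(real^'n::finite \<Rightarrow> real) \<Rightarrow> (real^'n \<Rightarrow> real) \<Rightarrow> real^'n \<Rightarrow> real" where
  "convolution \<phi> \<nu> x = (LINT z|lebesgue. \<phi> (x - z) * \<nu> z)"

definition approximant ::
    "(real^'n::finite \<Rightarrow> real) \<Rightarrow> (real^'n) set \<Rightarrow> (real^'n) set \<Rightarrow> (real^'n \<Rightarrow> real^'n \<Rightarrow> real) \<Rightarrow>
     (real^'n \<Rightarrow> real) \<Rightarrow> (real^'n \<Rightarrow> real) \<Rightarrow> real^'n \<Rightarrow> real" where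
  "approximant \<phi> \<Xi> \<Omega> a \<nu> p x =
     (\<Sum>\<xi>\<in>\<Xi>. (LINT z:\<Omega>|lebesgue. a \<xi> z * \<nu> z) * \<phi> (x - \<xi>)) + p x"

section \<open>Well-definedness of the multi-index notions\<close>

text \<open>The sums over multi-indices above are finite sums, and the choice in \<open>mderiv\<close> is possible.\<close>

lemma finite_mdeg_le: "finite {\<beta> :: 'n::finite \<Rightarrow> nat. mdeg \<beta> \<le> m}"
proof (rule finite_subset)
  show "{\<beta> :: 'n \<Rightarrow> nat. mdeg \<beta> \<le> m} \<subseteq> PiE UNIV (\<lambda>_. {..m})"
  proof
    fix \<beta> :: "'n \<Rightarrow> nat"
    assume "\<beta> \<in> {\<beta>. mdeg \<beta> \<le> m}"
    then have m: "mdeg \<beta> \<le> m" by simp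
    have "\<beta> i \<le> m" for i
    proof -
      have "\<beta> i \<le> mdeg \<beta>"
        unfolding mdeg_def by (rule member_le_sum) simp_all
      with m show ?thesis by linarith
    qed
    then show "\<beta> \<in> PiE UNIV (\<lambda>_. {..m})"
      by (simp add: PiE_UNIV_domain)
  qed
  show "finite (PiE (UNIV :: 'n set) (\<lambda>_. {..m}))"
    by (intro finite_PiE) simp_all
qed

lemma finite_mdeg_eq: "finite {\<beta> :: 'n::finite \<Rightarrow> nat. mdeg \<beta> = m}"
  by (rule finite_subset[OF Collect_mono finite_mdeg_le[of m]]) simp

lemma ex_direction_list:
  fixes \<beta> :: "'n::finite \<Rightarrow> nat"
  shows "\<exists>js. \<forall>i. count_list js i = \<beta> i"
proof -
  obtain js where js: "mset js = Abs_multiset \<beta>"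
    using ex_mset[of "Abs_multiset \<beta>"] ..
  have "count (mset js) = \<beta>"
    unfolding js by (rule count_Abs_multiset) simp
  then have "count_list js i = \<beta> i" for i
    using count_mset[of js i] by simp
  then show ?thesis by blast
qed

end

theory Submission
  imports Defs
begin

text \<open>
The error \<open>f - T f\<close> is an integral operator applied to \<open>\<nu>\<close>, with kernel
\<open>\<phi> (x - z) - (\<Sum>\<xi>. a \<xi> z * \<phi> (x - \<xi>))\<close>. Away from the origin and from the sphere of radius \<open>r0\<close>,
Taylor expansion and the reproduction of polynomials bound the derivatives of this kernel of order \<open>j\<close> by a multiple of
\<open>h powr (L - j - \<epsilon>) * norm (x - z) powr (s - L + \<epsilon>)\<close>, which is integrable outside a ball of radius \<open>O(h)\<close> with the
right power of \<open>h\<close>. For even \<open>s\<close> the logarithm is rescaled: \<open>ln (norm x) = ln (norm x / h) + ln h\<close>, and the term with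
\<open>ln h\<close> is as smooth as \<open>v\<close>, so that it gains \<open>h powr (L - j)\<close>, and \<open>L > s + d\<close> absorbs \<open>ln h\<close>.
In the shell of width \<open>h\<close> around the sphere only derivatives of order at most \<open>s + d - 1\<close> are continuous, but the shell has
measure \<open>O(h)\<close>. The Schur test turns these bounds into \<open>L2\<close> bounds. Within distance \<open>O(h)\<close> of the origin the kernel is
estimated by the Cauchy--Schwarz inequality with the weights \<open>a \<xi> z\<close>, which only needs the square integrability of the
derivatives of \<open>\<phi>\<close> of order less than \<open>s + d/2\<close>. All derivatives are handled as functions that are absolutely
continuous on coordinate lines, which yields both the weak derivatives and, by interpolating the
\<open>L2\<close> bounds of a function and its gradient, the Slobodeckij seminorm.
\<close>

section \<open>Partial derivatives and Taylor expansion\<close>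

text \<open>The Schur test alone cannot finish near the origin. There the error kernel contains
  \<open>a \<xi> z\<close> times a derivative of size \<open>norm (x - \<xi>) powr (s - j)\<close>,
  and for \<open>j > s\<close> the integral over \<open>z\<close> has no bound uniform in
  \<open>x\<close>, since the singular factor does not depend on \<open>z\<close>. It is still
  square integrable in \<open>x\<close> for j < s + d/2. This is the origin of the bound on
  \<open>\<lceil>\<sigma>\<rceil>\<close>; the ceiling enters because a fractional seminorm is
  interpolated between two integer orders. The logarithm is measured at scale \<open>h\<close>
  because \<open>ln (norm x)\<close> would leave a factor \<open>ln h\<close> near the origin,
  whereas \<open>norm x / h\<close> stays bounded there, and farther out its logarithm costs a small
  power that the surplus L - s - d pays for. In the shell one power of \<open>h\<close> comes from a
  Lipschitz bound for the derivatives of order \<open>k0\<close>, the integer part of s + d - 1, and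
  one from the measure; k0 + 2 > s + d is just enough. Derivatives are indexed by words of
  directions; multi-indices occur only where the definitions demand them.\<close>

definition has_partial :: "'n::finite \<Rightarrow> (real^'n \<Rightarrow> real) \<Rightarrow> real^'n \<Rightarrow> real \<Rightarrow> bool" where
  "has_partial i f x D \<longleftrightarrow> ((\<lambda>t. f (x + t *\<^sub>R axis i 1)) has_real_derivative D) (at 0)"

lemma has_partial_partial:
  "(\<lambda>t. f (x + t *\<^sub>R axis i 1)) differentiable (at 0) \<Longrightarrow> has_partial i f x (partial i f x)"
  unfolding has_partial_def partial_def by (simp add: DERIV_deriv_iff_real_differentiable)

lemma partial_eqI: "has_partial i f x D \<Longrightarrow> partial i f x = D"
  unfolding has_partial_def partial_def by (rule DERIV_imp_deriv)

lemma has_partial_imp_differentiable: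
  "has_partial i f x D \<Longrightarrow> (\<lambda>t. f (x + t *\<^sub>R axis i 1)) differentiable (at 0)"
  unfolding has_partial_def using real_differentiable_def by blast

lemma has_partial_cong_open:
  assumes "open S" "x \<in> S" "\<And>y. y \<in> S \<Longrightarrow> f y = g y" "has_partial i f x D"
  shows "has_partial i g x D"
proof -
  have "open ((\<lambda>t. x + t *\<^sub>R axis i 1) -` S)"
    by (rule open_vimage[OF assms(1)]) (intro continuous_intros)
  then show ?thesis using assms unfolding has_partial_def
    by (elim has_field_derivative_transform_within_open) auto
qed

lemma partial_cong_open:
  assumes "open S" "x \<in> S" "\<And>y. y \<in> S \<Longrightarrow> f y = g y"
  shows "partial i f x = partial i g x"
proof -
  have "has_partial i f x D = has_partial i g x D" for D
    using has_partial_cong_open[OF assms(1,2)] assms(3) by metis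
  then show ?thesis unfolding partial_def deriv_def has_partial_def by simp
qed

lemma foldr_partial_cong_open:
  assumes "open S" "\<And>y. y \<in> S \<Longrightarrow> f y = g y" "x \<in> S"
  shows "foldr partial js f x = foldr partial js g x"
  using assms(3)
proof (induction js arbitrary: x)
  case (Cons j js)
  have "partial j (foldr partial js f) x = partial j (foldr partial js g) x"
    by (rule partial_cong_open[OF assms(1) Cons.prems Cons.IH])
  then show ?case by simp
qed (use assms in simp)

lemma Ck_on_cong_open:
  assumes "open S" "\<And>y. y \<in> S \<Longrightarrow> f y = g y" "Ck_on k S f"
  shows "Ck_on k S g"
  using assms(2,3)
proof (induction k arbitrary: f g)
  case 0
  then show ?case by (simp cong: continuous_on_cong)
next
  case (Suc k)
  have "continuous_on S g" using Suc.prems by (simp cong: continuous_on_cong)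
  moreover have "(\<lambda>t. g (x + t *\<^sub>R axis i 1)) differentiable at 0" if "x \<in> S" for i x
  proof -
    have "has_partial i f x (partial i f x)" using Suc.prems(2) that by (auto intro: has_partial_partial)
    with has_partial_cong_open[OF assms(1) that, of f g i] Suc.prems(1) show ?thesis
      by (blast intro: has_partial_imp_differentiable)
  qed
  moreover have "Ck_on k S (partial i g)" for i
  proof (rule Suc.IH)
    show "partial i f y = partial i g y" if "y \<in> S" for y
      using that Suc.prems(1) by (rule partial_cong_open[OF assms(1)])
    show "Ck_on k S (partial i f)" using Suc.prems(2) by simp
  qed
  ultimately show ?case by simp
qed

lemma Ck_on_imp_continuous: "Ck_on k S f \<Longrightarrow> continuous_on S f"
  by (cases k) auto

lemma Ck_on_SucD: "Ck_on (Suc k) S f \<Longrightarrow> Ck_on k S f"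
  by (induction k arbitrary: f) auto

lemma Ck_on_le: "Ck_on k S f \<Longrightarrow> j \<le> k \<Longrightarrow> Ck_on j S f"
  by (induction k) (auto simp: le_Suc_eq simp del: Ck_on.simps dest: Ck_on_SucD)

lemma Ck_on_subset: "Ck_on k S f \<Longrightarrow> T \<subseteq> S \<Longrightarrow> Ck_on k T f"
  by (induction k arbitrary: f) (auto intro: continuous_on_subset)

lemma Ck_on_Un:
  "open S \<Longrightarrow> open T \<Longrightarrow> Ck_on k S f \<Longrightarrow> Ck_on k T f \<Longrightarrow> Ck_on k (S \<union> T) f"
  by (induction k arbitrary: f) (auto intro: continuous_on_open_Un)

text \<open>Lets the candidate derivatives be given by any formula \<open>D\<close>: agreement with
  \<open>partial\<close> on the open set is enough, because \<open>Ck_on\<close> only looks at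
  values there.\<close>

lemma Ck_on_SucI:
  assumes "open S" "continuous_on S f" "\<And>i x. x \<in> S \<Longrightarrow> has_partial i f x (D i x)" "\<And>i. Ck_on k S (D i)"
  shows "Ck_on (Suc k) S f"
proof -
  have "Ck_on k S (partial i f)" for i
    by (rule Ck_on_cong_open[OF assms(1) _ assms(4)[of i]]) (simp add: partial_eqI[OF assms(3)])
  then show ?thesis using assms(2) has_partial_imp_differentiable[OF assms(3)] by simp
qed

lemma Ck_on_has_partial:
  "Ck_on k S f \<Longrightarrow> 0 < k \<Longrightarrow> x \<in> S \<Longrightarrow> has_partial i f x (partial i f x)"
  by (cases k) (auto intro: has_partial_partial)

lemma Ck_on_foldr_partial:
  "Ck_on (k + length js) S f \<Longrightarrow> Ck_on k S (foldr partial js f)"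
proof (induction js arbitrary: k)
  case (Cons j js)
  then have "Ck_on (Suc k) S (foldr partial js f)" by (simp del: Ck_on.simps)
  then show ?case by simp
qed simp

section \<open>Total differentiability and Taylor's formula along segments\<close>

lemma has_partial_line:
  assumes "has_partial i f (y + t *\<^sub>R axis i 1) D"
  shows "((\<lambda>t. f (y + t *\<^sub>R axis i 1)) has_real_derivative D) (at t)"
proof -
  have "((\<lambda>h. f (y + t *\<^sub>R axis i 1 + h *\<^sub>R axis i 1)) has_real_derivative D) (at (0))"
    using assms unfolding has_partial_def .
  then have "((\<lambda>h. f (y + (h + t) *\<^sub>R axis i 1)) has_real_derivative D) (at 0)"
    by (simp add: algebra_simps)
  then show ?thesis using DERIV_shift[of "\<lambda>t. f (y + t *\<^sub>R axis i 1)" D 0 t] by simp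
qed

lemma norm_axis_sum_le: "norm (\<Sum>i\<in>A. v $ i *\<^sub>R axis i (1::real)) \<le> norm (v :: real^'n::finite)"
proof (rule norm_le_componentwise_cart)
  fix j
  have "(\<Sum>i\<in>A. v $ i *\<^sub>R axis i (1::real)) $ j = (\<Sum>i\<in>A. if i = j then v $ i else 0)"
    unfolding sum_component by (rule sum.cong) (auto simp: axis_def)
  also have "\<dots> = (if j \<in> A then v $ j else 0)"
    by (simp add: sum.delta)
  finally show "norm ((\<Sum>i\<in>A. v $ i *\<^sub>R axis i (1::real)) $ j) \<le> norm (v $ j)" by simp
qed

lemma axis_sum_eq: "(\<Sum>i\<in>UNIV. v $ i *\<^sub>R axis i (1::real)) = (v :: real^'n::finite)"
proof -
  have "(\<Sum>i\<in>UNIV. v $ i *\<^sub>R axis i (1::real)) $ j = v $ j" for j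
  proof -
    have "(\<Sum>i\<in>UNIV. v $ i *\<^sub>R axis i (1::real)) $ j = (\<Sum>i\<in>UNIV. if i = j then v $ i else 0)"
      unfolding sum_component by (rule sum.cong) (auto simp: axis_def)
    then show ?thesis by simp
  qed
  then show ?thesis by (simp add: vec_eq_iff)
qed

text \<open>Continuous partial derivatives give total differentiability by moving one coordinate at
  a time. \<open>A\<close> holds the coordinates already moved; the mean value inequality for the
  next one and the induction hypothesis each contribute \<open>e/2\<close>.\<close>

lemma partial_sum_approx:
  fixes f :: "real^'n::finite \<Rightarrow> real"
  assumes S: "open S" "Ck_on 1 S f" "x \<in> S" and "finite A" and "e > 0"
  shows "\<exists>\<delta>>0. \<forall>v. norm v < \<delta> \<longrightarrow>
    \<bar>f (x + (\<Sum>i\<in>A. v $ i *\<^sub>R axis i 1)) - f x - (\<Sum>i\<in>A. v $ i * partial i f x)\<bar> \<le> e * norm v"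
  using assms(4,5)
proof (induction A arbitrary: e)
  case empty
  then show ?case by (auto intro!: exI[of _ 1])
next
  case (insert a A)
  obtain d1 where d1: "d1 > 0" and IH: "\<And>v. norm v < d1 \<Longrightarrow>
    \<bar>f (x + (\<Sum>i\<in>A. v $ i *\<^sub>R axis i 1)) - f x - (\<Sum>i\<in>A. v $ i * partial i f x)\<bar> \<le> e/2 * norm v"
    using insert.IH[of "e/2"] insert.prems by auto
  have "continuous_on S (partial a f)" using S by simp
  then obtain d2 where d2: "d2 > 0" and c: "\<And>y. y \<in> S \<Longrightarrow> dist y x < d2 \<Longrightarrow> \<bar>partial a f y - partial a f x\<bar> < e/2"
    using insert.prems S(3) unfolding continuous_on_iff dist_real_def by (metis half_gt_zero)
  obtain d3 where d3: "d3 > 0" "ball x d3 \<subseteq> S" using S open_contains_ball by blast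
  \<comment> \<open>Every point visited is \<open>x\<close> plus a partial sum and one more
    coordinate step, each of norm at most \<open>norm v\<close>; hence the halves of
    \<open>d2\<close> and \<open>d3\<close>.\<close>
  define d where "d = Min {d1, d2/2, d3/2}"
  have d: "d > 0" "d \<le> d1" "d \<le> d2/2" "d \<le> d3/2" using d1 d2 d3 by (auto simp: d_def)
  have "\<bar>f (x + (\<Sum>i\<in>insert a A. v $ i *\<^sub>R axis i 1)) - f x - (\<Sum>i\<in>insert a A. v $ i * partial i f x)\<bar> \<le> e * norm v"
    if v: "norm v < d" for v
  proof -
    define y where "y = x + (\<Sum>i\<in>A. v $ i *\<^sub>R axis i 1)"
    let ?c = "partial a f x"
    let ?g = "\<lambda>t. f (y + t *\<^sub>R axis a 1) - t * ?c"
    have near: "dist (y + t *\<^sub>R axis a 1) x < 2 * d" if "t \<in> closed_segment 0 (v $ a)" for t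
    proof -
      have "\<bar>t\<bar> \<le> \<bar>v $ a\<bar>" using that by (auto simp: closed_segment_eq_real_ivl split: if_splits)
      also have "\<dots> \<le> norm v" by (rule component_le_norm_cart)
      finally have "\<bar>t\<bar> \<le> norm v" .
      moreover have "norm (\<Sum>i\<in>A. v $ i *\<^sub>R axis i (1::real)) \<le> norm v" by (rule norm_axis_sum_le)
      ultimately have "norm ((\<Sum>i\<in>A. v $ i *\<^sub>R axis i (1::real)) + t *\<^sub>R axis a 1) \<le> norm v + norm v"
        by (intro norm_triangle_mono) simp_all
      then show ?thesis using v by (simp add: y_def dist_norm algebra_simps)
    qed
    have inS: "y + t *\<^sub>R axis a 1 \<in> S" if "t \<in> closed_segment 0 (v $ a)" for t
      using near[OF that] d d3 by (auto simp: dist_commute subset_iff)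
    have "norm (?g (v $ a) - ?g 0) \<le> e/2 * norm (v $ a - 0)"
    proof (rule field_differentiable_bound[where S="closed_segment 0 (v $ a)" and f' = "\<lambda>t. partial a f (y + t *\<^sub>R axis a 1) - ?c"])
      fix t assume t: "t \<in> closed_segment 0 (v $ a)"
      have "((\<lambda>t. f (y + t *\<^sub>R axis a 1)) has_real_derivative partial a f (y + t *\<^sub>R axis a 1)) (at t)"
        by (intro has_partial_line Ck_on_has_partial[OF S(2)] inS t) simp
      then have "(?g has_real_derivative partial a f (y + t *\<^sub>R axis a 1) - ?c) (at t)"
        by (auto intro!: derivative_eq_intros)
      then show "(?g has_field_derivative partial a f (y + t *\<^sub>R axis a 1) - ?c) (at t within closed_segment 0 (v $ a))"
        by (rule has_field_derivative_at_within)
      show "norm (partial a f (y + t *\<^sub>R axis a 1) - ?c) \<le> e / 2"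
        using c[OF inS[OF t]] near[OF t] d by (simp add: less_imp_le)
    qed auto
    moreover have "\<bar>v $ a\<bar> \<le> norm v" by (rule component_le_norm_cart)
    ultimately have 1: "\<bar>f (y + v $ a *\<^sub>R axis a 1) - v $ a * ?c - f y\<bar> \<le> e/2 * norm v"
      using insert.prems by (simp) (smt (verit, best) half_gt_zero mult_left_mono)
    have 2: "\<bar>f y - f x - (\<Sum>i\<in>A. v $ i * partial i f x)\<bar> \<le> e/2 * norm v"
      unfolding y_def using IH v d by simp
    have 3: "x + (\<Sum>i\<in>insert a A. v $ i *\<^sub>R axis i 1) = y + v $ a *\<^sub>R axis a 1"
      using insert.hyps by (simp add: y_def algebra_simps)
    have 4: "(\<Sum>i\<in>insert a A. v $ i * partial i f x) = v $ a * ?c + (\<Sum>i\<in>A. v $ i * partial i f x)"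
      using insert.hyps by simp
    show ?thesis unfolding 3 4 using 1 2 by linarith
  qed
  then show ?case using d by blast
qed

lemma Ck_on_has_derivative:
  fixes f :: "real^'n::finite \<Rightarrow> real"
  assumes S: "open S" "Ck_on 1 S f" "x \<in> S"
  shows "(f has_derivative (\<lambda>v. \<Sum>i\<in>UNIV. v $ i * partial i f x)) (at x)"
  unfolding has_derivative_at_alt
proof (intro conjI allI impI)
  show "bounded_linear (\<lambda>v. \<Sum>i\<in>UNIV. v $ i * partial i f x)"
    by (intro bounded_linear_sum bounded_linear_mult_const bounded_linear_vec_nth)
  fix e :: real assume "e > 0"
  from partial_sum_approx[OF S finite[of UNIV] this]
  obtain d where d: "d > 0" and *: "\<And>v. norm v < d \<Longrightarrow> \<bar>f (x + v) - f x - (\<Sum>i\<in>UNIV. v $ i * partial i f x)\<bar> \<le> e * norm v"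
    by (auto simp: axis_sum_eq)
  show "\<exists>d>0. \<forall>y. norm (y - x) < d \<longrightarrow> norm (f y - f x - (\<Sum>i\<in>UNIV. (y - x) $ i * partial i f x)) \<le> e * norm (y - x)"
    using d *[of "_ - x"] by (intro exI[of _ d]) auto
qed

lemma Ck_on_has_real_derivative_line:
  fixes f :: "real^'n::finite \<Rightarrow> real"
  assumes S: "open S" "Ck_on 1 S f" "y + t *\<^sub>R w \<in> S"
  shows "((\<lambda>t. f (y + t *\<^sub>R w)) has_real_derivative (\<Sum>i\<in>UNIV. w $ i * partial i f (y + t *\<^sub>R w))) (at t)"
proof -
  have "((\<lambda>t. y + t *\<^sub>R w) has_derivative (\<lambda>h. h *\<^sub>R w)) (at t)"
    by (auto intro!: derivative_eq_intros)
  from has_derivative_compose[OF this Ck_on_has_derivative[OF S]]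
  show ?thesis unfolding has_field_derivative_def
    by (rule has_derivative_eq_rhs) (auto simp: sum_distrib_left mult_ac)
qed

text \<open>The j-th power of the operator w . grad applied to \<open>f\<close>. The recursion
  differentiates \<open>f\<close> itself first, so inductions on the order keep \<open>f\<close>
  arbitrary.\<close>

primrec dir_deriv :: "nat \<Rightarrow> real^'n::finite \<Rightarrow> (real^'n \<Rightarrow> real) \<Rightarrow> real^'n \<Rightarrow> real" where
  "dir_deriv 0 w f x = f x"
| "dir_deriv (Suc j) w f x = (\<Sum>i\<in>UNIV. w $ i * dir_deriv j w (partial i f) x)"

lemma dir_deriv_has_real_derivative:
  fixes f :: "real^'n::finite \<Rightarrow> real"
  assumes "open S" "Ck_on (Suc j) S f" "y + t *\<^sub>R w \<in> S"
  shows "((\<lambda>t. dir_deriv j w f (y + t *\<^sub>R w)) has_real_derivative dir_deriv (Suc j) w f (y + t *\<^sub>R w)) (at t)"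
  using assms(2)
proof (induction j arbitrary: f)
  case 0
  then show ?case using Ck_on_has_real_derivative_line[OF assms(1) _ assms(3), of f] by simp
next
  case (Suc j)
  have "((\<lambda>t. w $ i * dir_deriv j w (partial i f) (y + t *\<^sub>R w)) has_real_derivative
          w $ i * dir_deriv (Suc j) w (partial i f) (y + t *\<^sub>R w)) (at t)" for i
    by (intro DERIV_cmult Suc.IH) (use Suc.prems in auto)
  then have "((\<lambda>t. \<Sum>i\<in>UNIV. w $ i * dir_deriv j w (partial i f) (y + t *\<^sub>R w)) has_real_derivative
          (\<Sum>i\<in>UNIV. w $ i * dir_deriv (Suc j) w (partial i f) (y + t *\<^sub>R w))) (at t)"
    by (intro DERIV_sum)
  then show ?case by simp
qed

lemma Ck_on_taylor:
  fixes f :: "real^'n::finite \<Rightarrow> real"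
  assumes "open S" "Ck_on N S f" "\<And>t. 0 \<le> t \<Longrightarrow> t \<le> 1 \<Longrightarrow> y + t *\<^sub>R w \<in> S"
  shows "\<exists>t. 0 \<le> t \<and> t \<le> 1 \<and>
    f (y + w) = (\<Sum>j<N. dir_deriv j w f y / fact j) + dir_deriv N w f (y + t *\<^sub>R w) / fact N"
\<comment> \<open>\<open>Maclaurin\<close> needs positive order; for order 0 the formula is trivial
  with \<open>t = 1\<close>.\<close>
proof (cases "N = 0")
  case True
  then show ?thesis by (intro exI[of _ 1]) simp
next
  case False
  have C: "Ck_on (Suc j) S f" if "j < N" for j
    using Ck_on_le[OF assms(2), of "Suc j"] that by (simp del: Ck_on.simps)
  have "\<exists>t. 0 < t \<and> t < 1 \<and> (\<lambda>t. f (y + t *\<^sub>R w)) 1 =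
      (\<Sum>j<N. (\<lambda>t. dir_deriv j w f (y + t *\<^sub>R w)) 0 / fact j * 1 ^ j) +
      (\<lambda>t. dir_deriv N w f (y + t *\<^sub>R w)) t / fact N * 1 ^ N"
    by (rule Maclaurin[where diff = "\<lambda>j t. dir_deriv j w f (y + t *\<^sub>R w)"])
      (use False assms in \<open>auto intro!: dir_deriv_has_real_derivative[OF assms(1)] C simp del: dir_deriv.simps(2) Ck_on.simps\<close>)
  then show ?thesis by (auto intro: less_imp_le)
qed

text \<open>Expanding the operator gives one term per word of length \<open>N\<close>, weighted by a
  product of components of \<open>w\<close>; the absolute weights sum to the N-th power of the l1
  norm of \<open>w\<close>.\<close>

lemma dir_deriv_bound:
  assumes "\<And>ks. length ks = N \<Longrightarrow> \<bar>foldr partial ks f x\<bar> \<le> B"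
  shows "\<bar>dir_deriv N w f x\<bar> \<le> (\<Sum>i\<in>UNIV. \<bar>w $ i\<bar>) ^ N * B"
  using assms
proof (induction N arbitrary: f)
  case 0
  then show ?case using 0[of "[]"] by simp
next
  case (Suc N)
  have "\<bar>dir_deriv (Suc N) w f x\<bar> \<le> (\<Sum>i\<in>UNIV. \<bar>w $ i * dir_deriv N w (partial i f) x\<bar>)"
    by (simp add: sum_abs)
  also have "\<dots> \<le> (\<Sum>i\<in>UNIV. \<bar>w $ i\<bar> * ((\<Sum>i\<in>UNIV. \<bar>w $ i\<bar>) ^ N * B))"
  proof (intro sum_mono)
    fix i
    have "\<bar>dir_deriv N w (partial i f) x\<bar> \<le> (\<Sum>i\<in>UNIV. \<bar>w $ i\<bar>) ^ N * B"
    proof (rule Suc.IH)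
      fix ks :: "'a list" assume "length ks = N"
      then show "\<bar>foldr partial ks (partial i f) x\<bar> \<le> B" using Suc.prems[of "ks @ [i]"] by simp
    qed
    then show "\<bar>w $ i * dir_deriv N w (partial i f) x\<bar> \<le> \<bar>w $ i\<bar> * ((\<Sum>i\<in>UNIV. \<bar>w $ i\<bar>) ^ N * B)"
      by (simp add: abs_mult mult_left_mono)
  qed
  also have "\<dots> = (\<Sum>i\<in>UNIV. \<bar>w $ i\<bar>) ^ Suc N * B"
    by (simp add: sum_distrib_right mult.assoc)
  finally show ?case .
qed

section \<open>Symmetry of second derivatives and independence of the order of
  differentiation\<close>

lemma second_difference:
  fixes f :: "real^'n::finite \<Rightarrow> real"
  assumes "Ck_on 2 S f" "ball x (3 * h) \<subseteq> S" "h > 0"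
  shows "\<exists>p\<in>ball x (3 * h). f (x + h *\<^sub>R axis i 1 + h *\<^sub>R axis j 1) - f (x + h *\<^sub>R axis i 1) - f (x + h *\<^sub>R axis j 1) + f x
    = h\<^sup>2 * partial j (partial i f) p"
proof -
  \<comment> \<open>The square with corner \<open>x\<close> and side \<open>h\<close> has points at
    distance at most \<open>2 * h\<close>, so it lies in the open ball of radius
    \<open>3 * h\<close>.\<close>
  have in_ball: "x + a *\<^sub>R axis i 1 + b *\<^sub>R axis j 1 \<in> ball x (3 * h)"
    if "0 \<le> a" "a \<le> h" "0 \<le> b" "b \<le> h" for a b
  proof -
    have "norm (a *\<^sub>R axis i (1::real) + b *\<^sub>R axis j 1) \<le> norm (a *\<^sub>R axis i (1::real)) + norm (b *\<^sub>R axis j (1::real))"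
      by (rule norm_triangle_ineq)
    also have "\<dots> = a + b" using that by simp
    finally have "norm (a *\<^sub>R axis i (1::real) + b *\<^sub>R axis j 1) < 3 * h" using that assms(3) by linarith
    moreover have "dist x (x + a *\<^sub>R axis i 1 + b *\<^sub>R axis j 1) = norm (a *\<^sub>R axis i (1::real) + b *\<^sub>R axis j 1)"
      by (metis add.assoc add_diff_cancel_left' dist_commute dist_norm)
    ultimately show ?thesis by simp
  qed
  have Cf: "Ck_on 1 S f" and Cp: "\<And>i. Ck_on 1 S (partial i f)"
    using assms(1) Ck_on_le[of 2 S f 1] by (auto simp: numeral_2_eq_2)
  let ?g = "\<lambda>s. f (x + h *\<^sub>R axis j 1 + s *\<^sub>R axis i 1) - f (x + s *\<^sub>R axis i 1)"
  have "\<exists>\<theta>>0. \<theta> < h \<and> ?g h - ?g 0 = (h - 0) * (partial i f (x + h *\<^sub>R axis j 1 + \<theta> *\<^sub>R axis i 1) - partial i f (x + \<theta> *\<^sub>R axis i 1))"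
  proof (rule MVT2)
    fix s assume "0 \<le> s" "s \<le> h"
    then show "(?g has_real_derivative (partial i f (x + h *\<^sub>R axis j 1 + s *\<^sub>R axis i 1) - partial i f (x + s *\<^sub>R axis i 1))) (at s)"
      using in_ball[of s h] in_ball[of s 0] assms
      by (intro derivative_intros has_partial_line Ck_on_has_partial[OF Cf]) (auto simp: algebra_simps subset_iff)
  qed fact
  then obtain \<theta> where \<theta>: "0 < \<theta>" "\<theta> < h" and
    1: "?g h - ?g 0 = h * (partial i f (x + h *\<^sub>R axis j 1 + \<theta> *\<^sub>R axis i 1) - partial i f (x + \<theta> *\<^sub>R axis i 1))"
    by auto
  have "\<exists>\<eta>>0. \<eta> < h \<and> partial i f (x + \<theta> *\<^sub>R axis i 1 + h *\<^sub>R axis j 1) - partial i f (x + \<theta> *\<^sub>R axis i 1 + 0 *\<^sub>R axis j 1)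
      = (h - 0) * partial j (partial i f) (x + \<theta> *\<^sub>R axis i 1 + \<eta> *\<^sub>R axis j 1)"
  proof (rule MVT2)
    fix s assume "0 \<le> s" "s \<le> h"
    then show "((\<lambda>s. partial i f (x + \<theta> *\<^sub>R axis i 1 + s *\<^sub>R axis j 1)) has_real_derivative partial j (partial i f) (x + \<theta> *\<^sub>R axis i 1 + s *\<^sub>R axis j 1)) (at s)"
      using in_ball[of \<theta> s] \<theta> assms
      by (intro has_partial_line Ck_on_has_partial[OF Cp]) auto
  qed fact
  then obtain \<eta> where \<eta>: "0 < \<eta>" "\<eta> < h" and
    2: "partial i f (x + \<theta> *\<^sub>R axis i 1 + h *\<^sub>R axis j 1) - partial i f (x + \<theta> *\<^sub>R axis i 1)
      = h * partial j (partial i f) (x + \<theta> *\<^sub>R axis i 1 + \<eta> *\<^sub>R axis j 1)"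
    by auto
  have "?g h - ?g 0 = h\<^sup>2 * partial j (partial i f) (x + \<theta> *\<^sub>R axis i 1 + \<eta> *\<^sub>R axis j 1)"
    unfolding 1 using 2 by (simp add: algebra_simps power2_eq_square)
  then show ?thesis
    using in_ball[of \<theta> \<eta>] \<theta> \<eta> by (intro bexI[of _ "x + \<theta> *\<^sub>R axis i 1 + \<eta> *\<^sub>R axis j 1"]) (auto simp: algebra_simps)
qed

text \<open>The second difference of \<open>f\<close> over a square of side \<open>h\<close> is
  symmetric in \<open>i\<close> and \<open>j\<close>, and by two mean value steps it equals h^2
  times either mixed derivative at some nearby point. Continuity at \<open>x\<close> then forces
  both values to agree; \<open>e\<close> is half of the supposed gap.\<close>

lemma partial_commute:
  fixes f :: "real^'n::finite \<Rightarrow> real"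
  assumes "open S" "Ck_on 2 S f" "x \<in> S"
  shows "partial i (partial j f) x = partial j (partial i f) x"
proof (rule ccontr)
  let ?F = "\<lambda>i j. partial i (partial j f)"
  assume ne: "?F i j x \<noteq> ?F j i x"
  define e where "e = \<bar>?F i j x - ?F j i x\<bar> / 2"
  have e: "e > 0" using ne by (simp add: e_def)
  have "\<exists>d>0. \<forall>y\<in>S. dist y x < d \<longrightarrow> \<bar>?F i j y - ?F i j x\<bar> < e" for i j
  proof -
    have "continuous_on S (?F i j)" using assms(2) by (simp add: numeral_2_eq_2)
    then show ?thesis using assms(3) e unfolding continuous_on_iff dist_real_def by blast
  qed
  then obtain d1 d2 where d: "d1 > 0" "d2 > 0"
    and c1: "\<And>y. y \<in> S \<Longrightarrow> dist y x < d1 \<Longrightarrow> \<bar>?F i j y - ?F i j x\<bar> < e"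
    and c2: "\<And>y. y \<in> S \<Longrightarrow> dist y x < d2 \<Longrightarrow> \<bar>?F j i y - ?F j i x\<bar> < e" by metis
  obtain d3 where d3: "d3 > 0" "ball x d3 \<subseteq> S" using assms open_contains_ball by blast
  define h where "h = Min {d1, d2, d3} / 3"
  have h: "h > 0" "3 * h \<le> d1" "3 * h \<le> d2" "3 * h \<le> d3" using d d3 by (auto simp: h_def)
  have sub: "ball x (3 * h) \<subseteq> S" using h d3 by (meson order_trans subset_ball)
  obtain p where p: "p \<in> ball x (3 * h)" "f (x + h *\<^sub>R axis i 1 + h *\<^sub>R axis j 1) - f (x + h *\<^sub>R axis i 1) - f (x + h *\<^sub>R axis j 1) + f x
    = h\<^sup>2 * ?F j i p" using second_difference[OF assms(2) sub h(1)] by blast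
  obtain q where q: "q \<in> ball x (3 * h)" "f (x + h *\<^sub>R axis j 1 + h *\<^sub>R axis i 1) - f (x + h *\<^sub>R axis j 1) - f (x + h *\<^sub>R axis i 1) + f x
    = h\<^sup>2 * ?F i j q" using second_difference[OF assms(2) sub h(1)] by blast
  have "h\<^sup>2 * ?F j i p = h\<^sup>2 * ?F i j q" using p(2) q(2) by (simp add: algebra_simps)
  then have "?F j i p = ?F i j q" using h by simp
  moreover have "\<bar>?F j i p - ?F j i x\<bar> < e" using c2[OF subsetD[OF sub p(1)]] p(1) h by (simp add: dist_commute)
  moreover have "\<bar>?F i j q - ?F i j x\<bar> < e" using c1[OF subsetD[OF sub q(1)]] q(1) h by (simp add: dist_commute)
  moreover have "\<bar>?F i j x - ?F j i x\<bar> \<le> \<bar>?F i j q - ?F i j x\<bar> + \<bar>?F i j q - ?F j i x\<bar>" by linarith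
  ultimately show False unfolding e_def by simp
qed

text \<open>Commutes one direction past the word \<open>as\<close>, one transposition per induction
  step; arbitrary permutations then follow by induction on the word.\<close>

lemma foldr_partial_insert:
  fixes f :: "real^'n::finite \<Rightarrow> real"
  assumes "open S" "Ck_on (Suc (length (as @ bs))) S f" "x \<in> S"
  shows "foldr partial (as @ i # bs) f x = foldr partial (i # as @ bs) f x"
  using assms(2,3)
proof (induction as arbitrary: x)
  case (Cons a as)
  let ?g = "foldr partial (as @ bs) f"
  have "foldr partial ((a # as) @ i # bs) f x = partial a (partial i ?g) x"
  proof -
    have "foldr partial (as @ i # bs) f y = partial i ?g y" if "y \<in> S" for y
      using Cons.IH[OF _ that] Cons.prems Ck_on_SucD by (auto simp del: Ck_on.simps)
    from partial_cong_open[OF assms(1) Cons.prems(2) this] show ?thesis by simp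
  qed
  also have "\<dots> = partial i (partial a ?g) x"
  proof (rule partial_commute[OF assms(1) _ Cons.prems(2)])
    have "Ck_on (2 + length (as @ bs)) S f" using Cons.prems(1) by (simp del: Ck_on.simps)
    then show "Ck_on 2 S ?g" by (rule Ck_on_foldr_partial)
  qed
  finally show ?case by simp
qed simp

lemma foldr_partial_perm:
  fixes f :: "real^'n::finite \<Rightarrow> real"
  assumes "open S" "Ck_on (length js) S f" "x \<in> S" "mset js = mset ks"
  shows "foldr partial js f x = foldr partial ks f x"
  using assms(2-)
proof (induction js arbitrary: ks x)
  case (Cons j js)
  then obtain as bs where ks: "ks = as @ j # bs"
    by (metis list.set_intros(1) mset_eq_setD split_list)
  have m: "mset js = mset (as @ bs)" using Cons.prems(3) ks by simp
  have l: "length js = length (as @ bs)" using m mset_eq_length by blast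
  have "foldr partial ks f x = foldr partial (j # as @ bs) f x"
    unfolding ks by (rule foldr_partial_insert[OF assms(1)]) (use Cons.prems l in \<open>auto simp del: Ck_on.simps\<close>)
  also have "\<dots> = foldr partial (j # js) f x"
  proof -
    have "Ck_on (length js) S f" using Cons.prems(1) Ck_on_SucD by (simp del: Ck_on.simps)
    from Cons.IH[OF this _ m]
    have "partial j (foldr partial (as @ bs) f) x = partial j (foldr partial js f) x"
      by (intro partial_cong_open[OF assms(1) Cons.prems(2)]) simp
    then show ?thesis by simp
  qed
  finally show ?case by simp
qed auto

section \<open>Words of directions versus multi-indices\<close>

definition mlist :: "('n::finite \<Rightarrow> nat) \<Rightarrow> 'n list" where
  "mlist \<beta> = (SOME js. \<forall>i. count_list js i = \<beta> i)"

lemma count_mlist: "count_list (mlist \<beta>) i = \<beta> i"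
  unfolding mlist_def using someI_ex[OF ex_direction_list[of \<beta>]] by blast

lemma length_mlist: "length (mlist \<beta>) = mdeg \<beta>"
proof -
  have "length (mlist \<beta>) = (\<Sum>i\<in>set (mlist \<beta>). count_list (mlist \<beta>) i)"
    by (simp add: sum_count_set)
  also have "\<dots> = (\<Sum>i\<in>UNIV. count_list (mlist \<beta>) i)"
    by (rule sum.mono_neutral_left) (auto simp: count_list_0_iff)
  finally show ?thesis by (simp add: count_mlist mdeg_def)
qed

lemma mderiv_mlist: "mderiv \<beta> f = foldr partial (mlist \<beta>) f"
  by (simp add: mderiv_def mlist_def)

lemma foldr_partial_eq_mderiv:
  fixes f :: "real^'n::finite \<Rightarrow> real"
  assumes "open S" "Ck_on (length js) S f" "x \<in> S"
  shows "foldr partial js f x = mderiv (count_list js) f x" "mdeg (count_list js) = length js"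
proof -
  have m: "mset js = mset (mlist (count_list js))"
    by (rule multiset_eqI) (simp add: count_mset count_mlist)
  show "foldr partial js f x = mderiv (count_list js) f x"
    unfolding mderiv_mlist using foldr_partial_perm[OF assms m] .
  show "mdeg (count_list js) = length js"
    using m by (metis length_mlist mset_eq_length)
qed

text \<open>A symbol-type estimate: \<open>W\<close> is the size of the function and \<rho> the
  length scale on which it varies, so each derivative costs one factor 1/\<rho>. With \<rho> =
  \<open>norm\<close> it describes functions singular at the origin, with \<rho> = 1 ordinary bounds
  in C^k; both are stable under sums and products.\<close>

definition deriv_bound :: "nat \<Rightarrow> (real^'n::finite) set \<Rightarrow> (real^'n \<Rightarrow> real) \<Rightarrow> (real^'n \<Rightarrow> real) \<Rightarrow> (real^'n \<Rightarrow> real) \<Rightarrow> bool"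
  where "deriv_bound k S \<rho> W f \<longleftrightarrow> Ck_on k S f \<and>
    (\<forall>js. length js \<le> k \<longrightarrow> (\<forall>x\<in>S. \<bar>foldr partial js f x\<bar> \<le> W x / \<rho> x ^ length js))"

lemma deriv_boundD:
  assumes "deriv_bound k S \<rho> W f" "length js \<le> k" "x \<in> S"
  shows "\<bar>foldr partial js f x\<bar> \<le> W x / \<rho> x ^ length js"
  using assms unfolding deriv_bound_def by blast

lemma deriv_bound_Ck_on: "deriv_bound k S \<rho> W f \<Longrightarrow> Ck_on k S f"
  unfolding deriv_bound_def by blast

lemma deriv_bound_abs_le: "deriv_bound k S \<rho> W f \<Longrightarrow> x \<in> S \<Longrightarrow> \<bar>f x\<bar> \<le> W x"
  using deriv_boundD[of k S \<rho> W f "[]" x] by simp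

lemma deriv_bound_subset: "deriv_bound k S \<rho> W f \<Longrightarrow> T \<subseteq> S \<Longrightarrow> deriv_bound k T \<rho> W f"
  unfolding deriv_bound_def using Ck_on_subset by blast

lemma deriv_bound_SucD: "deriv_bound (Suc k) S \<rho> W f \<Longrightarrow> deriv_bound k S \<rho> W f"
  unfolding deriv_bound_def using Ck_on_SucD le_SucI by blast

lemma deriv_bound_mono:
  assumes "deriv_bound k S \<rho> W f" "\<And>x. x \<in> S \<Longrightarrow> 0 < \<rho> x" "\<And>x. x \<in> S \<Longrightarrow> W x \<le> W' x"
  shows "deriv_bound k S \<rho> W' f"
proof -
  have "W x / \<rho> x ^ n \<le> W' x / \<rho> x ^ n" if "x \<in> S" for x n
    using assms(2,3)[OF that] by (intro divide_right_mono) auto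
  then show ?thesis using assms(1) unfolding deriv_bound_def by (meson order_trans)
qed

lemma deriv_bound_partial:
  assumes "deriv_bound (Suc k) S \<rho> W f"
  shows "deriv_bound k S \<rho> (\<lambda>x. W x / \<rho> x) (partial i f)"
  unfolding deriv_bound_def
proof (intro conjI allI impI ballI)
  show "Ck_on k S (partial i f)" using deriv_bound_Ck_on[OF assms] by simp
  fix js :: "'a list" and x assume "length js \<le> k" "x \<in> S"
  then show "\<bar>foldr partial js (partial i f) x\<bar> \<le> W x / \<rho> x / \<rho> x ^ length js"
    using deriv_boundD[OF assms, of "js @ [i]" x] by simp
qed

lemma deriv_bound_0: "deriv_bound 0 S \<rho> W f \<longleftrightarrow> continuous_on S f \<and> (\<forall>x\<in>S. \<bar>f x\<bar> \<le> W x)"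
  unfolding deriv_bound_def by auto

lemma deriv_bound_SucI:
  assumes "open S" "continuous_on S f" "\<And>x. x \<in> S \<Longrightarrow> \<bar>f x\<bar> \<le> W x"
    "\<And>i x. x \<in> S \<Longrightarrow> has_partial i f x (D i x)" "\<And>i. deriv_bound k S \<rho> (\<lambda>x. W x / \<rho> x) (D i)"
  shows "deriv_bound (Suc k) S \<rho> W f"
  unfolding deriv_bound_def
proof (intro conjI allI impI ballI)
  show "Ck_on (Suc k) S f"
    using assms(1,2,4) deriv_bound_Ck_on[OF assms(5)] by (rule Ck_on_SucI)
  fix js :: "'a list" and x assume js: "length js \<le> Suc k" and x: "x \<in> S"
  show "\<bar>foldr partial js f x\<bar> \<le> W x / \<rho> x ^ length js"
  \<comment> \<open>\<open>foldr\<close> applies the last letter of the word first, so the word is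
    split at its end.\<close>
  proof (cases js rule: rev_cases)
    case Nil
    then show ?thesis using assms(3)[OF x] by simp
  next
    case (snoc ks i)
    have "foldr partial ks (partial i f) x = foldr partial ks (D i) x"
      using partial_eqI[OF assms(4)] by (intro foldr_partial_cong_open[OF assms(1) _ x])
    moreover have "\<bar>foldr partial ks (D i) x\<bar> \<le> W x / \<rho> x / \<rho> x ^ length ks"
      using js snoc by (intro deriv_boundD[OF assms(5)] x) simp
    ultimately show ?thesis using snoc by simp
  qed
qed

lemma has_partial_add: "has_partial i f x D \<Longrightarrow> has_partial i g x E \<Longrightarrow> has_partial i (\<lambda>x. f x + g x) x (D + E)"
  unfolding has_partial_def by (rule DERIV_add)

lemma has_partial_mult:
  "has_partial i f x D \<Longrightarrow> has_partial i g x E \<Longrightarrow> has_partial i (\<lambda>x. f x * g x) x (D * g x + f x * E)"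
  unfolding has_partial_def by (drule (1) DERIV_mult) (simp add: mult.commute)

lemma has_partial_const: "has_partial i (\<lambda>_. c) x 0"
  unfolding has_partial_def by simp

lemma has_partial_coord: "has_partial i (\<lambda>x. x $ j) x (if i = j then 1 else 0)"
  unfolding has_partial_def by (auto intro!: derivative_eq_intros simp: axis_def)

lemma deriv_bound_add:
  assumes "open S" "deriv_bound k S \<rho> Wf f" "deriv_bound k S \<rho> Wg g"
  shows "deriv_bound k S \<rho> (\<lambda>x. Wf x + Wg x) (\<lambda>x. f x + g x)"
  using assms(2,3)
proof (induction k arbitrary: f g Wf Wg)
  case 0
  then show ?case unfolding deriv_bound_0
    by (auto intro!: continuous_intros intro: order_trans[OF abs_triangle_ineq] add_mono)
next
  case (Suc k)
  note C = deriv_bound_Ck_on[OF Suc.prems(1)] deriv_bound_Ck_on[OF Suc.prems(2)]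
  show ?case
  proof (rule deriv_bound_SucI[OF assms(1)])
    show "continuous_on S (\<lambda>x. f x + g x)" using C by (auto intro!: continuous_intros)
    show "\<bar>f x + g x\<bar> \<le> Wf x + Wg x" if "x \<in> S" for x
      using deriv_bound_abs_le[OF Suc.prems(1) that] deriv_bound_abs_le[OF Suc.prems(2) that] by linarith
    show "has_partial i (\<lambda>x. f x + g x) x (partial i f x + partial i g x)" if "x \<in> S" for i x
      using C that by (intro has_partial_add Ck_on_has_partial) auto
    show "deriv_bound k S \<rho> (\<lambda>x. (Wf x + Wg x) / \<rho> x) (\<lambda>x. partial i f x + partial i g x)" for i
      using Suc.IH[OF deriv_bound_partial[OF Suc.prems(1), of i] deriv_bound_partial[OF Suc.prems(2), of i]]
      by (simp add: add_divide_distrib)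
  qed
qed

text \<open>By the product rule each order doubles the number of terms, hence \<open>2 ^ k\<close>.
  Whichever factor is differentiated, the product of the weights loses the same factor
  \<rho>.\<close>

lemma deriv_bound_mult:
  assumes "open S" "deriv_bound k S \<rho> Wf f" "deriv_bound k S \<rho> Wg g"
  shows "deriv_bound k S \<rho> (\<lambda>x. 2 ^ k * (Wf x * Wg x)) (\<lambda>x. f x * g x)"
  using assms(2,3)
proof (induction k arbitrary: f g Wf Wg)
  case 0
  then show ?case unfolding deriv_bound_0
    by (auto intro!: continuous_intros simp: abs_mult intro!: mult_mono intro: order_trans[OF abs_ge_zero])
next
  case (Suc k)
  note C = deriv_bound_Ck_on[OF Suc.prems(1)] deriv_bound_Ck_on[OF Suc.prems(2)]
  show ?case
  proof (rule deriv_bound_SucI[OF assms(1)])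
    show "continuous_on S (\<lambda>x. f x * g x)" using C by (auto intro!: continuous_intros)
    show "\<bar>f x * g x\<bar> \<le> 2 ^ Suc k * (Wf x * Wg x)" if "x \<in> S" for x
    proof -
      note b = deriv_bound_abs_le[OF Suc.prems(1) that] deriv_bound_abs_le[OF Suc.prems(2) that]
      have "\<bar>f x * g x\<bar> \<le> 1 * (Wf x * Wg x)"
        using b by (auto simp: abs_mult intro!: mult_mono intro: order_trans[OF abs_ge_zero])
      also have "\<dots> \<le> 2 ^ Suc k * (Wf x * Wg x)"
        using b by (intro mult_right_mono mult_nonneg_nonneg one_le_power) (auto intro: order_trans[OF abs_ge_zero])
      finally show ?thesis .
    qed
    show "has_partial i (\<lambda>x. f x * g x) x (partial i f x * g x + f x * partial i g x)" if "x \<in> S" for i x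
      using C that by (intro has_partial_mult Ck_on_has_partial) auto
    show "deriv_bound k S \<rho> (\<lambda>x. 2 ^ Suc k * (Wf x * Wg x) / \<rho> x) (\<lambda>x. partial i f x * g x + f x * partial i g x)" for i
      using deriv_bound_add[OF assms(1) 
        Suc.IH[OF deriv_bound_partial[OF Suc.prems(1), of i] deriv_bound_SucD[OF Suc.prems(2)]]
        Suc.IH[OF deriv_bound_SucD[OF Suc.prems(1)] deriv_bound_partial[OF Suc.prems(2), of i]]]
      by (simp add: field_simps)
  qed
qed

lemma deriv_bound_zero:
  assumes "open S" "\<And>x. x \<in> S \<Longrightarrow> 0 < \<rho> x" "\<And>x. x \<in> S \<Longrightarrow> 0 \<le> W x"
  shows "deriv_bound k S \<rho> W (\<lambda>_. 0)"
  using assms(3)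
proof (induction k arbitrary: W)
  case (Suc k)
  show ?case
  proof (rule deriv_bound_SucI[where D = "\<lambda>_ _. 0"])
    show "deriv_bound k S \<rho> (\<lambda>x. W x / \<rho> x) (\<lambda>_. 0)"
      using assms(2) Suc.prems by (intro Suc.IH) (simp add: less_imp_le)
  qed (use Suc.prems assms in \<open>auto intro!: has_partial_const\<close>)
qed (auto simp: deriv_bound_0)

lemma deriv_bound_const:
  assumes "open S" "\<And>x. x \<in> S \<Longrightarrow> 0 < \<rho> x"
  shows "deriv_bound k S \<rho> (\<lambda>_. \<bar>c\<bar>) (\<lambda>_. c)"
proof (cases k)
  case (Suc k)
  show ?thesis unfolding Suc
    by (rule deriv_bound_SucI[where D = "\<lambda>_ _. 0"])
      (use assms in \<open>auto intro!: has_partial_const deriv_bound_zero divide_nonneg_pos\<close>)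
qed (auto simp: deriv_bound_0)

text \<open>The derivative of a coordinate is 0 or 1, so \<open>W\<close> has to dominate \<rho> as
  well as the coordinate itself.\<close>

lemma deriv_bound_coord:
  assumes "open S" "\<And>x. x \<in> S \<Longrightarrow> 0 < \<rho> x" "\<And>x. x \<in> S \<Longrightarrow> \<rho> x \<le> W x" "\<And>x. x \<in> S \<Longrightarrow> norm x \<le> W x"
  shows "deriv_bound k S \<rho> W (\<lambda>x. x $ j)"
proof -
  have le: "\<bar>x $ j\<bar> \<le> W x" if "x \<in> S" for x
    using component_le_norm_cart[of x j] assms(4)[OF that] by linarith
  show ?thesis
  proof (cases k)
    case 0
    then show ?thesis using le by (auto simp: deriv_bound_0 intro!: continuous_intros)
  next
    case (Suc k)
    show ?thesis unfolding Suc
    proof (rule deriv_bound_SucI[where D = "\<lambda>i _. if i = j then 1 else 0"])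
      show "has_partial i (\<lambda>x. x $ j) x (if i = j then 1 else 0)" for i x
        by (rule has_partial_coord)
      fix i
      have "deriv_bound k S \<rho> (\<lambda>_. \<bar>if i = j then 1 else 0\<bar>) (\<lambda>_. if i = j then 1 else 0)"
        by (rule deriv_bound_const[OF assms(1,2)])
      then show "deriv_bound k S \<rho> (\<lambda>x. W x / \<rho> x) (\<lambda>_. if i = j then 1 else 0)"
        by (rule deriv_bound_mono) (use assms in \<open>auto simp: le_divide_eq intro: order_trans[OF less_imp_le]\<close>)
    qed (use assms le in \<open>auto intro!: has_partial_coord continuous_intros\<close>)
  qed
qed

lemma norm_has_real_derivative_axis:
  assumes "x \<noteq> (0 :: real^'n::finite)"
  shows "((\<lambda>t. norm (x + t *\<^sub>R axis i 1)) has_real_derivative x $ i / norm x) (at 0)"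
proof -
  have "((\<lambda>t. x + t *\<^sub>R axis i 1) has_derivative (\<lambda>h. h *\<^sub>R axis i (1::real))) (at 0)"
    by (auto intro!: derivative_eq_intros)
  moreover have "(norm has_derivative (\<lambda>h. h \<bullet> sgn (x + 0 *\<^sub>R axis i 1))) (at (x + 0 *\<^sub>R axis i 1))"
    using GDERIV_norm[of "x + 0 *\<^sub>R axis i 1"] assms unfolding gderiv_def by simp
  ultimately have "((\<lambda>t. norm (x + t *\<^sub>R axis i 1)) has_derivative (\<lambda>h. (h *\<^sub>R axis i 1) \<bullet> sgn (x + 0 *\<^sub>R axis i 1))) (at 0)"
    by (rule has_derivative_compose)
  then show ?thesis unfolding has_field_derivative_def
    by (rule has_derivative_eq_rhs) (auto simp: sgn_div_norm inner_commute[of _ x] inner_axis field_simps)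
qed

text \<open>The derivative is kept as a coordinate times the power \<open>p - 2\<close>, so an
  induction that leaves \<open>p\<close> arbitrary can reuse the bound for powers.\<close>

lemma has_partial_norm_powr:
  assumes "x \<noteq> (0 :: real^'n::finite)"
  shows "has_partial i (\<lambda>x. norm x powr p) x (p * (x $ i * norm x powr (p - 2)))"
proof -
  have "((\<lambda>t. norm (x + t *\<^sub>R axis i 1) powr p) has_real_derivative p * norm (x + 0 *\<^sub>R axis i 1) powr (p - 1) * (x $ i / norm x)) (at 0)"
    by (rule DERIV_chain2[OF has_real_derivative_powr norm_has_real_derivative_axis[OF assms]]) (use assms in simp)
  moreover have "norm x powr (p - 2) = norm x powr (p - 1) / norm x"
    using assms by (simp add: powr_diff power2_eq_square field_simps)
  ultimately show ?thesis unfolding has_partial_def by (simp add: mult_ac)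
qed

lemma has_partial_ln_norm:
  assumes "x \<noteq> (0 :: real^'n::finite)" "h > 0"
  shows "has_partial i (\<lambda>x. ln (norm x / h)) x (x $ i * norm x powr (- 2))"
proof -
  have "((\<lambda>t. ln (norm (x + t *\<^sub>R axis i 1) / h)) has_real_derivative (x $ i * norm x powr (- 2))) (at 0)"
    using assms 
    by (auto intro!: derivative_eq_intros norm_has_real_derivative_axis simp: powr_minus power2_eq_square field_simps)
  then show ?thesis unfolding has_partial_def .
qed

lemma norm_powr_deriv_bound:
  "\<exists>C\<ge>0. deriv_bound k (- {0 :: real^'n::finite}) norm (\<lambda>x. C * norm x powr p) (\<lambda>x. norm x powr p)"
proof (induction k arbitrary: p)
  case 0
  show ?case by (rule exI[of _ 1]) (auto simp: deriv_bound_0 intro!: continuous_intros)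
next
  case (Suc k)
  have op: "open (- {0 :: real^'n})" by (simp add: open_Compl)
  obtain C where C: "C \<ge> 0" "deriv_bound k (- {0 :: real^'n}) norm (\<lambda>x. C * norm x powr (p - 2)) (\<lambda>x. norm x powr (p - 2))"
    using Suc.IH by blast
  \<comment> \<open>The 1 covers the undifferentiated function; the rest is the constant of the
    product \<open>p * (x $ i * norm x powr (p - 2))\<close>.\<close>
  define B where "B = 1 + 2 ^ k * (\<bar>p\<bar> * (2 ^ k * C))"
  have B: "B \<ge> 1" using C by (simp add: B_def)
  have "deriv_bound (Suc k) (- {0 :: real^'n}) norm (\<lambda>x. B * norm x powr p) (\<lambda>x. norm x powr p)"
  proof (rule deriv_bound_SucI[OF op, where D = "\<lambda>i x. p * (x $ i * norm x powr (p - 2))"])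
    show "\<bar>norm x powr p\<bar> \<le> B * norm x powr p" for x :: "real^'n"
      using mult_right_mono[OF B, of "norm x powr p"] by simp
    fix i
    have "deriv_bound k (- {0 :: real^'n}) norm (\<lambda>x. 2 ^ k * (\<bar>p\<bar> * (2 ^ k * (norm x * (C * norm x powr (p - 2))))))
       (\<lambda>x. p * (x $ i * norm x powr (p - 2)))"
      by (rule deriv_bound_mult[OF op deriv_bound_const deriv_bound_mult[OF op deriv_bound_coord C(2)]]) auto
    then show "deriv_bound k (- {0 :: real^'n}) norm (\<lambda>x. B * norm x powr p / norm x) (\<lambda>x. p * (x $ i * norm x powr (p - 2)))"
    proof (rule deriv_bound_mono)
      fix x :: "real^'n" assume x: "x \<in> - {0}"
      have "norm x * norm x powr (p - 2) = norm x powr p / norm x"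
        using x by (simp add: powr_diff power2_eq_square)
      then have "2 ^ k * (\<bar>p\<bar> * (2 ^ k * (norm x * (C * norm x powr (p - 2))))) = (B - 1) * (norm x powr p / norm x)"
        unfolding B_def by (simp add: mult_ac)
      also have "\<dots> \<le> B * (norm x powr p / norm x)" by (intro mult_right_mono) auto
      finally show "2 ^ k * (\<bar>p\<bar> * (2 ^ k * (norm x * (C * norm x powr (p - 2))))) \<le> B * norm x powr p / norm x" by simp
    qed auto
  qed (auto intro!: continuous_intros has_partial_norm_powr)
  then show ?case using B by (intro exI[of _ B]) auto
qed

text \<open>The first derivative does not involve \<open>h\<close>, so one constant serves all
  \<open>h\<close>; only the undifferentiated logarithm keeps the scale.\<close>

lemma ln_norm_deriv_bound:
  "\<exists>C\<ge>0. \<forall>h>0. deriv_bound k (- {0 :: real^'n::finite}) norm (\<lambda>x. C + \<bar>ln (norm x / h)\<bar>) (\<lambda>x. ln (norm x / h))"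
proof (cases k)
  case 0
  show ?thesis unfolding 0 by (rule exI[of _ 0]) (auto simp: deriv_bound_0 intro!: continuous_intros)
next
  case (Suc k)
  have op: "open (- {0 :: real^'n})" by (simp add: open_Compl)
  obtain C where C: "C \<ge> 0" "deriv_bound k (- {0 :: real^'n}) norm (\<lambda>x. C * norm x powr (- 2)) (\<lambda>x. norm x powr (- 2))"
    using norm_powr_deriv_bound by blast
  have "deriv_bound (Suc k) (- {0 :: real^'n}) norm (\<lambda>x. 2 ^ k * C + \<bar>ln (norm x / h)\<bar>) (\<lambda>x. ln (norm x / h))" if "h > 0" for h
  proof (rule deriv_bound_SucI[OF op, where D = "\<lambda>i x. x $ i * norm x powr (- 2)"])
    fix i
    have "deriv_bound k (- {0 :: real^'n}) norm (\<lambda>x. 2 ^ k * (norm x * (C * norm x powr (- 2)))) (\<lambda>x. x $ i * norm x powr (- 2))"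
      by (rule deriv_bound_mult[OF op deriv_bound_coord C(2)]) auto
    then show "deriv_bound k (- {0 :: real^'n}) norm (\<lambda>x. (2 ^ k * C + \<bar>ln (norm x / h)\<bar>) / norm x) (\<lambda>x. x $ i * norm x powr (- 2))"
    proof (rule deriv_bound_mono)
      fix x :: "real^'n" assume x: "x \<in> - {0}"
      have "2 ^ k * (norm x * (C * norm x powr (- 2))) = 2 ^ k * C / norm x"
        using x by (simp add: powr_minus power2_eq_square field_simps)
      also have "\<dots> \<le> (2 ^ k * C + \<bar>ln (norm x / h)\<bar>) / norm x" by (intro divide_right_mono) auto
      finally show "2 ^ k * (norm x * (C * norm x powr (- 2))) \<le> (2 ^ k * C + \<bar>ln (norm x / h)\<bar>) / norm x" .
    qed auto
  qed (use that C in \<open>auto intro!: continuous_intros has_partial_ln_norm\<close>)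
  then show ?thesis using C Suc by (intro exI[of _ "2 ^ k * C"]) auto
qed

section \<open>Test functions and weak derivatives\<close>

text \<open>The usual flat functions P(1/t) exp(-1/t), with an arbitrary polynomial so that the
  family is closed under differentiation; smoothness then follows by induction without formulas for
  higher derivatives.\<close>

definition flat :: "real poly \<Rightarrow> real \<Rightarrow> real" where
  "flat P t = (if t > 0 then poly P (1 / t) * exp (- (1 / t)) else 0)"

lemma poly_exp_decay: "((\<lambda>s :: real. poly P s * exp (- s)) \<longlongrightarrow> 0) at_top"
proof -
  have "((\<lambda>s. \<Sum>i\<le>degree P. coeff P i * (s ^ i / exp s)) \<longlongrightarrow> (\<Sum>i\<le>degree P. coeff P i * 0)) at_top"
    by (intro tendsto_intros tendsto_power_div_exp_0)
  then show ?thesis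
    by (simp add: poly_altdef exp_minus field_simps sum_distrib_left sum_divide_distrib)
qed

lemma flat_tendsto_0: "(flat P \<longlongrightarrow> 0) (at 0)"
proof (rule filterlim_split_at)
  have "eventually (\<lambda>t. flat P t = 0) (at_left 0)"
    unfolding eventually_at_filter by (auto simp: flat_def)
  then show "(flat P \<longlongrightarrow> 0) (at_left 0)" by (rule tendsto_eventually)
  have "((\<lambda>t. poly P (inverse t) * exp (- (inverse t))) \<longlongrightarrow> 0) (at_right 0)"
    by (rule filterlim_compose[OF poly_exp_decay filterlim_inverse_at_top_right])
  moreover have "eventually (\<lambda>t. poly P (inverse t) * exp (- (inverse t)) = flat P t) (at_right 0)"
    unfolding eventually_at_filter by (auto simp: flat_def inverse_eq_divide)
  ultimately show "(flat P \<longlongrightarrow> 0) (at_right 0)" by (rule Lim_transform_eventually)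
qed

lemma flat_has_derivative:
  "(flat P has_real_derivative flat (monom 1 2 * (P - pderiv P)) t) (at t)"
proof -
  consider "t > 0" | "t = 0" | "t < 0" by linarith
  then show ?thesis
  proof cases
    case 1
    have "((\<lambda>t. poly P (1 / t) * exp (- (1 / t))) has_real_derivative flat (monom 1 2 * (P - pderiv P)) t) (at t)"
      using 1 by (auto intro!: derivative_eq_intros DERIV_chain2[OF poly_DERIV]
          simp: flat_def poly_monom field_simps power2_eq_square)
    then show ?thesis
      by (rule has_field_derivative_transform_within_open[of _ _ _ "{0<..}"]) (use 1 in \<open>auto simp: flat_def\<close>)
  next
    case 2
    \<comment> \<open>The difference quotient at 0 divides by \<open>y\<close>, which multiplies the
      polynomial in 1/y by its variable; it is again a flat function and tends to 0.\<close>
    have "eventually (\<lambda>y. flat (pCons 0 P) y = (flat P y - flat P 0) / (y - 0)) (at 0)"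
      unfolding eventually_at_filter by (auto simp: flat_def)
    with flat_tendsto_0[of "pCons 0 P"] have "((\<lambda>y. (flat P y - flat P 0) / (y - 0)) \<longlongrightarrow> 0) (at 0)"
      by (rule Lim_transform_eventually)
    then show ?thesis unfolding 2 has_field_derivative_iff by (simp add: flat_def)
  next
    case 3
    have "((\<lambda>t. 0) has_real_derivative 0) (at t)" by simp
    then have "(flat P has_real_derivative 0) (at t)"
      by (rule has_field_derivative_transform_within_open[of _ _ _ "{..<0}"]) (use 3 in \<open>auto simp: flat_def\<close>)
    then show ?thesis using 3 by (simp add: flat_def)
  qed
qed

lemma continuous_on_flat: "continuous_on A (flat P)"
  using flat_has_derivative[of P] by (meson DERIV_isCont continuous_at_imp_continuous_on)

lemma Ck_on_add:
  assumes "open S" "Ck_on k S f" "Ck_on k S g" shows "Ck_on k S (\<lambda>x. f x + g x)"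
  using assms(2,3)
proof (induction k arbitrary: f g)
  case (Suc k)
  show ?case
    by (rule Ck_on_SucI[OF assms(1), where D = "\<lambda>i x. partial i f x + partial i g x"])
      (use Suc.prems in \<open>auto intro!: continuous_intros Suc.IH has_partial_add has_partial_partial\<close>)
qed (auto intro!: continuous_intros)

lemma Ck_on_mult:
  assumes "open S" "Ck_on k S f" "Ck_on k S g" shows "Ck_on k S (\<lambda>x. f x * g x)"
  using assms(2,3)
proof (induction k arbitrary: f g)
  case (Suc k)
  note l = Ck_on_SucD[OF Suc.prems(1)] Ck_on_SucD[OF Suc.prems(2)]
  show ?case
    by (rule Ck_on_SucI[OF assms(1), where D = "\<lambda>i x. partial i f x * g x + f x * partial i g x"])
      (use Suc.prems l in \<open>auto intro!: continuous_intros Ck_on_add[OF assms(1)] Suc.IH has_partial_mult has_partial_partial\<close>)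
qed (auto intro!: continuous_intros)

lemma Ck_on_const: "open S \<Longrightarrow> Ck_on k S (\<lambda>_. c)"
  using deriv_bound_Ck_on[OF deriv_bound_const[of S "\<lambda>_. 1"]] by auto

lemma Ck_on_prod:
  "open S \<Longrightarrow> (\<And>i. i \<in> I \<Longrightarrow> Ck_on k S (f i)) \<Longrightarrow> Ck_on k S (\<lambda>x. \<Prod>i\<in>I. f i x)"
  by (induction I rule: infinite_finite_induct) (auto intro!: Ck_on_const Ck_on_mult)

lemma Ck_on_flat: "Ck_on k UNIV (\<lambda>x :: real^'n::finite. flat P (c * x $ i + b))"
proof (induction k arbitrary: P)
  case 0
  show ?case by (auto intro!: continuous_on_compose2[OF continuous_on_flat[of UNIV]] continuous_intros)
next
  case (Suc k)
  show ?case
  proof (rule Ck_on_SucI[OF open_UNIV, where D = "\<lambda>j x. (if j = i then c else 0) * flat (monom 1 2 * (P - pderiv P)) (c * x $ i + b)"])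
    show "continuous_on UNIV (\<lambda>x :: real^'n. flat P (c * x $ i + b))"
      by (auto intro!: continuous_on_compose2[OF continuous_on_flat[of UNIV]] continuous_intros)
    fix j and x :: "real^'n"
    have "((\<lambda>t. c * (x + t *\<^sub>R axis j 1) $ i + b) has_real_derivative (if j = i then c else 0)) (at 0)"
      by (auto intro!: derivative_eq_intros simp: axis_def)
    from DERIV_chain2[OF flat_has_derivative this]
    show "has_partial j (\<lambda>x. flat P (c * x $ i + b)) x ((if j = i then c else 0) * flat (monom 1 2 * (P - pderiv P)) (c * x $ i + b))"
      unfolding has_partial_def by (simp add: mult.commute)
  qed (intro Ck_on_mult Ck_on_const Suc.IH open_UNIV)
qed

text \<open>Written in the affine form required by \<open>Ck_on_flat\<close>;
  \<open>box_bump_alt\<close> is the readable form. Each coordinate has a rising factor at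
  \<open>a\<close> and a falling factor at \<open>b\<close>. Growing \<open>n\<close> drives
  exp(-1/t) to 1, so the bumps converge pointwise to the indicator of the open box.\<close>

definition box_bump :: "real^'n::finite \<Rightarrow> real^'n \<Rightarrow> nat \<Rightarrow> real^'n \<Rightarrow> real" where
  "box_bump a b n x = (\<Prod>i\<in>UNIV. flat 1 (Suc n * x $ i + - (Suc n * a $ i)) * flat 1 (- Suc n * x $ i + Suc n * b $ i))"

lemma flat_1: "flat 1 t = (if t > 0 then exp (- (1 / t)) else 0)"
  by (simp add: flat_def)

lemma box_bump_alt:
  "box_bump a b n x = (\<Prod>i\<in>UNIV. flat 1 (Suc n * (x $ i - a $ i)) * flat 1 (Suc n * (b $ i - x $ i)))"
  unfolding box_bump_def by (rule prod.cong) (auto simp: algebra_simps)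

lemma box_bump_eq_0:
  assumes "x \<notin> box a b"
  shows "box_bump a b n x = 0"
  unfolding box_bump_alt
proof (rule prod_zero)
  obtain i where "x $ i \<le> a $ i \<or> b $ i \<le> x $ i" using assms by (auto simp: mem_box_cart not_less)
  then show "\<exists>i\<in>UNIV. flat 1 (Suc n * (x $ i - a $ i)) * flat 1 (Suc n * (b $ i - x $ i)) = 0"
    by (intro bexI[of _ i]) (auto simp: flat_1 zero_less_mult_iff)
qed simp

lemma box_bump_bounds: "0 \<le> box_bump a b n x" "box_bump a b n x \<le> 1"
  unfolding box_bump_def by (auto intro!: prod_nonneg prod_le_1 mult_le_one simp: flat_1)

lemma box_bump_test: "test_function (box_bump a b n)"
  unfolding test_function_def
proof (intro conjI allI)
  show "Ck_on k UNIV (box_bump a b n)" for k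
    unfolding box_bump_def by (intro Ck_on_prod Ck_on_mult Ck_on_flat open_UNIV)
  have "closure {x. box_bump a b n x \<noteq> 0} \<subseteq> cbox a b"
    by (rule closure_minimal) (use box_bump_eq_0 box_subset_cbox in blast, rule closed_cbox)
  then show "compact (closure {x. box_bump a b n x \<noteq> 0})"
    by (meson bounded_cbox bounded_subset closed_closure compact_eq_bounded_closed)
qed

lemma flat_1_tendsto:
  assumes "t > (0 :: real)"
  shows "(\<lambda>n. flat 1 (real (Suc n) * t)) \<longlonglongrightarrow> 1"
proof -
  have "(\<lambda>n. exp (- ((1 / t) * inverse (real (Suc n))))) \<longlonglongrightarrow> exp (- ((1 / t) * 0))"
    by (intro tendsto_intros LIMSEQ_inverse_real_of_nat)
  moreover have "flat 1 (real (Suc n) * t) = exp (- ((1 / t) * inverse (real (Suc n))))" for n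
  proof -
    have "0 < real (Suc n) * t" using assms by (intro mult_pos_pos) auto
    then show ?thesis unfolding flat_1 by (simp add: inverse_eq_divide mult.commute)
  qed
  ultimately show ?thesis by simp
qed

lemma box_bump_tendsto: "(\<lambda>n. box_bump a b n x) \<longlonglongrightarrow> indicator (box a b) x"
proof (cases "x \<in> box a b")
  case True
  have "(\<lambda>n. flat 1 (Suc n * (x $ i - a $ i)) * flat 1 (Suc n * (b $ i - x $ i))) \<longlonglongrightarrow> 1 * 1" for i
    by (intro tendsto_mult flat_1_tendsto) (use True in \<open>auto simp: mem_box_cart\<close>)
  then have "(\<lambda>n. \<Prod>i\<in>UNIV. flat 1 (Suc n * (x $ i - a $ i)) * flat 1 (Suc n * (b $ i - x $ i))) \<longlonglongrightarrow> (\<Prod>i\<in>(UNIV :: 'a set). 1)"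
    by (intro tendsto_prod) simp
  then show ?thesis using True by (simp add: box_bump_alt)
qed (simp add: box_bump_eq_0)

lemma test_function_continuous: "test_function \<psi> \<Longrightarrow> continuous_on UNIV \<psi>"
  unfolding test_function_def using Ck_on_imp_continuous by blast

lemma support_closure: "f x \<noteq> 0 \<Longrightarrow> x \<in> closure {x. f x \<noteq> 0}"
  by (rule subsetD[OF closure_subset]) simp

lemma test_function_bounded: "test_function \<psi> \<Longrightarrow> \<exists>B\<ge>0. \<forall>x. \<bar>\<psi> x\<bar> \<le> B"
proof -
  assume t: "test_function \<psi>"
  let ?K = "closure {x. \<psi> x \<noteq> 0}"
  have "compact (\<psi> ` ?K)"
    using t test_function_continuous[OF t] continuous_on_subset
    by (intro compact_continuous_image) (auto simp: test_function_def)
  then obtain B where B: "\<forall>y\<in>\<psi> ` ?K. norm y \<le> B"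
    using bounded_iff[of "\<psi> ` ?K"] compact_imp_bounded by blast
  have "\<bar>\<psi> x\<bar> \<le> \<bar>B\<bar>" for x
  proof (cases "\<psi> x = 0")
    case False
    then have "x \<in> ?K" by (rule support_closure)
    then have "norm (\<psi> x) \<le> B" using B by blast
    then show ?thesis by simp
  qed simp
  then show ?thesis by (intro exI[of _ "\<bar>B\<bar>"]) auto
qed

lemma test_function_partial:
  assumes "test_function \<psi>" shows "test_function (partial i \<psi>)"
  unfolding test_function_def
proof (intro conjI allI)
  show "Ck_on k UNIV (partial i \<psi>)" for k
    using assms Ck_on.simps(2)[of k UNIV \<psi>] unfolding test_function_def by blast
  let ?K = "closure {x. \<psi> x \<noteq> 0}"
  have "partial i \<psi> x = 0" if "x \<in> - ?K" for x
  proof -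
    have "partial i \<psi> x = partial i (\<lambda>_. 0) x"
      by (rule partial_cong_open[OF _ that]) (use support_closure[of \<psi>] in auto)
    then show ?thesis using partial_eqI[OF has_partial_const] by simp
  qed
  then have "closure {x. partial i \<psi> x \<noteq> 0} \<subseteq> ?K"
    by (intro closure_minimal) auto
  moreover have "bounded ?K" using assms unfolding test_function_def by (blast intro: compact_imp_bounded)
  ultimately show "compact (closure {x. partial i \<psi> x \<noteq> 0})"
    by (simp add: compact_eq_bounded_closed bounded_subset)
qed

lemma test_function_foldr_partial: "test_function \<psi> \<Longrightarrow> test_function (foldr partial js \<psi>)"
  by (induction js) (auto intro: test_function_partial)

section \<open>Locally integrable functions tested against smooth functions\<close>

lemma locally_integrable_measurable:
  assumes "locally_integrable (g :: real^'n::finite \<Rightarrow> real)"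
  shows "g \<in> borel_measurable lebesgue"
proof -
  let ?f = "\<lambda>n x. indicator (cball 0 (real n)) x * g x"
  have meas: "?f n \<in> borel_measurable lebesgue" for n
  proof -
    have "set_integrable lebesgue (cball 0 (real n)) g"
      using assms by (simp add: locally_integrable_def)
    from borel_measurable_integrable[OF this[unfolded set_integrable_def]] show ?thesis by simp
  qed
  have lim: "(\<lambda>n. ?f n x) \<longlonglongrightarrow> g x" for x
  proof (rule tendsto_eventually)
    have "eventually (\<lambda>n. norm x \<le> real n) sequentially"
    proof -
      obtain N where "norm x \<le> real N" using real_arch_simple by blast
      then show ?thesis by (intro eventually_sequentiallyI[of N]) linarith
    qed
    then show "eventually (\<lambda>n. ?f n x = g x) sequentially" by eventually_elim simp
  qed
  show ?thesis by (rule borel_measurable_LIMSEQ_real[OF lim meas])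
qed

lemma integrable_mult_bounded_support:
  assumes g: "locally_integrable (g :: real^'n::finite \<Rightarrow> real)" and K: "compact K"
    and \<psi>: "\<psi> \<in> borel_measurable lebesgue" "\<And>x. \<bar>\<psi> x\<bar> \<le> B" "\<And>x. x \<notin> K \<Longrightarrow> \<psi> x = 0"
  shows "integrable lebesgue (\<lambda>x. g x * \<psi> x)"
proof (rule Bochner_Integration.integrable_bound)
  show "integrable lebesgue (\<lambda>x. B * (indicator K x *\<^sub>R g x))"
    using g K unfolding locally_integrable_def set_integrable_def by auto
  show "(\<lambda>x. g x * \<psi> x) \<in> borel_measurable lebesgue"
    using locally_integrable_measurable[OF g] \<psi>(1) by measurable
  have "0 \<le> B" using \<psi>(2)[of undefined] by linarith
  then show "AE x in lebesgue. norm (g x * \<psi> x) \<le> norm (B * (indicator K x *\<^sub>R g x))"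
    using \<psi>(2,3) by (intro AE_I2) (auto simp: abs_mult indicator_def mult.commute[of "\<bar>g _\<bar>"] intro!: mult_right_mono)
qed

lemma test_function_measurable: "test_function \<psi> \<Longrightarrow> \<psi> \<in> borel_measurable borel"
  using test_function_continuous borel_measurable_continuous_onI by blast

lemma integrable_mult_test:
  assumes "locally_integrable (g :: real^'n::finite \<Rightarrow> real)" "test_function \<psi>"
  shows "integrable lebesgue (\<lambda>x. g x * \<psi> x)"
proof -
  obtain B where B: "\<And>x. \<bar>\<psi> x\<bar> \<le> B" using test_function_bounded[OF assms(2)] by auto
  have K: "compact (closure {x. \<psi> x \<noteq> 0})" using assms(2) by (simp add: test_function_def)
  have Z: "\<psi> x = 0" if "x \<notin> closure {x. \<psi> x \<noteq> 0}" for x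
    using that support_closure[of \<psi> x] by argo
  have m: "\<psi> \<in> borel_measurable lebesgue"
    using test_function_measurable[OF assms(2)] by (intro measurable_completion) simp
  show ?thesis by (rule integrable_mult_bounded_support[OF assms(1) K m B Z])
qed

text \<open>Boxes are stable under intersection and generate the Borel sets, so the sets with
  vanishing integral form a Dynkin class containing them; the vanishing total integral handles
  complements.\<close>

lemma box_integral_zero_imp_AE_zero:
  fixes f :: "'a::euclidean_space \<Rightarrow> real"
  assumes f: "integrable lborel f" and 0: "integral\<^sup>L lborel f = 0"
    and box: "\<And>a b. (LINT x:box a b|lborel. f x) = 0"
  shows "AE x in lborel. f x = 0"
proof (rule sigma_finite_measure.density_zero[OF sigma_finite_lborel f])
  fix A :: "'a set" assume "A \<in> sets lborel"
  then have A: "A \<in> sigma_sets UNIV (range (\<lambda>(a, b). box a b))" by (simp add: borel_eq_box)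
  have G: "Int_stable (range (\<lambda>(a, b). box a b :: 'a set))" by (auto simp: Int_stable_def box_Int_box)
  have subset_Pow: "range (\<lambda>(a, b). box a b :: 'a set) \<subseteq> Pow UNIV" by simp
  have sm: "B \<in> sets borel" if "B \<in> sigma_sets UNIV (range (\<lambda>(a, b). box a b))" for B :: "'a set"
    using that by (simp add: borel_eq_box)
  show "(LINT x:A|lborel. f x) = 0"
    using A
  proof (induction rule: sigma_sets_induct_disjoint[OF G subset_Pow, consumes 1, case_names basic empty compl union])
    case (compl B)
    have "(LINT x:UNIV - B|lborel. f x) = (\<integral>x. f x - indicator B x *\<^sub>R f x \<partial>lborel)"
      unfolding set_lebesgue_integral_def by (intro Bochner_Integration.integral_cong) (auto simp: indicator_def)
    also have "\<dots> = integral\<^sup>L lborel f - (LINT x:B|lborel. f x)"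
      unfolding set_lebesgue_integral_def
      using sm[OF compl.hyps] by (intro Bochner_Integration.integral_diff f integrable_mult_indicator) auto
    finally show ?case using 0 compl.IH by simp
  next
    case (union B)
    have "(LINT x:(\<Union>i. B i)|lborel. f x) = (\<Sum>i. LINT x:B i|lborel. f x)"
    proof (rule lebesgue_integral_countable_add)
      show "B i \<in> sets lborel" for i using sm union.hyps by auto
      show "B i \<inter> B j = {}" if "i \<noteq> j" for i j using union.hyps that by (auto simp: disjoint_family_on_def)
      show "set_integrable lborel (\<Union>i. B i) f"
        unfolding set_integrable_def using sm union.hyps by (intro integrable_mult_indicator f) auto
    qed
    then show ?case using union.IH by simp
  next
    case empty
    then show ?case by (simp add: set_lebesgue_integral_def)
  next
    case (basic B)
    then show ?case using box by auto
  qed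
qed

text \<open>Dominated convergence with the bumps turns vanishing test integrals into vanishing
  integrals over boxes. Since \<open>g\<close> is only locally integrable, the box criterion is
  applied to a Borel representative cut off by the boxes \<open>?B n\<close>, whose intersections
  with boxes are boxes again.\<close>

theorem fundamental_lemma_variations:
  fixes g :: "real^'n::finite \<Rightarrow> real"
  assumes g: "locally_integrable g" and 0: "\<And>\<psi>. test_function \<psi> \<Longrightarrow> (LINT x|lebesgue. g x * \<psi> x) = 0"
  shows "AE x in lebesgue. g x = 0"
proof -
  have int: "integrable lebesgue (\<lambda>x. g x * indicator (cbox a b) x)" for a b
  proof -
    have "set_integrable lebesgue (cbox a b) g" using g compact_cbox by (simp add: locally_integrable_def)
    then show ?thesis by (simp add: set_integrable_def mult.commute)
  qed
  have m[measurable]: "g \<in> borel_measurable lebesgue" by (rule locally_integrable_measurable[OF g])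
  have mb: "box_bump a b n \<in> borel_measurable lebesgue" for a b :: "real^'n" and n
    using test_function_measurable[OF box_bump_test, of a b n] by (intro measurable_completion) simp
  have [measurable]: "(\<lambda>x. g x * box_bump a b n x) \<in> borel_measurable lebesgue" for a b n
    using m mb by (rule borel_measurable_times)
  have box: "(LINT x|lebesgue. g x * indicator (box a b) x) = 0" for a b
  proof -
    have "(\<lambda>n. LINT x|lebesgue. g x * box_bump a b n x) \<longlonglongrightarrow> (LINT x|lebesgue. g x * indicator (box a b) x)"
    proof (rule integral_dominated_convergence[where w = "\<lambda>x. \<bar>g x * indicator (cbox a b) x\<bar>"])
      show "AE x in lebesgue. (\<lambda>n. g x * box_bump a b n x) \<longlonglongrightarrow> g x * indicator (box a b) x"
        by (intro AE_I2 tendsto_intros box_bump_tendsto)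
      show "AE x in lebesgue. norm (g x * box_bump a b n x) \<le> \<bar>g x * indicator (cbox a b) x\<bar>" for n
      proof (intro AE_I2)
        fix x
        show "norm (g x * box_bump a b n x) \<le> \<bar>g x * indicator (cbox a b) x\<bar>"
        proof (cases "x \<in> cbox a b")
          case True
          then show ?thesis using box_bump_bounds[of a b n x] by (simp add: abs_mult mult_left_le)
        next
          case False
          then have "x \<notin> box a b" using box_subset_cbox[of a b] by blast
          then show ?thesis by (simp add: box_bump_eq_0)
        qed
      qed
      show "integrable lebesgue (\<lambda>x. \<bar>g x * indicator (cbox a b) x\<bar>)" using int by (rule integrable_abs)
      show "(\<lambda>x. g x * indicator (box a b) x) \<in> borel_measurable lebesgue" by (intro borel_measurable_times m measurable_completion) measurable
    qed measurable
    moreover have "(LINT x|lebesgue. g x * box_bump a b n x) = 0" for n by (intro 0 box_bump_test)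
    ultimately show ?thesis by (simp add: LIMSEQ_const_iff)
  qed
  obtain G where G: "G \<in> borel_measurable lborel" "AE x in lborel. g x = G x"
    using completion_ex_borel_measurable_real[OF m] by blast
  have G[measurable]: "G \<in> borel_measurable borel" and ae: "AE x in lebesgue. g x = G x"
    using G by (auto intro: AE_completion)
  let ?B = "\<lambda>n::nat. box (- (real n *\<^sub>R One)) (real n *\<^sub>R One) :: (real^'n) set"
  have Gl: "G \<in> borel_measurable lebesgue" by (intro measurable_completion) simp
  have il: "indicator (box a b) \<in> borel_measurable lebesgue" for a b :: "real^'n"
    by (intro measurable_completion) measurable
  have eq: "(LINT x|lebesgue. g x * indicator (box a b) x) = (LINT x|lborel. G x * indicator (box a b) x)" for a b
  proof -
    have "(LINT x|lebesgue. g x * indicator (box a b) x) = (LINT x|lebesgue. G x * indicator (box a b) x)"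
      by (intro integral_cong_AE borel_measurable_times m Gl il) (use ae in \<open>auto elim: eventually_mono\<close>)
    also have "\<dots> = (LINT x|lborel. G x * indicator (box a b) x)"
      by (rule integral_completion) measurable
    finally show ?thesis .
  qed
  have aeB: "AE x in lborel. G x * indicator (?B n) x = 0" for n
  proof (rule box_integral_zero_imp_AE_zero)
    have "integrable lebesgue (\<lambda>x. G x * indicator (?B n) x)"
    proof (rule Bochner_Integration.integrable_bound[OF int[of "- (real n *\<^sub>R One)" "real n *\<^sub>R One"]])
      show "(\<lambda>x. G x * indicator (?B n) x) \<in> borel_measurable lebesgue"
        by (intro measurable_completion) measurable
      show "AE x in lebesgue. norm (G x * indicator (?B n) x) \<le> norm (g x * indicator (cbox (- (real n *\<^sub>R One)) (real n *\<^sub>R One)) x)"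
        using ae
      proof eventually_elim
        fix x assume "g x = G x"
        moreover have "x \<in> ?B n \<Longrightarrow> x \<in> cbox (- (real n *\<^sub>R One)) (real n *\<^sub>R One)"
          by (rule subsetD[OF box_subset_cbox])
        ultimately show "norm (G x * indicator (?B n) x) \<le> norm (g x * indicator (cbox (- (real n *\<^sub>R One)) (real n *\<^sub>R One)) x)"
          by (cases "x \<in> ?B n") simp_all
      qed
    qed
    then show "integrable lborel (\<lambda>x. G x * indicator (?B n) x)"
      by (subst (asm) integrable_completion) simp_all
    show "(LINT x|lborel. G x * indicator (?B n) x) = 0" by (simp add: eq[symmetric] box)
    fix a b
    obtain c d where cd: "box a b \<inter> ?B n = box c d" unfolding box_Int_box by blast
    have "(LINT x:box a b|lborel. G x * indicator (?B n) x) = (LINT x|lborel. G x * indicator (box a b \<inter> ?B n) x)"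
      unfolding set_lebesgue_integral_def by (intro Bochner_Integration.integral_cong) (auto simp: indicator_def)
    then show "(LINT x:box a b|lborel. G x * indicator (?B n) x) = 0" unfolding cd by (simp add: eq[symmetric] box)
  qed
  have "AE x in lborel. \<forall>n. G x * indicator (?B n) x = 0"
    unfolding AE_all_countable using aeB by blast
  then have "AE x in lborel. G x = 0"
  proof eventually_elim
    fix x assume *: "\<forall>n. G x * indicator (?B n) x = 0"
    obtain n where "x \<in> ?B n" using UN_box_eq_UNIV[where 'a="real^'n"] by blast
    then show "G x = 0" using *[rule_format, of n] by simp
  qed
  then have "AE x in lebesgue. G x = 0" by (rule AE_completion)
  with ae show ?thesis by eventually_elim simp
qed

section \<open>Uniqueness of weak derivatives\<close>

lemma locally_integrable_diff:
  "locally_integrable f \<Longrightarrow> locally_integrable g \<Longrightarrow> locally_integrable (\<lambda>x. f x - g x)"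
  unfolding locally_integrable_def by (auto intro: set_integral_diff)

lemma is_weak_deriv_unique:
  assumes "is_weak_deriv \<beta> u g" "is_weak_deriv \<beta> u k"
  shows "AE x in lebesgue. g x = k x"
proof -
  have l: "locally_integrable g" "locally_integrable k" using assms by (auto simp: is_weak_deriv_def)
  have "AE x in lebesgue. g x - k x = 0"
  proof (rule fundamental_lemma_variations)
    show "locally_integrable (\<lambda>x. g x - k x)" using l by (rule locally_integrable_diff)
    fix \<psi> :: "real^'a \<Rightarrow> real" assume t: "test_function \<psi>"
    have "(LINT x|lebesgue. g x * \<psi> x) = (LINT x|lebesgue. k x * \<psi> x)"
      using assms t unfolding is_weak_deriv_def by auto
    then show "(LINT x|lebesgue. (g x - k x) * \<psi> x) = 0"
      using integrable_mult_test[OF l(1) t] integrable_mult_test[OF l(2) t] by (simp add: left_diff_distrib)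
  qed
  then show ?thesis by eventually_elim simp
qed

text \<open>Controls the choice in \<open>weak_deriv\<close>: once an explicit weak derivative is
  known, the chosen one may be replaced by it in every integral.\<close>

lemma weak_deriv_AE_eq:
  assumes "is_weak_deriv \<beta> u g"
  shows "AE x in lebesgue. weak_deriv \<beta> u x = g x" "is_weak_deriv \<beta> u (weak_deriv \<beta> u)"
proof -
  show w: "is_weak_deriv \<beta> u (weak_deriv \<beta> u)"
    unfolding weak_deriv_def by (rule someI[where P = "is_weak_deriv \<beta> u", OF assms])
  show "AE x in lebesgue. weak_deriv \<beta> u x = g x" by (rule is_weak_deriv_unique[OF w assms])
qed

section \<open>Absolute continuity on coordinate lines and integration by parts\<close>

lemma nn_integral_shift:
  fixes f :: "'a::euclidean_space \<Rightarrow> ennreal"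
  assumes [measurable]: "f \<in> borel_measurable borel"
  shows "(\<integral>\<^sup>+x. f (x + c) \<partial>lborel) = (\<integral>\<^sup>+x. f x \<partial>lborel)"
  by (subst lborel_distr_plus[symmetric, of c], subst nn_integral_distr) (auto simp: add.commute)

lemma nn_integral_reflect:
  fixes f :: "'a::euclidean_space \<Rightarrow> ennreal"
  assumes [measurable]: "f \<in> borel_measurable borel"
  shows "(\<integral>\<^sup>+x. f (c - x) \<partial>lborel) = (\<integral>\<^sup>+x. f x \<partial>lborel)"
proof -
  have "lborel = distr lborel borel (\<lambda>x :: 'a. c - x)"
    using lborel_affine[of "-1" c] by (simp add: density_1)
  then have "(\<integral>\<^sup>+x. f x \<partial>lborel) = (\<integral>\<^sup>+x. f x \<partial>distr lborel borel (\<lambda>x :: 'a. c - x))" by metis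
  then show ?thesis by (subst (asm) nn_integral_distr) auto
qed

lemma lborel_integral_shift:
  fixes f :: "'a::euclidean_space \<Rightarrow> real"
  assumes [measurable]: "f \<in> borel_measurable borel"
  shows "(LINT x|lborel. f (x + c)) = (LINT x|lborel. f x)"
  by (subst lborel_distr_plus[symmetric, of c], subst integral_distr) (auto simp: add.commute)

lemma cball_in_borel [measurable]: "cball (c :: 'a::euclidean_space) r \<in> sets borel"
  by (intro borel_closed closed_cball)

lemma bounded_subset_cball_0: "bounded (S :: 'a::real_normed_vector set) \<Longrightarrow> \<exists>R. S \<subseteq> cball 0 R"
  unfolding bounded_iff by (auto simp: subset_iff)

text \<open>Local integrability of a Borel function with respect to \<open>lborel\<close>. Borel
  functions rather than Lebesgue measurable ones keep compositions with shifts jointly measurable,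
  as the Fubini theorems on product measures demand.\<close>

definition lint :: "(real^'n::finite \<Rightarrow> real) \<Rightarrow> bool" where
  "lint F \<longleftrightarrow> F \<in> borel_measurable borel \<and>
    (\<forall>R. (\<integral>\<^sup>+x. ennreal \<bar>F x\<bar> * indicator (cball 0 R) x \<partial>lborel) < \<infinity>)"

lemma lintD: "lint F \<Longrightarrow> F \<in> borel_measurable borel"
  "lint F \<Longrightarrow> (\<integral>\<^sup>+x. ennreal \<bar>F x\<bar> * indicator (cball 0 R) x \<partial>lborel) < \<infinity>"
  unfolding lint_def by auto

lemma lint_integrable_mult:
  assumes F: "lint F" and k[measurable]: "k \<in> borel_measurable borel"
    and B: "\<And>x. \<bar>k x\<bar> \<le> B" and Z: "\<And>x. x \<notin> cball 0 R \<Longrightarrow> k x = 0"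
  shows "integrable lborel (\<lambda>x. F x * k x)"
proof (rule integrableI_bounded)
  have [measurable]: "F \<in> borel_measurable borel" using F by (rule lintD)
  show "(\<lambda>x. F x * k x) \<in> borel_measurable lborel" by measurable
  have B0: "0 \<le> B" using B[of undefined] by linarith
  have "(\<integral>\<^sup>+x. ennreal (norm (F x * k x)) \<partial>lborel) \<le> (\<integral>\<^sup>+x. ennreal B * (ennreal \<bar>F x\<bar> * indicator (cball 0 R) x) \<partial>lborel)"
  proof (rule nn_integral_mono)
    fix x
    show "ennreal (norm (F x * k x)) \<le> ennreal B * (ennreal \<bar>F x\<bar> * indicator (cball 0 R) x)"
    proof (cases "x \<in> cball 0 R")
      case True
      have "\<bar>F x * k x\<bar> \<le> B * \<bar>F x\<bar>" using B[of x] by (simp add: abs_mult mult.commute[of B] mult_left_mono)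
      then show ?thesis using True B0 by (simp add: ennreal_mult'[symmetric] ennreal_leI)
    next
      case False
      then show ?thesis using Z by simp
    qed
  qed
  also have "\<dots> = ennreal B * (\<integral>\<^sup>+x. ennreal \<bar>F x\<bar> * indicator (cball 0 R) x \<partial>lborel)"
    by (rule nn_integral_cmult) measurable
  also have "\<dots> < \<infinity>" using lintD(2)[OF F, of R] by (simp add: ennreal_mult_less_top)
  finally show "(\<integral>\<^sup>+x. ennreal (norm (F x * k x)) \<partial>lborel) < \<infinity>" .
qed

lemma lint_locally_integrable:
  assumes "lint F" shows "locally_integrable F"
  unfolding locally_integrable_def
proof (intro allI impI)
  fix A :: "(real^'a) set" assume A: "compact A"
  then obtain R where R: "A \<subseteq> cball 0 R" using bounded_subset_cball_0[OF compact_imp_bounded] by blast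
  have [measurable]: "A \<in> sets borel" using A by (simp add: compact_imp_closed)
  have [measurable]: "F \<in> borel_measurable borel" using assms by (rule lintD)
  have "integrable lborel (\<lambda>x. F x * indicator A x)"
    by (rule lint_integrable_mult[OF assms, of _ 1 R]) (use R in \<open>auto simp: indicator_def\<close>)
  then show "set_integrable lebesgue A F"
    unfolding set_integrable_def by (subst integrable_completion) (auto simp: mult.commute)
qed

text \<open>The integrated form of saying that \<open>G\<close> is the i-th derivative of
  \<open>F\<close>. The null set may depend on \<tau>, so the property survives translation, linear
  combination and convolution, and no exceptional lines have to be tracked.\<close>

definition line_deriv :: "'n \<Rightarrow> (real^'n::finite \<Rightarrow> real) \<Rightarrow> (real^'n \<Rightarrow> real) \<Rightarrow> bool" where
  "line_deriv i F G \<longleftrightarrow> (\<forall>\<tau>>0. AE x in lborel.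
     F (x + \<tau> *\<^sub>R axis i 1) - F x = (LINT \<eta>:{0..\<tau>}|lborel. G (x + \<eta> *\<^sub>R axis i 1)))"

lemma test_function_lipschitz:
  assumes t: "test_function \<psi>" and B: "\<And>x. \<bar>partial i \<psi> x\<bar> \<le> B"
  shows "\<bar>\<psi> (y + s *\<^sub>R axis i 1) - \<psi> y\<bar> \<le> B * \<bar>s\<bar>"
proof -
  have C: "Ck_on 1 UNIV \<psi>" using t by (simp add: test_function_def)
  have "norm (\<psi> (y + s *\<^sub>R axis i 1) - \<psi> (y + 0 *\<^sub>R axis i 1)) \<le> B * norm (s - 0)"
  proof (rule field_differentiable_bound[where S = UNIV and f' = "\<lambda>t. partial i \<psi> (y + t *\<^sub>R axis i 1)"])
    fix z
    show "((\<lambda>t. \<psi> (y + t *\<^sub>R axis i 1)) has_field_derivative partial i \<psi> (y + z *\<^sub>R axis i 1)) (at z within UNIV)"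
      by (intro has_partial_line Ck_on_has_partial[OF C]) auto
    show "norm (partial i \<psi> (y + z *\<^sub>R axis i 1)) \<le> B" using B by simp
  qed auto
  then show ?thesis by simp
qed

text \<open>The Fubini prerequisite for pairing \<open>G\<close> on lines with \<psi>. A shift by at
  most 1 moves the support into the ball of radius \<open>R + 1\<close>, so local integrability of
  \<open>G\<close> suffices.\<close>

lemma line_deriv_integrable_pair:
  fixes G \<psi> :: "real^'n::finite \<Rightarrow> real"
  assumes G: "lint G" and \<psi>m[measurable]: "\<psi> \<in> borel_measurable borel" and B: "\<And>x. \<bar>\<psi> x\<bar> \<le> B"
    and Z: "\<And>x. x \<notin> cball 0 R \<Longrightarrow> \<psi> x = 0" and \<tau>: "0 \<le> \<tau>" "\<tau> \<le> 1"
  shows "integrable (lborel \<Otimes>\<^sub>M lborel) (\<lambda>(y, \<eta>). indicator {0..\<tau>} \<eta> * (G (y + \<eta> *\<^sub>R axis i 1) * \<psi> y))"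
proof (rule integrableI_bounded)
  have Gm[measurable]: "G \<in> borel_measurable borel" using G by (rule lintD)
  let ?f = "\<lambda>(y, \<eta>). indicator {0..\<tau>} \<eta> * (G (y + \<eta> *\<^sub>R axis i 1) * \<psi> y)"
  show m: "?f \<in> borel_measurable (lborel \<Otimes>\<^sub>M lborel)" by measurable
  have B0: "0 \<le> B" using B[of undefined] by linarith
  define A where "A = (\<integral>\<^sup>+x. ennreal \<bar>G x\<bar> * indicator (cball 0 (R + 1)) x \<partial>lborel)"
  have A: "A < \<infinity>" unfolding A_def by (rule lintD(2)[OF G])
  have inner: "(\<integral>\<^sup>+y. ennreal (norm (?f (y, \<eta>))) \<partial>lborel) \<le> ennreal B * A * indicator {0..\<tau>} \<eta>" for \<eta>
  proof (cases "\<eta> \<in> {0..\<tau>}")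
    case True
    have "(\<integral>\<^sup>+y. ennreal (norm (?f (y, \<eta>))) \<partial>lborel) \<le> (\<integral>\<^sup>+y. (\<lambda>x. ennreal B * (ennreal \<bar>G x\<bar> * indicator (cball 0 (R + 1)) x)) (y + \<eta> *\<^sub>R axis i 1) \<partial>lborel)"
    proof (rule nn_integral_mono)
      fix y
      show "ennreal (norm (?f (y, \<eta>))) \<le> (\<lambda>x. ennreal B * (ennreal \<bar>G x\<bar> * indicator (cball 0 (R + 1)) x)) (y + \<eta> *\<^sub>R axis i 1)"
      proof (cases "y \<in> cball 0 R")
        case y: True
        have "norm (y + \<eta> *\<^sub>R axis i (1::real)) \<le> norm y + norm (\<eta> *\<^sub>R axis i (1::real))" by (rule norm_triangle_ineq)
        also have "\<dots> \<le> R + 1" using y True \<tau> by simp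
        finally have "y + \<eta> *\<^sub>R axis i 1 \<in> cball 0 (R + 1)" by simp
        moreover have "\<bar>G (y + \<eta> *\<^sub>R axis i 1) * \<psi> y\<bar> \<le> B * \<bar>G (y + \<eta> *\<^sub>R axis i 1)\<bar>"
          using B[of y] by (simp add: abs_mult mult.commute[of B] mult_left_mono)
        ultimately show ?thesis using True B0 by (simp add: ennreal_mult'[symmetric] ennreal_leI)
      qed (simp add: Z)
    qed
    also have "\<dots> = (\<integral>\<^sup>+x. ennreal B * (ennreal \<bar>G x\<bar> * indicator (cball 0 (R + 1)) x) \<partial>lborel)"
      by (rule nn_integral_shift) measurable
    also have "\<dots> = ennreal B * A" unfolding A_def by (rule nn_integral_cmult) measurable
    finally show ?thesis using True by simp
  qed simp
  have "(\<integral>\<^sup>+z. ennreal (norm (?f z)) \<partial>(lborel \<Otimes>\<^sub>M lborel)) = (\<integral>\<^sup>+\<eta>. (\<integral>\<^sup>+y. ennreal (norm (?f (y, \<eta>))) \<partial>lborel) \<partial>lborel)"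
    by (rule lborel_pair.nn_integral_snd[symmetric]) measurable
  also have "\<dots> \<le> (\<integral>\<^sup>+\<eta>. ennreal B * A * indicator {0..\<tau>} \<eta> \<partial>lborel)"
    by (rule nn_integral_mono) (rule inner)
  also have "\<dots> = ennreal B * A * ennreal \<tau>" using \<tau> by (simp add: nn_integral_cmult_indicator)
  also have "\<dots> < \<infinity>" using A by (simp add: ennreal_mult_less_top)
  finally show "(\<integral>\<^sup>+z. ennreal (norm (?f z)) \<partial>(lborel \<Otimes>\<^sub>M lborel)) < \<infinity>" .
qed

text \<open>Pairing \<open>F\<close> with the difference quotient of \<psi> equals, after a
  translation and Fubini, the mean over [0, \<tau>] of \<open>H \<eta>\<close>, the pairing of
  \<open>G\<close> with \<psi> shifted by \<eta>. As \<tau> tends to 0 the mean tends to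
  \<open>H 0\<close> because \<psi> is Lipschitz, and the quotient tends to minus the derivative
  because the shift is backwards.\<close>

lemma line_deriv_integration_by_parts:
  fixes F G \<psi> :: "real^'n::finite \<Rightarrow> real"
  assumes F: "lint F" and G: "lint G" and ld: "line_deriv i F G" and t: "test_function \<psi>"
  shows "(LINT x|lborel. F x * partial i \<psi> x) = - (LINT x|lborel. G x * \<psi> x)"
proof -
  let ?e = "axis i (1::real) :: real^'n"
  have Fm[measurable]: "F \<in> borel_measurable borel" using F by (rule lintD)
  have Gm[measurable]: "G \<in> borel_measurable borel" using G by (rule lintD)
  have tm[measurable]: "\<psi> \<in> borel_measurable borel" "partial i \<psi> \<in> borel_measurable borel"
    by (intro test_function_measurable test_function_partial t)+
  obtain B0 where B0: "\<And>x. \<bar>\<psi> x\<bar> \<le> B0" using test_function_bounded[OF t] by auto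
  obtain B1 where B1: "0 \<le> B1" "\<And>x. \<bar>partial i \<psi> x\<bar> \<le> B1" using test_function_bounded[OF test_function_partial[OF t]] by auto
  have "bounded (closure {x. \<psi> x \<noteq> 0})" using t unfolding test_function_def by (blast intro: compact_imp_bounded)
  then obtain R where R: "closure {x. \<psi> x \<noteq> 0} \<subseteq> cball 0 R" using bounded_subset_cball_0 by blast
  have Z: "\<psi> x = 0" if "x \<notin> cball 0 R" for x
    using that R support_closure[of \<psi> x] by blast
  define C where "C = (LINT y|lborel. \<bar>G y\<bar> * indicator (cball 0 (R + 1)) y)"
  have absG: "lint (\<lambda>y. \<bar>G y\<bar>)" using G unfolding lint_def by auto
  have absF: "lint (\<lambda>y. \<bar>F y\<bar>)" using F unfolding lint_def by auto
  have lip: "\<bar>\<psi> (y - \<eta> *\<^sub>R ?e) - \<psi> y\<bar> \<le> B1 * \<eta> * indicator (cball 0 (R + 1)) y" if "0 \<le> \<eta>" "\<eta> \<le> 1" for y \<eta>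
  proof (cases "y \<in> cball 0 (R + 1)")
    case True
    then show ?thesis using test_function_lipschitz[OF t B1(2), of y "- \<eta>"] that by simp
  next
    case False
    have "norm y \<le> norm (y - \<eta> *\<^sub>R ?e) + norm (\<eta> *\<^sub>R ?e)"
      using norm_triangle_ineq[of "y - \<eta> *\<^sub>R ?e" "\<eta> *\<^sub>R ?e"] by simp
    then have "norm (y - \<eta> *\<^sub>R ?e) > R" using False that by simp
    then show ?thesis using False Z[of y] Z[of "y - \<eta> *\<^sub>R ?e"] by simp
  qed
  have intF: "integrable lborel (\<lambda>y. F y * \<psi> (y - \<eta> *\<^sub>R ?e))" 
    and intG: "integrable lborel (\<lambda>y. G y * \<psi> (y - \<eta> *\<^sub>R ?e))" if "0 \<le> \<eta>" "\<eta> \<le> 1" for \<eta>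
  proof -
    have "\<psi> (y - \<eta> *\<^sub>R ?e) = 0" if y: "y \<notin> cball 0 (R + 1)" for y
      using lip[OF \<open>0 \<le> \<eta>\<close> \<open>\<eta> \<le> 1\<close>, of y] y Z[of y] by simp
    then show "integrable lborel (\<lambda>y. F y * \<psi> (y - \<eta> *\<^sub>R ?e))" "integrable lborel (\<lambda>y. G y * \<psi> (y - \<eta> *\<^sub>R ?e))"
      by (auto intro!: lint_integrable_mult[OF F, of _ B0 "R + 1"] lint_integrable_mult[OF G, of _ B0 "R + 1"] B0)
  qed
  define H where "H \<eta> = (LINT y|lborel. G y * \<psi> (y - \<eta> *\<^sub>R ?e))" for \<eta>
  have H0: "H 0 = (LINT y|lborel. G y * \<psi> y)" by (simp add: H_def)
  have Hlip: "\<bar>H \<eta> - H 0\<bar> \<le> B1 * C * \<eta>" if \<eta>: "0 \<le> \<eta>" "\<eta> \<le> 1" for \<eta>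
  proof -
    have "H \<eta> - H 0 = (LINT y|lborel. G y * \<psi> (y - \<eta> *\<^sub>R ?e) - G y * \<psi> (y - 0 *\<^sub>R ?e))"
      unfolding H_def using intG[OF \<eta>] intG[of 0] by (intro Bochner_Integration.integral_diff[symmetric]) auto
    also have "\<bar>\<dots>\<bar> \<le> (LINT y|lborel. \<bar>G y * \<psi> (y - \<eta> *\<^sub>R ?e) - G y * \<psi> (y - 0 *\<^sub>R ?e)\<bar>)"
      by (rule integral_abs_bound)
    also have "\<dots> \<le> (LINT y|lborel. \<bar>G y\<bar> * (B1 * \<eta> * indicator (cball 0 (R + 1)) y))"
    proof (rule integral_mono)
      show "integrable lborel (\<lambda>y. \<bar>G y * \<psi> (y - \<eta> *\<^sub>R ?e) - G y * \<psi> (y - 0 *\<^sub>R ?e)\<bar>)"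
        using intG[OF \<eta>] intG[of 0] by (intro integrable_abs Bochner_Integration.integrable_diff) auto
      show "integrable lborel (\<lambda>y. \<bar>G y\<bar> * (B1 * \<eta> * indicator (cball 0 (R + 1)) y))"
        by (rule lint_integrable_mult[OF absG, of _ "B1 * \<eta>" "R + 1"]) (use B1 \<eta> in \<open>auto simp: indicator_def\<close>)
      fix y
      have "\<bar>G y * \<psi> (y - \<eta> *\<^sub>R ?e) - G y * \<psi> (y - 0 *\<^sub>R ?e)\<bar> = \<bar>G y\<bar> * \<bar>\<psi> (y - \<eta> *\<^sub>R ?e) - \<psi> y\<bar>"
        by (simp add: abs_mult[symmetric] right_diff_distrib)
      then show "\<bar>G y * \<psi> (y - \<eta> *\<^sub>R ?e) - G y * \<psi> (y - 0 *\<^sub>R ?e)\<bar> \<le> \<bar>G y\<bar> * (B1 * \<eta> * indicator (cball 0 (R + 1)) y)"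
        using mult_left_mono[OF lip[OF \<eta>, of y], of "\<bar>G y\<bar>"] by simp
    qed
    also have "\<dots> = (LINT y|lborel. (B1 * \<eta>) * (\<bar>G y\<bar> * indicator (cball 0 (R + 1)) y))"
      by (intro Bochner_Integration.integral_cong) auto
    also have "\<dots> = B1 * C * \<eta>" unfolding C_def by simp
    finally show ?thesis .
  qed
  have step: "(LINT y|lborel. F y * (\<psi> (y - \<tau> *\<^sub>R ?e) - \<psi> y)) = (LINT \<eta>|lborel. indicator {0..\<tau>} \<eta> * H \<eta>)"
    and intH: "integrable lborel (\<lambda>\<eta>. indicator {0..\<tau>} \<eta> * H \<eta>)" if \<tau>: "0 < \<tau>" "\<tau> \<le> 1" for \<tau>
  proof -
    let ?f = "\<lambda>y \<eta>. indicator {0..\<tau>} \<eta> * (G (y + \<eta> *\<^sub>R ?e) * \<psi> y)"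
    have ip: "integrable (lborel \<Otimes>\<^sub>M lborel) (case_prod ?f)"
      using line_deriv_integrable_pair[OF G tm(1) B0 Z, where \<tau> = \<tau> and i = i] \<tau> by simp
    have inner: "(LINT y|lborel. ?f y \<eta>) = indicator {0..\<tau>} \<eta> * H \<eta>" for \<eta>
      using lborel_integral_shift[of "\<lambda>y. G y * \<psi> (y - \<eta> *\<^sub>R ?e)" "\<eta> *\<^sub>R ?e"] by (simp add: H_def)
    show "integrable lborel (\<lambda>\<eta>. indicator {0..\<tau>} \<eta> * H \<eta>)"
      using lborel_pair.integrable_snd[OF ip] unfolding inner .
    have sh: "(LINT y|lborel. F y * \<psi> (y - \<tau> *\<^sub>R ?e)) = (LINT y|lborel. F (y + \<tau> *\<^sub>R ?e) * \<psi> y)"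
      using lborel_integral_shift[of "\<lambda>y. F y * \<psi> (y - \<tau> *\<^sub>R ?e)" "\<tau> *\<^sub>R ?e"] by simp
    have intF': "integrable lborel (\<lambda>y. F (y + \<tau> *\<^sub>R ?e) * \<psi> y)"
    proof -
      have "integrable (distr lborel borel ((+) (\<tau> *\<^sub>R ?e))) (\<lambda>y. F y * \<psi> (y - \<tau> *\<^sub>R ?e))"
        using intF[of \<tau>] \<tau> by (simp add: lborel_distr_plus)
      then show ?thesis by (subst (asm) integrable_distr_eq) (auto simp: add.commute)
    qed
    have "(LINT y|lborel. F y * (\<psi> (y - \<tau> *\<^sub>R ?e) - \<psi> y)) = (LINT y|lborel. F y * \<psi> (y - \<tau> *\<^sub>R ?e)) - (LINT y|lborel. F y * \<psi> y)"
      using intF[of \<tau>] intF[of 0] \<tau> by (simp add: right_diff_distrib)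
    also have "\<dots> = (LINT y|lborel. F (y + \<tau> *\<^sub>R ?e) * \<psi> y - F y * \<psi> y)"
      unfolding sh using intF' intF[of 0] by simp
    also have "\<dots> = (LINT y|lborel. (LINT \<eta>|lborel. ?f y \<eta>))"
    proof (rule integral_cong_AE)
      have "AE y in lborel. F (y + \<tau> *\<^sub>R ?e) - F y = (LINT \<eta>:{0..\<tau>}|lborel. G (y + \<eta> *\<^sub>R ?e))"
        using ld \<tau> unfolding line_deriv_def by blast
      then show "AE y in lborel. F (y + \<tau> *\<^sub>R ?e) * \<psi> y - F y * \<psi> y = (LINT \<eta>|lborel. ?f y \<eta>)"
      proof eventually_elim
        fix y assume *: "F (y + \<tau> *\<^sub>R ?e) - F y = (LINT \<eta>:{0..\<tau>}|lborel. G (y + \<eta> *\<^sub>R ?e))"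
        have "F (y + \<tau> *\<^sub>R ?e) * \<psi> y - F y * \<psi> y = (LINT \<eta>|lborel. indicator {0..\<tau>} \<eta> * G (y + \<eta> *\<^sub>R ?e)) * \<psi> y"
          unfolding *[unfolded set_lebesgue_integral_def real_scaleR_def, symmetric] by (simp add: left_diff_distrib)
        also have "\<dots> = (LINT \<eta>|lborel. ?f y \<eta>)"
          by (subst integral_mult_left_zero[symmetric]) (simp add: mult.assoc)
        finally show "F (y + \<tau> *\<^sub>R ?e) * \<psi> y - F y * \<psi> y = (LINT \<eta>|lborel. ?f y \<eta>)" .
      qed
    qed measurable
    also have "\<dots> = (LINT \<eta>|lborel. (LINT y|lborel. ?f y \<eta>))"
      by (rule lborel_pair.Fubini_integral[OF ip, symmetric])
    finally show "(LINT y|lborel. F y * (\<psi> (y - \<tau> *\<^sub>R ?e) - \<psi> y)) = (LINT \<eta>|lborel. indicator {0..\<tau>} \<eta> * H \<eta>)"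
      unfolding inner .
  qed
  \<comment> \<open>A sequence of shifts replaces the limit in \<tau>, since dominated convergence
    is applied to sequences.\<close>
  define T where "T n = inverse (real (Suc n))" for n
  have T: "0 < T n" "T n \<le> 1" for n unfolding T_def by (auto simp: field_simps)
  have T0: "T \<longlonglongrightarrow> 0" unfolding T_def by (rule LIMSEQ_inverse_real_of_nat)
  have rhs: "\<bar>(LINT y|lborel. F y * (\<psi> (y - T n *\<^sub>R ?e) - \<psi> y)) / T n - H 0\<bar> \<le> B1 * C * T n" for n
  proof -
    let ?I = "indicator {0..T n} :: real \<Rightarrow> real"
    have iI: "integrable lborel (\<lambda>\<eta>. ?I \<eta> * c)" for c
      by (intro integrable_mult_left integrable_real_indicator) (auto simp: emeasure_lborel_Icc_eq)
    have sI: "(LINT \<eta>|lborel. ?I \<eta> * c) = T n * c" for c using T[of n] by simp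
    have "(LINT \<eta>|lborel. ?I \<eta> * H \<eta>) - T n * H 0 = (LINT \<eta>|lborel. ?I \<eta> * H \<eta> - ?I \<eta> * H 0)"
      using intH[OF T] iI sI by (subst Bochner_Integration.integral_diff) auto
    also have "\<bar>\<dots>\<bar> \<le> (LINT \<eta>|lborel. \<bar>?I \<eta> * H \<eta> - ?I \<eta> * H 0\<bar>)" by (rule integral_abs_bound)
    also have "\<dots> \<le> (LINT \<eta>|lborel. ?I \<eta> * (B1 * C * T n))"
    proof (rule integral_mono)
      show "integrable lborel (\<lambda>\<eta>. \<bar>?I \<eta> * H \<eta> - ?I \<eta> * H 0\<bar>)"
        using intH[OF T] iI by (intro integrable_abs Bochner_Integration.integrable_diff) auto
      show "integrable lborel (\<lambda>\<eta>. ?I \<eta> * (B1 * C * T n))" by (rule iI)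
      fix \<eta> :: real
      show "\<bar>?I \<eta> * H \<eta> - ?I \<eta> * H 0\<bar> \<le> ?I \<eta> * (B1 * C * T n)"
      proof (cases "\<eta> \<in> {0..T n}")
        case True
        have C0: "0 \<le> C" unfolding C_def by (intro Bochner_Integration.integral_nonneg) auto
        have "\<bar>H \<eta> - H 0\<bar> \<le> B1 * C * \<eta>" using True T[of n] by (intro Hlip) auto
        also have "\<dots> \<le> B1 * C * T n" using True B1 C0 by (intro mult_left_mono) auto
        finally show ?thesis using True by simp
      qed simp
    qed
    also have "\<dots> = T n * (B1 * C * T n)" by (rule sI)
    finally have "\<bar>(LINT \<eta>|lborel. ?I \<eta> * H \<eta>) - T n * H 0\<bar> \<le> T n * (B1 * C * T n)" .
    moreover have "(LINT \<eta>|lborel. ?I \<eta> * H \<eta>) / T n - H 0 = ((LINT \<eta>|lborel. ?I \<eta> * H \<eta>) - T n * H 0) / T n"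
      using T[of n] by (simp add: field_simps)
    ultimately have "\<bar>(LINT \<eta>|lborel. ?I \<eta> * H \<eta>) / T n - H 0\<bar> \<le> (T n * (B1 * C * T n)) / T n"
      using T[of n] by (simp only: abs_divide) (intro divide_mono; simp)
    then show ?thesis using step[OF T] T[of n] by simp
  qed
  have "(\<lambda>n. (LINT y|lborel. F y * (\<psi> (y - T n *\<^sub>R ?e) - \<psi> y)) / T n) \<longlonglongrightarrow> H 0"
  proof (rule Lim_transform_bound[where f = "\<lambda>n. (LINT y|lborel. F y * (\<psi> (y - T n *\<^sub>R ?e) - \<psi> y)) / T n - H 0" and g = "\<lambda>n. B1 * C * T n", THEN LIM_zero_cancel])
    show "\<forall>\<^sub>F n in sequentially. norm ((LINT y|lborel. F y * (\<psi> (y - T n *\<^sub>R ?e) - \<psi> y)) / T n - H 0) \<le> norm (B1 * C * T n)"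
      using rhs by (intro always_eventually allI) (smt (verit) real_norm_def)
    show "(\<lambda>n. B1 * C * T n) \<longlonglongrightarrow> 0" using tendsto_mult_left[OF T0, of "B1 * C"] by simp
  qed
  moreover have "(\<lambda>n. LINT y|lborel. F y * ((\<psi> (y - T n *\<^sub>R ?e) - \<psi> y) / T n)) \<longlonglongrightarrow> (LINT y|lborel. F y * (- partial i \<psi> y))"
  proof (rule integral_dominated_convergence[where w = "\<lambda>y. \<bar>F y\<bar> * (B1 * indicator (cball 0 (R + 1)) y)"])
    show "integrable lborel (\<lambda>y. \<bar>F y\<bar> * (B1 * indicator (cball 0 (R + 1)) y))"
      by (rule lint_integrable_mult[OF absF, of _ B1 "R + 1"]) (use B1 in \<open>auto simp: indicator_def\<close>)
    show "AE y in lborel. (\<lambda>n. F y * ((\<psi> (y - T n *\<^sub>R ?e) - \<psi> y) / T n)) \<longlonglongrightarrow> F y * (- partial i \<psi> y)"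
    proof (intro AE_I2 tendsto_mult tendsto_const)
      fix y
      have "has_partial i \<psi> y (partial i \<psi> y)"
        using t by (intro Ck_on_has_partial[of 1 UNIV]) (auto simp: test_function_def simp del: Ck_on.simps)
      then have "((\<lambda>s. (\<psi> (y + s *\<^sub>R ?e) - \<psi> y) / s) \<longlongrightarrow> partial i \<psi> y) (at 0)"
        unfolding has_partial_def has_field_derivative_iff by simp
      moreover have "filterlim (\<lambda>n. - T n) (at 0) sequentially"
      proof -
        have "T n \<noteq> 0" for n using T(1)[of n] by simp
        then show ?thesis using tendsto_minus[OF T0] by (simp add: filterlim_at)
      qed
      ultimately have "(\<lambda>n. (\<psi> (y + (- T n) *\<^sub>R ?e) - \<psi> y) / (- T n)) \<longlonglongrightarrow> partial i \<psi> y"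
        by (rule filterlim_compose)
      from tendsto_minus[OF this] show "(\<lambda>n. (\<psi> (y - T n *\<^sub>R ?e) - \<psi> y) / T n) \<longlonglongrightarrow> - partial i \<psi> y" by simp
    qed
    fix n
    show "AE y in lborel. norm (F y * ((\<psi> (y - T n *\<^sub>R ?e) - \<psi> y) / T n)) \<le> \<bar>F y\<bar> * (B1 * indicator (cball 0 (R + 1)) y)"
    proof (intro AE_I2)
      fix y
      have "\<bar>(\<psi> (y - T n *\<^sub>R ?e) - \<psi> y) / T n\<bar> \<le> B1 * indicator (cball 0 (R + 1)) y"
        using lip[of "T n" y] T[of n] by (simp add: abs_divide divide_le_eq mult_ac)
      then show "norm (F y * ((\<psi> (y - T n *\<^sub>R ?e) - \<psi> y) / T n)) \<le> \<bar>F y\<bar> * (B1 * indicator (cball 0 (R + 1)) y)"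
        unfolding real_norm_def abs_mult by (intro mult_left_mono) auto
    qed
  qed measurable
  ultimately have "H 0 = (LINT y|lborel. F y * (- partial i \<psi> y))"
    using LIMSEQ_unique by simp
  then show ?thesis by (simp add: H0)
qed

text \<open>Each integration by parts takes the outermost derivative off \<psi> and pushes it in
  front of the word of \<open>u\<close>, so the word arrives reversed.\<close>

lemma weak_deriv_chain:
  fixes u :: "'n::finite list \<Rightarrow> real^'n \<Rightarrow> real"
  assumes l: "\<And>js. length js \<le> k \<Longrightarrow> lint (u js)"
    and d: "\<And>i js. length js < k \<Longrightarrow> line_deriv i (u js) (u (i # js))" and t: "test_function \<psi>"
  shows "length ks + length js \<le> k \<Longrightarrow>
    (LINT x|lborel. u ks x * foldr partial js \<psi> x) = (- 1) ^ length js * (LINT x|lborel. u (rev js @ ks) x * \<psi> x)"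
proof (induction js arbitrary: ks)
  case (Cons j js)
  have "(LINT x|lborel. u ks x * foldr partial (j # js) \<psi> x) = - (LINT x|lborel. u (j # ks) x * foldr partial js \<psi> x)"
    using Cons.prems line_deriv_integration_by_parts[OF l[of ks] l[of "j # ks"] d[of ks j] test_function_foldr_partial[OF t, of js]]
    by simp
  also have "\<dots> = - ((- 1) ^ length js * (LINT x|lborel. u (rev js @ j # ks) x * \<psi> x))"
    using Cons.IH[of "j # ks"] Cons.prems by simp
  finally show ?case by simp
qed simp

text \<open>The family \<open>u\<close> lists iterated derivatives by word. One word per multi-index
  is enough, and its reversal is the one produced by moving derivatives off the test
  function.\<close>

lemma is_weak_deriv_chain:
  fixes u :: "'n::finite list \<Rightarrow> real^'n \<Rightarrow> real"
  assumes l: "\<And>js. length js \<le> k \<Longrightarrow> lint (u js)"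
    and d: "\<And>i js. length js < k \<Longrightarrow> line_deriv i (u js) (u (i # js))" and \<beta>: "mdeg \<beta> \<le> k"
  shows "is_weak_deriv \<beta> (u []) (u (rev (mlist \<beta>)))"
  unfolding is_weak_deriv_def
proof (intro conjI allI impI)
  show "locally_integrable (u [])" "locally_integrable (u (rev (mlist \<beta>)))"
    using \<beta> by (auto intro!: lint_locally_integrable l simp: length_mlist)
  fix \<psi> :: "real^'n \<Rightarrow> real" assume t: "test_function \<psi>"
  have m: "(\<lambda>x. u [] x * mderiv \<beta> \<psi> x) \<in> borel_measurable lborel" "(\<lambda>x. u (rev (mlist \<beta>)) x * \<psi> x) \<in> borel_measurable lborel"
    using lintD(1)[OF l[of "[]"]] lintD(1)[OF l[of "rev (mlist \<beta>)"]] \<beta> test_function_measurable[OF t]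
      test_function_measurable[OF test_function_foldr_partial[OF t, of "mlist \<beta>"]]
    by (auto intro!: borel_measurable_times simp: mderiv_mlist length_mlist)
  show "(LINT x|lebesgue. u [] x * mderiv \<beta> \<psi> x) = (- 1) ^ mdeg \<beta> * (LINT x|lebesgue. u (rev (mlist \<beta>)) x * \<psi> x)"
    unfolding integral_completion[OF m(1)] integral_completion[OF m(2)]
    using weak_deriv_chain[OF l d t, where ks = "[]" and js = "mlist \<beta>"] \<beta> by (simp add: mderiv_mlist length_mlist)
qed

section \<open>Local integrability under line averages and convolution\<close>

definition loc_finite :: "('a::euclidean_space \<Rightarrow> ennreal) \<Rightarrow> bool" where
  "loc_finite Q \<longleftrightarrow> Q \<in> borel_measurable borel \<and> (\<forall>R. (\<integral>\<^sup>+x. Q x * indicator (cball 0 R) x \<partial>lborel) < \<infinity>)"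

lemma loc_finiteD: "loc_finite Q \<Longrightarrow> Q \<in> borel_measurable borel"
  "loc_finite Q \<Longrightarrow> (\<integral>\<^sup>+x. Q x * indicator (cball 0 R) x \<partial>lborel) < \<infinity>"
  unfolding loc_finite_def by auto

lemma lint_iff_loc_finite: "lint F \<longleftrightarrow> F \<in> borel_measurable borel \<and> loc_finite (\<lambda>x. ennreal \<bar>F x\<bar>)"
  unfolding lint_def loc_finite_def by auto

lemma loc_finite_AE:
  assumes "loc_finite Q" shows "AE x in lborel. Q x < \<infinity>"
proof -
  have [measurable]: "Q \<in> borel_measurable borel" using assms by (rule loc_finiteD)
  have fin: "AE x in lborel. Q x * indicator (cball 0 (real n)) x \<noteq> \<infinity>" for n
    by (rule nn_integral_PInf_AE) (use loc_finiteD(2)[OF assms, of "real n"] in auto)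
  have "AE x in lborel. \<forall>n. Q x * indicator (cball 0 (real n)) x \<noteq> \<infinity>"
    unfolding AE_all_countable using fin by blast
  then show ?thesis
  proof eventually_elim
    fix x assume *: "\<forall>n. Q x * indicator (cball 0 (real n)) x \<noteq> \<infinity>"
    obtain n where "norm x \<le> real n" using real_arch_simple by blast
    then show "Q x < \<infinity>" using *[rule_format, of n] by (simp add: less_top)
  qed
qed

text \<open>The one estimate behind the local finiteness of line averages and convolutions: a shift
  by at most \<open>r\<close> is absorbed by enlarging the ball.\<close>

lemma nn_integral_shift_cball_le:
  fixes Q :: "'a::euclidean_space \<Rightarrow> ennreal"
  assumes [measurable]: "Q \<in> borel_measurable borel" and c: "norm c \<le> r"
  shows "(\<integral>\<^sup>+x. Q (x + c) * indicator (cball 0 R) x \<partial>lborel) \<le> (\<integral>\<^sup>+x. Q x * indicator (cball 0 (R + r)) x \<partial>lborel)"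
proof -
  have "(\<integral>\<^sup>+x. Q (x + c) * indicator (cball 0 R) x \<partial>lborel) \<le> (\<integral>\<^sup>+x. (\<lambda>x. Q x * indicator (cball 0 (R + r)) x) (x + c) \<partial>lborel)"
  proof (rule nn_integral_mono)
    fix x
    have "norm (x + c) \<le> R + r" if "norm x \<le> R" using norm_triangle_ineq[of x c] that c by linarith
    then show "Q (x + c) * indicator (cball 0 R) x \<le> (\<lambda>x. Q x * indicator (cball 0 (R + r)) x) (x + c)"
      by (auto simp: indicator_def)
  qed
  also have "\<dots> = (\<integral>\<^sup>+x. Q x * indicator (cball 0 (R + r)) x \<partial>lborel)" by (rule nn_integral_shift) measurable
  finally show ?thesis .
qed

lemma loc_finite_line:
  fixes Q :: "real^'n::finite \<Rightarrow> ennreal"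
  assumes Q: "loc_finite Q" and \<tau>: "0 \<le> \<tau>"
  shows "loc_finite (\<lambda>x. \<integral>\<^sup>+\<eta>. indicator {0..\<tau>} \<eta> * Q (x + \<eta> *\<^sub>R axis i 1) \<partial>lborel)"
  unfolding loc_finite_def
proof (intro conjI allI)
  have m[measurable]: "Q \<in> borel_measurable borel" using Q by (rule loc_finiteD)
  show "(\<lambda>x. \<integral>\<^sup>+\<eta>. indicator {0..\<tau>} \<eta> * Q (x + \<eta> *\<^sub>R axis i 1) \<partial>lborel) \<in> borel_measurable borel" by measurable
  fix R
  let ?A = "\<integral>\<^sup>+x. Q x * indicator (cball 0 (R + \<tau>)) x \<partial>lborel"
  have "(\<integral>\<^sup>+x. (\<integral>\<^sup>+\<eta>. indicator {0..\<tau>} \<eta> * Q (x + \<eta> *\<^sub>R axis i 1) \<partial>lborel) * indicator (cball 0 R) x \<partial>lborel)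
     = (\<integral>\<^sup>+x. (\<integral>\<^sup>+\<eta>. indicator {0..\<tau>} \<eta> * (Q (x + \<eta> *\<^sub>R axis i 1) * indicator (cball 0 R) x) \<partial>lborel) \<partial>lborel)"
    by (subst nn_integral_multc[symmetric]) (auto simp: mult.assoc)
  also have "\<dots> = (\<integral>\<^sup>+\<eta>. (\<integral>\<^sup>+x. indicator {0..\<tau>} \<eta> * (Q (x + \<eta> *\<^sub>R axis i 1) * indicator (cball 0 R) x) \<partial>lborel) \<partial>lborel)"
    by (rule lborel_pair.Fubini') measurable
  also have "\<dots> = (\<integral>\<^sup>+\<eta>. indicator {0..\<tau>} \<eta> * (\<integral>\<^sup>+x. Q (x + \<eta> *\<^sub>R axis i 1) * indicator (cball 0 R) x \<partial>lborel) \<partial>lborel)"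
    by (intro nn_integral_cong nn_integral_cmult) measurable
  also have "\<dots> \<le> (\<integral>\<^sup>+\<eta>. indicator {0..\<tau>} \<eta> * ?A \<partial>lborel)"
  proof (rule nn_integral_mono)
    fix \<eta>
    show "indicator {0..\<tau>} \<eta> * (\<integral>\<^sup>+x. Q (x + \<eta> *\<^sub>R axis i 1) * indicator (cball 0 R) x \<partial>lborel) \<le> indicator {0..\<tau>} \<eta> * ?A"
      using nn_integral_shift_cball_le[OF m, of "\<eta> *\<^sub>R axis i 1" \<tau> R] by (cases "\<eta> \<in> {0..\<tau>}") auto
  qed
  also have "\<dots> = ennreal \<tau> * ?A" using \<tau> by (simp add: nn_integral_multc)
  also have "\<dots> < \<infinity>" using loc_finiteD(2)[OF Q, of "R + \<tau>"] by (simp add: ennreal_mult_less_top)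
  finally show "(\<integral>\<^sup>+x. (\<integral>\<^sup>+\<eta>. indicator {0..\<tau>} \<eta> * Q (x + \<eta> *\<^sub>R axis i 1) \<partial>lborel) * indicator (cball 0 R) x \<partial>lborel) < \<infinity>" .
qed

lemma loc_finite_conv:
  fixes Q w :: "real^'n::finite \<Rightarrow> ennreal"
  assumes Q: "loc_finite Q" and w[measurable]: "w \<in> borel_measurable borel" and fin: "(\<integral>\<^sup>+z. w z \<partial>lborel) < \<infinity>"
    and Z: "\<And>z. z \<notin> cball 0 r \<Longrightarrow> w z = 0"
  shows "loc_finite (\<lambda>x. \<integral>\<^sup>+z. w z * Q (x - z) \<partial>lborel)"
  unfolding loc_finite_def
proof (intro conjI allI)
  have m[measurable]: "Q \<in> borel_measurable borel" using Q by (rule loc_finiteD)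
  show "(\<lambda>x. \<integral>\<^sup>+z. w z * Q (x - z) \<partial>lborel) \<in> borel_measurable borel" by measurable
  fix R
  let ?A = "\<integral>\<^sup>+x. Q x * indicator (cball 0 (R + r)) x \<partial>lborel"
  have "(\<integral>\<^sup>+x. (\<integral>\<^sup>+z. w z * Q (x - z) \<partial>lborel) * indicator (cball 0 R) x \<partial>lborel)
     = (\<integral>\<^sup>+x. (\<integral>\<^sup>+z. w z * (Q (x - z) * indicator (cball 0 R) x) \<partial>lborel) \<partial>lborel)"
    by (subst nn_integral_multc[symmetric]) (auto simp: mult.assoc)
  also have "\<dots> = (\<integral>\<^sup>+z. (\<integral>\<^sup>+x. w z * (Q (x - z) * indicator (cball 0 R) x) \<partial>lborel) \<partial>lborel)"
    by (rule lborel_pair.Fubini') measurable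
  also have "\<dots> = (\<integral>\<^sup>+z. w z * (\<integral>\<^sup>+x. Q (x - z) * indicator (cball 0 R) x \<partial>lborel) \<partial>lborel)"
    by (intro nn_integral_cong nn_integral_cmult) measurable
  also have "\<dots> \<le> (\<integral>\<^sup>+z. w z * ?A \<partial>lborel)"
  proof (rule nn_integral_mono)
    fix z
    show "w z * (\<integral>\<^sup>+x. Q (x - z) * indicator (cball 0 R) x \<partial>lborel) \<le> w z * ?A"
      using nn_integral_shift_cball_le[OF m, of "- z" r R] Z[of z] 
      by (cases "z \<in> cball 0 r") (auto intro!: mult_left_mono)
  qed
  also have "\<dots> = (\<integral>\<^sup>+z. w z \<partial>lborel) * ?A" by (rule nn_integral_multc) measurable
  also have "\<dots> < \<infinity>" using loc_finiteD(2)[OF Q, of "R + r"] fin by (simp add: ennreal_mult_less_top)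
  finally show "(\<integral>\<^sup>+x. (\<integral>\<^sup>+z. w z * Q (x - z) \<partial>lborel) * indicator (cball 0 R) x \<partial>lborel) < \<infinity>" .
qed

lemma AE_lborel_shift: "AE x in lborel. P x \<Longrightarrow> AE x in lborel. P (x + c)" for c :: "'a::euclidean_space"
proof -
  assume "AE x in lborel. P x"
  then have "AE x in distr lborel borel ((+) c). P x"
    by (rule subst[OF lborel_distr_plus[symmetric], where P = "\<lambda>M. AE x in M. P x"])
  then have "AE x in lborel. P (c + x)" by (rule AE_distrD[rotated]) measurable
  then show ?thesis by (simp add: add.commute)
qed

lemma AE_lborel_reflect: "AE x in lborel. P x \<Longrightarrow> AE x in lborel. P (c - x)" for c :: "'a::euclidean_space"
proof -
  assume P: "AE x in lborel. P x"
  have "lborel = distr lborel borel (\<lambda>x :: 'a. c - x)"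
    using lborel_affine[of "-1" c] by (simp add: density_1)
  then have "AE x in distr lborel borel (\<lambda>x :: 'a. c - x). P x"
    using P by (rule subst[where P = "\<lambda>M. AE x in M. P x"])
  then show ?thesis by (rule AE_distrD[rotated]) measurable
qed

lemma abs_integral_le_nn_integral:
  fixes f :: "'a \<Rightarrow> real"
  shows "ennreal \<bar>integral\<^sup>L M f\<bar> \<le> (\<integral>\<^sup>+x. ennreal \<bar>f x\<bar> \<partial>M)"
proof (cases "integrable M f")
  case True
  then show ?thesis using integral_norm_bound_ennreal[OF True] by simp
qed (simp add: not_integrable_integral_eq)

lemma lint_translate: assumes "lint F" shows "lint (\<lambda>x. F (x - c))"
  unfolding lint_def
proof (intro conjI allI)
  have [measurable]: "F \<in> borel_measurable borel" using assms by (rule lintD)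
  show "(\<lambda>x. F (x - c)) \<in> borel_measurable borel" by measurable
  fix R
  have "(\<integral>\<^sup>+x. ennreal \<bar>F (x - c)\<bar> * indicator (cball 0 R) x \<partial>lborel) \<le> (\<integral>\<^sup>+x. ennreal \<bar>F x\<bar> * indicator (cball 0 (R + norm c)) x \<partial>lborel)"
    using nn_integral_shift_cball_le[of "\<lambda>x. ennreal \<bar>F x\<bar>" "- c" "norm c" R] by simp
  then show "(\<integral>\<^sup>+x. ennreal \<bar>F (x - c)\<bar> * indicator (cball 0 R) x \<partial>lborel) < \<infinity>"
    using lintD(2)[OF assms, of "R + norm c"] by (rule le_less_trans)
qed

lemma lint_lin: assumes "lint F" "lint G" shows "lint (\<lambda>x. F x - c * G x)"
  unfolding lint_def
proof (intro conjI allI)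
  have [measurable]: "F \<in> borel_measurable borel" "G \<in> borel_measurable borel" using assms by (auto intro: lintD)
  show "(\<lambda>x. F x - c * G x) \<in> borel_measurable borel" by measurable
  fix R
  have "(\<integral>\<^sup>+x. ennreal \<bar>F x - c * G x\<bar> * indicator (cball 0 R) x \<partial>lborel)
     \<le> (\<integral>\<^sup>+x. ennreal \<bar>F x\<bar> * indicator (cball 0 R) x + ennreal \<bar>c\<bar> * (ennreal \<bar>G x\<bar> * indicator (cball 0 R) x) \<partial>lborel)"
  proof (rule nn_integral_mono)
    fix x
    have "\<bar>F x - c * G x\<bar> \<le> \<bar>F x\<bar> + \<bar>c\<bar> * \<bar>G x\<bar>" by (metis abs_mult abs_triangle_ineq4)
    then have "ennreal \<bar>F x - c * G x\<bar> \<le> ennreal \<bar>F x\<bar> + ennreal \<bar>c\<bar> * ennreal \<bar>G x\<bar>"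
      by (simp add: ennreal_mult'[symmetric] ennreal_plus[symmetric] ennreal_leI del: ennreal_plus)
    then show "ennreal \<bar>F x - c * G x\<bar> * indicator (cball 0 R) x \<le> ennreal \<bar>F x\<bar> * indicator (cball 0 R) x + ennreal \<bar>c\<bar> * (ennreal \<bar>G x\<bar> * indicator (cball 0 R) x)"
      by (auto simp: indicator_def)
  qed
  also have "\<dots> = (\<integral>\<^sup>+x. ennreal \<bar>F x\<bar> * indicator (cball 0 R) x \<partial>lborel) + ennreal \<bar>c\<bar> * (\<integral>\<^sup>+x. ennreal \<bar>G x\<bar> * indicator (cball 0 R) x \<partial>lborel)"
    by (subst nn_integral_add) (auto simp: nn_integral_cmult)
  also have "\<dots> < \<infinity>" using lintD(2)[OF assms(1), of R] lintD(2)[OF assms(2), of R] by (simp add: ennreal_mult_less_top)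
  finally show "(\<integral>\<^sup>+x. ennreal \<bar>F x - c * G x\<bar> * indicator (cball 0 R) x \<partial>lborel) < \<infinity>" .
qed

text \<open>The integral of a function that is not integrable is 0 by convention, so additivity in
  \<open>line_deriv_lin\<close> needs integrability on almost every line.\<close>

lemma lint_line_integrable:
  assumes "lint G" "0 \<le> \<tau>"
  shows "AE x in lborel. set_integrable lborel {0..\<tau>} (\<lambda>\<eta>. G (x + \<eta> *\<^sub>R axis i 1))"
proof -
  have m[measurable]: "G \<in> borel_measurable borel" using assms(1) by (rule lintD)
  have "loc_finite (\<lambda>x. ennreal \<bar>G x\<bar>)" using assms(1) by (simp add: lint_iff_loc_finite)
  from loc_finite_AE[OF loc_finite_line[OF this assms(2), of i]]
  show ?thesis
  proof eventually_elim
    fix x assume fin: "(\<integral>\<^sup>+\<eta>. indicator {0..\<tau>} \<eta> * ennreal \<bar>G (x + \<eta> *\<^sub>R axis i 1)\<bar> \<partial>lborel) < \<infinity>"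
    show "set_integrable lborel {0..\<tau>} (\<lambda>\<eta>. G (x + \<eta> *\<^sub>R axis i 1))"
      unfolding set_integrable_def
    proof (rule integrableI_bounded)
      have "(\<integral>\<^sup>+\<eta>. ennreal (norm (indicat_real {0..\<tau>} \<eta> *\<^sub>R G (x + \<eta> *\<^sub>R axis i 1))) \<partial>lborel) = (\<integral>\<^sup>+\<eta>. indicator {0..\<tau>} \<eta> * ennreal \<bar>G (x + \<eta> *\<^sub>R axis i 1)\<bar> \<partial>lborel)"
        by (intro nn_integral_cong) (auto simp: indicator_def)
      then show "(\<integral>\<^sup>+\<eta>. ennreal (norm (indicat_real {0..\<tau>} \<eta> *\<^sub>R G (x + \<eta> *\<^sub>R axis i 1))) \<partial>lborel) < \<infinity>" using fin by simp
    qed measurable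
  qed
qed

lemma line_deriv_lin:
  assumes "line_deriv i F1 G1" "line_deriv i F2 G2" "lint G1" "lint G2"
  shows "line_deriv i (\<lambda>x. F1 x - c * F2 x) (\<lambda>x. G1 x - c * G2 x)"
  unfolding line_deriv_def
proof (intro allI impI)
  fix \<tau> :: real assume \<tau>: "\<tau> > 0"
  have "AE x in lborel. F1 (x + \<tau> *\<^sub>R axis i 1) - F1 x = (LINT \<eta>:{0..\<tau>}|lborel. G1 (x + \<eta> *\<^sub>R axis i 1))"
    "AE x in lborel. F2 (x + \<tau> *\<^sub>R axis i 1) - F2 x = (LINT \<eta>:{0..\<tau>}|lborel. G2 (x + \<eta> *\<^sub>R axis i 1))"
    using assms \<tau> unfolding line_deriv_def by auto
  then show "AE x in lborel. F1 (x + \<tau> *\<^sub>R axis i 1) - c * F2 (x + \<tau> *\<^sub>R axis i 1) - (F1 x - c * F2 x) =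
     (LINT \<eta>:{0..\<tau>}|lborel. G1 (x + \<eta> *\<^sub>R axis i 1) - c * G2 (x + \<eta> *\<^sub>R axis i 1))"
    using lint_line_integrable[OF assms(3) less_imp_le[OF \<tau>], of i] lint_line_integrable[OF assms(4) less_imp_le[OF \<tau>], of i]
  proof eventually_elim
    case (elim x)
    have "(LINT \<eta>:{0..\<tau>}|lborel. G1 (x + \<eta> *\<^sub>R axis i 1) - c * G2 (x + \<eta> *\<^sub>R axis i 1)) =
      (LINT \<eta>:{0..\<tau>}|lborel. G1 (x + \<eta> *\<^sub>R axis i 1)) - c * (LINT \<eta>:{0..\<tau>}|lborel. G2 (x + \<eta> *\<^sub>R axis i 1))"
      using elim(3,4) \<tau> by (subst set_integral_diff) auto
    then show ?case using elim(1,2)[symmetric] by (simp add: algebra_simps)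
  qed
qed

lemma line_deriv_translate:
  assumes "line_deriv i F G" shows "line_deriv i (\<lambda>x. F (x - c)) (\<lambda>x. G (x - c))"
  unfolding line_deriv_def
proof (intro allI impI)
  fix \<tau> :: real assume \<tau>: "\<tau> > 0"
  then have "AE x in lborel. F (x + \<tau> *\<^sub>R axis i 1) - F x = (LINT \<eta>:{0..\<tau>}|lborel. G (x + \<eta> *\<^sub>R axis i 1))"
    using assms unfolding line_deriv_def by auto
  from AE_lborel_shift[OF this, of "- c"]
  show "AE x in lborel. F (x + \<tau> *\<^sub>R axis i 1 - c) - F (x - c) = (LINT \<eta>:{0..\<tau>}|lborel. G (x + \<eta> *\<^sub>R axis i 1 - c))"
    by eventually_elim (simp add: algebra_simps)
qed

text \<open>With \<open>F\<close> the kernel and \<open>b\<close> the coefficients of the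
  approximant this is the approximation error; with a derivative of the kernel it is the
  corresponding derivative of the error.\<close>

definition conv_diff :: "(real^'n::finite \<Rightarrow> real) \<Rightarrow> (real^'n) set \<Rightarrow> (real^'n \<Rightarrow> real) \<Rightarrow> (real^'n \<Rightarrow> real) \<Rightarrow> real^'n \<Rightarrow> real" where
  "conv_diff \<nu> \<Xi> b F x = (LINT z|lborel. \<nu> z * F (x - z)) - (\<Sum>\<xi>\<in>\<Xi>. b \<xi> * F (x - \<xi>))"

context
  fixes \<nu> :: "real^'n::finite \<Rightarrow> real" and r :: real
  assumes \<nu>m[measurable]: "\<nu> \<in> borel_measurable borel" and \<nu>i: "integrable lborel \<nu>"
    and \<nu>Z: "\<And>z. z \<notin> cball 0 r \<Longrightarrow> \<nu> z = 0"
begin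

lemma loc_finite_conv_abs:
  assumes "lint F" shows "loc_finite (\<lambda>x. \<integral>\<^sup>+z. ennreal \<bar>\<nu> z\<bar> * ennreal \<bar>F (x - z)\<bar> \<partial>lborel)"
  by (rule loc_finite_conv[of "\<lambda>x. ennreal \<bar>F x\<bar>" "\<lambda>z. ennreal \<bar>\<nu> z\<bar>" r])
    (use assms \<nu>i \<nu>Z in \<open>auto simp: lint_iff_loc_finite integrable_iff_bounded\<close>)

lemma lint_conv:
  assumes "lint F" shows "lint (\<lambda>x. LINT z|lborel. \<nu> z * F (x - z))"
  unfolding lint_def
proof (intro conjI allI)
  have m[measurable]: "F \<in> borel_measurable borel" using assms by (rule lintD)
  show "(\<lambda>x. LINT z|lborel. \<nu> z * F (x - z)) \<in> borel_measurable borel" by measurable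
  fix R
  have "(\<integral>\<^sup>+x. ennreal \<bar>LINT z|lborel. \<nu> z * F (x - z)\<bar> * indicator (cball 0 R) x \<partial>lborel)
    \<le> (\<integral>\<^sup>+x. (\<integral>\<^sup>+z. ennreal \<bar>\<nu> z\<bar> * ennreal \<bar>F (x - z)\<bar> \<partial>lborel) * indicator (cball 0 R) x \<partial>lborel)"
    using abs_integral_le_nn_integral[of lborel "\<lambda>z. \<nu> z * F (_ - z)"]
    by (intro nn_integral_mono mult_right_mono) (auto simp: abs_mult ennreal_mult')
  also have "\<dots> < \<infinity>" by (rule loc_finiteD(2)[OF loc_finite_conv_abs[OF assms]])
  finally show "(\<integral>\<^sup>+x. ennreal \<bar>LINT z|lborel. \<nu> z * F (x - z)\<bar> * indicator (cball 0 R) x \<partial>lborel) < \<infinity>" .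
qed

lemma conv_integrable_AE:
  assumes "lint F" shows "AE x in lborel. integrable lborel (\<lambda>z. \<nu> z * F (x - z))"
  using loc_finite_AE[OF loc_finite_conv_abs[OF assms]]
proof eventually_elim
  fix x assume *: "(\<integral>\<^sup>+z. ennreal \<bar>\<nu> z\<bar> * ennreal \<bar>F (x - z)\<bar> \<partial>lborel) < \<infinity>"
  have m[measurable]: "F \<in> borel_measurable borel" using assms by (rule lintD)
  show "integrable lborel (\<lambda>z. \<nu> z * F (x - z))"
    by (rule integrableI_bounded) (use * in \<open>auto simp: abs_mult ennreal_mult'\<close>)
qed

text \<open>Fubini in \<open>z\<close> and \<eta>. Joint integrability for almost every
  \<open>x\<close> comes from local finiteness of the convolution of absolute values, averaged over
  the line.\<close>

lemma line_deriv_conv: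
  assumes F: "lint F" and G: "lint G" and ld: "line_deriv i F G"
  shows "line_deriv i (\<lambda>x. LINT z|lborel. \<nu> z * F (x - z)) (\<lambda>x. LINT z|lborel. \<nu> z * G (x - z))"
  unfolding line_deriv_def
proof (intro allI impI)
  have Fm[measurable]: "F \<in> borel_measurable borel" using F by (rule lintD)
  have Gm[measurable]: "G \<in> borel_measurable borel" using G by (rule lintD)
  let ?e = "axis i (1::real) :: real^'n"
  fix \<tau> :: real assume \<tau>: "\<tau> > 0"
  have ld': "AE x in lborel. F (x + \<tau> *\<^sub>R ?e) - F x = (LINT \<eta>:{0..\<tau>}|lborel. G (x + \<eta> *\<^sub>R ?e))"
    using ld \<tau> unfolding line_deriv_def by auto
  show "AE x in lborel. (LINT z|lborel. \<nu> z * F (x + \<tau> *\<^sub>R ?e - z)) - (LINT z|lborel. \<nu> z * F (x - z)) =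
     (LINT \<eta>:{0..\<tau>}|lborel. (LINT z|lborel. \<nu> z * G (x + \<eta> *\<^sub>R ?e - z)))"
    using conv_integrable_AE[OF F] AE_lborel_shift[OF conv_integrable_AE[OF F], of "\<tau> *\<^sub>R ?e"]
      loc_finite_AE[OF loc_finite_line[OF loc_finite_conv_abs[OF G] less_imp_le[OF \<tau>], of i]]
  proof eventually_elim
    case (elim x)
    let ?f = "\<lambda>z \<eta>. indicator {0..\<tau>} \<eta> * (\<nu> z * G (x + \<eta> *\<^sub>R ?e - z))"
    have ip: "integrable (lborel \<Otimes>\<^sub>M lborel) (case_prod ?f)"
    proof (rule integrableI_bounded)
      show "case_prod ?f \<in> borel_measurable (lborel \<Otimes>\<^sub>M lborel)" by measurable
      have "(\<integral>\<^sup>+p. ennreal (norm (case_prod ?f p)) \<partial>(lborel \<Otimes>\<^sub>M lborel)) = (\<integral>\<^sup>+\<eta>. (\<integral>\<^sup>+z. ennreal (norm (case_prod ?f (z, \<eta>))) \<partial>lborel) \<partial>lborel)"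
        by (rule lborel_pair.nn_integral_snd[symmetric]) measurable
      also have "\<dots> = (\<integral>\<^sup>+\<eta>. indicator {0..\<tau>} \<eta> * (\<integral>\<^sup>+z. ennreal \<bar>\<nu> z\<bar> * ennreal \<bar>G (x + \<eta> *\<^sub>R ?e - z)\<bar> \<partial>lborel) \<partial>lborel)"
        by (rule nn_integral_cong) (auto simp: indicator_def abs_mult ennreal_mult')
      finally show "(\<integral>\<^sup>+p. ennreal (norm (case_prod ?f p)) \<partial>(lborel \<Otimes>\<^sub>M lborel)) < \<infinity>" using elim(3) by simp
    qed
    have "(LINT z|lborel. \<nu> z * F (x + \<tau> *\<^sub>R ?e - z)) - (LINT z|lborel. \<nu> z * F (x - z)) =
       (LINT z|lborel. \<nu> z * F (x + \<tau> *\<^sub>R ?e - z) - \<nu> z * F (x - z))"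
      using elim(1,2) by (intro Bochner_Integration.integral_diff[symmetric])
    also have "\<dots> = (LINT z|lborel. (LINT \<eta>|lborel. ?f z \<eta>))"
    proof (rule integral_cong_AE)
      show "AE z in lborel. \<nu> z * F (x + \<tau> *\<^sub>R ?e - z) - \<nu> z * F (x - z) = (LINT \<eta>|lborel. ?f z \<eta>)"
        using AE_lborel_reflect[OF ld', of x]
      proof eventually_elim
        fix z assume *: "F (x - z + \<tau> *\<^sub>R ?e) - F (x - z) = (LINT \<eta>:{0..\<tau>}|lborel. G (x - z + \<eta> *\<^sub>R ?e))"
        have "\<nu> z * F (x + \<tau> *\<^sub>R ?e - z) - \<nu> z * F (x - z) = \<nu> z * (F (x - z + \<tau> *\<^sub>R ?e) - F (x - z))"
          by (simp add: algebra_simps)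
        also have "\<dots> = (LINT \<eta>|lborel. \<nu> z * (indicator {0..\<tau>} \<eta> *\<^sub>R G (x - z + \<eta> *\<^sub>R ?e)))"
          unfolding * set_lebesgue_integral_def by (rule integral_mult_right_zero[symmetric])
        also have "\<dots> = (LINT \<eta>|lborel. ?f z \<eta>)"
          by (intro Bochner_Integration.integral_cong) (auto simp: algebra_simps)
        finally show "\<nu> z * F (x + \<tau> *\<^sub>R ?e - z) - \<nu> z * F (x - z) = (LINT \<eta>|lborel. ?f z \<eta>)" .
      qed
    qed measurable
    also have "\<dots> = (LINT \<eta>|lborel. (LINT z|lborel. ?f z \<eta>))"
      by (rule lborel_pair.Fubini_integral[OF ip, symmetric])
    also have "\<dots> = (LINT \<eta>:{0..\<tau>}|lborel. (LINT z|lborel. \<nu> z * G (x + \<eta> *\<^sub>R ?e - z)))"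
      unfolding set_lebesgue_integral_def by simp
    finally show ?case .
  qed
qed

lemma lint_conv_diff:
  assumes "finite \<Xi>" "lint F" shows "lint (conv_diff \<nu> \<Xi> b F)"
  using assms(1)
proof (induction \<Xi>)
  case empty
  then show ?case using lint_conv[OF assms(2)] by (simp add: conv_diff_def[abs_def])
next
  case (insert \<xi> \<Xi>)
  have "conv_diff \<nu> (insert \<xi> \<Xi>) b F = (\<lambda>x. conv_diff \<nu> \<Xi> b F x - b \<xi> * F (x - \<xi>))"
    using insert.hyps by (auto simp: conv_diff_def fun_eq_iff)
  then show ?case using lint_lin[OF insert.IH lint_translate[OF assms(2)], of "b \<xi>" \<xi>] by simp
qed

lemma line_deriv_conv_diff:
  assumes "finite \<Xi>" and F: "lint F" and G: "lint G" and ld: "line_deriv i F G"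
  shows "line_deriv i (conv_diff \<nu> \<Xi> b F) (conv_diff \<nu> \<Xi> b G)"
  using assms(1)
proof (induction \<Xi>)
  case empty
  then show ?case using line_deriv_conv[OF F G ld] by (simp add: conv_diff_def[abs_def])
next
  case (insert \<xi> \<Xi>)
  have eq: "conv_diff \<nu> (insert \<xi> \<Xi>) b F = (\<lambda>x. conv_diff \<nu> \<Xi> b F x - b \<xi> * F (x - \<xi>))" for F
    using insert.hyps by (auto simp: conv_diff_def fun_eq_iff)
  show ?case unfolding eq
    by (intro line_deriv_lin insert.IH line_deriv_translate ld lint_conv_diff insert.hyps lint_translate G)
qed

end

section \<open>Integral operators and radial integrals\<close>

text \<open>Integrating 2 f(x) g(x) f(y) g(y) <= f(x)^2 g(y)^2 + g(x)^2 f(y)^2 in both variables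
  proves the inequality without normalising, so zero and infinite norms need no separate
  cases.\<close>

lemma nn_integral_Cauchy_Schwarz:
  fixes f g :: "'a \<Rightarrow> real"
  assumes [measurable]: "f \<in> borel_measurable M" "g \<in> borel_measurable M"
    and f: "\<And>x. 0 \<le> f x" and g: "\<And>x. 0 \<le> g x"
  shows "(\<integral>\<^sup>+x. ennreal (f x * g x) \<partial>M)\<^sup>2 \<le> (\<integral>\<^sup>+x. ennreal ((f x)\<^sup>2) \<partial>M) * (\<integral>\<^sup>+x. ennreal ((g x)\<^sup>2) \<partial>M)"
proof -
  let ?I = "\<integral>\<^sup>+x. ennreal (f x * g x) \<partial>M" and ?F = "\<integral>\<^sup>+x. ennreal ((f x)\<^sup>2) \<partial>M" and ?G = "\<integral>\<^sup>+x. ennreal ((g x)\<^sup>2) \<partial>M"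
  have pw: "2 * (ennreal (f x * g x) * ennreal (f y * g y)) \<le> ennreal ((f x)\<^sup>2) * ennreal ((g y)\<^sup>2) + ennreal ((g x)\<^sup>2) * ennreal ((f y)\<^sup>2)" for x y
  proof -
    have "2 * ((f x * g x) * (f y * g y)) \<le> (f x)\<^sup>2 * (g y)\<^sup>2 + (g x)\<^sup>2 * (f y)\<^sup>2"
      using sum_squares_bound[of "f x * g y" "g x * f y"] by (simp add: power_mult_distrib mult_ac)
    then have "ennreal (2 * ((f x * g x) * (f y * g y))) \<le> ennreal ((f x)\<^sup>2 * (g y)\<^sup>2 + (g x)\<^sup>2 * (f y)\<^sup>2)"
      by (rule ennreal_leI)
    then show ?thesis using f g by (simp add: ennreal_mult ennreal_plus)
  qed
  have "2 * ?I\<^sup>2 = (\<integral>\<^sup>+x. (\<integral>\<^sup>+y. 2 * (ennreal (f x * g x) * ennreal (f y * g y)) \<partial>M) \<partial>M)"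
    by (simp add: nn_integral_cmult nn_integral_multc power2_eq_square)
  also have "\<dots> \<le> (\<integral>\<^sup>+x. (\<integral>\<^sup>+y. ennreal ((f x)\<^sup>2) * ennreal ((g y)\<^sup>2) + ennreal ((g x)\<^sup>2) * ennreal ((f y)\<^sup>2) \<partial>M) \<partial>M)"
    by (intro nn_integral_mono pw)
  also have "\<dots> = ?F * ?G + ?G * ?F"
    by (simp add: nn_integral_cmult nn_integral_multc nn_integral_add)
  also have "\<dots> = 2 * (?F * ?G)" by (simp add: mult.commute[of ?G] mult_2)
  finally show ?thesis by (subst (asm) ennreal_mult_le_mult_iff) auto
qed

text \<open>A Schur test for a factored kernel. Equal factors give the classical form with row and
  column integrals; unequal ones are needed near the origin, where one factor is bounded and the
  other is merely square integrable in \<open>x\<close>.\<close>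

lemma nn_integral_schur:
  fixes \<nu> :: "real^'n::finite \<Rightarrow> real" and a b :: "real^'n \<Rightarrow> real^'n \<Rightarrow> real"
  assumes [measurable]: "\<nu> \<in> borel_measurable borel" 
    and am[measurable]: "(\<lambda>(x, z). a x z) \<in> borel_measurable (borel \<Otimes>\<^sub>M borel)" 
    and bm[measurable]: "(\<lambda>(x, z). b x z) \<in> borel_measurable (borel \<Otimes>\<^sub>M borel)"
    and a: "\<And>x z. 0 \<le> a x z" and b: "\<And>x z. 0 \<le> b x z"
    and A: "\<And>x. (\<integral>\<^sup>+z. ennreal ((a x z)\<^sup>2) \<partial>lborel) \<le> A" and B: "\<And>z. (\<integral>\<^sup>+x. ennreal ((b x z)\<^sup>2) \<partial>lborel) \<le> B"
  shows "(\<integral>\<^sup>+x. (\<integral>\<^sup>+z. ennreal (\<bar>\<nu> z\<bar> * (a x z * b x z)) \<partial>lborel)\<^sup>2 \<partial>lborel) \<le> A * B * (\<integral>\<^sup>+z. ennreal ((\<nu> z)\<^sup>2) \<partial>lborel)"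
proof -
  have [measurable]: "(\<lambda>z. a x z) \<in> borel_measurable borel" "(\<lambda>z. b x z) \<in> borel_measurable borel" for x
    using measurable_compose[OF measurable_Pair1'[of x borel borel] am] measurable_compose[OF measurable_Pair1'[of x borel borel] bm] by simp_all
  have [measurable]: "(\<lambda>x. b x z) \<in> borel_measurable borel" for z
    using measurable_compose[OF measurable_Pair2'[of z borel borel] bm] by simp
  have "(\<integral>\<^sup>+x. (\<integral>\<^sup>+z. ennreal (\<bar>\<nu> z\<bar> * (a x z * b x z)) \<partial>lborel)\<^sup>2 \<partial>lborel)
     \<le> (\<integral>\<^sup>+x. A * (\<integral>\<^sup>+z. ennreal ((b x z * \<bar>\<nu> z\<bar>)\<^sup>2) \<partial>lborel) \<partial>lborel)"
  proof (rule nn_integral_mono)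
    fix x
    have "(\<integral>\<^sup>+z. ennreal (\<bar>\<nu> z\<bar> * (a x z * b x z)) \<partial>lborel)\<^sup>2 = (\<integral>\<^sup>+z. ennreal (a x z * (b x z * \<bar>\<nu> z\<bar>)) \<partial>lborel)\<^sup>2"
      by (simp add: mult_ac)
    also have "\<dots> \<le> (\<integral>\<^sup>+z. ennreal ((a x z)\<^sup>2) \<partial>lborel) * (\<integral>\<^sup>+z. ennreal ((b x z * \<bar>\<nu> z\<bar>)\<^sup>2) \<partial>lborel)"
      by (rule nn_integral_Cauchy_Schwarz) (use a b in auto)
    also have "\<dots> \<le> A * (\<integral>\<^sup>+z. ennreal ((b x z * \<bar>\<nu> z\<bar>)\<^sup>2) \<partial>lborel)" by (intro mult_right_mono A) simp
    finally show "(\<integral>\<^sup>+z. ennreal (\<bar>\<nu> z\<bar> * (a x z * b x z)) \<partial>lborel)\<^sup>2 \<le> A * (\<integral>\<^sup>+z. ennreal ((b x z * \<bar>\<nu> z\<bar>)\<^sup>2) \<partial>lborel)" .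
  qed
  also have "\<dots> = A * (\<integral>\<^sup>+x. (\<integral>\<^sup>+z. ennreal ((b x z * \<bar>\<nu> z\<bar>)\<^sup>2) \<partial>lborel) \<partial>lborel)"
    by (rule nn_integral_cmult) measurable
  also have "(\<integral>\<^sup>+x. (\<integral>\<^sup>+z. ennreal ((b x z * \<bar>\<nu> z\<bar>)\<^sup>2) \<partial>lborel) \<partial>lborel) = (\<integral>\<^sup>+z. (\<integral>\<^sup>+x. ennreal ((b x z * \<bar>\<nu> z\<bar>)\<^sup>2) \<partial>lborel) \<partial>lborel)"
    by (rule lborel_pair.Fubini') measurable
  also have "\<dots> \<le> (\<integral>\<^sup>+z. B * ennreal ((\<nu> z)\<^sup>2) \<partial>lborel)"
  proof (rule nn_integral_mono)
    fix z
    have "(\<integral>\<^sup>+x. ennreal ((b x z * \<bar>\<nu> z\<bar>)\<^sup>2) \<partial>lborel) = (\<integral>\<^sup>+x. ennreal ((b x z)\<^sup>2) * ennreal ((\<nu> z)\<^sup>2) \<partial>lborel)"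
      by (intro nn_integral_cong) (simp add: power_mult_distrib ennreal_mult)
    also have "\<dots> = (\<integral>\<^sup>+x. ennreal ((b x z)\<^sup>2) \<partial>lborel) * ennreal ((\<nu> z)\<^sup>2)" by (rule nn_integral_multc) measurable
    also have "\<dots> \<le> B * ennreal ((\<nu> z)\<^sup>2)" by (intro mult_right_mono B) simp
    finally show "(\<integral>\<^sup>+x. ennreal ((b x z * \<bar>\<nu> z\<bar>)\<^sup>2) \<partial>lborel) \<le> B * ennreal ((\<nu> z)\<^sup>2)" .
  qed
  also have "\<dots> = B * (\<integral>\<^sup>+z. ennreal ((\<nu> z)\<^sup>2) \<partial>lborel)" by (rule nn_integral_cmult) measurable
  finally show ?thesis by (simp add: mult.assoc mult_left_mono)
qed

section \<open>Radial integrals by dyadic shells\<close>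

lemma ex_dyadic: assumes "1 \<le> (t :: real)" shows "\<exists>j. 2 ^ j \<le> t \<and> t < 2 ^ Suc j"
proof -
  obtain n where n: "t < 2 ^ n" using real_arch_pow[of 2 t] by auto
  define m where "m = (LEAST n. t < 2 ^ n)"
  have m: "t < 2 ^ m" unfolding m_def by (rule LeastI[of "\<lambda>n. t < 2 ^ n", OF n])
  then have "m \<noteq> 0" using assms by (cases m) auto
  then obtain j where j: "m = Suc j" by (cases m) auto
  have "\<not> t < 2 ^ j" using not_less_Least[of j "\<lambda>n. t < 2 ^ n"] j unfolding m_def by simp
  then show ?thesis using m j by (intro exI[of _ j]) auto
qed

text \<open>On a shell between \<rho>/2 and \<rho> the power exceeds its value at \<rho> by at most
  the factor \<open>2 powr \<bar>p\<bar>\<close>, whatever the sign of \<open>p\<close>, and the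
  volume of the shell is bounded by that of the ball. Leaving the radii abstract serves both ends of
  the scale.\<close>

lemma nn_integral_dyadic:
  fixes A :: "(real^'n::finite) set" and \<rho> :: "nat \<Rightarrow> real" and p :: real
  assumes A: "\<And>x. x \<in> A \<Longrightarrow> x \<noteq> 0 \<Longrightarrow> \<exists>j. \<rho> j / 2 \<le> norm x \<and> norm x \<le> \<rho> j" and \<rho>: "\<And>j. 0 < \<rho> j"
  shows "(\<integral>\<^sup>+x. ennreal (norm x powr (- p)) * indicator A x \<partial>lborel)
    \<le> (\<Sum>j. ennreal (2 powr \<bar>p\<bar> * unit_ball_vol (CARD('n)) * \<rho> j powr (real CARD('n) - p)))"
proof -
  let ?c = "2 powr \<bar>p\<bar>"
  have "(\<integral>\<^sup>+x. ennreal (norm x powr (- p)) * indicator A x \<partial>lborel)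
    \<le> (\<integral>\<^sup>+x. (\<Sum>j. ennreal (?c * \<rho> j powr (- p)) * indicator (cball 0 (\<rho> j)) (x :: real^'n)) \<partial>lborel)"
  proof (rule nn_integral_mono)
    fix x :: "real^'n"
    show "ennreal (norm x powr (- p)) * indicator A x \<le> (\<Sum>j. ennreal (?c * \<rho> j powr (- p)) * indicator (cball 0 (\<rho> j)) x)"
    proof (cases "x \<in> A \<and> x \<noteq> 0")
      case True
      then obtain j where j: "\<rho> j / 2 \<le> norm x" "norm x \<le> \<rho> j" using A by blast
      have x0: "norm x > 0" using True by simp
      have le: "norm x powr (- p) \<le> ?c * \<rho> j powr (- p)"
      proof (cases "p \<ge> 0")
        case p: True
        have "norm x powr (- p) \<le> (\<rho> j / 2) powr (- p)"
          using j \<rho>[of j] p by (intro powr_mono2') auto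
        also have "\<dots> = ?c * \<rho> j powr (- p)"
          using p \<rho>[of j] by (simp add: powr_divide powr_minus field_simps)
        finally show ?thesis .
      next
        case p: False
        have "norm x powr (- p) \<le> \<rho> j powr (- p)" using j p by (intro powr_mono2) auto
        also have "\<dots> \<le> ?c * \<rho> j powr (- p)" using ge_one_powr_ge_zero[of 2 "\<bar>p\<bar>"] by (simp add: mult_le_cancel_right1)
        finally show ?thesis .
      qed
      have "ennreal (norm x powr (- p)) * indicator A x \<le> ennreal (?c * \<rho> j powr (- p)) * indicator (cball 0 (\<rho> j)) x"
        using le j True by (auto intro!: ennreal_leI)
      also have "\<dots> \<le> (\<Sum>j. ennreal (?c * \<rho> j powr (- p)) * indicator (cball 0 (\<rho> j)) x)"
      proof -
        define f where "f j = ennreal (?c * \<rho> j powr (- p)) * indicator (cball 0 (\<rho> j)) x" for j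
        have "f j \<le> suminf f" using sum_le_suminf[of f "{j}"] by simp
        then show ?thesis unfolding f_def .
      qed
      finally show ?thesis .
    next
      case False
      then have "ennreal (norm x powr (- p)) * indicator A x = 0" by auto
      then show ?thesis by (simp only: zero_le)
    qed
  qed
  also have "\<dots> = (\<Sum>j. (\<integral>\<^sup>+x. ennreal (?c * \<rho> j powr (- p)) * indicator (cball 0 (\<rho> j)) (x :: real^'n) \<partial>lborel))"
    by (rule nn_integral_suminf) measurable
  also have "\<dots> = (\<Sum>j. ennreal (2 powr \<bar>p\<bar> * unit_ball_vol (CARD('n)) * \<rho> j powr (real CARD('n) - p)))"
  proof (rule arg_cong[of _ _ suminf], rule ext)
    fix j
    have "(\<integral>\<^sup>+x. ennreal (?c * \<rho> j powr (- p)) * indicator (cball 0 (\<rho> j)) (x :: real^'n) \<partial>lborel) =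
      ennreal (?c * \<rho> j powr (- p)) * emeasure lborel (cball (0 :: real^'n) (\<rho> j))"
      by (rule nn_integral_cmult_indicator) simp
    also have "\<dots> = ennreal (?c * \<rho> j powr (- p)) * ennreal (unit_ball_vol (CARD('n)) * \<rho> j ^ CARD('n))"
      using \<rho>[of j] by (simp add: emeasure_cball)
    also have "\<dots> = ennreal (?c * \<rho> j powr (- p) * (unit_ball_vol (CARD('n)) * \<rho> j ^ CARD('n)))"
      by (rule ennreal_mult[symmetric]) (use \<rho>[of j] in auto)
    also have "?c * \<rho> j powr (- p) * (unit_ball_vol (CARD('n)) * \<rho> j ^ CARD('n)) = 2 powr \<bar>p\<bar> * unit_ball_vol (CARD('n)) * \<rho> j powr (real CARD('n) - p)"
      using \<rho>[of j] by (simp add: powr_diff powr_minus powr_realpow field_simps)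
    finally show "(\<integral>\<^sup>+x. ennreal (?c * \<rho> j powr (- p)) * indicator (cball 0 (\<rho> j)) (x :: real^'n) \<partial>lborel) = ennreal (2 powr \<bar>p\<bar> * unit_ball_vol (CARD('n)) * \<rho> j powr (real CARD('n) - p))" .
  qed
  finally show ?thesis .
qed

lemma suminf_ennreal_geometric:
  assumes "0 \<le> c" "0 \<le> q" "q < 1"
  shows "(\<Sum>j. ennreal (c * q ^ j)) = ennreal (c * (1 / (1 - q)))"
proof -
  have s: "summable (\<lambda>j. c * q ^ j)" using assms by (intro summable_mult summable_geometric) simp
  have "(\<Sum>j. ennreal (c * q ^ j)) = ennreal (\<Sum>j. c * q ^ j)"
    using assms s by (intro suminf_ennreal2) auto
  also have "(\<Sum>j. c * q ^ j) = c * (1 / (1 - q))"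
    using assms by (subst suminf_mult) (auto simp: suminf_geometric summable_geometric)
  finally show ?thesis .
qed

lemma nn_integral_norm_powr_near:
  assumes p: "p < real CARD('n)"
  shows "\<exists>C\<ge>0. \<forall>R>0. (\<integral>\<^sup>+x. ennreal (norm (x :: real^'n::finite) powr (- p)) * indicator (cball 0 R) x \<partial>lborel) \<le> ennreal (C * R powr (real CARD('n) - p))"
proof -
  let ?K = "2 powr \<bar>p\<bar> * unit_ball_vol (CARD('n))"
  \<comment> \<open>Halving the radius multiplies volume times power by \<open>q\<close>, and p < d
    makes this ratio less than 1.\<close>
  define q where "q = (1/2 :: real) powr (real CARD('n) - p)"
  have q: "0 \<le> q" "q < 1" using p powr_less_mono[of 0 "real CARD('n) - p" 2] unfolding q_def by (auto simp: powr_divide)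
  have "(\<integral>\<^sup>+x. ennreal (norm (x :: real^'n::finite) powr (- p)) * indicator (cball 0 R) x \<partial>lborel) \<le> ennreal ((?K * (1 / (1 - q))) * R powr (real CARD('n) - p))"
    if R: "R > 0" for R
  proof -
    have "(\<integral>\<^sup>+x. ennreal (norm (x :: real^'n::finite) powr (- p)) * indicator (cball 0 R) x \<partial>lborel)
      \<le> (\<Sum>j. ennreal (?K * (R * (1/2) ^ j) powr (real CARD('n) - p)))"
    proof (rule nn_integral_dyadic)
      fix x :: "real^'n" assume x: "x \<in> cball 0 R" "x \<noteq> 0"
      then obtain j where "2 ^ j \<le> R / norm x" "R / norm x < 2 ^ Suc j" using ex_dyadic[of "R / norm x"] by auto
      then show "\<exists>j. R * (1 / 2) ^ j / 2 \<le> norm x \<and> norm x \<le> R * (1 / 2) ^ j"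
        using x by (intro exI[of _ j]) (auto simp: field_simps power_one_over)
    qed (use R in auto)
    also have "\<dots> = (\<Sum>j. ennreal ((?K * R powr (real CARD('n) - p)) * q ^ j))"
    proof (rule arg_cong[of _ _ suminf], rule ext)
      fix j
      have "(R * (1/2) ^ j) powr (real CARD('n) - p) = R powr (real CARD('n) - p) * ((1/2) ^ j) powr (real CARD('n) - p)"
        using R by (simp add: powr_mult)
      also have "((1/2 :: real) ^ j) powr (real CARD('n) - p) = q ^ j"
        unfolding q_def by (simp add: powr_realpow[symmetric] powr_powr mult.commute)
      finally show "ennreal (?K * (R * (1/2) ^ j) powr (real CARD('n) - p)) = ennreal ((?K * R powr (real CARD('n) - p)) * q ^ j)" by (simp add: mult_ac)
    qed
    also have "\<dots> = ennreal (?K * R powr (real CARD('n) - p) * (1 / (1 - q)))" using q by (intro suminf_ennreal_geometric) auto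
    finally show ?thesis by (simp add: mult_ac)
  qed
  moreover have "?K * (1 / (1 - q)) \<ge> 0" using q by auto
  ultimately show ?thesis by blast
qed

lemma nn_integral_norm_powr_far:
  assumes p: "p > real CARD('n)"
  shows "\<exists>C\<ge>0. \<forall>R>0. (\<integral>\<^sup>+x. ennreal (norm (x :: real^'n::finite) powr (- p)) * indicator (- ball 0 R) x \<partial>lborel) \<le> ennreal (C * R powr (real CARD('n) - p))"
proof -
  let ?K = "2 powr \<bar>p\<bar> * unit_ball_vol (CARD('n))"
  \<comment> \<open>The radii double outwards, the first outer radius being \<open>2 * R\<close>,
    which accounts for the additional factor \<open>q\<close>; now p > d gives
    \<open>q < 1\<close>.\<close>
  define q where "q = (2 :: real) powr (real CARD('n) - p)"
  have q: "0 \<le> q" "q < 1" using p powr_less_mono[of "real CARD('n) - p" 0 2] unfolding q_def by auto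
  have "(\<integral>\<^sup>+x. ennreal (norm (x :: real^'n::finite) powr (- p)) * indicator (- ball 0 R) x \<partial>lborel) \<le> ennreal ((?K * q * (1 / (1 - q))) * R powr (real CARD('n) - p))"
    if R: "R > 0" for R
  proof -
    have "(\<integral>\<^sup>+x. ennreal (norm (x :: real^'n::finite) powr (- p)) * indicator (- ball 0 R) x \<partial>lborel)
      \<le> (\<Sum>j. ennreal (?K * (R * 2 ^ Suc j) powr (real CARD('n) - p)))"
    proof (rule nn_integral_dyadic)
      fix x :: "real^'n" assume x: "x \<in> - ball 0 R" "x \<noteq> 0"
      then obtain j where "2 ^ j \<le> norm x / R" "norm x / R < 2 ^ Suc j" using ex_dyadic[of "norm x / R"] R by auto
      then show "\<exists>j. R * 2 ^ Suc j / 2 \<le> norm x \<and> norm x \<le> R * 2 ^ Suc j"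
        using R by (intro exI[of _ j]) (auto simp: field_simps)
    qed (use R in auto)
    also have "\<dots> = (\<Sum>j. ennreal ((?K * q * R powr (real CARD('n) - p)) * q ^ j))"
    proof (rule arg_cong[of _ _ suminf], rule ext)
      fix j
      have "(R * 2 ^ Suc j) powr (real CARD('n) - p) = R powr (real CARD('n) - p) * (2 ^ Suc j) powr (real CARD('n) - p)"
        using R by (simp add: powr_mult)
      also have "((2 :: real) ^ Suc j) powr (real CARD('n) - p) = q ^ Suc j"
        unfolding q_def by (simp add: powr_realpow[symmetric] powr_powr mult.commute del: power_Suc)
      finally show "ennreal (?K * (R * 2 ^ Suc j) powr (real CARD('n) - p)) = ennreal ((?K * q * R powr (real CARD('n) - p)) * q ^ j)" by (simp add: mult_ac)
    qed
    also have "\<dots> = ennreal (?K * q * R powr (real CARD('n) - p) * (1 / (1 - q)))" using q by (intro suminf_ennreal_geometric) auto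
    finally show ?thesis by (simp add: mult_ac)
  qed
  moreover have "?K * q * (1 / (1 - q)) \<ge> 0" using q by auto
  ultimately show ?thesis by blast
qed

section \<open>The Slobodeckij seminorm\<close>

text \<open>Cauchy-Schwarz on the interval of length \<tau> gives one factor \<tau>, Fubini with
  translation invariance the other.\<close>

lemma line_deriv_L2_diff_pos:
  fixes g G :: "real^'n::finite \<Rightarrow> real"
  assumes gm[measurable]: "g \<in> borel_measurable borel" and Gm[measurable]: "G \<in> borel_measurable borel"
    and ld: "line_deriv i g G" and \<tau>: "\<tau> > 0"
  shows "(\<integral>\<^sup>+x. ennreal ((g (x + \<tau> *\<^sub>R axis i 1) - g x)\<^sup>2) \<partial>lborel) \<le> ennreal (\<tau>\<^sup>2) * (\<integral>\<^sup>+x. ennreal ((G x)\<^sup>2) \<partial>lborel)"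
proof -
  let ?e = "axis i (1::real) :: real^'n" and ?I = "indicator {0..\<tau>} :: real \<Rightarrow> real"
  have "(\<integral>\<^sup>+x. ennreal ((g (x + \<tau> *\<^sub>R ?e) - g x)\<^sup>2) \<partial>lborel) \<le> (\<integral>\<^sup>+x. ennreal \<tau> * (\<integral>\<^sup>+\<eta>. ennreal ((?I \<eta> * \<bar>G (x + \<eta> *\<^sub>R ?e)\<bar>)\<^sup>2) \<partial>lborel) \<partial>lborel)"
  proof (rule nn_integral_mono_AE)
    have "AE x in lborel. g (x + \<tau> *\<^sub>R ?e) - g x = (LINT \<eta>:{0..\<tau>}|lborel. G (x + \<eta> *\<^sub>R ?e))"
      using ld \<tau> unfolding line_deriv_def by auto
    then show "AE x in lborel. ennreal ((g (x + \<tau> *\<^sub>R ?e) - g x)\<^sup>2) \<le> ennreal \<tau> * (\<integral>\<^sup>+\<eta>. ennreal ((?I \<eta> * \<bar>G (x + \<eta> *\<^sub>R ?e)\<bar>)\<^sup>2) \<partial>lborel)"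
    proof eventually_elim
      fix x assume *: "g (x + \<tau> *\<^sub>R ?e) - g x = (LINT \<eta>:{0..\<tau>}|lborel. G (x + \<eta> *\<^sub>R ?e))"
      have "ennreal ((g (x + \<tau> *\<^sub>R ?e) - g x)\<^sup>2) = (ennreal \<bar>LINT \<eta>|lborel. ?I \<eta> * G (x + \<eta> *\<^sub>R ?e)\<bar>)\<^sup>2"
        unfolding * set_lebesgue_integral_def by (simp add: ennreal_power)
      also have "\<dots> \<le> (\<integral>\<^sup>+\<eta>. ennreal \<bar>?I \<eta> * G (x + \<eta> *\<^sub>R ?e)\<bar> \<partial>lborel)\<^sup>2"
        by (intro power_mono abs_integral_le_nn_integral) simp
      \<comment> \<open>The indicator is idempotent: one copy is the second factor in
        Cauchy-Schwarz, the other keeps the square of \<open>G\<close> on the interval.\<close>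
      also have "\<dots> = (\<integral>\<^sup>+\<eta>. ennreal (?I \<eta> * (?I \<eta> * \<bar>G (x + \<eta> *\<^sub>R ?e)\<bar>)) \<partial>lborel)\<^sup>2"
        by (intro arg_cong[of _ _ "\<lambda>t. t\<^sup>2"] nn_integral_cong) (auto simp: indicator_def)
      also have "\<dots> \<le> (\<integral>\<^sup>+\<eta>. ennreal ((?I \<eta>)\<^sup>2) \<partial>lborel) * (\<integral>\<^sup>+\<eta>. ennreal ((?I \<eta> * \<bar>G (x + \<eta> *\<^sub>R ?e)\<bar>)\<^sup>2) \<partial>lborel)"
        by (rule nn_integral_Cauchy_Schwarz) auto
      also have "(\<integral>\<^sup>+\<eta>. ennreal ((?I \<eta>)\<^sup>2) \<partial>lborel) = (\<integral>\<^sup>+\<eta>. indicator {0..\<tau>} \<eta> \<partial>lborel)"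
        by (intro nn_integral_cong) (auto simp: indicator_def)
      also have "\<dots> = ennreal \<tau>" using \<tau> by simp
      finally show "ennreal ((g (x + \<tau> *\<^sub>R ?e) - g x)\<^sup>2) \<le> ennreal \<tau> * (\<integral>\<^sup>+\<eta>. ennreal ((?I \<eta> * \<bar>G (x + \<eta> *\<^sub>R ?e)\<bar>)\<^sup>2) \<partial>lborel)" .
    qed
  qed
  also have "\<dots> = ennreal \<tau> * (\<integral>\<^sup>+x. (\<integral>\<^sup>+\<eta>. ennreal ((?I \<eta> * \<bar>G (x + \<eta> *\<^sub>R ?e)\<bar>)\<^sup>2) \<partial>lborel) \<partial>lborel)"
    by (rule nn_integral_cmult) measurable
  also have "(\<integral>\<^sup>+x. (\<integral>\<^sup>+\<eta>. ennreal ((?I \<eta> * \<bar>G (x + \<eta> *\<^sub>R ?e)\<bar>)\<^sup>2) \<partial>lborel) \<partial>lborel) = (\<integral>\<^sup>+\<eta>. (\<integral>\<^sup>+x. ennreal ((?I \<eta> * \<bar>G (x + \<eta> *\<^sub>R ?e)\<bar>)\<^sup>2) \<partial>lborel) \<partial>lborel)"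
    by (rule lborel_pair.Fubini') measurable
  also have "\<dots> = (\<integral>\<^sup>+\<eta>. (\<integral>\<^sup>+x. ennreal ((G x)\<^sup>2) \<partial>lborel) * indicator {0..\<tau>} \<eta> \<partial>lborel)"
  proof (rule nn_integral_cong)
    fix \<eta>
    show "(\<integral>\<^sup>+x. ennreal ((?I \<eta> * \<bar>G (x + \<eta> *\<^sub>R ?e)\<bar>)\<^sup>2) \<partial>lborel) = (\<integral>\<^sup>+x. ennreal ((G x)\<^sup>2) \<partial>lborel) * indicator {0..\<tau>} \<eta>"
      using nn_integral_shift[of "\<lambda>x. ennreal ((G x)\<^sup>2)" "\<eta> *\<^sub>R ?e"] by (cases "\<eta> \<in> {0..\<tau>}") auto
  qed
  also have "\<dots> = (\<integral>\<^sup>+x. ennreal ((G x)\<^sup>2) \<partial>lborel) * ennreal \<tau>"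
    using \<tau> by (simp add: nn_integral_cmult_indicator)
  also have "ennreal \<tau> * \<dots> = ennreal (\<tau>\<^sup>2) * (\<integral>\<^sup>+x. ennreal ((G x)\<^sup>2) \<partial>lborel)"
    using \<tau> by (simp add: power2_eq_square ennreal_mult mult_ac)
  finally show ?thesis .
qed

lemma line_deriv_L2_diff:
  fixes g G :: "real^'n::finite \<Rightarrow> real"
  assumes gm[measurable]: "g \<in> borel_measurable borel" and Gm[measurable]: "G \<in> borel_measurable borel"
    and ld: "line_deriv i g G"
  shows "(\<integral>\<^sup>+x. ennreal ((g (x + \<tau> *\<^sub>R axis i 1) - g x)\<^sup>2) \<partial>lborel) \<le> ennreal (\<tau>\<^sup>2) * (\<integral>\<^sup>+x. ennreal ((G x)\<^sup>2) \<partial>lborel)"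
proof -
  consider "\<tau> > 0" | "\<tau> = 0" | "- \<tau> > 0" by linarith
  then show ?thesis
  proof cases
    case 3
    have "(\<integral>\<^sup>+x. ennreal ((g (x + \<tau> *\<^sub>R axis i 1) - g x)\<^sup>2) \<partial>lborel) = (\<integral>\<^sup>+x. ennreal ((g (x + (- \<tau>) *\<^sub>R axis i 1) - g x)\<^sup>2) \<partial>lborel)"
      using nn_integral_shift[of "\<lambda>x. ennreal ((g (x + \<tau> *\<^sub>R axis i 1) - g x)\<^sup>2)" "(- \<tau>) *\<^sub>R axis i 1"]
      by (simp add: power2_commute[of "g _" "g (_ - _)"])
    also have "\<dots> \<le> ennreal ((- \<tau>)\<^sup>2) * (\<integral>\<^sup>+x. ennreal ((G x)\<^sup>2) \<partial>lborel)"
      by (rule line_deriv_L2_diff_pos[OF gm Gm ld 3])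
    finally show ?thesis by simp
  qed (auto intro: line_deriv_L2_diff_pos[OF gm Gm ld])
qed

lemma nn_integral_square_add_le:
  fixes f g :: "'a \<Rightarrow> real"
  assumes [measurable]: "f \<in> borel_measurable M" "g \<in> borel_measurable M"
  shows "(\<integral>\<^sup>+x. ennreal ((f x + g x)\<^sup>2) \<partial>M) \<le> 2 * (\<integral>\<^sup>+x. ennreal ((f x)\<^sup>2) \<partial>M) + 2 * (\<integral>\<^sup>+x. ennreal ((g x)\<^sup>2) \<partial>M)"
proof -
  have "(\<integral>\<^sup>+x. ennreal ((f x + g x)\<^sup>2) \<partial>M) \<le> (\<integral>\<^sup>+x. 2 * ennreal ((f x)\<^sup>2) + 2 * ennreal ((g x)\<^sup>2) \<partial>M)"
  proof (rule nn_integral_mono)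
    fix x
    have "(f x + g x)\<^sup>2 \<le> 2 * (f x)\<^sup>2 + 2 * (g x)\<^sup>2"
      using sum_squares_bound[of "f x" "g x"] by (simp add: power2_sum)
    then have "ennreal ((f x + g x)\<^sup>2) \<le> ennreal (2 * (f x)\<^sup>2 + 2 * (g x)\<^sup>2)" by (rule ennreal_leI)
    then show "ennreal ((f x + g x)\<^sup>2) \<le> 2 * ennreal ((f x)\<^sup>2) + 2 * ennreal ((g x)\<^sup>2)" by (simp add: ennreal_mult ennreal_plus)
  qed
  also have "\<dots> = 2 * (\<integral>\<^sup>+x. ennreal ((f x)\<^sup>2) \<partial>M) + 2 * (\<integral>\<^sup>+x. ennreal ((g x)\<^sup>2) \<partial>M)"
    by (simp add: nn_integral_add nn_integral_cmult)
  finally show ?thesis .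
qed

text \<open>Telescoping through the coordinates; each splitting of a square costs a factor 2, hence
  \<open>2 ^ card A\<close>.\<close>

lemma L2_diff_directions:
  fixes g :: "real^'n::finite \<Rightarrow> real"
  assumes gm[measurable]: "g \<in> borel_measurable borel" and Gm: "\<And>i. G i \<in> borel_measurable borel"
    and ld: "\<And>i. line_deriv i g (G i)" and X: "\<And>i. (\<integral>\<^sup>+x. ennreal ((G i x)\<^sup>2) \<partial>lborel) \<le> ennreal X" and X0: "0 \<le> X"
  shows "(\<integral>\<^sup>+x. ennreal ((g (x + (\<Sum>i\<in>A. t $ i *\<^sub>R axis i 1)) - g x)\<^sup>2) \<partial>lborel) \<le> ennreal (2 ^ card A * (\<Sum>i\<in>A. (t $ i)\<^sup>2) * X)"
  using finite[of A]
proof (induction A)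
  case (insert a A)
  let ?c = "\<Sum>i\<in>A. t $ i *\<^sub>R axis i 1" and ?e = "t $ a *\<^sub>R axis a (1::real)"
  have "(\<integral>\<^sup>+x. ennreal ((g (x + (\<Sum>i\<in>insert a A. t $ i *\<^sub>R axis i 1)) - g x)\<^sup>2) \<partial>lborel)
    = (\<integral>\<^sup>+x. ennreal (((g (x + ?c + ?e) - g (x + ?c)) + (g (x + ?c) - g x))\<^sup>2) \<partial>lborel)"
    using insert.hyps by (simp add: algebra_simps)
  also have "\<dots> \<le> 2 * (\<integral>\<^sup>+x. ennreal ((g (x + ?c + ?e) - g (x + ?c))\<^sup>2) \<partial>lborel) + 2 * (\<integral>\<^sup>+x. ennreal ((g (x + ?c) - g x)\<^sup>2) \<partial>lborel)"
    by (rule nn_integral_square_add_le) measurable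
  also have "(\<integral>\<^sup>+x. ennreal ((g (x + ?c + ?e) - g (x + ?c))\<^sup>2) \<partial>lborel) = (\<integral>\<^sup>+x. ennreal ((g (x + ?e) - g x)\<^sup>2) \<partial>lborel)"
    using nn_integral_shift[of "\<lambda>x. ennreal ((g (x + ?e) - g x)\<^sup>2)" ?c] by simp
  also have "\<dots> \<le> ennreal ((t $ a)\<^sup>2 * X)"
  proof -
    have "(\<integral>\<^sup>+x. ennreal ((g (x + ?e) - g x)\<^sup>2) \<partial>lborel) \<le> ennreal ((t $ a)\<^sup>2) * (\<integral>\<^sup>+x. ennreal ((G a x)\<^sup>2) \<partial>lborel)"
      by (rule line_deriv_L2_diff[OF gm Gm ld])
    also have "\<dots> \<le> ennreal ((t $ a)\<^sup>2) * ennreal X" by (intro mult_left_mono X) simp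
    finally show ?thesis using X0 by (simp add: ennreal_mult)
  qed
  also have "(\<integral>\<^sup>+x. ennreal ((g (x + ?c) - g x)\<^sup>2) \<partial>lborel) \<le> ennreal (2 ^ card A * (\<Sum>i\<in>A. (t $ i)\<^sup>2) * X)"
    by (rule insert.IH)
  also have "2 * ennreal ((t $ a)\<^sup>2 * X) + 2 * ennreal (2 ^ card A * (\<Sum>i\<in>A. (t $ i)\<^sup>2) * X)
      = ennreal (2 * ((t $ a)\<^sup>2 * X) + 2 * (2 ^ card A * (\<Sum>i\<in>A. (t $ i)\<^sup>2) * X))"
    using X0 by (simp add: ennreal_mult ennreal_plus sum_nonneg)
  also have "\<dots> \<le> ennreal (2 ^ card (insert a A) * (\<Sum>i\<in>insert a A. (t $ i)\<^sup>2) * X)"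
  proof (rule ennreal_leI)
    have "1 * ((t $ a)\<^sup>2 * X) \<le> 2 ^ card A * ((t $ a)\<^sup>2 * X)" using X0 by (intro mult_right_mono) auto
    then show "2 * ((t $ a)\<^sup>2 * X) + 2 * (2 ^ card A * (\<Sum>i\<in>A. (t $ i)\<^sup>2) * X) \<le> 2 ^ card (insert a A) * (\<Sum>i\<in>insert a A. (t $ i)\<^sup>2) * X"
      using insert.hyps by (simp add: algebra_simps)
  qed
  finally show ?case by (simp add: add_left_mono mult_left_mono)
qed simp

text \<open>Let D(t) be the squared norm of \<open>g\<close> shifted by \<open>t\<close> minus
  \<open>g\<close>; the seminorm is the integral of D(t) against |t|^(-d-2r). D(t) is at most 4 A^2,
  and by the gradient at most a multiple of |t|^2 (A/h)^2; the two bounds balance at |t| = h. The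
  first integral converges at infinity because r > 0, the second at 0 because r < 1.\<close>

lemma slobodeckij_lborel_bound:
  assumes r: "0 < r" "r < 1"
  shows "\<exists>C\<ge>0. \<forall>(g :: real^'n::finite \<Rightarrow> real) G A h. g \<in> borel_measurable borel \<longrightarrow> (\<forall>i. G i \<in> borel_measurable borel) \<longrightarrow>
    (\<forall>i. line_deriv i g (G i)) \<longrightarrow> 0 \<le> A \<longrightarrow> 0 < h \<longrightarrow>
    (\<integral>\<^sup>+x. ennreal ((g x)\<^sup>2) \<partial>lborel) \<le> ennreal (A\<^sup>2) \<longrightarrow>
    (\<forall>i. (\<integral>\<^sup>+x. ennreal ((G i x)\<^sup>2) \<partial>lborel) \<le> ennreal ((A / h)\<^sup>2)) \<longrightarrow>
    (\<integral>\<^sup>+x. \<integral>\<^sup>+y. ennreal ((g x - g y)\<^sup>2 / norm (x - y) powr (real CARD('n) + 2 * r)) \<partial>lborel \<partial>lborel)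
      \<le> ennreal (C * A\<^sup>2 * h powr (- 2 * r))"
proof -
  let ?d = "real CARD('n)"
  obtain Cn where Cn: "Cn \<ge> 0" "\<And>R. R > 0 \<Longrightarrow> (\<integral>\<^sup>+x. ennreal (norm (x :: real^'n) powr (- (?d + 2 * r - 2))) * indicator (cball 0 R) x \<partial>lborel) \<le> ennreal (Cn * R powr (?d - (?d + 2 * r - 2)))"
    using nn_integral_norm_powr_near[of "?d + 2 * r - 2", where 'n = 'n] r by auto
  obtain Cf where Cf: "Cf \<ge> 0" "\<And>R. R > 0 \<Longrightarrow> (\<integral>\<^sup>+x. ennreal (norm (x :: real^'n) powr (- (?d + 2 * r))) * indicator (- ball 0 R) x \<partial>lborel) \<le> ennreal (Cf * R powr (?d - (?d + 2 * r)))"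
    using nn_integral_norm_powr_far[of "?d + 2 * r", where 'n = 'n] r by auto
  define C where "C = 2 ^ CARD('n) * Cn + 4 * Cf"
  have "(\<integral>\<^sup>+x. \<integral>\<^sup>+y. ennreal ((g x - g y)\<^sup>2 / norm (x - y) powr (?d + 2 * r)) \<partial>lborel \<partial>lborel) \<le> ennreal (C * A\<^sup>2 * h powr (- 2 * r))"
    if gm[measurable]: "g \<in> borel_measurable borel" and Gm: "\<And>i. G i \<in> borel_measurable borel"
      and ld: "\<And>i. line_deriv i g (G i)" and A: "0 \<le> A" and h: "0 < h"
      and gA: "(\<integral>\<^sup>+x. ennreal ((g x)\<^sup>2) \<partial>lborel) \<le> ennreal (A\<^sup>2)"
      and GA: "\<And>i. (\<integral>\<^sup>+x. ennreal ((G i x)\<^sup>2) \<partial>lborel) \<le> ennreal ((A / h)\<^sup>2)"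
    for g :: "real^'n \<Rightarrow> real" and G A h
  proof -
    define w where "w t = norm t powr (- (?d + 2 * r))" for t :: "real^'n"
    have [measurable]: "w \<in> borel_measurable borel" unfolding w_def by measurable
    have w0: "0 \<le> w t" for t by (simp add: w_def)
    define D where "D t = (\<integral>\<^sup>+x. ennreal ((g (x + t) - g x)\<^sup>2) \<partial>lborel)" for t
    have D1: "D t \<le> ennreal (4 * A\<^sup>2)" for t
    proof -
      have "D t = (\<integral>\<^sup>+x. ennreal ((g (x + t) + (- g x))\<^sup>2) \<partial>lborel)" by (simp add: D_def)
      also have "\<dots> \<le> 2 * (\<integral>\<^sup>+x. ennreal ((g (x + t))\<^sup>2) \<partial>lborel) + 2 * (\<integral>\<^sup>+x. ennreal ((- g x)\<^sup>2) \<partial>lborel)"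
        by (rule nn_integral_square_add_le) measurable
      also have "\<dots> = 2 * (\<integral>\<^sup>+x. ennreal ((g x)\<^sup>2) \<partial>lborel) + 2 * (\<integral>\<^sup>+x. ennreal ((g x)\<^sup>2) \<partial>lborel)"
        using nn_integral_shift[of "\<lambda>x. ennreal ((g x)\<^sup>2)" t] by simp
      also have "\<dots> \<le> 2 * ennreal (A\<^sup>2) + 2 * ennreal (A\<^sup>2)" by (intro add_mono mult_left_mono gA) auto
      also have "\<dots> = ennreal (2 * A\<^sup>2 + 2 * A\<^sup>2)" by (subst ennreal_plus) (auto simp: ennreal_mult)
      finally show ?thesis by simp
    qed
    have D2: "D t \<le> ennreal (2 ^ CARD('n) * (norm t)\<^sup>2 * (A / h)\<^sup>2)" for t
    proof -
      have "D t \<le> ennreal (2 ^ CARD('n) * (\<Sum>i\<in>UNIV. (t $ i)\<^sup>2) * (A / h)\<^sup>2)"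
        using L2_diff_directions[OF gm Gm ld GA, of t UNIV] by (simp add: D_def axis_sum_eq)
      moreover have "(\<Sum>i\<in>UNIV. (t $ i)\<^sup>2) = (norm t)\<^sup>2" by (simp add: norm_vec_def L2_set_def sum_nonneg)
      ultimately show ?thesis by simp
    qed
    have "(\<integral>\<^sup>+x. \<integral>\<^sup>+y. ennreal ((g x - g y)\<^sup>2 / norm (x - y) powr (?d + 2 * r)) \<partial>lborel \<partial>lborel)
       = (\<integral>\<^sup>+x. \<integral>\<^sup>+t. ennreal (w t) * ennreal ((g (x + t) - g x)\<^sup>2) \<partial>lborel \<partial>lborel)"
    proof (rule nn_integral_cong)
      fix x
      have "(\<integral>\<^sup>+y. ennreal ((g x - g y)\<^sup>2 / norm (x - y) powr (?d + 2 * r)) \<partial>lborel)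
        = (\<integral>\<^sup>+t. ennreal ((g x - g (t + x))\<^sup>2 / norm (x - (t + x)) powr (?d + 2 * r)) \<partial>lborel)"
        by (rule nn_integral_shift[symmetric]) measurable
      also have "\<dots> = (\<integral>\<^sup>+t. ennreal (w t) * ennreal ((g (x + t) - g x)\<^sup>2) \<partial>lborel)"
        by (intro nn_integral_cong)
          (simp add: w_def powr_minus divide_inverse ennreal_mult[symmetric] power2_commute[of "g x"] add.commute mult.commute del: minus_add_distrib)
      finally show "(\<integral>\<^sup>+y. ennreal ((g x - g y)\<^sup>2 / norm (x - y) powr (?d + 2 * r)) \<partial>lborel) = (\<integral>\<^sup>+t. ennreal (w t) * ennreal ((g (x + t) - g x)\<^sup>2) \<partial>lborel)" .
    qed
    also have "\<dots> = (\<integral>\<^sup>+t. \<integral>\<^sup>+x. ennreal (w t) * ennreal ((g (x + t) - g x)\<^sup>2) \<partial>lborel \<partial>lborel)"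
      by (rule lborel_pair.Fubini') measurable
    also have "\<dots> = (\<integral>\<^sup>+t. ennreal (w t) * D t \<partial>lborel)"
      unfolding D_def by (intro nn_integral_cong nn_integral_cmult) measurable
    also have "\<dots> \<le> (\<integral>\<^sup>+t. ennreal (2 ^ CARD('n) * (A / h)\<^sup>2) * (ennreal (norm t powr (- (?d + 2 * r - 2))) * indicator (cball 0 h) t)
       + ennreal (4 * A\<^sup>2) * (ennreal (norm t powr (- (?d + 2 * r))) * indicator (- ball 0 h) (t :: real^'n)) \<partial>lborel)"
    proof (rule nn_integral_mono)
      fix t :: "real^'n"
      show "ennreal (w t) * D t \<le> ennreal (2 ^ CARD('n) * (A / h)\<^sup>2) * (ennreal (norm t powr (- (?d + 2 * r - 2))) * indicator (cball 0 h) t)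
       + ennreal (4 * A\<^sup>2) * (ennreal (norm t powr (- (?d + 2 * r))) * indicator (- ball 0 h) t)"
      proof (cases "norm t < h")
        case True
        have "ennreal (w t) * D t \<le> ennreal (w t) * ennreal (2 ^ CARD('n) * (norm t)\<^sup>2 * (A / h)\<^sup>2)"
          by (intro mult_left_mono D2) simp
        also have "\<dots> = ennreal (w t * (2 ^ CARD('n) * (norm t)\<^sup>2 * (A / h)\<^sup>2))" by (rule ennreal_mult[symmetric]) (auto simp: w0)
        also have "w t * (2 ^ CARD('n) * (norm t)\<^sup>2 * (A / h)\<^sup>2) = (2 ^ CARD('n) * (A / h)\<^sup>2) * norm t powr (- (?d + 2 * r - 2))"
        \<comment> \<open>At the origin both sides vanish, because \<open>0 powr\<close> anything is
          0.\<close>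
        proof (cases "t = 0")
          case False
          then have "w t * (norm t)\<^sup>2 = norm t powr (- (?d + 2 * r - 2))"
          proof -
            have "(norm t)\<^sup>2 = norm t powr 2" using False by simp
            then have "w t * (norm t)\<^sup>2 = norm t powr (- (?d + 2 * r) + 2)" by (simp only: w_def powr_add)
            then show ?thesis by (simp add: algebra_simps)
          qed
          then have "2 ^ CARD('n) * (A / h)\<^sup>2 * (w t * (norm t)\<^sup>2) = (2 ^ CARD('n) * (A / h)\<^sup>2) * norm t powr (- (?d + 2 * r - 2))"
            by (simp only:)
          then show ?thesis by (simp only: mult_ac)
        qed (simp add: w_def)
        also have "ennreal \<dots> = ennreal (2 ^ CARD('n) * (A / h)\<^sup>2) * (ennreal (norm t powr (- (?d + 2 * r - 2))) * indicator (cball 0 h) t)"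
          using True by (simp add: ennreal_mult)
        finally show ?thesis by (simp add: add_increasing2)
      next
        case False
        have "ennreal (w t) * D t \<le> ennreal (w t) * ennreal (4 * A\<^sup>2)"
          by (intro mult_left_mono D1) simp
        also have "\<dots> = ennreal (4 * A\<^sup>2) * (ennreal (norm t powr (- (?d + 2 * r))) * indicator (- ball 0 h) t)"
          using False by (simp add: w_def mult.commute)
        finally show ?thesis by (simp add: add_increasing)
      qed
    qed
    also have "\<dots> = ennreal (2 ^ CARD('n) * (A / h)\<^sup>2) * (\<integral>\<^sup>+t. ennreal (norm t powr (- (?d + 2 * r - 2))) * indicator (cball 0 h) (t :: real^'n) \<partial>lborel)
       + ennreal (4 * A\<^sup>2) * (\<integral>\<^sup>+t. ennreal (norm t powr (- (?d + 2 * r))) * indicator (- ball 0 h) (t :: real^'n) \<partial>lborel)"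
      by (subst nn_integral_add) (auto intro!: arg_cong2[of _ _ _ _ "(+)"] nn_integral_cmult)
    also have "\<dots> \<le> ennreal (2 ^ CARD('n) * (A / h)\<^sup>2) * ennreal (Cn * h powr (?d - (?d + 2 * r - 2))) + ennreal (4 * A\<^sup>2) * ennreal (Cf * h powr (?d - (?d + 2 * r)))"
      by (intro add_mono mult_left_mono Cn(2) Cf(2) h) auto
    also have "\<dots> = ennreal (2 ^ CARD('n) * (A / h)\<^sup>2 * (Cn * h powr (?d - (?d + 2 * r - 2))) + 4 * A\<^sup>2 * (Cf * h powr (?d - (?d + 2 * r))))"
      using Cn Cf by (simp add: ennreal_mult ennreal_plus)
    also have "2 ^ CARD('n) * (A / h)\<^sup>2 * (Cn * h powr (?d - (?d + 2 * r - 2))) + 4 * A\<^sup>2 * (Cf * h powr (?d - (?d + 2 * r))) = C * A\<^sup>2 * h powr (- 2 * r)"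
    proof -
      have "h powr (?d - (?d + 2 * r - 2)) = h powr (- 2 * r) * h\<^sup>2"
      proof -
        have "h\<^sup>2 = h powr 2" using h by simp
        then have "h powr (- 2 * r) * h\<^sup>2 = h powr (- 2 * r + 2)" by (simp only: powr_add)
        then show ?thesis by (simp add: algebra_simps)
      qed
      moreover have "h powr (?d - (?d + 2 * r)) = h powr (- 2 * r)" by simp
      ultimately show ?thesis using h by (simp add: C_def field_simps power_divide)
    qed
    finally show ?thesis .
  qed
  moreover have "C \<ge> 0" using Cn Cf by (simp add: C_def)
  ultimately show ?thesis by blast
qed

section \<open>The kernel and its derivatives\<close>

text \<open>Continuous extensions to the compact closed ball are bounded, and there are finitely
  many multi-indices; commuting partial derivatives carries the bound over to words.\<close>

lemma Ck_on_closure_deriv_bound: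
  fixes f :: "real^'n::finite \<Rightarrow> real"
  assumes "Ck_on_closure k (ball 0 r) f"
  shows "\<exists>C\<ge>0. deriv_bound k (ball 0 r) (\<lambda>_. 1) (\<lambda>_. C) f"
proof -
  have C: "Ck_on k (ball 0 r) f" using assms by (simp add: Ck_on_closure_def)
  have "\<exists>B. \<forall>x\<in>ball 0 r. \<bar>mderiv \<beta> f x\<bar> \<le> B" if "mdeg \<beta> \<le> k" for \<beta>
  proof -
    obtain g where g: "continuous_on (closure (ball 0 r)) g" "\<forall>x\<in>ball 0 r. g x = mderiv \<beta> f x"
      using assms \<open>mdeg \<beta> \<le> k\<close> unfolding Ck_on_closure_def by blast
    have "compact (g ` closure (ball 0 r))"
      using g(1) by (intro compact_continuous_image) (auto simp: compact_closure)
    then obtain B where "\<forall>y\<in>g ` closure (ball 0 r). norm y \<le> B"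
      using compact_imp_bounded bounded_iff by metis
    then have "\<forall>x\<in>ball 0 r. \<bar>mderiv \<beta> f x\<bar> \<le> B"
      using g(2) closure_subset by (metis image_eqI real_norm_def subsetD)
    then show ?thesis by blast
  qed
  then obtain B where B: "\<And>\<beta> x. mdeg \<beta> \<le> k \<Longrightarrow> x \<in> ball 0 r \<Longrightarrow> \<bar>mderiv \<beta> f x\<bar> \<le> B \<beta>" by metis
  define M where "M = (\<Sum>\<beta> | mdeg \<beta> \<le> k. \<bar>B \<beta>\<bar>)"
  have "\<bar>foldr partial js f x\<bar> \<le> M" if "length js \<le> k" "x \<in> ball 0 r" for js x
  proof -
    have "Ck_on (length js) (ball 0 r) f" using C that by (blast intro: Ck_on_le)
    note * = foldr_partial_eq_mderiv[OF open_ball this \<open>x \<in> _\<close>]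
    have "\<bar>foldr partial js f x\<bar> \<le> B (count_list js)" using B[OF _ \<open>x \<in> _\<close>] * that by simp
    also have "\<dots> \<le> \<bar>B (count_list js)\<bar>" by simp
    also have "\<dots> \<le> M" unfolding M_def
      by (rule member_le_sum) (use * that finite_mdeg_le in auto)
    finally show ?thesis .
  qed
  moreover have "M \<ge> 0" unfolding M_def by (simp add: sum_nonneg)
  ultimately show ?thesis using C unfolding deriv_bound_def by (intro exI[of _ M]) simp
qed

text \<open>Changing the scale from 1 to \<open>norm\<close> costs only \<open>max 1 r ^ k\<close>,
  which bounds all powers of \<open>norm x\<close> of exponent at most \<open>k\<close> on the
  ball.\<close>

lemma deriv_bound_ball_norm:
  fixes f :: "real^'n::finite \<Rightarrow> real"
  assumes "deriv_bound k (ball 0 r) (\<lambda>_. 1) (\<lambda>_. C) f"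
  shows "deriv_bound k (ball 0 r - {0}) norm (\<lambda>_. C * (max 1 r) ^ k) f"
  unfolding deriv_bound_def
proof (intro conjI allI impI ballI)
  show "Ck_on k (ball 0 r - {0}) f" using deriv_bound_Ck_on[OF assms] Ck_on_subset by blast
  fix js :: "'n list" and x :: "real^'n" assume js: "length js \<le> k" and x: "x \<in> ball 0 r - {0}"
  have le: "\<bar>foldr partial js f x\<bar> \<le> C" using deriv_boundD[OF assms js, of x] x by simp
  have "norm x ^ length js \<le> (max 1 r) ^ length js" using x by (intro power_mono) auto
  also have "\<dots> \<le> (max 1 r) ^ k" using js by (intro power_increasing) auto
  finally have "1 \<le> (max 1 r) ^ k / norm x ^ length js" using x by simp
  moreover have "0 \<le> C" using le by linarith
  ultimately have "C * 1 \<le> C * ((max 1 r) ^ k / norm x ^ length js)" by (rule mult_left_mono)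
  then show "\<bar>foldr partial js f x\<bar> \<le> C * (max 1 r) ^ k / norm x ^ length js" using le by simp
qed

text \<open>For even \<open>s\<close> the power is the polynomial (x . x)^j, so no singularity at
  the origin remains; positivity of \<open>s\<close> makes the two agree at 0 as well.\<close>

lemma even_powr_deriv_bound:
  assumes "s = 2 * real j" "s > 0"
  shows "\<exists>C\<ge>0. deriv_bound k (ball (0 :: real^'n::finite) r) (\<lambda>_. 1) (\<lambda>_. C) (\<lambda>x. norm x powr s)"
proof -
  let ?P = "\<lambda>f. \<exists>C\<ge>0. deriv_bound k (ball (0 :: real^'n::finite) r) (\<lambda>_. 1) (\<lambda>_. C) f"
  have add: "?P (\<lambda>x. f x + g x)" if f: "?P f" and g: "?P g" for f g
  proof -
    obtain A B where "A \<ge> 0" "B \<ge> 0" "deriv_bound k (ball (0 :: real^'n::finite) r) (\<lambda>_. 1) (\<lambda>_. A) f"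
      "deriv_bound k (ball (0 :: real^'n::finite) r) (\<lambda>_. 1) (\<lambda>_. B) g" using f g by blast
    then show ?thesis using deriv_bound_add[OF open_ball] by (intro exI[of _ "A + B"]) auto
  qed
  have mult: "?P (\<lambda>x. f x * g x)" if f: "?P f" and g: "?P g" for f g
  proof -
    obtain A B where "A \<ge> 0" "B \<ge> 0" "deriv_bound k (ball (0 :: real^'n::finite) r) (\<lambda>_. 1) (\<lambda>_. A) f"
      "deriv_bound k (ball (0 :: real^'n::finite) r) (\<lambda>_. 1) (\<lambda>_. B) g" using f g by blast
    then show ?thesis using deriv_bound_mult[OF open_ball] by (intro exI[of _ "2 ^ k * (A * B)"]) auto
  qed
  have const: "?P (\<lambda>_. c)" for c
    using deriv_bound_const[OF open_ball, where \<rho> = "\<lambda>_. 1"] by (intro exI[of _ "\<bar>c\<bar>"]) auto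
  have coord: "?P (\<lambda>x. x $ i)" for i
    using deriv_bound_coord[OF open_ball, of 0 r "\<lambda>_. 1" "\<lambda>_. max 1 r" k i]
    by (intro exI[of _ "max 1 r"]) auto
  have sum: "?P (\<lambda>x. \<Sum>i\<in>I. x $ i * x $ i)" for I :: "'n set"
    using finite[of I] by (induction I) (auto intro!: add mult coord const)
  have pow: "?P (\<lambda>x. (\<Sum>i\<in>UNIV. x $ i * x $ i) ^ n)" for n
    by (induction n) (auto intro!: mult sum const)
  have "(\<Sum>i\<in>UNIV. x $ i * x $ i) ^ j = norm x powr s" for x :: "real^'n"
  proof -
    have "(\<Sum>i\<in>UNIV. x $ i * x $ i) = (norm x)\<^sup>2"
      by (simp add: norm_vec_def L2_set_def sum_nonneg power2_eq_square)
    then have "(\<Sum>i\<in>UNIV. x $ i * x $ i) ^ j = norm x ^ (2 * j)" by (simp add: power_mult)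
    also have "\<dots> = norm x powr s"
      using assms powr_realpow[of "norm x" "2 * j"] by (cases "x = 0") auto
    finally show ?thesis .
  qed
  then show ?thesis using pow[of j] by simp
qed

text \<open>The constant \<open>C\<close> must not depend on \<open>h\<close>, while the split
  itself may: the bound for the smooth part then carries \<open>1 + \<bar>ln h\<bar>\<close>, and
  the bound for the singular part involves \<open>h\<close> only through the ratio
  \<open>norm x / h\<close>.\<close>

lemma kernel_split:
  fixes \<phi> u v :: "real^'n::finite \<Rightarrow> real"
  assumes u: "Ck_on_closure L (ball 0 r) u" and v: "Ck_on_closure L (ball 0 r) v" and s: "s > 0"
    and \<phi>: "\<And>x. norm x < r \<Longrightarrow> \<phi> x = u x + h_fun s x * v x"
  shows "\<exists>C\<ge>0. \<forall>h>0. \<exists>w g. (\<forall>x\<in>ball 0 r - {0}. \<phi> x = w x + g x) \<and>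
     deriv_bound L (ball 0 r) (\<lambda>_. 1) (\<lambda>_. C * (1 + \<bar>ln h\<bar>)) w \<and>
     deriv_bound L (ball 0 r - {0}) norm (\<lambda>x. C * norm x powr s * (1 + \<bar>ln (norm x / h)\<bar>)) g"
proof -
  let ?B = "ball (0 :: real^'n) r" and ?Q = "ball (0 :: real^'n) r - {0}"
  have op0: "open ?Q" by (rule open_Diff) auto
  obtain Cu where Cu: "Cu \<ge> 0" "deriv_bound L ?B (\<lambda>_. 1) (\<lambda>_. Cu) u" using Ck_on_closure_deriv_bound[OF u] by auto
  obtain Cv where Cv: "Cv \<ge> 0" "deriv_bound L ?B (\<lambda>_. 1) (\<lambda>_. Cv) v" using Ck_on_closure_deriv_bound[OF v] by auto
  obtain Cp where Cp: "Cp \<ge> 0" "deriv_bound L (- {0 :: real^'n}) norm (\<lambda>x. Cp * norm x powr s) (\<lambda>x. norm x powr s)"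
    using norm_powr_deriv_bound by blast
  define V where "V = Cv * (max 1 r) ^ L"
  have V: "V \<ge> 0" using Cv by (simp add: V_def)
  have v0: "deriv_bound L ?Q norm (\<lambda>_. V) v" unfolding V_def using deriv_bound_ball_norm[OF Cv(2)] .
  have p0: "deriv_bound L ?Q norm (\<lambda>x. Cp * norm x powr s) (\<lambda>x. norm x powr s)"
    using Cp(2) deriv_bound_subset by blast
  show ?thesis
  proof (cases "\<exists>k::nat. s = 2 * real k")
    \<comment> \<open>No logarithm is present: the split is the same for every \<open>h\<close>, and
      the logarithmic factors in the bounds are slack.\<close>
    case False
    define C where "C = Cu + 2 ^ L * (Cp * V)"
    have C: "C \<ge> 0" "Cu \<le> C" "2 ^ L * (Cp * V) \<le> C" using Cu Cp V by (auto simp: C_def)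
    have "\<exists>w g. (\<forall>x\<in>?Q. \<phi> x = w x + g x) \<and>
     deriv_bound L ?B (\<lambda>_. 1) (\<lambda>_. C * (1 + \<bar>ln h\<bar>)) w \<and>
     deriv_bound L ?Q norm (\<lambda>x. C * norm x powr s * (1 + \<bar>ln (norm x / h)\<bar>)) g" if "h > 0" for h
    proof (intro exI conjI ballI)
      show "\<phi> x = u x + norm x powr s * v x" if "x \<in> ?Q" for x
        using \<phi>[of x] False that by (simp add: h_fun_def)
      show "deriv_bound L ?B (\<lambda>_. 1) (\<lambda>_. C * (1 + \<bar>ln h\<bar>)) u"
        using Cu(2)
      proof (rule deriv_bound_mono)
        have "Cu * 1 \<le> C * (1 + \<bar>ln h\<bar>)" using C Cu by (intro mult_mono) auto
        then show "Cu \<le> C * (1 + \<bar>ln h\<bar>)" by simp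
      qed auto
      show "deriv_bound L ?Q norm (\<lambda>x. C * norm x powr s * (1 + \<bar>ln (norm x / h)\<bar>)) (\<lambda>x. norm x powr s * v x)"
        using deriv_bound_mult[OF op0 p0 v0]
      proof (rule deriv_bound_mono)
        fix x :: "real^'n"
        have "2 ^ L * (Cp * norm x powr s * V) = (2 ^ L * (Cp * V)) * norm x powr s * 1" by simp
        also have "\<dots> \<le> C * norm x powr s * (1 + \<bar>ln (norm x / h)\<bar>)"
          using C by (intro mult_mono mult_right_mono) auto
        finally show "2 ^ L * (Cp * norm x powr s * V) \<le> C * norm x powr s * (1 + \<bar>ln (norm x / h)\<bar>)" .
      qed auto
    qed
    then show ?thesis using C(1) by blast
  next
    case True
    then obtain j where j: "s = 2 * real j" by blast
    obtain Ce where Ce: "Ce \<ge> 0" "deriv_bound L ?B (\<lambda>_. 1) (\<lambda>_. Ce) (\<lambda>x. norm x powr s)"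
      using even_powr_deriv_bound[OF j s] by blast
    obtain Cl where Cl: "Cl \<ge> 0" "\<And>h. h > 0 \<Longrightarrow> deriv_bound L (- {0 :: real^'n}) norm (\<lambda>x. Cl + \<bar>ln (norm x / h)\<bar>) (\<lambda>x. ln (norm x / h))"
      using ln_norm_deriv_bound by blast
    define C where "C = Cu + 2 ^ L * (2 ^ L * (Ce * Cv)) + 2 ^ L * (2 ^ L * (Cp * V)) * (Cl + 1)"
    have C: "C \<ge> 0" "Cu + 2 ^ L * (2 ^ L * (Ce * Cv)) \<le> C" "2 ^ L * (2 ^ L * (Cp * V)) * (Cl + 1) \<le> C"
      using Cu Cp V Ce Cv Cl by (auto simp: C_def)
    have "\<exists>w g. (\<forall>x\<in>?Q. \<phi> x = w x + g x) \<and>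
     deriv_bound L ?B (\<lambda>_. 1) (\<lambda>_. C * (1 + \<bar>ln h\<bar>)) w \<and>
     deriv_bound L ?Q norm (\<lambda>x. C * norm x powr s * (1 + \<bar>ln (norm x / h)\<bar>)) g" if h: "h > 0" for h
    proof (intro exI conjI ballI)
      show "\<phi> x = (u x + ln h * (norm x powr s * v x)) + norm x powr s * (ln (norm x / h) * v x)" if "x \<in> ?Q" for x
        using \<phi>[of x] True that h by (simp add: h_fun_def ln_div algebra_simps)
      have "deriv_bound L ?B (\<lambda>_. 1) (\<lambda>_. Cu + 2 ^ L * (\<bar>ln h\<bar> * (2 ^ L * (Ce * Cv)))) (\<lambda>x. u x + ln h * (norm x powr s * v x))"
        by (rule deriv_bound_add[OF open_ball Cu(2) deriv_bound_mult[OF open_ball deriv_bound_const[OF open_ball] deriv_bound_mult[OF open_ball Ce(2) Cv(2)]]]) simp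
      then show "deriv_bound L ?B (\<lambda>_. 1) (\<lambda>_. C * (1 + \<bar>ln h\<bar>)) (\<lambda>x. u x + ln h * (norm x powr s * v x))"
      proof (rule deriv_bound_mono)
        have "Cu + 2 ^ L * (\<bar>ln h\<bar> * (2 ^ L * (Ce * Cv))) \<le> Cu * (1 + \<bar>ln h\<bar>) + (2 ^ L * (2 ^ L * (Ce * Cv))) * (1 + \<bar>ln h\<bar>)"
          using Cu Ce Cv by (simp add: algebra_simps)
        also have "\<dots> = (Cu + 2 ^ L * (2 ^ L * (Ce * Cv))) * (1 + \<bar>ln h\<bar>)" by (simp add: algebra_simps)
        also have "\<dots> \<le> C * (1 + \<bar>ln h\<bar>)" using C by (intro mult_right_mono) auto
        finally show "Cu + 2 ^ L * (\<bar>ln h\<bar> * (2 ^ L * (Ce * Cv))) \<le> C * (1 + \<bar>ln h\<bar>)" .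
      qed auto
      have l0: "deriv_bound L ?Q norm (\<lambda>x. Cl + \<bar>ln (norm x / h)\<bar>) (\<lambda>x. ln (norm x / h))"
        using Cl(2)[OF h] deriv_bound_subset by blast
      show "deriv_bound L ?Q norm (\<lambda>x. C * norm x powr s * (1 + \<bar>ln (norm x / h)\<bar>)) (\<lambda>x. norm x powr s * (ln (norm x / h) * v x))"
        using deriv_bound_mult[OF op0 p0 deriv_bound_mult[OF op0 l0 v0]]
      proof (rule deriv_bound_mono)
        fix x :: "real^'n"
        have "2 ^ L * (Cp * norm x powr s * (2 ^ L * ((Cl + \<bar>ln (norm x / h)\<bar>) * V)))
          = (2 ^ L * (2 ^ L * (Cp * V))) * (Cl + \<bar>ln (norm x / h)\<bar>) * norm x powr s" by simp
        also have "\<dots> \<le> (2 ^ L * (2 ^ L * (Cp * V))) * ((Cl + 1) * (1 + \<bar>ln (norm x / h)\<bar>)) * norm x powr s"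
          using Cp V Cl by (intro mult_right_mono mult_left_mono) (auto simp: algebra_simps)
        also have "\<dots> = (2 ^ L * (2 ^ L * (Cp * V)) * (Cl + 1)) * (norm x powr s * (1 + \<bar>ln (norm x / h)\<bar>))" by simp
        also have "\<dots> \<le> C * (norm x powr s * (1 + \<bar>ln (norm x / h)\<bar>))"
          using C by (intro mult_right_mono) auto
        finally show "2 ^ L * (Cp * norm x powr s * (2 ^ L * ((Cl + \<bar>ln (norm x / h)\<bar>) * V))) \<le> C * norm x powr s * (1 + \<bar>ln (norm x / h)\<bar>)"
          by (simp add: mult_ac)
      qed auto
    qed
    then show ?thesis using C(1) by blast
  qed
qed

section \<open>Taylor terms as polynomials in the node\<close>

lemma polynomial_deg_le_const: "polynomial_deg_le m (\<lambda>_ :: real^'n::finite. c)"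
proof -
  have "(\<Sum>\<beta> | mdeg \<beta> \<le> m. (if \<beta> = (\<lambda>_. 0) then c else 0) * (\<Prod>i\<in>UNIV. (x $ i) ^ \<beta> i)) = c" for x :: "real^'n::finite"
  proof -
    have "(\<Sum>\<beta> | mdeg \<beta> \<le> m. (if \<beta> = (\<lambda>_. 0) then c else 0) * (\<Prod>i\<in>UNIV. (x $ i) ^ \<beta> i))
       = (\<Sum>\<beta> | mdeg \<beta> \<le> m. if \<beta> = (\<lambda>_ :: 'n. 0) then c else 0)"
      by (rule sum.cong) auto
    also have "\<dots> = c" by (subst sum.delta[OF finite_mdeg_le]) (simp add: mdeg_def)
    finally show ?thesis .
  qed
  then show ?thesis unfolding polynomial_deg_le_def by (intro exI[of _ "\<lambda>\<beta>. if \<beta> = (\<lambda>_. 0) then c else 0"]) simp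
qed

lemma polynomial_deg_le_add:
  assumes "polynomial_deg_le m p" "polynomial_deg_le m q"
  shows "polynomial_deg_le m (\<lambda>x. p x + q x)"
proof -
  obtain c d where "\<forall>x. p x = (\<Sum>\<beta> | mdeg \<beta> \<le> m. c \<beta> * (\<Prod>i\<in>UNIV. (x $ i) ^ \<beta> i))"
    "\<forall>x. q x = (\<Sum>\<beta> | mdeg \<beta> \<le> m. d \<beta> * (\<Prod>i\<in>UNIV. (x $ i) ^ \<beta> i))"
    using assms unfolding polynomial_deg_le_def by blast
  then show ?thesis unfolding polynomial_deg_le_def
    by (intro exI[of _ "\<lambda>\<beta>. c \<beta> + d \<beta>"]) (simp add: algebra_simps sum.distrib)
qed

lemma polynomial_deg_le_cmult:
  assumes "polynomial_deg_le m p"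
  shows "polynomial_deg_le m (\<lambda>x. a * p x)"
proof -
  obtain c where "\<forall>x. p x = (\<Sum>\<beta> | mdeg \<beta> \<le> m. c \<beta> * (\<Prod>i\<in>UNIV. (x $ i) ^ \<beta> i))"
    using assms unfolding polynomial_deg_le_def by blast
  then show ?thesis unfolding polynomial_deg_le_def
    by (intro exI[of _ "\<lambda>\<beta>. a * c \<beta>"]) (simp add: sum_distrib_left mult.assoc)
qed

lemma polynomial_deg_le_sum:
  "(\<And>i. i \<in> I \<Longrightarrow> polynomial_deg_le m (p i)) \<Longrightarrow> polynomial_deg_le m (\<lambda>x. \<Sum>i\<in>I. p i x)"
  by (induction I rule: infinite_finite_induct) (auto intro!: polynomial_deg_le_const polynomial_deg_le_add)

lemma polynomial_deg_le_mono:
  assumes "polynomial_deg_le m p" "m \<le> k"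
  shows "polynomial_deg_le k (p :: real^'n::finite \<Rightarrow> real)"
proof -
  obtain c where c: "\<forall>x. p x = (\<Sum>\<beta> | mdeg \<beta> \<le> m. c \<beta> * (\<Prod>i\<in>UNIV. (x $ i) ^ \<beta> i))"
    using assms unfolding polynomial_deg_le_def by blast
  have "(\<Sum>\<beta> | mdeg \<beta> \<le> m. c \<beta> * (\<Prod>i\<in>UNIV. (x $ i) ^ \<beta> i))
     = (\<Sum>\<beta> | mdeg \<beta> \<le> k. (if mdeg \<beta> \<le> m then c \<beta> else 0) * (\<Prod>i\<in>UNIV. (x $ i) ^ \<beta> i))" for x :: "real^'n"
    by (rule sum.mono_neutral_cong_left) (use assms finite_mdeg_le in auto)
  then show ?thesis unfolding polynomial_deg_le_def using c
    by (intro exI[of _ "\<lambda>\<beta>. if mdeg \<beta> \<le> m then c \<beta> else 0"]) simp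
qed

lemma polynomial_deg_le_coord_mult:
  assumes "polynomial_deg_le m (p :: real^'n::finite \<Rightarrow> real)"
  shows "polynomial_deg_le (Suc m) (\<lambda>x. x $ j * p x)"
proof -
  obtain c where c: "\<forall>x. p x = (\<Sum>\<beta> | mdeg \<beta> \<le> m. c \<beta> * (\<Prod>i\<in>UNIV. (x $ i) ^ \<beta> i))"
    using assms unfolding polynomial_deg_le_def by blast
  have mono: "polynomial_deg_le (Suc m) (\<lambda>x. x $ j * (\<Prod>i\<in>UNIV. (x $ i) ^ \<beta> i))" if \<beta>: "mdeg \<beta> \<le> m" for \<beta> :: "'n \<Rightarrow> nat"
  proof -
    let ?\<gamma> = "\<beta>(j := Suc (\<beta> j))"
    have "mdeg ?\<gamma> = Suc (mdeg \<beta>)" unfolding mdeg_def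
      by (simp add: sum.remove[of UNIV j] )
    then have deg: "mdeg ?\<gamma> \<le> Suc m" using \<beta> by simp
    have "x $ j * (\<Prod>i\<in>UNIV. (x $ i) ^ \<beta> i) = (\<Prod>i\<in>UNIV. (x $ i) ^ ?\<gamma> i)" for x :: "real^'n"
      by (simp add: prod.remove[of UNIV j])
    moreover have "(\<Sum>\<gamma> | mdeg \<gamma> \<le> Suc m. (if \<gamma> = ?\<gamma> then 1 else 0) * (\<Prod>i\<in>UNIV. (x $ i) ^ \<gamma> i)) = (\<Prod>i\<in>UNIV. (x $ i) ^ ?\<gamma> i)" for x :: "real^'n"
    proof -
      have "(\<Sum>\<gamma> | mdeg \<gamma> \<le> Suc m. (if \<gamma> = ?\<gamma> then 1 else 0) * (\<Prod>i\<in>UNIV. (x $ i) ^ \<gamma> i))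
         = (\<Sum>\<gamma> | mdeg \<gamma> \<le> Suc m. if \<gamma> = ?\<gamma> then (\<Prod>i\<in>UNIV. (x $ i) ^ \<gamma> i) else 0)"
        by (rule sum.cong) auto
      also have "\<dots> = (\<Prod>i\<in>UNIV. (x $ i) ^ ?\<gamma> i)" using deg by (subst sum.delta[OF finite_mdeg_le]) simp
      finally show ?thesis .
    qed
    ultimately show ?thesis unfolding polynomial_deg_le_def
      by (intro exI[of _ "\<lambda>\<gamma>. if \<gamma> = ?\<gamma> then 1 else 0"]) simp
  qed
  have "polynomial_deg_le (Suc m) (\<lambda>x. \<Sum>\<beta> | mdeg \<beta> \<le> m. c \<beta> * (x $ j * (\<Prod>i\<in>UNIV. (x $ i) ^ \<beta> i)))"
    by (intro polynomial_deg_le_sum polynomial_deg_le_cmult mono) simp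
  moreover have "x $ j * p x = (\<Sum>\<beta> | mdeg \<beta> \<le> m. c \<beta> * (x $ j * (\<Prod>i\<in>UNIV. (x $ i) ^ \<beta> i)))" for x
    using c by (simp add: sum_distrib_left mult.left_commute)
  ultimately show ?thesis by simp
qed

text \<open>As a function of the node \<xi>, each order multiplies by one more coordinate of
  \<open>z - \<xi>\<close>; this is what makes Taylor polynomials reproducible.\<close>

lemma polynomial_deg_le_dir_deriv:
  "polynomial_deg_le j (\<lambda>\<xi>. dir_deriv j (z - \<xi>) f y)"
proof (induction j arbitrary: f)
  case 0
  show ?case by (simp add: polynomial_deg_le_const)
next
  case (Suc j)
  have "polynomial_deg_le (Suc j) (\<lambda>\<xi>. z $ i * dir_deriv j (z - \<xi>) (partial i f) y + (- 1) * (\<xi> $ i * dir_deriv j (z - \<xi>) (partial i f) y))" for i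
    by (intro polynomial_deg_le_add polynomial_deg_le_cmult polynomial_deg_le_coord_mult polynomial_deg_le_mono[OF Suc.IH]) auto
  then have "polynomial_deg_le (Suc j) (\<lambda>\<xi>. \<Sum>i\<in>UNIV. z $ i * dir_deriv j (z - \<xi>) (partial i f) y + (- 1) * (\<xi> $ i * dir_deriv j (z - \<xi>) (partial i f) y))"
    by (intro polynomial_deg_le_sum)
  then show ?case by (simp add: algebra_simps sum_subtractf)
qed

lemma dir_deriv_zero: "0 < j \<Longrightarrow> dir_deriv j 0 f y = 0"
  by (cases j) auto

lemma foldr_partial_add:
  assumes S: "open S" and f: "Ck_on (length js) S f" and g: "Ck_on (length js) S g" and x: "x \<in> S"
  shows "foldr partial js (\<lambda>x. f x + g x) x = foldr partial js f x + foldr partial js g x"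
  using f g x
proof (induction js arbitrary: x)
  case (Cons j js)
  have C: "Ck_on 1 S (foldr partial js f)" "Ck_on 1 S (foldr partial js g)"
    using Cons.prems by (auto intro!: Ck_on_foldr_partial simp del: Ck_on.simps)
  have "partial j (foldr partial js (\<lambda>x. f x + g x)) x = partial j (\<lambda>x. foldr partial js f x + foldr partial js g x) x"
    by (rule partial_cong_open[OF S Cons.prems(3)]) (use Cons.IH Cons.prems(1,2) Ck_on_SucD in \<open>auto simp del: Ck_on.simps\<close>)
  also have "\<dots> = partial j (foldr partial js f) x + partial j (foldr partial js g) x"
    using Ck_on_has_partial[OF C(1) _ Cons.prems(3)] Ck_on_has_partial[OF C(2) _ Cons.prems(3)]
    by (intro partial_eqI has_partial_add) auto
  finally show ?case by simp
qed simp

section \<open>Finiteness on lines and powers dominating logarithms\<close>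

lemma uniform_bound:
  fixes f :: "'i \<Rightarrow> 'a \<Rightarrow> real"
  assumes "finite I" "\<And>i. i \<in> I \<Longrightarrow> \<exists>B. \<forall>x\<in>S. \<bar>f i x\<bar> \<le> B"
  shows "\<exists>B\<ge>0. \<forall>i\<in>I. \<forall>x\<in>S. \<bar>f i x\<bar> \<le> B"
proof -
  obtain B where B: "\<And>i x. i \<in> I \<Longrightarrow> x \<in> S \<Longrightarrow> \<bar>f i x\<bar> \<le> B i" using assms(2) by metis
  have "\<bar>f i x\<bar> \<le> (\<Sum>i\<in>I. \<bar>B i\<bar>)" if "i \<in> I" "x \<in> S" for i x
  proof -
    have "\<bar>f i x\<bar> \<le> \<bar>B i\<bar>" using B[OF that] by linarith
    also have "\<dots> \<le> (\<Sum>i\<in>I. \<bar>B i\<bar>)" using assms(1) that by (intro member_le_sum) auto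
    finally show ?thesis .
  qed
  then show ?thesis by (intro exI[of _ "\<Sum>i\<in>I. \<bar>B i\<bar>"]) (auto simp: sum_nonneg)
qed

lemma finite_lists_length_eq_UNIV: "finite {js :: 'n::finite list. length js = k}"
  using finite_lists_length_eq[of "UNIV :: 'n set" k] by simp

text \<open>The condition is a quadratic equation in \<open>t\<close> whose leading coefficient
  \<open>w \<bullet> w\<close> is not zero.\<close>

lemma finite_line_sphere:
  assumes "w \<noteq> (0 :: 'a::real_inner)" shows "finite {t. norm (x + t *\<^sub>R w) = r}"
proof -
  let ?p = "[: x \<bullet> x - r\<^sup>2, 2 * (x \<bullet> w), w \<bullet> w :]"
  have "{t. norm (x + t *\<^sub>R w) = r} \<subseteq> {t. poly ?p t = 0}"
  proof
    fix t assume "t \<in> {t. norm (x + t *\<^sub>R w) = r}"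
    then have "(norm (x + t *\<^sub>R w))\<^sup>2 = r\<^sup>2" by simp
    then show "t \<in> {t. poly ?p t = 0}"
      unfolding power2_norm_eq_inner by (simp add: inner_add_left inner_add_right inner_commute algebra_simps power2_eq_square)
  qed
  moreover have "finite {t. poly ?p t = 0}" using assms by (intro poly_roots_finite) simp
  ultimately show ?thesis by (rule finite_subset)
qed

lemma finite_line_zero:
  assumes "w \<noteq> (0 :: 'a::real_inner)" shows "finite {t. x + t *\<^sub>R w = 0}"
  using finite_line_sphere[OF assms, of x 0] by simp

text \<open>The bound ln y <= y^\<delta> / \<delta> controls large arguments, and the same bound at
  1/t controls small ones.\<close>

lemma abs_ln_le_powr:
  fixes t \<delta> :: real
  assumes "t > 0" "\<delta> > 0" shows "\<bar>ln t\<bar> \<le> (t powr \<delta> + t powr (- \<delta>)) / \<delta>"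
proof -
  have up: "ln y \<le> y powr \<delta> / \<delta>" if "y > 0" for y
  proof (cases "y \<ge> 1")
    case True
    then show ?thesis using ln_powr_bound[of y \<delta>] assms(2) by simp
  next
    case False
    then have "ln y \<le> 0" using that by simp
    also have "0 \<le> y powr \<delta> / \<delta>" using assms by simp
    finally show ?thesis .
  qed
  have "- ln t \<le> t powr (- \<delta>) / \<delta>"
    using up[of "inverse t"] assms by (simp add: ln_inverse powr_minus inverse_powr)
  then show ?thesis using up[OF assms(1)] assms by (auto simp: add_divide_distrib abs_le_iff intro: add_increasing add_increasing2)
qed

lemma one_plus_abs_ln_le:
  fixes \<delta> T :: real
  assumes "\<delta> > 0" "T > 0"
  shows "\<exists>C\<ge>0. \<forall>t. 0 < t \<longrightarrow> t \<le> T \<longrightarrow> 1 + \<bar>ln t\<bar> \<le> C * t powr (- \<delta>)"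
proof -
  \<comment> \<open>\<open>T powr \<delta>\<close> pays for the summand 1, and
    \<open>T powr (2 * \<delta>)\<close> turns \<open>t powr \<delta>\<close> into
    \<open>t powr (- \<delta>)\<close> for t <= T.\<close>
  define C where "C = T powr \<delta> + (T powr (2 * \<delta>) + 1) / \<delta>"
  have "1 + \<bar>ln t\<bar> \<le> C * t powr (- \<delta>)" if t: "0 < t" "t \<le> T" for t
  proof -
    have "1 = t powr \<delta> * t powr (- \<delta>)" using t by (simp add: powr_add[symmetric])
    also have "\<dots> \<le> T powr \<delta> * t powr (- \<delta>)" using t assms by (intro mult_right_mono powr_mono2) auto
    finally have 1: "1 \<le> T powr \<delta> * t powr (- \<delta>)" .
    have "t powr \<delta> = t powr (2 * \<delta>) * t powr (- \<delta>)" by (simp add: powr_add[symmetric])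
    also have "\<dots> \<le> T powr (2 * \<delta>) * t powr (- \<delta>)" using t assms by (intro mult_right_mono powr_mono2) auto
    finally have "(t powr \<delta> + t powr (- \<delta>)) / \<delta> \<le> (T powr (2 * \<delta>) * t powr (- \<delta>) + t powr (- \<delta>)) / \<delta>"
      using assms by (intro divide_right_mono add_mono) auto
    then have "\<bar>ln t\<bar> \<le> (T powr (2 * \<delta>) * t powr (- \<delta>) + t powr (- \<delta>)) / \<delta>"
      using abs_ln_le_powr[OF t(1) assms(1)] by linarith
    with 1 show ?thesis by (simp add: C_def algebra_simps add_divide_distrib)
  qed
  moreover have "C \<ge> 0" using assms by (simp add: C_def)
  ultimately show ?thesis by blast
qed

text \<open>The substitution of 1/t for t leaves the absolute logarithm unchanged and exchanges the
  two ends of the scale.\<close>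

lemma one_plus_abs_ln_ge:
  fixes \<delta> T :: real
  assumes "\<delta> > 0" "T > 0"
  shows "\<exists>C\<ge>0. \<forall>t. T \<le> t \<longrightarrow> 1 + \<bar>ln t\<bar> \<le> C * t powr \<delta>"
proof -
  obtain C where C: "C \<ge> 0" "\<And>t. 0 < t \<Longrightarrow> t \<le> 1 / T \<Longrightarrow> 1 + \<bar>ln t\<bar> \<le> C * t powr (- \<delta>)"
    using one_plus_abs_ln_le[of \<delta> "1 / T"] assms by auto
  have "1 + \<bar>ln t\<bar> \<le> C * t powr \<delta>" if "T \<le> t" for t
  proof -
    have "t > 0" using that assms by linarith
    moreover have "1 / t \<le> 1 / T" using that assms by (intro divide_left_mono) auto
    ultimately show ?thesis using C(2)[of "1 / t"] by (simp add: ln_div powr_minus powr_divide)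
  qed
  then show ?thesis using C(1) by blast
qed

text \<open>With \<open>r = r0\<close> this is where the kernel has all derivatives up to order
  \<open>L\<close>; the complement is a null set that a line meets only finitely often.\<close>

definition regular_set :: "real \<Rightarrow> (real^'n::finite) set" where
  "regular_set r = {x. x \<noteq> 0 \<and> norm x \<noteq> r}"

lemma open_regular_set: "open (regular_set r :: (real^'n::finite) set)"
proof -
  have "regular_set r = - {0 :: real^'n} \<inter> - sphere 0 r" by (auto simp: regular_set_def)
  then show ?thesis by (simp add: open_Int open_Compl)
qed

lemma AE_regular_set: "AE x :: real^'n::finite in lborel. x \<in> regular_set r"
proof -
  have "negligible (sphere (0 :: real^'n) r)" by (rule negligible_sphere)
  then have "AE x :: real^'n in lebesgue. x \<notin> sphere 0 r"
    by (intro AE_not_in) (simp add: negligible_iff_null_sets)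
  then have 1: "AE x :: real^'n in lborel. x \<notin> sphere 0 r" by (simp only: AE_completion_iff)
  have "AE x :: real^'n in lborel. x \<noteq> 0" by (rule AE_lborel_singleton)
  with 1 show ?thesis by eventually_elim (simp add: regular_set_def)
qed

text \<open>The assumption on the kernel in the form the estimates use: words instead of
  multi-indices, fixed constants, and the split near the origin at every scale \<open>h\<close> in
  place of \<open>u\<close> and \<open>v\<close>.\<close>

locale kernel =
  fixes \<phi> :: "real^'n::finite \<Rightarrow> real" and s r0 Cs CL :: real and L k0 :: nat
  assumes s_gt: "s > real CARD('n) / 2" and L_gt: "real L > s + real CARD('n)" and r0_pos: "r0 > 0"
    and k0_def: "k0 = nat \<lfloor>s + real CARD('n) - 1\<rfloor>"
    and cont: "continuous_on UNIV \<phi>"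
    and Ck0: "Ck_on k0 (- {0}) \<phi>"
    and CkL: "Ck_on L (regular_set r0) \<phi>"
    and Cs_nonneg: "Cs \<ge> 0"
    and split: "\<And>h. h > 0 \<Longrightarrow> \<exists>w g. (\<forall>x\<in>ball 0 r0 - {0}. \<phi> x = w x + g x) \<and>
     deriv_bound L (ball 0 r0) (\<lambda>_. 1) (\<lambda>_. Cs * (1 + \<bar>ln h\<bar>)) w \<and>
     deriv_bound L (ball 0 r0 - {0}) norm (\<lambda>x. Cs * norm x powr s * (1 + \<bar>ln (norm x / h)\<bar>)) g"
    and CL_nonneg: "CL \<ge> 0"
    and decay: "\<And>js x. length js = L \<Longrightarrow> norm x > r0 \<Longrightarrow> \<bar>foldr partial js \<phi> x\<bar> \<le> CL * norm x powr (s - real L)"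

lemma kernel_assumption_imp_kernel:
  fixes \<phi> :: "real^'n::finite \<Rightarrow> real"
  assumes "kernel_assumption \<phi> s L"
  shows "\<exists>r0 Cs CL. kernel \<phi> s r0 Cs CL L (nat \<lfloor>s + real CARD('n) - 1\<rfloor>)"
proof -
  note A = assms[unfolded kernel_assumption_def]
  have s: "s > real CARD('n) / 2" using A by blast
  obtain r0 where r0: "r0 > 0" and Ck: "Ck_on L {x. norm x > r0} \<phi>"
    and dec: "\<exists>C. \<forall>\<beta> x. mdeg \<beta> = L \<longrightarrow> norm x > r0 \<longrightarrow> \<bar>mderiv \<beta> \<phi> x\<bar> \<le> C * norm x powr (s - real (mdeg \<beta>))"
    and uv: "\<exists>u v. Ck_on_closure L (ball 0 r0) u \<and> Ck_on_closure L (ball 0 r0) v \<and>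
               (\<forall>x. norm x < r0 \<longrightarrow> \<phi> x = u x + h_fun s x * v x)" using A by blast
  obtain C where C: "\<And>\<beta> x. mdeg \<beta> = L \<Longrightarrow> norm x > r0 \<Longrightarrow> \<bar>mderiv \<beta> \<phi> x\<bar> \<le> C * norm x powr (s - real (mdeg \<beta>))"
    using dec by blast
  obtain u v where u: "Ck_on_closure L (ball 0 r0) u" and v: "Ck_on_closure L (ball 0 r0) v"
    and \<phi>: "\<And>x. norm x < r0 \<Longrightarrow> \<phi> x = u x + h_fun s x * v x" using uv by blast
  have "s > 0" using s by (smt (verit) of_nat_0_le_iff divide_nonneg_nonneg)
  from kernel_split[OF u v this \<phi>]
  obtain Cs where Cs: "Cs \<ge> 0" "\<And>h. h > 0 \<Longrightarrow> \<exists>w g. (\<forall>x\<in>ball 0 r0 - {0}. \<phi> x = w x + g x) \<and>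
     deriv_bound L (ball 0 r0) (\<lambda>_. 1) (\<lambda>_. Cs * (1 + \<bar>ln h\<bar>)) w \<and>
     deriv_bound L (ball 0 r0 - {0}) norm (\<lambda>x. Cs * norm x powr s * (1 + \<bar>ln (norm x / h)\<bar>)) g"
    by auto
  have oo: "open {x :: real^'n. norm x > r0}" by (intro open_Collect_less continuous_intros)
  have op: "open (ball 0 r0 - {0 :: real^'n})" by (rule open_Diff) auto
  \<comment> \<open>At scale 1 the logarithm of the scale vanishes; this instance only shows that
    \<phi> is \<open>L\<close> times continuously differentiable on the punctured ball.\<close>
  obtain w g where wg: "\<forall>x\<in>ball 0 r0 - {0}. \<phi> x = w x + g x" "deriv_bound L (ball 0 r0) (\<lambda>_. 1) (\<lambda>_. Cs * (1 + \<bar>ln 1\<bar>)) w"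
     "deriv_bound L (ball 0 r0 - {0}) norm (\<lambda>x. Cs * norm x powr s * (1 + \<bar>ln (norm x / 1)\<bar>)) g"
    using Cs(2)[of 1] by auto
  have "Ck_on L (ball 0 r0 - {0}) (\<lambda>x. w x + g x)"
    by (intro Ck_on_add op Ck_on_subset[OF deriv_bound_Ck_on[OF wg(2)]] deriv_bound_Ck_on[OF wg(3)]) auto
  then have "Ck_on L (ball 0 r0 - {0}) \<phi>" by (rule Ck_on_cong_open[OF op, rotated]) (use wg(1) in simp)
  from Ck_on_Un[OF op oo this Ck]
  have CU: "Ck_on L (regular_set r0) \<phi>"
    by (rule Ck_on_subset) (auto simp: regular_set_def)
  have dec': "\<bar>foldr partial js \<phi> x\<bar> \<le> \<bar>C\<bar> * norm x powr (s - real L)" if js: "length js = L" and x: "norm x > r0" for js x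
  proof -
    have "Ck_on (length js) {x. norm x > r0} \<phi>" using Ck js by simp
    note * = foldr_partial_eq_mderiv[OF oo this, of x]
    have "\<bar>foldr partial js \<phi> x\<bar> \<le> C * norm x powr (s - real L)"
      using * C[of "count_list js" x] js x by simp
    also have "\<dots> \<le> \<bar>C\<bar> * norm x powr (s - real L)" by (intro mult_right_mono) auto
    finally show ?thesis .
  qed
  have "kernel \<phi> s r0 Cs \<bar>C\<bar> L (nat \<lfloor>s + real CARD('n) - 1\<rfloor>)"
  proof (rule kernel.intro)
    show "s > real CARD('n) / 2" by (rule s)
    show "real L > s + real CARD('n)" "continuous_on UNIV \<phi>" using A by blast+
    show "r0 > 0" "Cs \<ge> 0" by fact+
    show "Ck_on (nat \<lfloor>s + real CARD('n) - 1\<rfloor>) (- {0}) \<phi>" using A by (simp only: Compl_eq_Diff_UNIV)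
    show "Ck_on L (regular_set r0) \<phi>" by (rule CU)
    show "0 \<le> \<bar>C\<bar>" by simp
  qed (fact refl, fact Cs(2), fact dec')
  then show ?thesis by blast
qed

context kernel
begin

lemma k0_bounds: "real k0 \<le> s + real CARD('n) - 1" "s + real CARD('n) - 1 < real k0 + 1" "k0 < L"
proof -
  have "1 \<le> CARD('n)" by (simp add: Suc_leI)
  then have "real CARD('n) \<ge> 1" by simp
  then have "s + real CARD('n) - 1 \<ge> 0" using s_gt by linarith
  then have "real k0 = of_int \<lfloor>s + real CARD('n) - 1\<rfloor>"
    unfolding k0_def by (intro of_nat_nat) (simp only: zero_le_floor)
  then show *: "real k0 \<le> s + real CARD('n) - 1" "s + real CARD('n) - 1 < real k0 + 1" by linarith+
  then show "k0 < L" using L_gt by linarith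
qed

lemma s_pos: "s > 0"
  using s_gt by (smt (verit) of_nat_0_le_iff divide_nonneg_nonneg)

lemma open_punctured: "open (ball 0 r0 - {0 :: real^'n})"
  by (rule open_Diff) auto

lemma foldr_split:
  assumes "\<forall>x\<in>ball 0 r0 - {0}. \<phi> x = w x + g x" "Ck_on L (ball 0 r0) w" "Ck_on L (ball 0 r0 - {0}) g"
    "length js \<le> L" "x \<in> ball 0 r0 - {0}"
  shows "foldr partial js \<phi> x = foldr partial js w x + foldr partial js g x"
proof -
  have "foldr partial js \<phi> x = foldr partial js (\<lambda>x. w x + g x) x"
    by (rule foldr_partial_cong_open[OF open_punctured]) (use assms in auto)
  also have "\<dots> = foldr partial js w x + foldr partial js g x"
    by (intro foldr_partial_add[OF open_punctured] Ck_on_le[OF Ck_on_subset[OF assms(2)] assms(4)] Ck_on_le[OF assms(3,4)] assms(5)) auto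
  finally show ?thesis .
qed

section \<open>Bounds on annuli and across the sphere of radius \<open>r0\<close>\<close>

lemma near_bound:
  assumes "length js \<le> L" "x \<noteq> 0" "norm x < r0"
  shows "\<bar>foldr partial js \<phi> x\<bar> \<le> Cs + Cs * norm x powr s * (1 + \<bar>ln (norm x)\<bar>) / norm x ^ length js"
proof -
  obtain w g where wg: "\<forall>x\<in>ball 0 r0 - {0}. \<phi> x = w x + g x" "deriv_bound L (ball 0 r0) (\<lambda>_. 1) (\<lambda>_. Cs * (1 + \<bar>ln 1\<bar>)) w"
     "deriv_bound L (ball 0 r0 - {0}) norm (\<lambda>x. Cs * norm x powr s * (1 + \<bar>ln (norm x / 1)\<bar>)) g"
    using split[of 1] by auto
  have "foldr partial js \<phi> x = foldr partial js w x + foldr partial js g x"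
    using assms by (intro foldr_split[OF wg(1) deriv_bound_Ck_on[OF wg(2)] deriv_bound_Ck_on[OF wg(3)]]) auto
  moreover have "\<bar>foldr partial js w x\<bar> \<le> Cs" using deriv_boundD[OF wg(2) assms(1), of x] assms by simp
  moreover have "\<bar>foldr partial js g x\<bar> \<le> Cs * norm x powr s * (1 + \<bar>ln (norm x)\<bar>) / norm x ^ length js"
    using deriv_boundD[OF wg(3) assms(1), of x] assms by simp
  ultimately show ?thesis by linarith
qed

text \<open>Later arguments start at distance at least \<open>r0 / 2\<close> from the origin and
  move by at most \<open>K * h \<le> r0 / 8\<close>, so the radius \<open>r0 / 4\<close> leaves
  room.\<close>

lemma inner_annulus_bound:
  "\<exists>B\<ge>0. \<forall>js x. length js \<le> L \<longrightarrow> r0 / 4 \<le> norm x \<longrightarrow> norm x < r0 \<longrightarrow> \<bar>foldr partial js \<phi> x\<bar> \<le> B"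
proof -
  define M where "M = max 1 (4 / r0)"
  define B where "B = Cs + Cs * r0 powr s * (1 + (\<bar>ln r0\<bar> + \<bar>ln (r0 / 4)\<bar>)) * M ^ L"
  have "\<bar>foldr partial js \<phi> x\<bar> \<le> B" if js: "length js \<le> L" and x: "r0 / 4 \<le> norm x" "norm x < r0" for js x
  proof -
    have x0: "norm x > 0" using x r0_pos by (smt (verit) divide_pos_pos)
    have "ln (norm x) \<le> ln r0" "ln (r0 / 4) \<le> ln (norm x)" using x x0 r0_pos by (auto simp del: ln_div)
    then have l: "\<bar>ln (norm x)\<bar> \<le> \<bar>ln r0\<bar> + \<bar>ln (r0 / 4)\<bar>" by linarith
    have "(1 / norm x) ^ length js \<le> M ^ length js"
    proof (rule power_mono)
      have "1 / norm x \<le> 4 / r0" using x x0 r0_pos by (simp add: field_simps)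
      then show "1 / norm x \<le> M" by (simp add: M_def)
    qed (use x0 in auto)
    also have "\<dots> \<le> M ^ L" using js by (intro power_increasing) (auto simp: M_def)
    finally have p: "1 / norm x ^ length js \<le> M ^ L" by (simp add: power_one_over)
    have "Cs * norm x powr s * (1 + \<bar>ln (norm x)\<bar>) / norm x ^ length js = Cs * norm x powr s * (1 + \<bar>ln (norm x)\<bar>) * (1 / norm x ^ length js)" by simp
    also have "\<dots> \<le> Cs * r0 powr s * (1 + (\<bar>ln r0\<bar> + \<bar>ln (r0 / 4)\<bar>)) * M ^ L"
      using Cs_nonneg x x0 s_pos l p by (intro mult_mono powr_mono2) auto
    finally show ?thesis using near_bound[OF js, of x] x x0 unfolding B_def by auto
  qed
  moreover have "B \<ge> 0" using Cs_nonneg r0_pos unfolding B_def M_def by auto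
  ultimately show ?thesis by blast
qed

lemma top_order_bound:
  "\<exists>B\<ge>0. \<forall>js x. length js = L \<longrightarrow> x \<in> regular_set r0 \<longrightarrow> r0 / 4 \<le> norm x \<longrightarrow> \<bar>foldr partial js \<phi> x\<bar> \<le> B * norm x powr (s - real L)"
proof -
  obtain B where B: "B \<ge> 0" "\<And>js x. length js \<le> L \<Longrightarrow> r0 / 4 \<le> norm x \<Longrightarrow> norm x < r0 \<Longrightarrow> \<bar>foldr partial js \<phi> x\<bar> \<le> B"
    using inner_annulus_bound by blast
  \<comment> \<open>Inside the ball \<open>norm x powr (s - L)\<close> is at least
    \<open>r0 powr (s - L)\<close> because \<open>s < L\<close>, so the constant bound
    \<open>B\<close> becomes a multiple of this power.\<close>
  define K where "K = CL + B * r0 powr (real L - s)"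
  have "\<bar>foldr partial js \<phi> x\<bar> \<le> K * norm x powr (s - real L)"
    if js: "length js = L" and x: "x \<in> regular_set r0" "r0 / 4 \<le> norm x" for js x
  proof (cases "norm x < r0")
    case True
    have x0: "norm x > 0" using x r0_pos by (smt (verit) divide_pos_pos)
    have "1 = norm x powr (real L - s) * norm x powr (s - real L)" using x0 by (simp add: powr_add[symmetric])
    also have "\<dots> \<le> r0 powr (real L - s) * norm x powr (s - real L)"
      using x0 True L_gt by (intro mult_right_mono powr_mono2) auto
    finally have "B * 1 \<le> B * (r0 powr (real L - s) * norm x powr (s - real L))" using B by (intro mult_left_mono) auto
    also have "\<dots> \<le> K * norm x powr (s - real L)"
      using CL_nonneg by (simp add: K_def algebra_simps)
    finally show ?thesis using B(2)[of js x] js x True by simp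
  next
    case False
    then have "norm x > r0" using x by (simp add: regular_set_def)
    then have "\<bar>foldr partial js \<phi> x\<bar> \<le> CL * norm x powr (s - real L)" using decay js by blast
    also have "\<dots> \<le> K * norm x powr (s - real L)" using B by (intro mult_right_mono) (auto simp: K_def)
    finally show ?thesis .
  qed
  moreover have "K \<ge> 0" using CL_nonneg B by (simp add: K_def)
  ultimately show ?thesis by blast
qed

text \<open>Outside the sphere only the top order is bounded by assumption. Lower orders are
  recovered downwards by following the ray from the sphere of radius \<open>R\<close>, which is
  compact in the open exterior, inwards to \<open>x\<close>; so there is no blow-up as
  \<open>norm x\<close> decreases to \<open>r0\<close>.\<close>

lemma outer_annulus_bound:
  assumes "j \<le> L"
  shows "\<exists>B\<ge>0. \<forall>js x. length js = j \<longrightarrow> r0 < norm x \<longrightarrow> norm x \<le> R \<longrightarrow> \<bar>foldr partial js \<phi> x\<bar> \<le> B"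
  using assms
proof (induction rule: inc_induct)
  case base
  have "\<bar>foldr partial js \<phi> x\<bar> \<le> CL * r0 powr (s - real L)" if "length js = L" "r0 < norm x" for js x
  proof -
    have "\<bar>foldr partial js \<phi> x\<bar> \<le> CL * norm x powr (s - real L)" using that by (rule decay)
    also have "\<dots> \<le> CL * r0 powr (s - real L)"
      using that CL_nonneg r0_pos L_gt by (intro mult_left_mono powr_mono2') auto
    finally show ?thesis .
  qed
  then show ?case using CL_nonneg by (intro exI[of _ "CL * r0 powr (s - real L)"]) auto
next
  case (step j)
  obtain B where B: "B \<ge> 0" "\<And>js x. length js = Suc j \<Longrightarrow> r0 < norm x \<Longrightarrow> norm x \<le> R \<Longrightarrow> \<bar>foldr partial js \<phi> x\<bar> \<le> B"
    using step.IH by blast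
  let ?S = "{x :: real^'n. r0 < norm x}"
  have opS: "open ?S" by (intro open_Collect_less continuous_intros)
  have sub: "?S \<subseteq> regular_set r0" using r0_pos by (auto simp: regular_set_def)
  have CkS: "Ck_on 1 ?S (foldr partial js \<phi>)" if "length js = j" for js
    by (rule Ck_on_foldr_partial, rule Ck_on_le[OF Ck_on_subset[OF CkL sub]]) (use that step.hyps in auto)
  have sph: "\<exists>B. \<forall>x\<in>sphere 0 R \<inter> ?S. \<bar>foldr partial js \<phi> x\<bar> \<le> B" if "js \<in> {js. length js = j}" for js
  proof (cases "R > r0")
    case True
    have "compact (foldr partial js \<phi> ` sphere 0 R)"
      by (intro compact_continuous_image continuous_on_subset[OF Ck_on_imp_continuous[OF CkS]]) (use that True in auto)
    then obtain B where "\<forall>y\<in>foldr partial js \<phi> ` sphere 0 R. norm y \<le> B"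
      using bounded_iff[of "foldr partial js \<phi> ` sphere 0 R"] compact_imp_bounded by blast
    then show ?thesis by (intro exI[of _ B]) auto
  next
    case False
    then show ?thesis by auto
  qed
  from uniform_bound[where f = "\<lambda>js. foldr partial js \<phi>" and I = "{js. length js = j}" and S = "sphere 0 R \<inter> ?S", OF finite_lists_length_eq_UNIV sph]
  obtain B' where B': "B' \<ge> 0" "\<And>js x. length js = j \<Longrightarrow> norm x = R \<Longrightarrow> r0 < R \<Longrightarrow> \<bar>foldr partial js \<phi> x\<bar> \<le> B'" by auto
  have "\<bar>foldr partial js \<phi> x\<bar> \<le> B' + real CARD('n) * \<bar>R\<bar> * B" if js: "length js = j" and x: "r0 < norm x" "norm x \<le> R" for js x
  proof -
    let ?f = "foldr partial js \<phi>"
    \<comment> \<open>The radial step that reaches the sphere of radius \<open>R\<close> at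
      parameter 1.\<close>
    define w where "w = (R / norm x - 1) *\<^sub>R x"
    have x0: "norm x > 0" using x r0_pos by linarith
    have le1: "1 \<le> R / norm x" using x x0 by simp
    have in_line: "x + t *\<^sub>R w \<in> ?S" "norm (x + t *\<^sub>R w) \<le> R" if "t \<in> {0..1}" for t
    proof -
      have "x + t *\<^sub>R w = (1 + t * (R / norm x - 1)) *\<^sub>R x" by (simp add: w_def algebra_simps)
      then have n: "norm (x + t *\<^sub>R w) = (1 + t * (R / norm x - 1)) * norm x"
        using that le1 by (simp add: abs_of_nonneg)
      have "1 * norm x \<le> (1 + t * (R / norm x - 1)) * norm x" using that le1 by (intro mult_right_mono) auto
      then show "x + t *\<^sub>R w \<in> ?S" using x n by simp
      have "t * (R / norm x - 1) \<le> 1 * (R / norm x - 1)" using that le1 by (intro mult_right_mono) auto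
      then have "(1 + t * (R / norm x - 1)) * norm x \<le> (R / norm x) * norm x" by (intro mult_right_mono) auto
      then show "norm (x + t *\<^sub>R w) \<le> R" using n x0 by simp
    qed
    have nw: "norm w \<le> \<bar>R\<bar>"
    proof -
      have "norm w = (R / norm x - 1) * norm x" using le1 by (simp add: w_def)
      also have "\<dots> = R - norm x" using x0 by (simp add: field_simps)
      finally show ?thesis using x0 by linarith
    qed
    have end1: "x + 1 *\<^sub>R w = (R / norm x) *\<^sub>R x" by (simp add: w_def algebra_simps)
    have "norm (?f (x + 1 *\<^sub>R w) - ?f (x + 0 *\<^sub>R w)) \<le> (real CARD('n) * \<bar>R\<bar> * B) * norm (1 - 0 :: real)"
    proof (rule field_differentiable_bound[where S = "{0..1}" and f' = "\<lambda>t. \<Sum>i\<in>UNIV. w $ i * partial i ?f (x + t *\<^sub>R w)"])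
      fix t :: real assume t: "t \<in> {0..1}"
      show "((\<lambda>t. ?f (x + t *\<^sub>R w)) has_field_derivative (\<Sum>i\<in>UNIV. w $ i * partial i ?f (x + t *\<^sub>R w))) (at t within {0..1})"
        by (rule has_field_derivative_at_within[OF Ck_on_has_real_derivative_line[OF opS CkS[OF js] in_line(1)[OF t]]])
      have "norm (\<Sum>i\<in>UNIV. w $ i * partial i ?f (x + t *\<^sub>R w)) \<le> (\<Sum>i\<in>(UNIV :: 'n set). \<bar>R\<bar> * B)"
      proof (rule sum_norm_le)
        fix i
        have "\<bar>partial i ?f (x + t *\<^sub>R w)\<bar> \<le> B"
          using B(2)[of "i # js" "x + t *\<^sub>R w"] in_line[OF t] js by simp
        moreover have "\<bar>w $ i\<bar> \<le> \<bar>R\<bar>" using component_le_norm_cart[of w i] nw by linarith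
        ultimately show "norm (w $ i * partial i ?f (x + t *\<^sub>R w)) \<le> \<bar>R\<bar> * B"
          using B by (auto simp: abs_mult intro!: mult_mono)
      qed
      then show "norm (\<Sum>i\<in>UNIV. w $ i * partial i ?f (x + t *\<^sub>R w)) \<le> real CARD('n) * \<bar>R\<bar> * B" by (simp add: mult.assoc)
    qed auto
    moreover have "\<bar>?f ((R / norm x) *\<^sub>R x)\<bar> \<le> B'" using B'(2)[OF js, of "(R / norm x) *\<^sub>R x"] x x0 by simp
    ultimately show ?thesis unfolding end1 by simp
  qed
  then show ?case using B B' by (intro exI[of _ "B' + real CARD('n) * \<bar>R\<bar> * B"]) auto
qed

lemma annulus_bound:
  assumes "j \<le> L"
  shows "\<exists>B\<ge>0. \<forall>js x. length js = j \<longrightarrow> x \<in> regular_set r0 \<longrightarrow> r0 / 4 \<le> norm x \<longrightarrow> norm x \<le> R \<longrightarrow> \<bar>foldr partial js \<phi> x\<bar> \<le> B"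
proof -
  obtain B1 where B1: "B1 \<ge> 0" "\<And>js x. length js \<le> L \<Longrightarrow> r0 / 4 \<le> norm x \<Longrightarrow> norm x < r0 \<Longrightarrow> \<bar>foldr partial js \<phi> x\<bar> \<le> B1"
    using inner_annulus_bound by blast
  obtain B2 where B2: "B2 \<ge> 0" "\<And>js x. length js = j \<Longrightarrow> r0 < norm x \<Longrightarrow> norm x \<le> R \<Longrightarrow> \<bar>foldr partial js \<phi> x\<bar> \<le> B2"
    using outer_annulus_bound[OF assms] by blast
  have "\<bar>foldr partial js \<phi> x\<bar> \<le> B1 + B2" if "length js = j" "x \<in> regular_set r0" "r0 / 4 \<le> norm x" "norm x \<le> R" for js x
  proof (cases "norm x < r0")
    case True
    then show ?thesis using B1(2)[of js x] B2(1) that assms by simp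
  next
    case False
    then have "r0 < norm x" using that by (simp add: regular_set_def)
    then show ?thesis using B1(1) B2(2)[of js x] that by simp
  qed
  then show ?thesis using B1(1) B2(1) by (intro exI[of _ "B1 + B2"]) auto
qed

text \<open>Derivatives of order \<open>k0\<close> are continuous across the sphere and have bounded
  gradient off it. A segment meets the sphere finitely often, so the strong form of the fundamental
  theorem of calculus still gives a Lipschitz bound.\<close>

lemma shell_lipschitz:
  "\<exists>B\<ge>0. \<forall>js y w. length js = k0 \<longrightarrow> (\<forall>t\<in>{0..1}. r0 / 4 \<le> norm (y + t *\<^sub>R w) \<and> norm (y + t *\<^sub>R w) \<le> R) \<longrightarrow>
     \<bar>foldr partial js \<phi> (y + w) - foldr partial js \<phi> y\<bar> \<le> B * norm w"
proof -
  obtain B where B: "B \<ge> 0" "\<And>js x. length js = Suc k0 \<Longrightarrow> x \<in> regular_set r0 \<Longrightarrow> r0 / 4 \<le> norm x \<Longrightarrow> norm x \<le> R \<Longrightarrow> \<bar>foldr partial js \<phi> x\<bar> \<le> B"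
    using annulus_bound[of "Suc k0" R] k0_bounds(3) by auto
  have "\<bar>foldr partial js \<phi> (y + w) - foldr partial js \<phi> y\<bar> \<le> real CARD('n) * B * norm w"
    if js: "length js = k0" and seg: "\<And>t. t \<in> {0..1} \<Longrightarrow> r0 / 4 \<le> norm (y + t *\<^sub>R w) \<and> norm (y + t *\<^sub>R w) \<le> R" for js y w
  proof (cases "w = 0")
    case False
    let ?f = "foldr partial js \<phi>"
    let ?f' = "\<lambda>t. if y + t *\<^sub>R w \<in> regular_set r0 then (\<Sum>i\<in>UNIV. w $ i * partial i ?f (y + t *\<^sub>R w)) else 0"
    have nz: "y + t *\<^sub>R w \<noteq> 0" if "t \<in> {0..1}" for t using seg[OF that] r0_pos by auto
    have cont: "continuous_on (- {0}) ?f" using Ck_on_foldr_partial[of 0 js "- {0}" \<phi>] Ck0 js by simp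
    have CkU: "Ck_on 1 (regular_set r0) ?f"
      by (rule Ck_on_foldr_partial, rule Ck_on_le[OF CkL]) (use js k0_bounds(3) in auto)
    have "(?f' has_integral (?f (y + 1 *\<^sub>R w) - ?f (y + 0 *\<^sub>R w))) {0..1}"
    proof (rule fundamental_theorem_of_calculus_strong[where S = "{t. norm (y + t *\<^sub>R w) = r0}"])
      show "finite {t. norm (y + t *\<^sub>R w) = r0}" by (rule finite_line_sphere[OF False])
      show "continuous_on {0..1} (\<lambda>t. ?f (y + t *\<^sub>R w))"
        by (rule continuous_on_compose2[OF cont]) (use nz in \<open>auto intro!: continuous_intros\<close>)
      fix t assume t: "t \<in> {0..1} - {t. norm (y + t *\<^sub>R w) = r0}"
      then have "y + t *\<^sub>R w \<in> regular_set r0" using nz[of t] by (auto simp: regular_set_def)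
      then show "((\<lambda>t. ?f (y + t *\<^sub>R w)) has_vector_derivative ?f' t) (at t)"
        using Ck_on_has_real_derivative_line[OF open_regular_set CkU] by (simp add: has_real_derivative_iff_has_vector_derivative)
    qed simp
    then have hi: "(?f' has_integral (?f (y + w) - ?f y)) (cbox 0 1)" by simp
    have "norm (?f (y + w) - ?f y) \<le> (real CARD('n) * B * norm w) * measure lborel (cbox 0 (1 :: real))"
    proof (rule has_integral_bound[OF _ hi])
      show "0 \<le> real CARD('n) * B * norm w" using B by simp
      fix t :: real assume "t \<in> cbox 0 1"
      then have t: "t \<in> {0..1}" by simp
      show "norm (?f' t) \<le> real CARD('n) * B * norm w"
      proof (cases "y + t *\<^sub>R w \<in> regular_set r0")
        case True
        have "norm (\<Sum>i\<in>UNIV. w $ i * partial i ?f (y + t *\<^sub>R w)) \<le> (\<Sum>i\<in>(UNIV :: 'n set). norm w * B)"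
        proof (rule sum_norm_le)
          fix i
          have "\<bar>partial i ?f (y + t *\<^sub>R w)\<bar> \<le> B"
            using B(2)[of "i # js" "y + t *\<^sub>R w"] seg[OF t] js True by simp
          moreover have "\<bar>w $ i\<bar> \<le> norm w" by (rule component_le_norm_cart)
          ultimately show "norm (w $ i * partial i ?f (y + t *\<^sub>R w)) \<le> norm w * B"
            using B by (auto simp: abs_mult intro!: mult_mono)
        qed
        then show ?thesis using True by (simp add: mult_ac)
      qed (use B in simp)
    qed
    then show ?thesis by simp
  qed simp
  then show ?thesis using B(1) by (intro exI[of _ "real CARD('n) * B"]) auto
qed

end

section \<open>Derivatives of the kernel as functions on the whole space\<close>

lemma lint_powr_bound:
  fixes F :: "real^'n::finite \<Rightarrow> real"
  assumes Fm[measurable]: "F \<in> borel_measurable borel" and p: "p < real CARD('n)"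
    and bd: "\<And>R. \<exists>B\<ge>0. \<exists>C\<ge>0. \<forall>x. norm x \<le> R \<longrightarrow> \<bar>F x\<bar> \<le> B + C * norm x powr (- p)"
  shows "lint F"
  unfolding lint_def
proof (intro conjI allI)
  fix R :: real
  define R' where "R' = max R 1"
  obtain B C where B: "B \<ge> 0" and C: "C \<ge> 0" and le: "\<And>x. norm x \<le> R' \<Longrightarrow> \<bar>F x\<bar> \<le> B + C * norm x powr (- p)"
    using bd[of R'] by blast
  obtain N where N: "\<And>R. R > 0 \<Longrightarrow> (\<integral>\<^sup>+x. ennreal (norm (x :: real^'n) powr (- p)) * indicator (cball 0 R) x \<partial>lborel) \<le> ennreal (N * R powr (CARD('n) - p))"
    using nn_integral_norm_powr_near[OF p] by blast
  have R': "R' > 0" by (simp add: R'_def)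
  have "(\<integral>\<^sup>+x. ennreal \<bar>F x\<bar> * indicator (cball 0 R) x \<partial>lborel)
    \<le> (\<integral>\<^sup>+x. ennreal B * indicator (cball 0 R') x + ennreal C * (ennreal (norm x powr (- p)) * indicator (cball 0 R') (x :: real^'n)) \<partial>lborel)"
  proof (rule nn_integral_mono)
    fix x :: "real^'n"
    show "ennreal \<bar>F x\<bar> * indicator (cball 0 R) x \<le> ennreal B * indicator (cball 0 R') x + ennreal C * (ennreal (norm x powr (- p)) * indicator (cball 0 R') x)"
    proof (cases "x \<in> cball 0 R")
      case True
      then have x: "norm x \<le> R'" by (simp add: R'_def)
      have "ennreal \<bar>F x\<bar> \<le> ennreal (B + C * norm x powr (- p))" by (intro ennreal_leI le x)
      also have "\<dots> = ennreal B + ennreal C * ennreal (norm x powr (- p))" using B C by (simp add: ennreal_plus ennreal_mult)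
      finally show ?thesis using True x by simp
    qed simp
  qed
  also have "\<dots> = ennreal B * emeasure lborel (cball (0 :: real^'n) R') + ennreal C * (\<integral>\<^sup>+x. ennreal (norm (x :: real^'n) powr (- p)) * indicator (cball 0 R') x \<partial>lborel)"
    by (subst nn_integral_add) (auto simp: nn_integral_cmult nn_integral_cmult_indicator)
  also have "\<dots> < \<infinity>"
  proof -
    have "(\<integral>\<^sup>+x. ennreal (norm (x :: real^'n) powr (- p)) * indicator (cball 0 R') x \<partial>lborel) < \<infinity>"
      using N[OF R'] by (rule le_less_trans) simp
    moreover have "emeasure lborel (cball (0 :: real^'n) R') < \<infinity>" using R' by (simp add: emeasure_cball)
    ultimately show ?thesis by (simp add: ennreal_mult_less_top)
  qed
  finally show "(\<integral>\<^sup>+x. ennreal \<bar>F x\<bar> * indicator (cball 0 R) x \<partial>lborel) < \<infinity>" .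
qed (rule Fm)

text \<open>A parallel to axis \<open>i\<close> keeps every other coordinate; given a second
  coordinate \<open>j\<close>, it reaches 0 only if \<open>x $ j = 0\<close>, which is a
  hyperplane.\<close>

lemma AE_line_avoids_zero:
  assumes "CARD('n::finite) \<noteq> 1"
  shows "AE x :: real^'n in lborel. \<forall>t. x + t *\<^sub>R axis i 1 \<noteq> 0"
proof -
  obtain j :: 'n where j: "j \<noteq> i"
  proof (rule ccontr)
    assume "\<not> thesis"
    then have "\<And>j. j = i" using that by blast
    then have "(UNIV :: 'n set) = {i}" by auto
    from arg_cong[OF this, of card] have "CARD('n) = 1" by simp
    then show False using assms by contradiction
  qed
  have "negligible {x :: real^'n. x $ j = 0}" by (rule negligible_standard_hyperplane_cart)
  then have "AE x :: real^'n in lebesgue. x \<notin> {x. x $ j = 0}"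
    by (intro AE_not_in) (simp add: negligible_iff_null_sets)
  then have "AE x :: real^'n in lborel. x \<notin> {x. x $ j = 0}" by (simp only: AE_completion_iff)
  then show ?thesis
  proof eventually_elim
    fix x :: "real^'n" assume x: "x \<notin> {x. x $ j = 0}"
    have eq: "(x + t *\<^sub>R axis i 1) $ j = x $ j" for t using j by (simp add: axis_def)
    show "\<forall>t. x + t *\<^sub>R axis i 1 \<noteq> 0"
    proof (intro allI notI)
      fix t assume "x + t *\<^sub>R axis i 1 = 0"
      then have "x $ j = 0" using eq[of t] by (simp del: vector_add_component)
      then show False using x by simp
    qed
  qed
qed

text \<open>\<open>m\<close> is the highest order of differentiation in play and \<epsilon> the
  price of the logarithm. The bound on \<open>m\<close> keeps the singular derivatives square
  integrable near 0 despite that loss; the bound on \<open>L\<close> keeps the tail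
  \<open>norm y powr (- (L - s - \<epsilon>))\<close> integrable at infinity.\<close>

locale kernel_order = kernel \<phi> s r0 Cs CL L k0
  for \<phi> :: "real^'n::finite \<Rightarrow> real" and s r0 Cs CL :: real and L k0 :: nat +
  fixes m :: nat and \<epsilon> :: real
  assumes eps_pos: "\<epsilon> > 0" and m_lt: "real m + \<epsilon> < s + real CARD('n) / 2" and eps_L: "s + real CARD('n) + \<epsilon> < real L"
begin

text \<open>\<open>m\<close> can exceed \<open>k0\<close> by one, so derivatives of the top order
  may jump across the sphere; \<open>shell_bound\<close> treats this case separately.\<close>

lemma m_le: "m \<le> L" "m < L" "m \<le> k0 + 1"
proof -
  have d: "real CARD('n) \<ge> 1" by (simp add: Suc_leI)
  have "real m < real L" using m_lt eps_L eps_pos d by linarith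
  then show "m \<le> L" "m < L" by auto
  have "real m < real k0 + 2" using m_lt eps_pos d k0_bounds(2) by linarith
  then show "m \<le> k0 + 1" by linarith
qed

lemma near_bound_powr:
  "\<exists>C\<ge>0. \<forall>js x. length js \<le> L \<longrightarrow> x \<noteq> 0 \<longrightarrow> norm x < r0 \<longrightarrow>
     \<bar>foldr partial js \<phi> x\<bar> \<le> Cs + C * norm x powr (s - real (length js) - \<epsilon>)"
proof -
  obtain C where C: "C \<ge> 0" "\<And>t. 0 < t \<Longrightarrow> t \<le> r0 \<Longrightarrow> 1 + \<bar>ln t\<bar> \<le> C * t powr (- \<epsilon>)"
    using one_plus_abs_ln_le[OF eps_pos r0_pos] by auto
  have "\<bar>foldr partial js \<phi> x\<bar> \<le> Cs + (Cs * C) * norm x powr (s - real (length js) - \<epsilon>)"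
    if "length js \<le> L" "x \<noteq> 0" "norm x < r0" for js x
  proof -
    have x0: "norm x > 0" using that by simp
    have "Cs * norm x powr s * (1 + \<bar>ln (norm x)\<bar>) / norm x ^ length js \<le> Cs * norm x powr s * (C * norm x powr (- \<epsilon>)) / norm x ^ length js"
      using C(2)[of "norm x"] that Cs_nonneg by (intro divide_right_mono mult_left_mono) auto
    also have "\<dots> = (Cs * C) * (norm x powr s * norm x powr (- \<epsilon>) / norm x powr (real (length js)))"
      using x0 by (simp add: powr_realpow)
    also have "norm x powr s * norm x powr (- \<epsilon>) / norm x powr (real (length js)) = norm x powr (s - real (length js) - \<epsilon>)"
      unfolding powr_add[symmetric] powr_diff[symmetric] by (simp add: algebra_simps)
    finally show ?thesis using near_bound[OF that] by linarith
  qed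
  then show ?thesis using C(1) Cs_nonneg by (intro exI[of _ "Cs * C"]) auto
qed

text \<open>Derivatives are set to 0 on the null set where they need not exist, which makes them
  Borel functions on the whole space. The empty word keeps \<phi> itself at every point, so that the
  error equals \<open>conv_diff\<close> of \<open>Phi []\<close> everywhere and not only almost
  everywhere.\<close>

definition Phi :: "'n list \<Rightarrow> real^'n \<Rightarrow> real" where
  "Phi js = (if js = [] then \<phi> else (\<lambda>x. indicator (regular_set r0) x *\<^sub>R foldr partial js \<phi> x))"

lemma Phi_regular: "x \<in> regular_set r0 \<Longrightarrow> Phi js x = foldr partial js \<phi> x"
  by (simp add: Phi_def)

lemma Phi_measurable: "length js \<le> L \<Longrightarrow> Phi js \<in> borel_measurable borel"
proof (cases "js = []")
  case True
  then show ?thesis using cont by (simp add: Phi_def borel_measurable_continuous_onI)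
next
  case False
  assume js: "length js \<le> L"
  have "Ck_on 0 (regular_set r0) (foldr partial js \<phi>)"
    by (rule Ck_on_foldr_partial, rule Ck_on_le[OF CkL]) (use js in auto)
  then have c: "continuous_on (regular_set r0) (foldr partial js \<phi>)" by simp
  have "regular_set r0 \<in> sets (borel :: (real^'n) measure)" by (rule borel_open[OF open_regular_set])
  from borel_measurable_continuous_on_indicator[OF this c] show ?thesis using False by (simp add: Phi_def)
qed

text \<open>Local integrability at 0 only needs \<open>length js + \<epsilon>\<close> below s + d,
  which is weaker than \<open>m_lt\<close>; away from 0 the annulus bound applies.\<close>

lemma lint_Phi:
  assumes js: "length js \<le> m" shows "lint (Phi js)"
proof (rule lint_powr_bound)
  let ?p = "- (s - real (length js) - \<epsilon>)"
  show "Phi js \<in> borel_measurable borel" using js m_le by (intro Phi_measurable) simp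
  have d: "real CARD('n) \<ge> 1" by (simp add: Suc_leI)
  show "?p < real CARD('n)"
  proof -
    have "real (length js) \<le> real m" using js by simp
    then show ?thesis using m_lt d by argo
  qed
  fix R
  show "\<exists>B\<ge>0. \<exists>C\<ge>0. \<forall>x. norm x \<le> R \<longrightarrow> \<bar>Phi js x\<bar> \<le> B + C * norm x powr (- ?p)"
  proof (cases "js = []")
    case True
    have "compact (\<phi> ` cball 0 R)" by (intro compact_continuous_image continuous_on_subset[OF cont]) auto
    then obtain B where B: "\<forall>y\<in>\<phi> ` cball 0 R. norm y \<le> B"
      using bounded_iff[of "\<phi> ` cball 0 R"] compact_imp_bounded by blast
    have "\<bar>Phi js x\<bar> \<le> \<bar>B\<bar> + 0 * norm x powr (- ?p)" if "norm x \<le> R" for x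
    proof -
      have "norm (\<phi> x) \<le> B" using B that by simp
      then show ?thesis using True by (simp add: Phi_def)
    qed
    then show ?thesis by (intro exI[of _ "\<bar>B\<bar>"] conjI exI[of _ 0]) auto
  next
    case False
    obtain C where C: "C \<ge> 0" "\<And>js x. length js \<le> L \<Longrightarrow> x \<noteq> 0 \<Longrightarrow> norm x < r0 \<Longrightarrow>
     \<bar>foldr partial js \<phi> x\<bar> \<le> Cs + C * norm x powr (s - real (length js) - \<epsilon>)" using near_bound_powr by blast
    have jsL: "length js \<le> L" using js m_le by simp
    obtain B where B: "B \<ge> 0" "\<And>ks x. length ks = length js \<Longrightarrow> x \<in> regular_set r0 \<Longrightarrow> r0 / 4 \<le> norm x \<Longrightarrow> norm x \<le> R \<Longrightarrow> \<bar>foldr partial ks \<phi> x\<bar> \<le> B"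
      using annulus_bound[OF jsL, of R] by blast
    have "\<bar>Phi js x\<bar> \<le> (Cs + B) + C * norm x powr (- ?p)" if x: "norm x \<le> R" for x
    proof (cases "x \<in> regular_set r0")
      case True
      show ?thesis
      proof (cases "norm x < r0")
        case r: True
        have "\<bar>foldr partial js \<phi> x\<bar> \<le> Cs + C * norm x powr (s - real (length js) - \<epsilon>)"
          using True r jsL by (intro C(2)) (auto simp: regular_set_def)
        then show ?thesis using True B(1) by (simp add: Phi_regular)
      next
        case r: False
        have "\<bar>foldr partial js \<phi> x\<bar> \<le> B" using True r r0_pos x by (intro B(2)) auto
        moreover have "0 \<le> C * norm x powr (- ?p)" using C(1) by simp
        ultimately show ?thesis using True Cs_nonneg by (simp add: Phi_regular)
      qed
    next
      case nr: False
      then have "Phi js x = 0" using False by (simp add: Phi_def)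
      moreover have "0 \<le> C * norm x powr (- ?p)" using C(1) by simp
      ultimately show ?thesis using B(1) Cs_nonneg by simp
    qed
    then show ?thesis using B(1) C(1) Cs_nonneg by (intro exI[of _ "Cs + B"] conjI exI[of _ C]) auto
  qed
qed

text \<open>The smooth part is continuous at 0, and the singular part is at most a multiple of
  \<open>norm x powr (s - length js - \<epsilon>)\<close>, hence tends to 0.\<close>

lemma foldr_continuous_extension:
  assumes "length js \<le> L" "s - real (length js) - \<epsilon> > 0"
  shows "\<exists>c. (foldr partial js \<phi> \<longlongrightarrow> c) (at 0)"
proof -
  obtain w g where wg: "\<forall>x\<in>ball 0 r0 - {0}. \<phi> x = w x + g x" "deriv_bound L (ball 0 r0) (\<lambda>_. 1) (\<lambda>_. Cs * (1 + \<bar>ln 1\<bar>)) w"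
     "deriv_bound L (ball 0 r0 - {0}) norm (\<lambda>x. Cs * norm x powr s * (1 + \<bar>ln (norm x / 1)\<bar>)) g"
    using split[of 1] by auto
  obtain C where C: "C \<ge> 0" "\<And>t. 0 < t \<Longrightarrow> t \<le> r0 \<Longrightarrow> 1 + \<bar>ln t\<bar> \<le> C * t powr (- \<epsilon>)"
    using one_plus_abs_ln_le[OF eps_pos r0_pos] by auto
  let ?a = "s - real (length js) - \<epsilon>"
  have ev: "\<forall>\<^sub>F x :: real^'n in at 0. x \<in> ball 0 r0 - {0}"
    using r0_pos by (auto simp: eventually_at dist_norm intro!: exI[of _ r0])
  have "Ck_on 0 (ball 0 r0) (foldr partial js w)"
    by (rule Ck_on_foldr_partial, rule Ck_on_le[OF deriv_bound_Ck_on[OF wg(2)]]) (use assms in simp)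
  then have "isCont (foldr partial js w) 0"
    using r0_pos by (simp add: continuous_on_eq_continuous_at)
  then have lw: "(foldr partial js w \<longlongrightarrow> foldr partial js w 0) (at 0)" by (simp add: isCont_def)
  have lg: "(foldr partial js g \<longlongrightarrow> 0) (at 0)"
  proof (rule Lim_null_comparison)
    show "\<forall>\<^sub>F x in at 0. norm (foldr partial js g x) \<le> Cs * C * norm x powr ?a"
      using ev
    proof eventually_elim
      fix x :: "real^'n" assume x: "x \<in> ball 0 r0 - {0}"
      then have x0: "norm x > 0" "norm x \<le> r0" by auto
      have "\<bar>foldr partial js g x\<bar> \<le> Cs * norm x powr s * (1 + \<bar>ln (norm x)\<bar>) / norm x ^ length js"
        using deriv_boundD[OF wg(3) assms(1) x] by simp
      also have "\<dots> \<le> Cs * norm x powr s * (C * norm x powr (- \<epsilon>)) / norm x ^ length js"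
        using C(2)[OF x0] Cs_nonneg by (intro divide_right_mono mult_left_mono) auto
      also have "\<dots> = (Cs * C) * (norm x powr s * norm x powr (- \<epsilon>) / norm x powr (real (length js)))"
        using x0 by (simp add: powr_realpow)
      also have "norm x powr s * norm x powr (- \<epsilon>) / norm x powr (real (length js)) = norm x powr ?a"
        unfolding powr_add[symmetric] powr_diff[symmetric] by (simp add: algebra_simps)
      finally show "norm (foldr partial js g x) \<le> Cs * C * norm x powr ?a" by simp
    qed
    have "((\<lambda>x :: real^'n. norm x powr ?a) \<longlongrightarrow> 0) (at 0)"
      using assms(2) by (intro tendsto_zero_powrI[where b = ?a] tendsto_norm_zero tendsto_ident_at tendsto_const) auto
    then show "((\<lambda>x :: real^'n. Cs * C * norm x powr ?a) \<longlongrightarrow> 0) (at 0)" by (rule tendsto_mult_right_zero)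
  qed
  have "(foldr partial js \<phi> \<longlongrightarrow> foldr partial js w 0 + 0) (at 0)"
  proof (rule Lim_transform_eventually[OF tendsto_add[OF lw lg]])
    show "\<forall>\<^sub>F x in at 0. foldr partial js w x + foldr partial js g x = foldr partial js \<phi> x"
      using ev
    proof eventually_elim
      fix x :: "real^'n" assume x: "x \<in> ball 0 r0 - {0}"
      show "foldr partial js w x + foldr partial js g x = foldr partial js \<phi> x"
        using foldr_split[OF wg(1) deriv_bound_Ck_on[OF wg(2)] deriv_bound_Ck_on[OF wg(3)] assms(1) x] by simp
    qed
  qed
  then show ?thesis by blast
qed

lemma foldr_continuous_punctured:
  assumes "length js \<le> k0" shows "continuous_on (- {0}) (foldr partial js \<phi>)"
proof -
  have "Ck_on 0 (- {0}) (foldr partial js \<phi>)"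
    by (rule Ck_on_foldr_partial, rule Ck_on_le[OF Ck0]) (use assms in simp)
  then show ?thesis by simp
qed

text \<open>In dimension one every line passes through the origin; there the derivatives of order below
  \<open>m\<close> have a continuous extension, while in higher dimensions almost every line avoids the origin.\<close>

lemma line_deriv_Phi:
  assumes js: "length js < m" shows "line_deriv i (Phi js) (Phi (i # js))"
  unfolding line_deriv_def
proof (intro allI impI)
  fix \<tau> :: real assume \<tau>: "\<tau> > 0"
  let ?e = "axis i (1::real) :: real^'n"
  let ?f = "foldr partial js \<phi>"
  have e0: "?e \<noteq> 0" by simp
  have jsk: "length js \<le> k0" using js m_le by simp
  have jsL: "length js \<le> L" using js m_le by simp
  have CkU: "Ck_on 1 (regular_set r0) ?f"
    by (rule Ck_on_foldr_partial, rule Ck_on_le[OF CkL]) (use js m_le in auto)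
  define P where "P x \<longleftrightarrow> CARD('n) \<noteq> 1 \<longrightarrow> (\<forall>t. x + t *\<^sub>R ?e \<noteq> 0)" for x
  have AEP: "AE x in lborel. P x"
    using AE_line_avoids_zero[of i] unfolding P_def by (cases "CARD('n) = 1") auto
  obtain c where c: "CARD('n) = 1 \<Longrightarrow> (?f \<longlongrightarrow> c) (at 0)"
  proof (cases "CARD('n) = 1")
    case True
    \<comment> \<open>In dimension one \<open>m + \<epsilon> < s + 1/2\<close>, so an order below
      \<open>m\<close> leaves a positive exponent.\<close>
    have "real (length js) + 1 \<le> real m" using js by simp
    then have "s - real (length js) - \<epsilon> > 0" using m_lt True by simp
    then show ?thesis using foldr_continuous_extension[OF jsL] that by blast
  qed (use that in auto)
  define F where "F x = (if x = 0 then c else ?f x)" for x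
  have contF: "continuous_on {0..\<tau>} (\<lambda>t. F (x + t *\<^sub>R ?e))" if "P x" for x
  proof (cases "CARD('n) = 1")
    case True
    have "isCont F y" for y
    proof (cases "y = 0")
      case y: True
      have "(F \<longlongrightarrow> c) (at 0)"
        by (rule Lim_transform_eventually[OF c[OF True]]) (auto simp: F_def eventually_at_filter)
      then show ?thesis using y by (simp add: isCont_def F_def)
    next
      case y: False
      have "continuous_on (- {0}) F"
        using foldr_continuous_punctured[OF jsk] by (rule continuous_on_cong[THEN iffD1, rotated 2]) (auto simp: F_def)
      then show ?thesis using y by (simp add: continuous_on_eq_continuous_at open_Compl)
    qed
    then have "continuous_on UNIV F" by (simp add: continuous_at_imp_continuous_on)
    then show ?thesis by (rule continuous_on_compose2) (auto intro!: continuous_intros)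
  next
    case False
    have nz: "x + t *\<^sub>R ?e \<noteq> 0" for t using that False by (simp add: P_def)
    then have "F (x + t *\<^sub>R ?e) = ?f (x + t *\<^sub>R ?e)" for t by (simp add: F_def)
    moreover have "continuous_on {0..\<tau>} (\<lambda>t. ?f (x + t *\<^sub>R ?e))"
      by (rule continuous_on_compose2[OF foldr_continuous_punctured[OF jsk]]) (use nz in \<open>auto intro!: continuous_intros\<close>)
    ultimately show ?thesis by simp
  qed
  have "lint (Phi (i # js))" using js by (intro lint_Phi) simp
  note li = lint_line_integrable[OF this less_imp_le[OF \<tau>], of i]
  show "AE x in lborel. Phi js (x + \<tau> *\<^sub>R ?e) - Phi js x = (LINT \<eta>:{0..\<tau>}|lborel. Phi (i # js) (x + \<eta> *\<^sub>R ?e))"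
    using AEP AE_regular_set[of r0] AE_lborel_shift[OF AE_regular_set[of r0], of "\<tau> *\<^sub>R ?e"] li
  proof eventually_elim
    case (elim x)
    \<comment> \<open>The finitely many parameters at which the line meets the origin or the sphere;
      \<open>F\<close> need not be differentiable there but is continuous along the line.\<close>
    let ?S = "{t. x + t *\<^sub>R ?e = 0} \<union> {t. norm (x + t *\<^sub>R ?e) = r0}"
    have FP: "F y = Phi js y" if "y \<in> regular_set r0" for y
      using that by (simp add: F_def Phi_regular) (simp add: regular_set_def)
    have "((\<lambda>t. Phi (i # js) (x + t *\<^sub>R ?e)) has_integral (F (x + \<tau> *\<^sub>R ?e) - F (x + 0 *\<^sub>R ?e))) {0..\<tau>}"
    proof (rule fundamental_theorem_of_calculus_strong[where S = ?S])
      show "finite ?S" using finite_line_sphere[OF e0] finite_line_zero[OF e0] by simp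
      show "continuous_on {0..\<tau>} (\<lambda>t. F (x + t *\<^sub>R ?e))" by (rule contF[OF elim(1)])
      fix t assume t: "t \<in> {0..\<tau>} - ?S"
      then have reg: "x + t *\<^sub>R ?e \<in> regular_set r0" by (simp add: regular_set_def)
      have "((\<lambda>t. ?f (x + t *\<^sub>R ?e)) has_real_derivative partial i ?f (x + t *\<^sub>R ?e)) (at t)"
        by (intro has_partial_line Ck_on_has_partial[OF CkU] reg) simp
      moreover have "open ((\<lambda>t. x + t *\<^sub>R ?e) -` regular_set r0)"
        by (rule open_vimage[OF open_regular_set]) (intro continuous_intros)
      ultimately have "((\<lambda>t. F (x + t *\<^sub>R ?e)) has_real_derivative partial i ?f (x + t *\<^sub>R ?e)) (at t)"
        by (rule has_field_derivative_transform_within_open) (use reg in \<open>auto simp: F_def regular_set_def\<close>)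
      then show "((\<lambda>t. F (x + t *\<^sub>R ?e)) has_vector_derivative Phi (i # js) (x + t *\<^sub>R ?e)) (at t)"
        using Phi_regular[OF reg, of "i # js"] by (simp add: has_real_derivative_iff_has_vector_derivative)
    qed (use \<tau> in simp)
    then have "integral {0..\<tau>} (\<lambda>t. Phi (i # js) (x + t *\<^sub>R ?e)) = Phi js (x + \<tau> *\<^sub>R ?e) - Phi js x"
      using FP elim(2,3) by (simp add: integral_unique)
    then show ?case using set_borel_integral_eq_integral(2)[OF elim(4)] by simp
  qed
qed

end

section \<open>Pointwise bounds for the error kernel\<close>

text \<open>The reproduction property at one fixed \<open>z\<close>, with a free radius \<rho> and
  without reference to \<Omega>, so that pointwise estimates concern a single weight vector
  \<alpha>.\<close>

definition repro :: "nat \<Rightarrow> (real^'n::finite) set \<Rightarrow> (real^'n \<Rightarrow> real) \<Rightarrow> real^'n \<Rightarrow> real \<Rightarrow> real \<Rightarrow> bool" where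
  "repro L \<Xi> \<alpha> z \<rho> \<Gamma> \<longleftrightarrow> finite \<Xi> \<and> (\<Sum>\<xi>\<in>\<Xi>. \<bar>\<alpha> \<xi>\<bar>) \<le> \<Gamma> \<and> (\<forall>\<xi>\<in>\<Xi>. \<alpha> \<xi> \<noteq> 0 \<longrightarrow> norm (z - \<xi>) \<le> \<rho>) \<and>
     (\<forall>p. polynomial_deg_le L p \<longrightarrow> (\<Sum>\<xi>\<in>\<Xi>. \<alpha> \<xi> * p \<xi>) = p z)"

lemma reproD:
  assumes "repro L \<Xi> \<alpha> z \<rho> \<Gamma>"
  shows "finite \<Xi>" "(\<Sum>\<xi>\<in>\<Xi>. \<bar>\<alpha> \<xi>\<bar>) \<le> \<Gamma>" "\<And>\<xi>. \<xi> \<in> \<Xi> \<Longrightarrow> \<alpha> \<xi> \<noteq> 0 \<Longrightarrow> norm (z - \<xi>) \<le> \<rho>"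
    "\<And>p. polynomial_deg_le L p \<Longrightarrow> (\<Sum>\<xi>\<in>\<Xi>. \<alpha> \<xi> * p \<xi>) = p z" "0 \<le> \<Gamma>"
proof -
  show "finite \<Xi>" "(\<Sum>\<xi>\<in>\<Xi>. \<bar>\<alpha> \<xi>\<bar>) \<le> \<Gamma>" "\<And>\<xi>. \<xi> \<in> \<Xi> \<Longrightarrow> \<alpha> \<xi> \<noteq> 0 \<Longrightarrow> norm (z - \<xi>) \<le> \<rho>"
    "\<And>p. polynomial_deg_le L p \<Longrightarrow> (\<Sum>\<xi>\<in>\<Xi>. \<alpha> \<xi> * p \<xi>) = p z"
    using assms unfolding repro_def by blast+
  moreover have "0 \<le> (\<Sum>\<xi>\<in>\<Xi>. \<bar>\<alpha> \<xi>\<bar>)" by (simp add: sum_nonneg)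
  ultimately show "0 \<le> \<Gamma>" by linarith
qed

text \<open>The weights reproduce \<open>P\<close> exactly, so only the deviation of
  \<open>G\<close> from \<open>P\<close> at nodes of nonzero weight is summed, and the l1 norm of
  the weights is at most \<Gamma>.\<close>

lemma reproduction_error:
  assumes rp: "repro L \<Xi> \<alpha> z \<rho> \<Gamma>" and P: "polynomial_deg_le L P" "P z = v"
    and err: "\<And>\<xi>. \<xi> \<in> \<Xi> \<Longrightarrow> \<alpha> \<xi> \<noteq> 0 \<Longrightarrow> \<bar>G \<xi> - P \<xi>\<bar> \<le> B" and B: "B \<ge> 0"
  shows "\<bar>v - (\<Sum>\<xi>\<in>\<Xi>. \<alpha> \<xi> * G \<xi>)\<bar> \<le> \<Gamma> * B"
proof -
  have "(\<Sum>\<xi>\<in>\<Xi>. \<alpha> \<xi> * G \<xi>) - v = (\<Sum>\<xi>\<in>\<Xi>. \<alpha> \<xi> * (G \<xi> - P \<xi>))"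
    using reproD(4)[OF rp P(1)] P(2) by (simp add: right_diff_distrib sum_subtractf)
  also have "\<bar>\<dots>\<bar> \<le> (\<Sum>\<xi>\<in>\<Xi>. \<bar>\<alpha> \<xi>\<bar> * B)"
  proof (rule order_trans[OF sum_abs sum_mono])
    fix \<xi> assume "\<xi> \<in> \<Xi>"
    then show "\<bar>\<alpha> \<xi> * (G \<xi> - P \<xi>)\<bar> \<le> \<bar>\<alpha> \<xi>\<bar> * B"
      using err by (cases "\<alpha> \<xi> = 0") (auto simp: abs_mult intro!: mult_left_mono)
  qed
  also have "\<dots> = (\<Sum>\<xi>\<in>\<Xi>. \<bar>\<alpha> \<xi>\<bar>) * B" by (simp add: sum_distrib_right)
  also have "\<dots> \<le> \<Gamma> * B" using reproD(2)[OF rp] B by (rule mult_right_mono)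
  finally show ?thesis by linarith
qed

lemma sum_abs_component_le: "(\<Sum>i\<in>UNIV. \<bar>w $ i\<bar>) \<le> real CARD('n) * norm (w :: real^'n::finite)"
proof -
  have "(\<Sum>i\<in>UNIV. \<bar>w $ i\<bar>) \<le> (\<Sum>i\<in>(UNIV :: 'n set). norm w)"
    by (intro sum_mono component_le_norm_cart)
  then show ?thesis by simp
qed

lemma taylor_poly:
  assumes "N \<le> Suc L"
  shows "polynomial_deg_le L (\<lambda>\<xi>. \<Sum>j<N. dir_deriv j (z - \<xi>) f y / fact j)"
proof (rule polynomial_deg_le_sum)
  fix j assume "j \<in> {..<N}"
  then have "polynomial_deg_le L (\<lambda>\<xi>. (1 / fact j) * dir_deriv j (z - \<xi>) f y)"
    using assms by (intro polynomial_deg_le_cmult polynomial_deg_le_mono[OF polynomial_deg_le_dir_deriv]) auto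
  then show "polynomial_deg_le L (\<lambda>\<xi>. dir_deriv j (z - \<xi>) f y / fact j)" by simp
qed

lemma taylor_poly_at: "0 < N \<Longrightarrow> (\<Sum>j<N. dir_deriv j 0 f y / fact j) = f y"
proof (cases N)
  case (Suc n)
  then show ?thesis by (simp add: sum.lessThan_Suc_shift dir_deriv_zero del: sum.lessThan_Suc)
qed simp

text \<open>The Taylor polynomial of \<open>f\<close> at \<open>x - z\<close> in direction
  \<open>z - \<xi>\<close> is a polynomial in \<xi> with value \<open>f (x - z)\<close> at
  \<open>z\<close>, and the step ends at \<open>x - \<xi>\<close>; after reproduction only the
  remainder of order \<open>N\<close> survives.\<close>

lemma taylor_reproduction:
  fixes f :: "real^'n::finite \<Rightarrow> real"
  assumes rp: "repro L \<Xi> \<alpha> z \<rho> \<Gamma>" and S: "open S" "Ck_on N S f" and N: "0 < N" "N \<le> Suc L"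
    and seg: "\<And>w t. norm w \<le> \<rho> \<Longrightarrow> t \<in> {0..1} \<Longrightarrow> x - z + t *\<^sub>R w \<in> S"
    and bd: "\<And>ks w t. length ks = N \<Longrightarrow> norm w \<le> \<rho> \<Longrightarrow> t \<in> {0..1} \<Longrightarrow> \<bar>foldr partial ks f (x - z + t *\<^sub>R w)\<bar> \<le> M"
    and M: "M \<ge> 0" and \<rho>: "\<rho> \<ge> 0"
  shows "\<bar>f (x - z) - (\<Sum>\<xi>\<in>\<Xi>. \<alpha> \<xi> * f (x - \<xi>))\<bar> \<le> \<Gamma> * ((real CARD('n) * \<rho>) ^ N * M)"
proof (rule reproduction_error[OF rp taylor_poly[OF N(2)]])
  show "(\<Sum>j<N. dir_deriv j (z - z) f (x - z) / fact j) = f (x - z)" using taylor_poly_at[OF N(1)] by simp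
  show "0 \<le> (real CARD('n) * \<rho>) ^ N * M" using M \<rho> by simp
  fix \<xi> assume "\<xi> \<in> \<Xi>" "\<alpha> \<xi> \<noteq> 0"
  then have w: "norm (z - \<xi>) \<le> \<rho>" by (rule reproD(3)[OF rp])
  obtain t where t: "0 \<le> t" "t \<le> 1" and eq: "f (x - z + (z - \<xi>)) = (\<Sum>j<N. dir_deriv j (z - \<xi>) f (x - z) / fact j) + dir_deriv N (z - \<xi>) f (x - z + t *\<^sub>R (z - \<xi>)) / fact N"
    using Ck_on_taylor[OF S, of "x - z" "z - \<xi>"] seg[OF w] by auto
  have "\<bar>dir_deriv N (z - \<xi>) f (x - z + t *\<^sub>R (z - \<xi>)) / fact N\<bar> \<le> \<bar>dir_deriv N (z - \<xi>) f (x - z + t *\<^sub>R (z - \<xi>))\<bar> / 1"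
    unfolding abs_divide by (intro divide_left_mono) (auto simp: fact_ge_1)
  also have "\<dots> \<le> (\<Sum>i\<in>UNIV. \<bar>(z - \<xi>) $ i\<bar>) ^ N * M"
    using dir_deriv_bound[of N f "x - z + t *\<^sub>R (z - \<xi>)" M "z - \<xi>"] bd[OF _ w] t by simp
  also have "\<dots> \<le> (real CARD('n) * \<rho>) ^ N * M"
  proof (intro mult_right_mono power_mono M)
    have "real CARD('n) * norm (z - \<xi>) \<le> real CARD('n) * \<rho>" using w by (intro mult_left_mono) auto
    then show "(\<Sum>i\<in>UNIV. \<bar>(z - \<xi>) $ i\<bar>) \<le> real CARD('n) * \<rho>" using sum_abs_component_le[of "z - \<xi>"] by linarith
  qed (simp add: sum_nonneg)
  finally show "\<bar>f (x - \<xi>) - (\<Sum>j<N. dir_deriv j (z - \<xi>) f (x - z) / fact j)\<bar> \<le> (real CARD('n) * \<rho>) ^ N * M"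
    using eq by simp
qed

lemma dir_deriv_diff_bound:
  assumes "\<And>ks. length ks = N \<Longrightarrow> \<bar>foldr partial ks f x - foldr partial ks f y\<bar> \<le> B"
  shows "\<bar>dir_deriv N w f x - dir_deriv N w f y\<bar> \<le> (\<Sum>i\<in>UNIV. \<bar>w $ i\<bar>) ^ N * B"
  using assms
proof (induction N arbitrary: f)
  case 0
  then show ?case using 0[of "[]"] by simp
next
  case (Suc N)
  have "dir_deriv (Suc N) w f x - dir_deriv (Suc N) w f y = (\<Sum>i\<in>UNIV. w $ i * (dir_deriv N w (partial i f) x - dir_deriv N w (partial i f) y))"
    by (simp add: right_diff_distrib sum_subtractf)
  also have "\<bar>\<dots>\<bar> \<le> (\<Sum>i\<in>UNIV. \<bar>w $ i\<bar> * ((\<Sum>i\<in>UNIV. \<bar>w $ i\<bar>) ^ N * B))"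
  proof (rule order_trans[OF sum_abs sum_mono])
    fix i
    have "\<bar>dir_deriv N w (partial i f) x - dir_deriv N w (partial i f) y\<bar> \<le> (\<Sum>i\<in>UNIV. \<bar>w $ i\<bar>) ^ N * B"
    proof (rule Suc.IH)
      fix ks :: "'a list" assume "length ks = N"
      then show "\<bar>foldr partial ks (partial i f) x - foldr partial ks (partial i f) y\<bar> \<le> B" using Suc.prems[of "ks @ [i]"] by simp
    qed
    then show "\<bar>w $ i * (dir_deriv N w (partial i f) x - dir_deriv N w (partial i f) y)\<bar> \<le> \<bar>w $ i\<bar> * ((\<Sum>i\<in>UNIV. \<bar>w $ i\<bar>) ^ N * B)"
      by (simp add: abs_mult mult_left_mono)
  qed
  also have "\<dots> = (\<Sum>i\<in>UNIV. \<bar>w $ i\<bar>) ^ Suc N * B"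
    by (simp add: sum_distrib_right mult.assoc)
  finally show ?case .
qed

text \<open>Here the polynomial includes the term of order \<open>N\<close>, frozen at
  \<open>x - z\<close>. The remainder is then an oscillation of the derivatives of order
  \<open>N\<close>, so a Lipschitz bound can replace derivatives of order
  \<open>N + 1\<close>.\<close>

lemma taylor_reproduction_diff:
  fixes f :: "real^'n::finite \<Rightarrow> real"
  assumes rp: "repro L \<Xi> \<alpha> z \<rho> \<Gamma>" and S: "open S" "Ck_on N S f" and N: "N \<le> L"
    and seg: "\<And>w t. norm w \<le> \<rho> \<Longrightarrow> t \<in> {0..1} \<Longrightarrow> x - z + t *\<^sub>R w \<in> S"
    and bd: "\<And>ks w. length ks = N \<Longrightarrow> norm w \<le> \<rho> \<Longrightarrow> \<bar>foldr partial ks f (x - z + w) - foldr partial ks f (x - z)\<bar> \<le> M"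
    and M: "M \<ge> 0" and \<rho>: "\<rho> \<ge> 0"
  shows "\<bar>f (x - z) - (\<Sum>\<xi>\<in>\<Xi>. \<alpha> \<xi> * f (x - \<xi>))\<bar> \<le> \<Gamma> * ((real CARD('n) * \<rho>) ^ N * M)"
proof (rule reproduction_error[OF rp taylor_poly[of "Suc N"]])
  show "Suc N \<le> Suc L" using N by simp
  show "(\<Sum>j<Suc N. dir_deriv j (z - z) f (x - z) / fact j) = f (x - z)" using taylor_poly_at[of "Suc N"] by simp
  show "0 \<le> (real CARD('n) * \<rho>) ^ N * M" using M \<rho> by simp
  fix \<xi> assume "\<xi> \<in> \<Xi>" "\<alpha> \<xi> \<noteq> 0"
  then have w: "norm (z - \<xi>) \<le> \<rho>" by (rule reproD(3)[OF rp])
  let ?D = "dir_deriv N (z - \<xi>) f"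
  obtain t where t: "0 \<le> t" "t \<le> 1" and eq: "f (x - z + (z - \<xi>)) = (\<Sum>j<N. dir_deriv j (z - \<xi>) f (x - z) / fact j) + ?D (x - z + t *\<^sub>R (z - \<xi>)) / fact N"
    using Ck_on_taylor[OF S, of "x - z" "z - \<xi>"] seg[OF w] by auto
  have "norm (t *\<^sub>R (z - \<xi>)) \<le> 1 * \<rho>" unfolding norm_scaleR using t w by (intro mult_mono) auto
  then have tw: "norm (t *\<^sub>R (z - \<xi>)) \<le> \<rho>" by simp
  have "\<bar>(?D (x - z + t *\<^sub>R (z - \<xi>)) - ?D (x - z)) / fact N\<bar> \<le> \<bar>?D (x - z + t *\<^sub>R (z - \<xi>)) - ?D (x - z)\<bar> / 1"
    unfolding abs_divide by (intro divide_left_mono) (auto simp: fact_ge_1)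
  also have "\<dots> \<le> (\<Sum>i\<in>UNIV. \<bar>(z - \<xi>) $ i\<bar>) ^ N * M"
    using dir_deriv_diff_bound[of N f "x - z + t *\<^sub>R (z - \<xi>)" "x - z" M "z - \<xi>"] bd[OF _ tw] by simp
  also have "\<dots> \<le> (real CARD('n) * \<rho>) ^ N * M"
  proof (intro mult_right_mono power_mono M)
    have "real CARD('n) * norm (z - \<xi>) \<le> real CARD('n) * \<rho>" using w by (intro mult_left_mono) auto
    then show "(\<Sum>i\<in>UNIV. \<bar>(z - \<xi>) $ i\<bar>) \<le> real CARD('n) * \<rho>" using sum_abs_component_le[of "z - \<xi>"] by linarith
  qed (simp add: sum_nonneg)
  finally show "\<bar>f (x - \<xi>) - (\<Sum>j<Suc N. dir_deriv j (z - \<xi>) f (x - z) / fact j)\<bar> \<le> (real CARD('n) * \<rho>) ^ N * M"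
    using eq by (simp add: diff_divide_distrib)
qed

lemma norm_segment_bounds:
  assumes "norm (w :: 'a::real_normed_vector) \<le> \<rho>" "t \<in> {0..1}"
  shows "norm (y + t *\<^sub>R w) \<le> norm y + \<rho>" "norm y - \<rho> \<le> norm (y + t *\<^sub>R w)"
proof -
  have "norm (t *\<^sub>R w) \<le> 1 * \<rho>" unfolding norm_scaleR using assms by (intro mult_mono) auto
  then have tw: "norm (t *\<^sub>R w) \<le> \<rho>" by simp
  show "norm (y + t *\<^sub>R w) \<le> norm y + \<rho>" using norm_triangle_ineq[of y "t *\<^sub>R w"] tw by linarith
  show "norm y - \<rho> \<le> norm (y + t *\<^sub>R w)" using norm_diff_ineq[of y "t *\<^sub>R w"] tw by linarith
qed

section \<open>Bounds for the error kernel at scale \<open>h\<close>\<close>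

context kernel_order
begin

text \<open>Covers the part of the kernel where reproduction is effective: the smooth part near the
  origin, the tail outside radius \<open>2 * K * h\<close>, and the shell around the sphere. The
  exponents are such that each summand has integral at most O(h^(s+d-q)).\<close>

definition majorant :: "real \<Rightarrow> nat \<Rightarrow> real \<Rightarrow> real \<Rightarrow> real^'n \<Rightarrow> real" where
  "majorant K q A h y = A * h powr (s + real CARD('n) - q) * indicator (ball 0 (r0 / 2)) y
     + A * h powr (L - q - \<epsilon>) * (norm y powr (- (L - s - \<epsilon>)) * indicator (- ball 0 (2 * K * h)) y)
     + A * h powr (real k0 + 1 - q) * indicator {y. r0 - K * h \<le> norm y \<and> norm y \<le> r0 + K * h} y"

text \<open>A bound for the singular part itself, without cancellation. Radius
  \<open>3 * K * h\<close> covers \<open>x - z\<close> of norm below \<open>2 * K * h\<close> and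
  also \<open>x - \<xi>\<close> for nodes within \<open>K * h\<close> of \<open>z\<close>.\<close>

definition near_fun :: "real \<Rightarrow> nat \<Rightarrow> real \<Rightarrow> real \<Rightarrow> real^'n \<Rightarrow> real" where
  "near_fun K q A h y = A * h powr \<epsilon> * norm y powr (s - q - \<epsilon>) * indicator (cball 0 (3 * K * h)) y"

context
  fixes K \<Gamma> :: real and js :: "'n list"
  assumes K: "K > 0" and \<Gamma>: "\<Gamma> > 0" and js: "length js \<le> m"
begin

lemma js_lt_L: "length js < L" using js m_le by simp

lemma smooth_part_bound:
  "\<exists>A\<ge>0. \<forall>h w \<Xi> \<alpha> x z. 0 < h \<longrightarrow> h \<le> 1 \<longrightarrow> 8 * (K * h) \<le> r0 \<longrightarrow>
     deriv_bound L (ball 0 r0) (\<lambda>_. 1) (\<lambda>_. Cs * (1 + \<bar>ln h\<bar>)) w \<longrightarrow> repro L \<Xi> \<alpha> z (K * h) \<Gamma> \<longrightarrow> norm (x - z) < r0 / 2 \<longrightarrow>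
     \<bar>foldr partial js w (x - z) - (\<Sum>\<xi>\<in>\<Xi>. \<alpha> \<xi> * foldr partial js w (x - \<xi>))\<bar> \<le> A * h powr (s + real CARD('n) - length js)"
proof -
  \<comment> \<open>\<delta> is the surplus of \<open>L\<close>: Taylor's formula gains h^(L-q), of
    which h^\<delta> is spent on \<open>ln h\<close>, leaving h^(s+d-q).\<close>
  define \<delta> where "\<delta> = real L - s - real CARD('n)"
  have "\<delta> > 0" using L_gt by (simp add: \<delta>_def)
  then obtain C where C: "C \<ge> 0" "\<And>t. 0 < t \<Longrightarrow> t \<le> 1 \<Longrightarrow> 1 + \<bar>ln t\<bar> \<le> C * t powr (- \<delta>)"
    using one_plus_abs_ln_le[of \<delta> 1] by auto
  define N where "N = L - length js"
  have N: "0 < N" "N \<le> Suc L" "real N = real L - real (length js)" using js_lt_L by (auto simp: N_def)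
  define A where "A = \<Gamma> * ((real CARD('n) * K) ^ N * (Cs * C))"
  have "\<bar>foldr partial js w (x - z) - (\<Sum>\<xi>\<in>\<Xi>. \<alpha> \<xi> * foldr partial js w (x - \<xi>))\<bar> \<le> A * h powr (s + real CARD('n) - length js)"
    if h: "0 < h" "h \<le> 1" "8 * (K * h) \<le> r0" and w: "deriv_bound L (ball 0 r0) (\<lambda>_. 1) (\<lambda>_. Cs * (1 + \<bar>ln h\<bar>)) w"
      and rp: "repro L \<Xi> \<alpha> z (K * h) \<Gamma>" and xz: "norm (x - z) < r0 / 2" for h w \<Xi> \<alpha> x z
  proof -
    have inball: "x - z + t *\<^sub>R v \<in> ball 0 r0" if "norm v \<le> K * h" "t \<in> {0..1}" for v t
      using norm_segment_bounds(1)[OF that, of "x - z"] xz h r0_pos by simp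
    have "\<bar>foldr partial js w (x - z) - (\<Sum>\<xi>\<in>\<Xi>. \<alpha> \<xi> * foldr partial js w (x - \<xi>))\<bar> \<le> \<Gamma> * ((real CARD('n) * (K * h)) ^ N * (Cs * (1 + \<bar>ln h\<bar>)))"
    proof (rule taylor_reproduction[OF rp open_ball _ N(1,2) inball])
      have "N + length js = L" using js_lt_L by (simp add: N_def)
      then show "Ck_on N (ball 0 r0) (foldr partial js w)"
        using deriv_bound_Ck_on[OF w] by (intro Ck_on_foldr_partial) simp
      fix ks :: "'n list" and v :: "real^'n" and t :: real
      assume ks: "length ks = N" and v: "norm v \<le> K * h" "t \<in> {0..1}"
      have "length (ks @ js) \<le> L" using ks js_lt_L by (simp add: N_def)
      from deriv_boundD[OF w this inball[OF v]]
      show "\<bar>foldr partial ks (foldr partial js w) (x - z + t *\<^sub>R v)\<bar> \<le> Cs * (1 + \<bar>ln h\<bar>)" by simp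
    next
      show "0 \<le> Cs * (1 + \<bar>ln h\<bar>)" by (intro mult_nonneg_nonneg Cs_nonneg) simp
    qed (use K h in auto)
    also have "\<dots> \<le> \<Gamma> * ((real CARD('n) * (K * h)) ^ N * (Cs * (C * h powr (- \<delta>))))"
      using C(2)[OF h(1,2)] Cs_nonneg K h \<Gamma> by (intro mult_left_mono) auto
    also have "\<dots> = A * (h ^ N * h powr (- \<delta>))" by (simp add: A_def power_mult_distrib)
    also have "h ^ N * h powr (- \<delta>) = h powr (s + real CARD('n) - length js)"
      using h N(3) by (simp add: powr_realpow[symmetric] powr_add[symmetric] \<delta>_def add.commute)
    finally show ?thesis .
  qed
  moreover have "A \<ge> 0" using C(1) Cs_nonneg K \<Gamma> by (simp add: A_def)
  ultimately show ?thesis by blast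
qed

text \<open>For \<open>norm y\<close> at most a multiple of \<open>h\<close> the logarithm of
  \<open>norm y / h\<close> costs the power -\<epsilon> of that ratio. The factor
  \<open>h powr \<epsilon>\<close> in \<open>near_fun\<close> thus keeps the total homogeneity in
  lengths at s - q.\<close>

lemma singular_near_bound:
  "\<exists>A\<ge>0. \<forall>h g y. 0 < h \<longrightarrow> 8 * (K * h) \<le> r0 \<longrightarrow>
     deriv_bound L (ball 0 r0 - {0}) norm (\<lambda>x. Cs * norm x powr s * (1 + \<bar>ln (norm x / h)\<bar>)) g \<longrightarrow>
     y \<noteq> 0 \<longrightarrow> norm y \<le> 3 * K * h \<longrightarrow> \<bar>foldr partial js g y\<bar> \<le> near_fun K (length js) A h y"
proof -
  obtain C where C: "C \<ge> 0" "\<And>t. 0 < t \<Longrightarrow> t \<le> 3 * K \<Longrightarrow> 1 + \<bar>ln t\<bar> \<le> C * t powr (- \<epsilon>)"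
    using one_plus_abs_ln_le[OF eps_pos, of "3 * K"] K by auto
  have "\<bar>foldr partial js g y\<bar> \<le> near_fun K (length js) (Cs * C) h y"
    if h: "0 < h" "8 * (K * h) \<le> r0" and g: "deriv_bound L (ball 0 r0 - {0}) norm (\<lambda>x. Cs * norm x powr s * (1 + \<bar>ln (norm x / h)\<bar>)) g"
      and y: "y \<noteq> 0" "norm y \<le> 3 * K * h" for h g y
  proof -
    have y0: "norm y > 0" using y by simp
    have "K * h > 0" using K h by simp
    then have yb: "y \<in> ball 0 r0 - {0}" using y h by simp
    have "\<bar>foldr partial js g y\<bar> \<le> Cs * norm y powr s * (1 + \<bar>ln (norm y / h)\<bar>) / norm y ^ length js"
      using js_lt_L by (intro deriv_boundD[OF g _ yb]) simp
    also have "\<dots> \<le> Cs * norm y powr s * (C * (norm y / h) powr (- \<epsilon>)) / norm y ^ length js"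
      using C(2)[of "norm y / h"] y0 y h Cs_nonneg by (intro divide_right_mono mult_left_mono) (auto simp: field_simps)
    also have "\<dots> = (Cs * C) * h powr \<epsilon> * (norm y powr s * norm y powr (- \<epsilon>) / norm y powr real (length js))"
      using y0 h by (simp add: powr_realpow powr_divide powr_minus field_simps)
    also have "norm y powr s * norm y powr (- \<epsilon>) / norm y powr real (length js) = norm y powr (s - length js - \<epsilon>)"
      unfolding powr_add[symmetric] powr_diff[symmetric] by (simp add: algebra_simps)
    finally show ?thesis using y by (simp add: near_fun_def)
  qed
  then show ?thesis using C(1) Cs_nonneg by (intro exI[of _ "Cs * C"]) auto
qed

text \<open>From norm \<open>2 * K * h\<close> on, the whole segment towards a node stays at least
  half as far from 0, where the singular part is \<open>L\<close> times differentiable. The ratio to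
  \<open>h\<close> is at least \<open>K\<close> there, so the logarithm costs only its power
  \<epsilon>.\<close>

lemma singular_far_bound:
  "\<exists>A\<ge>0. \<forall>h g \<Xi> \<alpha> x z. 0 < h \<longrightarrow> 8 * (K * h) \<le> r0 \<longrightarrow>
     deriv_bound L (ball 0 r0 - {0}) norm (\<lambda>x. Cs * norm x powr s * (1 + \<bar>ln (norm x / h)\<bar>)) g \<longrightarrow>
     repro L \<Xi> \<alpha> z (K * h) \<Gamma> \<longrightarrow> norm (x - z) < r0 / 2 \<longrightarrow> 2 * K * h \<le> norm (x - z) \<longrightarrow>
     \<bar>foldr partial js g (x - z) - (\<Sum>\<xi>\<in>\<Xi>. \<alpha> \<xi> * foldr partial js g (x - \<xi>))\<bar>
       \<le> A * h powr (L - length js - \<epsilon>) * norm (x - z) powr (- (L - s - \<epsilon>))"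
proof -
  obtain C where C: "C \<ge> 0" "\<And>t. K \<le> t \<Longrightarrow> 1 + \<bar>ln t\<bar> \<le> C * t powr \<epsilon>"
    using one_plus_abs_ln_ge[OF eps_pos K] by auto
  define N where "N = L - length js"
  have N: "0 < N" "N \<le> Suc L" "real N = real L - real (length js)" "N + length js = L" using js_lt_L by (auto simp: N_def)
  define a where "a = real L - s - \<epsilon>"
  have a: "a > 0" using eps_L s_pos unfolding a_def by (smt (verit) of_nat_0_le_iff)
  define A where "A = \<Gamma> * ((real CARD('n) * K) ^ N * (Cs * C * 2 powr a))"
  have "\<bar>foldr partial js g (x - z) - (\<Sum>\<xi>\<in>\<Xi>. \<alpha> \<xi> * foldr partial js g (x - \<xi>))\<bar> \<le> A * h powr (L - length js - \<epsilon>) * norm (x - z) powr (- a)"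
    if h: "0 < h" "8 * (K * h) \<le> r0" and g: "deriv_bound L (ball 0 r0 - {0}) norm (\<lambda>x. Cs * norm x powr s * (1 + \<bar>ln (norm x / h)\<bar>)) g"
      and rp: "repro L \<Xi> \<alpha> z (K * h) \<Gamma>" and xz: "norm (x - z) < r0 / 2" "2 * K * h \<le> norm (x - z)" for h g \<Xi> \<alpha> x z
  proof -
    let ?y = "x - z"
    have Kh: "K * h > 0" using K h by simp
    have lower: "norm ?y / 2 \<le> norm (?y + t *\<^sub>R v)" "K * h \<le> norm (?y + t *\<^sub>R v)" "?y + t *\<^sub>R v \<in> ball 0 r0 - {0}"
      if "norm v \<le> K * h" "t \<in> {0..1}" for v t
      using norm_segment_bounds[OF that, of ?y] xz h r0_pos Kh by auto
    let ?M = "Cs * C * 2 powr a * (h powr (- \<epsilon>) * norm ?y powr (- a))"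
    have "\<bar>foldr partial js g (x - z) - (\<Sum>\<xi>\<in>\<Xi>. \<alpha> \<xi> * foldr partial js g (x - \<xi>))\<bar> \<le> \<Gamma> * ((real CARD('n) * (K * h)) ^ N * ?M)"
    proof (rule taylor_reproduction[OF rp open_punctured _ N(1,2) lower(3)])
      show "Ck_on N (ball 0 r0 - {0}) (foldr partial js g)"
        using deriv_bound_Ck_on[OF g] N(4) by (intro Ck_on_foldr_partial) simp
      fix ks :: "'n list" and v :: "real^'n" and t :: real
      assume ks: "length ks = N" and v: "norm v \<le> K * h" "t \<in> {0..1}"
      let ?\<eta> = "?y + t *\<^sub>R v"
      have \<eta>0: "norm ?\<eta> > 0" using lower(2)[OF v] Kh by linarith
      have len: "length (ks @ js) = L" using ks N(4) by simp
      have "\<bar>foldr partial (ks @ js) g ?\<eta>\<bar> \<le> Cs * norm ?\<eta> powr s * (1 + \<bar>ln (norm ?\<eta> / h)\<bar>) / norm ?\<eta> ^ L"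
        using deriv_boundD[OF g _ lower(3)[OF v], of "ks @ js"] len by simp
      also have "\<dots> \<le> Cs * norm ?\<eta> powr s * (C * (norm ?\<eta> / h) powr \<epsilon>) / norm ?\<eta> ^ L"
        using C(2)[of "norm ?\<eta> / h"] lower(2)[OF v] h Cs_nonneg
        by (intro divide_right_mono mult_left_mono) (auto simp: field_simps)
      also have "\<dots> = (Cs * C) * h powr (- \<epsilon>) * (norm ?\<eta> powr s * norm ?\<eta> powr \<epsilon> / norm ?\<eta> powr real L)"
        using \<eta>0 h by (simp add: powr_realpow powr_divide powr_minus field_simps)
      also have "norm ?\<eta> powr s * norm ?\<eta> powr \<epsilon> / norm ?\<eta> powr real L = norm ?\<eta> powr (- a)"
        unfolding powr_add[symmetric] powr_diff[symmetric] by (simp add: a_def algebra_simps)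
      also have "(Cs * C) * h powr (- \<epsilon>) * norm ?\<eta> powr (- a) \<le> (Cs * C) * h powr (- \<epsilon>) * (norm ?y / 2) powr (- a)"
        using lower(1)[OF v] a xz Kh C(1) Cs_nonneg by (intro mult_left_mono powr_mono2') auto
      also have "(norm ?y / 2) powr (- a) = 2 powr a * norm ?y powr (- a)"
        by (simp add: powr_divide powr_minus field_simps)
      finally show "\<bar>foldr partial ks (foldr partial js g) ?\<eta>\<bar> \<le> ?M" by (simp add: mult_ac)
    qed (use Cs_nonneg C(1) Kh in auto)
    also have "\<dots> = A * (h ^ N * h powr (- \<epsilon>)) * norm ?y powr (- a)" by (simp add: A_def power_mult_distrib mult_ac)
    also have "h ^ N * h powr (- \<epsilon>) = h powr (L - length js - \<epsilon>)"
      using h N(3) by (simp add: powr_realpow[symmetric] powr_add[symmetric])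
    finally show ?thesis .
  qed
  moreover have "A \<ge> 0" using C(1) Cs_nonneg K \<Gamma> by (simp add: A_def)
  ultimately show ?thesis unfolding a_def by blast
qed

lemma outer_bound:
  "\<exists>A\<ge>0. \<forall>h \<Xi> \<alpha> x z. 0 < h \<longrightarrow> h \<le> 1 \<longrightarrow> 8 * (K * h) \<le> r0 \<longrightarrow>
     repro L \<Xi> \<alpha> z (K * h) \<Gamma> \<longrightarrow> r0 / 2 \<le> norm (x - z) \<longrightarrow> K * h < \<bar>norm (x - z) - r0\<bar> \<longrightarrow>
     \<bar>foldr partial js \<phi> (x - z) - (\<Sum>\<xi>\<in>\<Xi>. \<alpha> \<xi> * foldr partial js \<phi> (x - \<xi>))\<bar>
       \<le> A * h powr (L - length js - \<epsilon>) * norm (x - z) powr (- (L - s - \<epsilon>))"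
proof -
  obtain B where B: "B \<ge> 0" "\<And>js x. length js = L \<Longrightarrow> x \<in> regular_set r0 \<Longrightarrow> r0 / 4 \<le> norm x \<Longrightarrow> \<bar>foldr partial js \<phi> x\<bar> \<le> B * norm x powr (s - real L)"
    using top_order_bound by blast
  define N where "N = L - length js"
  have N: "0 < N" "N \<le> Suc L" "real N = real L - real (length js)" "N + length js = L" using js_lt_L by (auto simp: N_def)
  define A where "A = \<Gamma> * ((real CARD('n) * K) ^ N * (B * 2 powr (L - s) * (r0 / 2) powr (- \<epsilon>)))"
  have sL: "s < real L" using L_gt by (smt (verit) of_nat_0_le_iff)
  have "\<bar>foldr partial js \<phi> (x - z) - (\<Sum>\<xi>\<in>\<Xi>. \<alpha> \<xi> * foldr partial js \<phi> (x - \<xi>))\<bar> \<le> A * h powr (L - length js - \<epsilon>) * norm (x - z) powr (- (L - s - \<epsilon>))"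
    if h: "0 < h" "h \<le> 1" "8 * (K * h) \<le> r0" and rp: "repro L \<Xi> \<alpha> z (K * h) \<Gamma>"
      and xz: "r0 / 2 \<le> norm (x - z)" "K * h < \<bar>norm (x - z) - r0\<bar>" for h \<Xi> \<alpha> x z
  proof -
    let ?y = "x - z"
    have Kh: "K * h > 0" using K h by simp
    have y0: "norm ?y > 0" using xz r0_pos by linarith
    have lower: "norm ?y / 2 \<le> norm (?y + t *\<^sub>R v)" "r0 / 4 \<le> norm (?y + t *\<^sub>R v)" "?y + t *\<^sub>R v \<in> regular_set r0"
      if "norm v \<le> K * h" "t \<in> {0..1}" for v t
    proof -
      note b = norm_segment_bounds[OF that, of ?y]
      show 1: "norm ?y / 2 \<le> norm (?y + t *\<^sub>R v)" and 2: "r0 / 4 \<le> norm (?y + t *\<^sub>R v)"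
        using b xz h by linarith+
      have "norm (?y + t *\<^sub>R v) \<noteq> r0" using b xz(2) by linarith
      moreover have "?y + t *\<^sub>R v \<noteq> 0" using 2 r0_pos by auto
      ultimately show "?y + t *\<^sub>R v \<in> regular_set r0" by (simp add: regular_set_def)
    qed
    let ?M = "B * 2 powr (L - s) * (norm ?y powr (s - L))"
    have "\<bar>foldr partial js \<phi> (x - z) - (\<Sum>\<xi>\<in>\<Xi>. \<alpha> \<xi> * foldr partial js \<phi> (x - \<xi>))\<bar> \<le> \<Gamma> * ((real CARD('n) * (K * h)) ^ N * ?M)"
    proof (rule taylor_reproduction[OF rp open_regular_set _ N(1,2) lower(3)])
      show "Ck_on N (regular_set r0) (foldr partial js \<phi>)"
        using CkL N(4) by (intro Ck_on_foldr_partial) simp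
      fix ks :: "'n list" and v :: "real^'n" and t :: real
      assume ks: "length ks = N" and v: "norm v \<le> K * h" "t \<in> {0..1}"
      let ?\<eta> = "?y + t *\<^sub>R v"
      have "\<bar>foldr partial (ks @ js) \<phi> ?\<eta>\<bar> \<le> B * norm ?\<eta> powr (s - real L)"
        using ks N(4) lower[OF v] by (intro B(2)) auto
      also have "\<dots> \<le> B * (norm ?y / 2) powr (s - real L)"
        using lower(1)[OF v] y0 sL B(1) by (intro mult_left_mono powr_mono2') auto
      also have "(norm ?y / 2) powr (s - real L) = 2 powr (L - s) * norm ?y powr (s - L)"
        by (simp add: powr_divide powr_diff field_simps)
      finally show "\<bar>foldr partial ks (foldr partial js \<phi>) ?\<eta>\<bar> \<le> ?M" by (simp add: mult_ac)
    qed (use B(1) Kh in auto)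
    \<comment> \<open>No logarithm occurs in this range; the factors with exponent -\<epsilon> are
      inserted, using \<open>h \<le> 1\<close> and \<open>r0 / 2 \<le> norm (x - z)\<close>, to
      match the tail of \<open>majorant\<close>.\<close>
    also have "\<dots> \<le> \<Gamma> * ((real CARD('n) * (K * h)) ^ N * (B * 2 powr (L - s) * (norm ?y powr (- (L - s - \<epsilon>)) * (r0 / 2) powr (- \<epsilon>) * h powr (- \<epsilon>))))"
    proof -
      have "norm ?y powr (s - L) = norm ?y powr (- (L - s - \<epsilon>)) * norm ?y powr (- \<epsilon>)"
        by (simp add: powr_add[symmetric])
      also have "\<dots> \<le> norm ?y powr (- (L - s - \<epsilon>)) * (r0 / 2) powr (- \<epsilon>)"
        using xz r0_pos eps_pos by (intro mult_left_mono powr_mono2') auto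
      also have "\<dots> \<le> norm ?y powr (- (L - s - \<epsilon>)) * (r0 / 2) powr (- \<epsilon>) * h powr (- \<epsilon>)"
      proof -
        have "1 powr (- \<epsilon>) \<le> h powr (- \<epsilon>)" using h eps_pos by (intro powr_mono2') auto
        then have "1 \<le> h powr (- \<epsilon>)" by simp
        from mult_left_mono[OF this, of "norm ?y powr (- (L - s - \<epsilon>)) * (r0 / 2) powr (- \<epsilon>)"] show ?thesis by simp
      qed
      finally show ?thesis using \<Gamma> Kh B(1) by (intro mult_left_mono) auto
    qed
    also have "\<dots> = A * (h ^ N * h powr (- \<epsilon>)) * norm ?y powr (- (L - s - \<epsilon>))" by (simp add: A_def power_mult_distrib mult_ac)
    also have "h ^ N * h powr (- \<epsilon>) = h powr (L - length js - \<epsilon>)"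
      using h N(3) by (simp add: powr_realpow[symmetric] powr_add[symmetric])
    finally show ?thesis .
  qed
  moreover have "A \<ge> 0" using B(1) K \<Gamma> by (simp add: A_def)
  ultimately show ?thesis by blast
qed

text \<open>Up to order \<open>k0\<close> the expansion stops at order \<open>k0\<close>, and the
  Lipschitz bound supplies one more power of \<open>h\<close>. At order \<open>k0 + 1\<close> there
  is nothing to expand: the derivatives are bounded on both sides of the sphere, and the exponent of
  \<open>h\<close> is 0.\<close>

lemma shell_bound:
  "\<exists>A\<ge>0. \<forall>h \<Xi> \<alpha> x z. 0 < h \<longrightarrow> 8 * (K * h) \<le> r0 \<longrightarrow>
     repro L \<Xi> \<alpha> z (K * h) \<Gamma> \<longrightarrow> \<bar>norm (x - z) - r0\<bar> \<le> K * h \<longrightarrow>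
     x - z \<in> regular_set r0 \<longrightarrow> (\<forall>\<xi>\<in>\<Xi>. x - \<xi> \<in> regular_set r0) \<longrightarrow>
     \<bar>foldr partial js \<phi> (x - z) - (\<Sum>\<xi>\<in>\<Xi>. \<alpha> \<xi> * foldr partial js \<phi> (x - \<xi>))\<bar> \<le> A * h powr (real k0 + 1 - length js)"
proof (cases "length js \<le> k0")
  case True
  obtain B where B: "B \<ge> 0" "\<And>js y w. length js = k0 \<Longrightarrow> (\<forall>t\<in>{0..1}. r0 / 4 \<le> norm (y + t *\<^sub>R w) \<and> norm (y + t *\<^sub>R w) \<le> 2 * r0) \<Longrightarrow>
     \<bar>foldr partial js \<phi> (y + w) - foldr partial js \<phi> y\<bar> \<le> B * norm w"
    using shell_lipschitz[of "2 * r0"] by blast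
  define N where "N = k0 - length js"
  have N: "N \<le> L" "N + length js = k0" "real N + 1 = real k0 + 1 - real (length js)" using True k0_bounds(3) by (auto simp: N_def)
  define A where "A = \<Gamma> * ((real CARD('n) * K) ^ N * (B * K))"
  have "\<bar>foldr partial js \<phi> (x - z) - (\<Sum>\<xi>\<in>\<Xi>. \<alpha> \<xi> * foldr partial js \<phi> (x - \<xi>))\<bar> \<le> A * h powr (real k0 + 1 - length js)"
    if h: "0 < h" "8 * (K * h) \<le> r0" and rp: "repro L \<Xi> \<alpha> z (K * h) \<Gamma>" and xz: "\<bar>norm (x - z) - r0\<bar> \<le> K * h" for h \<Xi> \<alpha> x z
  proof -
    let ?y = "x - z"
    have Kh: "K * h > 0" using K h by simp
    have lower: "r0 / 4 \<le> norm (?y + t *\<^sub>R v)" "norm (?y + t *\<^sub>R v) \<le> 2 * r0" "?y + t *\<^sub>R v \<in> - {0}"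
      if "norm v \<le> K * h" "t \<in> {0..1}" for v t
    proof -
      note b = norm_segment_bounds[OF that, of ?y]
      show 1: "r0 / 4 \<le> norm (?y + t *\<^sub>R v)" and "norm (?y + t *\<^sub>R v) \<le> 2 * r0"
        using b xz h r0_pos by linarith+
      show "?y + t *\<^sub>R v \<in> - {0}" using 1 r0_pos by auto
    qed
    have "\<bar>foldr partial js \<phi> (x - z) - (\<Sum>\<xi>\<in>\<Xi>. \<alpha> \<xi> * foldr partial js \<phi> (x - \<xi>))\<bar> \<le> \<Gamma> * ((real CARD('n) * (K * h)) ^ N * (B * (K * h)))"
    proof (rule taylor_reproduction_diff[OF rp _ _ N(1) lower(3)])
      show "open (- {0 :: real^'n})" by (simp add: open_Compl)
      show "Ck_on N (- {0}) (foldr partial js \<phi>)"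
        using Ck0 N(2) by (intro Ck_on_foldr_partial) simp
      fix ks :: "'n list" and v :: "real^'n"
      assume ks: "length ks = N" and v: "norm v \<le> K * h"
      have "\<bar>foldr partial (ks @ js) \<phi> (?y + v) - foldr partial (ks @ js) \<phi> ?y\<bar> \<le> B * norm v"
        using ks N(2) lower(1,2)[OF v] by (intro B(2)) auto
      also have "\<dots> \<le> B * (K * h)" using v B(1) by (rule mult_left_mono)
      finally show "\<bar>foldr partial ks (foldr partial js \<phi>) (?y + v) - foldr partial ks (foldr partial js \<phi>) ?y\<bar> \<le> B * (K * h)" by simp
    qed (use B(1) Kh in auto)
    also have "\<dots> = A * (h ^ N * h powr 1)" using h by (simp add: A_def power_mult_distrib mult_ac)
    also have "h ^ N * h powr 1 = h powr (real k0 + 1 - length js)"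
      unfolding N(3)[symmetric] using h by (subst powr_realpow[symmetric]) (auto simp: powr_add)
    finally show ?thesis .
  qed
  moreover have "A \<ge> 0" using B(1) K \<Gamma> by (simp add: A_def)
  ultimately show ?thesis by blast
next
  case False
  then have lq: "length js = k0 + 1" using js m_le by simp
  have "length js \<le> L" using js_lt_L by simp
  from annulus_bound[OF this, of "2 * r0"]
  obtain B where B: "B \<ge> 0" "\<And>ks x. length ks = length js \<Longrightarrow> x \<in> regular_set r0 \<Longrightarrow> r0 / 4 \<le> norm x \<Longrightarrow> norm x \<le> 2 * r0 \<Longrightarrow> \<bar>foldr partial ks \<phi> x\<bar> \<le> B"
    by blast
  have "\<bar>foldr partial js \<phi> (x - z) - (\<Sum>\<xi>\<in>\<Xi>. \<alpha> \<xi> * foldr partial js \<phi> (x - \<xi>))\<bar> \<le> (B + \<Gamma> * B) * h powr (real k0 + 1 - length js)"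
    if h: "0 < h" "8 * (K * h) \<le> r0" and rp: "repro L \<Xi> \<alpha> z (K * h) \<Gamma>" and xz: "\<bar>norm (x - z) - r0\<bar> \<le> K * h"
      and reg: "x - z \<in> regular_set r0" "\<forall>\<xi>\<in>\<Xi>. x - \<xi> \<in> regular_set r0" for h \<Xi> \<alpha> x z
  proof -
    have 1: "\<bar>foldr partial js \<phi> (x - z)\<bar> \<le> B" using reg xz h r0_pos by (intro B(2)) auto
    have "\<bar>\<Sum>\<xi>\<in>\<Xi>. \<alpha> \<xi> * foldr partial js \<phi> (x - \<xi>)\<bar> \<le> (\<Sum>\<xi>\<in>\<Xi>. \<bar>\<alpha> \<xi>\<bar> * B)"
    proof (rule order_trans[OF sum_abs sum_mono])
      fix \<xi> assume \<xi>: "\<xi> \<in> \<Xi>"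
      show "\<bar>\<alpha> \<xi> * foldr partial js \<phi> (x - \<xi>)\<bar> \<le> \<bar>\<alpha> \<xi>\<bar> * B"
      proof (cases "\<alpha> \<xi> = 0")
        case False
        have "norm (z - \<xi>) \<le> K * h" using reproD(3)[OF rp \<xi> False] .
        from norm_segment_bounds[OF this, of 1 "x - z"] have "\<bar>foldr partial js \<phi> (x - \<xi>)\<bar> \<le> B"
          using reg(2) \<xi> xz h r0_pos by (intro B(2)) auto
        then show ?thesis by (simp add: abs_mult mult_left_mono)
      qed simp
    qed
    also have "\<dots> = (\<Sum>\<xi>\<in>\<Xi>. \<bar>\<alpha> \<xi>\<bar>) * B" by (simp add: sum_distrib_right)
    also have "\<dots> \<le> \<Gamma> * B" using reproD(2)[OF rp] B(1) by (rule mult_right_mono)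
    finally have "\<bar>foldr partial js \<phi> (x - z) - (\<Sum>\<xi>\<in>\<Xi>. \<alpha> \<xi> * foldr partial js \<phi> (x - \<xi>))\<bar> \<le> B + \<Gamma> * B" using 1 by linarith
    then show ?thesis using lq h by simp
  qed
  moreover have "B + \<Gamma> * B \<ge> 0" using B(1) \<Gamma> by simp
  ultimately show ?thesis by blast
qed

end

end

section \<open>Norms of the majorants and the L2 estimate of the error\<close>

lemma ball_in_borel [measurable]: "ball (c :: 'a::euclidean_space) r \<in> sets borel"
  by (intro borel_open open_ball)

lemma power_diff_le:
  fixes a b M :: real
  assumes "0 \<le> b" "b \<le> a" "a \<le> M" "1 \<le> M"
  shows "a ^ n - b ^ n \<le> real n * (a - b) * M ^ n"
proof (induction n)
  case (Suc n)
  have "a ^ Suc n - b ^ Suc n = a * (a ^ n - b ^ n) + b ^ n * (a - b)" by (simp add: algebra_simps)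
  also have "\<dots> \<le> M * (real n * (a - b) * M ^ n) + M ^ Suc n * (a - b)"
  proof (intro add_mono mult_mono mult_right_mono Suc.IH assms)
    have "b ^ n \<le> M ^ n" using assms by (intro power_mono) auto
    also have "\<dots> \<le> M ^ Suc n" using assms by (intro power_increasing) auto
    finally show "b ^ n \<le> M ^ Suc n" .
    show "0 \<le> a ^ n - b ^ n" using assms by (simp add: power_mono)
  qed (use assms in auto)
  also have "\<dots> = real (Suc n) * (a - b) * M ^ Suc n" by (simp add: algebra_simps)
  finally show ?case .
qed simp

lemma emeasure_shell_le:
  assumes r: "r > 0" "0 < \<rho>" "\<rho> \<le> r"
  shows "emeasure lborel {y :: real^'n::finite. r - \<rho> \<le> norm y \<and> norm y \<le> r + \<rho>}
    \<le> ennreal (unit_ball_vol (CARD('n)) * real CARD('n) * 2 * (max 1 (2 * r)) ^ CARD('n) * \<rho>)"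
proof -
  have "{y :: real^'n. r - \<rho> \<le> norm y \<and> norm y \<le> r + \<rho>} = cball 0 (r + \<rho>) - ball 0 (r - \<rho>)" by auto
  also have "emeasure lborel \<dots> = emeasure lborel (cball (0 :: real^'n) (r + \<rho>)) - emeasure lborel (ball (0 :: real^'n) (r - \<rho>))"
    using r by (intro emeasure_Diff) (auto simp: emeasure_ball)
  also have "\<dots> = ennreal (unit_ball_vol (CARD('n)) * (r + \<rho>) ^ CARD('n)) - ennreal (unit_ball_vol (CARD('n)) * (r - \<rho>) ^ CARD('n))"
    using r by (simp add: emeasure_ball emeasure_cball)
  also have "\<dots> = ennreal (unit_ball_vol (CARD('n)) * (r + \<rho>) ^ CARD('n) - unit_ball_vol (CARD('n)) * (r - \<rho>) ^ CARD('n))"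
    using r by (intro ennreal_minus) auto
  also have "\<dots> \<le> ennreal (unit_ball_vol (CARD('n)) * (real CARD('n) * ((r + \<rho>) - (r - \<rho>)) * (max 1 (2 * r)) ^ CARD('n)))"
    unfolding right_diff_distrib[symmetric]
    by (intro ennreal_leI mult_left_mono power_diff_le) (use r in auto)
  finally show ?thesis by (simp add: mult_ac)
qed

lemma ennreal_square_add_le: "(a + b :: ennreal)\<^sup>2 \<le> 2 * a\<^sup>2 + 2 * b\<^sup>2"
proof (cases a)
  case a: (real r)
  show ?thesis
  proof (cases b)
    case b: (real t)
    have "(r + t)\<^sup>2 \<le> 2 * r\<^sup>2 + 2 * t\<^sup>2" using sum_squares_bound[of r t] by (simp add: power2_sum)
    then have "ennreal ((r + t)\<^sup>2) \<le> ennreal (2 * r\<^sup>2 + 2 * t\<^sup>2)" by (rule ennreal_leI)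
    then show ?thesis using a b by (simp add: ennreal_power[symmetric] ennreal_plus ennreal_mult)
  qed (simp add: ennreal_mult_top power2_eq_square)
qed (simp add: ennreal_mult_top power2_eq_square)

text \<open>Cauchy-Schwarz for the measure with mass 1 at \<open>g0\<close> and mass
  \<open>c i\<close> at \<open>g i\<close>, whose total mass is at most 1 + \<Gamma>.\<close>

lemma weighted_square_le:
  fixes c g :: "'a \<Rightarrow> real"
  assumes c: "\<And>i. i \<in> I \<Longrightarrow> 0 \<le> c i" and S: "(\<Sum>i\<in>I. c i) \<le> \<Gamma>" and \<Gamma>: "\<Gamma> > 0"
  shows "(g0 + (\<Sum>i\<in>I. c i * g i))\<^sup>2 \<le> (1 + \<Gamma>) * (g0\<^sup>2 + (\<Sum>i\<in>I. c i * (g i)\<^sup>2))"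
proof -
  let ?T = "\<Sum>i\<in>I. c i * g i" and ?Q = "\<Sum>i\<in>I. c i * (g i)\<^sup>2"
  have Q: "?Q \<ge> 0" using c by (intro sum_nonneg) auto
  have "?T\<^sup>2 = (\<Sum>i\<in>I. sqrt (c i) * (sqrt (c i) * g i))\<^sup>2"
    using c by (intro arg_cong[of _ _ "\<lambda>t. t\<^sup>2"] sum.cong) (auto simp: mult.assoc[symmetric])
  also have "\<dots> \<le> (\<Sum>i\<in>I. (sqrt (c i))\<^sup>2) * (\<Sum>i\<in>I. (sqrt (c i) * g i)\<^sup>2)" by (rule Cauchy_Schwarz_ineq_sum)
  also have "\<dots> = (\<Sum>i\<in>I. c i) * ?Q" using c by (simp add: power_mult_distrib)
  also have "\<dots> \<le> \<Gamma> * ?Q" using S Q by (rule mult_right_mono)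
  finally have T: "?T\<^sup>2 \<le> \<Gamma> * ?Q" .
  \<comment> \<open>Young's inequality with weight \<Gamma> on the cross term, which produces
    exactly the constant 1 + \<Gamma>.\<close>
  have "2 * (\<Gamma> * g0) * ?T \<le> (\<Gamma> * g0)\<^sup>2 + ?T\<^sup>2" by (rule sum_squares_bound)
  also have "\<dots> \<le> \<Gamma> * (\<Gamma> * g0\<^sup>2 + ?Q)" using T by (simp add: power_mult_distrib power2_eq_square algebra_simps)
  finally have "\<Gamma> * (2 * g0 * ?T) \<le> \<Gamma> * (\<Gamma> * g0\<^sup>2 + ?Q)" by (simp add: mult_ac)
  then have "2 * g0 * ?T \<le> \<Gamma> * g0\<^sup>2 + ?Q" using \<Gamma> by simp
  then show ?thesis using T by (simp add: power2_sum algebra_simps)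
qed

context kernel_order
begin

lemma majorant_measurable [measurable]: "majorant K q A h \<in> borel_measurable borel"
proof -
  have p: "(\<lambda>y :: real^'n. norm y powr (- (L - s - \<epsilon>))) \<in> borel_measurable borel"
    by measurable
  have "majorant K q A h = (\<lambda>y. A * h powr (s + real CARD('n) - q) * indicator (ball 0 (r0 / 2)) y
     + A * h powr (L - q - \<epsilon>) * (norm y powr (- (L - s - \<epsilon>)) * indicator (- ball 0 (2 * K * h)) y)
     + A * h powr (real k0 + 1 - q) * indicator {y. r0 - K * h \<le> norm y \<and> norm y \<le> r0 + K * h} y)"
    by (rule ext) (rule majorant_def)
  moreover have "\<dots> \<in> borel_measurable borel"
    by (intro borel_measurable_add borel_measurable_times borel_measurable_const borel_measurable_indicator p
        borel_open borel_closed closed_Compl closed_Collect_conj closed_Collect_le continuous_intros open_ball)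
  ultimately show ?thesis by (simp only:)
qed

lemma near_fun_measurable [measurable]: "near_fun K q A h \<in> borel_measurable borel"
proof -
  have "near_fun K q A h = (\<lambda>y. A * h powr \<epsilon> * norm y powr (s - q - \<epsilon>) * indicator (cball 0 (3 * K * h)) y)"
    by (rule ext) (rule near_fun_def)
  moreover have "\<dots> \<in> borel_measurable borel"
  proof -
    have "(\<lambda>y :: real^'n. norm y powr (s - q - \<epsilon>)) \<in> borel_measurable borel" by measurable
    then show ?thesis
      by (intro borel_measurable_times borel_measurable_const borel_measurable_indicator cball_in_borel)
  qed
  ultimately show ?thesis by (simp only:)
qed

lemma majorant_nonneg: "A \<ge> 0 \<Longrightarrow> 0 \<le> majorant K q A h y"
  unfolding majorant_def by (intro add_nonneg_nonneg mult_nonneg_nonneg) auto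

lemma near_fun_nonneg: "A \<ge> 0 \<Longrightarrow> 0 \<le> near_fun K q A h y"
  unfolding near_fun_def by (intro mult_nonneg_nonneg) auto

lemma near_fun_mono: "A \<le> A' \<Longrightarrow> near_fun K q A h y \<le> near_fun K q A' h y"
  unfolding near_fun_def by (intro mult_right_mono) auto

text \<open>The ball contributes a constant volume, the tail h^(d-(L-s-\<epsilon>)) against the
  prefactor h^(L-q-\<epsilon>), and the shell one factor \<open>h\<close> by its width. The last
  suffices because k0 + 2 > s + d and h <= 1.\<close>

lemma majorant_integral:
  assumes K: "K > 0" and q: "q \<le> m" and A: "A \<ge> 0"
  shows "\<exists>C\<ge>0. \<forall>h. 0 < h \<longrightarrow> h \<le> 1 \<longrightarrow> 8 * (K * h) \<le> r0 \<longrightarrow>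
    (\<integral>\<^sup>+y. ennreal (majorant K q A h y) \<partial>lborel) \<le> ennreal (C * h powr (s + real CARD('n) - q))"
proof -
  let ?d = "real CARD('n)" and ?V = "unit_ball_vol (CARD('n))"
  have p: "real L - s - \<epsilon> > real CARD('n)" using eps_L by simp
  obtain Cf where Cf: "Cf \<ge> 0" "\<And>R. R > 0 \<Longrightarrow> (\<integral>\<^sup>+x. ennreal (norm (x :: real^'n) powr (- (L - s - \<epsilon>))) * indicator (- ball 0 R) x \<partial>lborel) \<le> ennreal (Cf * R powr (?d - (L - s - \<epsilon>)))"
    using nn_integral_norm_powr_far[OF p] by auto
  define C1 where "C1 = A * (?V * (r0 / 2) ^ CARD('n))"
  define C2 where "C2 = A * (Cf * (2 * K) powr (?d - (L - s - \<epsilon>)))"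
  define C3 where "C3 = A * (?V * ?d * 2 * (max 1 (2 * r0)) ^ CARD('n) * K)"
  have C: "C1 \<ge> 0" "C2 \<ge> 0" "C3 \<ge> 0" using A Cf K r0_pos by (auto simp: C1_def C2_def C3_def)
  have "(\<integral>\<^sup>+y. ennreal (majorant K q A h y) \<partial>lborel) \<le> ennreal ((C1 + C2 + C3) * h powr (s + ?d - q))"
    if h: "0 < h" "h \<le> 1" "8 * (K * h) \<le> r0" for h
  proof -
    have Kh: "K * h > 0" using K h by simp
    define S where "S = {y :: real^'n. r0 - K * h \<le> norm y \<and> norm y \<le> r0 + K * h}"
    have Sm: "S \<in> sets borel"
      unfolding S_def by (intro borel_closed closed_Collect_conj closed_Collect_le continuous_intros)
    define f1 where "f1 y = ennreal (A * h powr (s + ?d - q)) * indicator (ball 0 (r0 / 2)) y" for y :: "real^'n"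
    define f2 where "f2 y = ennreal (norm y powr (- (L - s - \<epsilon>))) * indicator (- ball 0 (2 * K * h)) y" for y :: "real^'n"
    define f3 where "f3 y = ennreal (A * h powr (real k0 + 1 - q)) * indicator S y" for y :: "real^'n"
    let ?c = "ennreal (A * h powr (L - q - \<epsilon>))"
    have cm: "(\<lambda>y. a * indicator B y) \<in> borel_measurable lborel" if "B \<in> sets borel" for a :: ennreal and B :: "(real^'n) set"
      using that by measurable
    have f1m: "f1 \<in> borel_measurable lborel" using cm[OF borel_open[OF open_ball]] by (simp only: f1_def[abs_def])
    have nm: "(\<lambda>y :: real^'n. ennreal (norm y powr (- (L - s - \<epsilon>)))) \<in> borel_measurable lborel" by measurable
    have im: "(indicator (- ball 0 (2 * K * h)) :: real^'n \<Rightarrow> ennreal) \<in> borel_measurable lborel" by simp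
    have f2m: "f2 \<in> borel_measurable lborel" 
      unfolding f2_def[abs_def] using nm im by (rule borel_measurable_times_ennreal)
    have f3m: "f3 \<in> borel_measurable lborel" using cm[OF Sm] by (simp only: f3_def[abs_def])
    have cf2m: "(\<lambda>y. ?c * f2 y) \<in> borel_measurable lborel" using f2m by simp
    have "(\<integral>\<^sup>+y. ennreal (majorant K q A h y) \<partial>lborel) = (\<integral>\<^sup>+y. (f1 y + ?c * f2 y) + f3 y \<partial>lborel)"
    proof (rule nn_integral_cong)
      fix y :: "real^'n"
      show "ennreal (majorant K q A h y) = (f1 y + ?c * f2 y) + f3 y"
        unfolding majorant_def f1_def f2_def f3_def S_def using A
        by (simp add: ennreal_plus ennreal_mult ennreal_indicator[symmetric] del: ennreal_indicator)
    qed
    also have "\<dots> = ((\<integral>\<^sup>+y. f1 y \<partial>lborel) + (\<integral>\<^sup>+y. ?c * f2 y \<partial>lborel)) + (\<integral>\<^sup>+y. f3 y \<partial>lborel)"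
      by (subst nn_integral_add[OF borel_measurable_add[OF f1m cf2m] f3m], subst nn_integral_add[OF f1m cf2m]) (rule refl)
    also have "(\<integral>\<^sup>+y. f1 y \<partial>lborel) = ennreal (A * h powr (s + ?d - q)) * emeasure lborel (ball (0 :: real^'n) (r0 / 2))"
      unfolding f1_def by (rule nn_integral_cmult_indicator) simp
    also have "(\<integral>\<^sup>+y. ?c * f2 y \<partial>lborel) = ?c * (\<integral>\<^sup>+y. f2 y \<partial>lborel)" by (rule nn_integral_cmult[OF f2m])
    also have "(\<integral>\<^sup>+y. f3 y \<partial>lborel) = ennreal (A * h powr (real k0 + 1 - q)) * emeasure lborel S"
      unfolding f3_def using Sm by (intro nn_integral_cmult_indicator) simp
    finally have "(\<integral>\<^sup>+y. ennreal (majorant K q A h y) \<partial>lborel) = (ennreal (A * h powr (s + ?d - q)) * emeasure lborel (ball (0 :: real^'n) (r0 / 2)) + ?c * (\<integral>\<^sup>+y. f2 y \<partial>lborel)) + ennreal (A * h powr (real k0 + 1 - q)) * emeasure lborel S" .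
    also have "\<dots> \<le> (ennreal (A * h powr (s + ?d - q)) * ennreal (?V * (r0 / 2) ^ CARD('n))
       + ennreal (A * h powr (L - q - \<epsilon>)) * ennreal (Cf * (2 * K * h) powr (?d - (L - s - \<epsilon>))))
       + ennreal (A * h powr (real k0 + 1 - q)) * ennreal (?V * ?d * 2 * (max 1 (2 * r0)) ^ CARD('n) * (K * h))"
    proof (intro add_mono mult_left_mono)
      show "emeasure lborel (ball (0 :: real^'n) (r0 / 2)) \<le> ennreal (?V * (r0 / 2) ^ CARD('n))"
        using r0_pos by (simp add: emeasure_ball)
      show "(\<integral>\<^sup>+y. f2 y \<partial>lborel) \<le> ennreal (Cf * (2 * K * h) powr (?d - (L - s - \<epsilon>)))"
        unfolding f2_def using K h by (intro Cf(2)) simp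
      show "emeasure lborel S \<le> ennreal (?V * ?d * 2 * (max 1 (2 * r0)) ^ CARD('n) * (K * h))"
        unfolding S_def using Kh h(3) r0_pos by (intro emeasure_shell_le) auto
    qed auto
    also have "\<dots> = ennreal ((A * h powr (s + ?d - q)) * (?V * (r0 / 2) ^ CARD('n)) + (A * h powr (L - q - \<epsilon>)) * (Cf * (2 * K * h) powr (?d - (L - s - \<epsilon>)))
       + (A * h powr (real k0 + 1 - q)) * (?V * ?d * 2 * (max 1 (2 * r0)) ^ CARD('n) * (K * h)))"
      using A Cf(1) K h r0_pos by (simp add: ennreal_mult[symmetric] ennreal_plus[symmetric] del: ennreal_plus)
    also have "\<dots> \<le> ennreal ((C1 + C2 + C3) * h powr (s + ?d - q))"
    proof (rule ennreal_leI)
      have 1: "(A * h powr (s + ?d - q)) * (?V * (r0 / 2) ^ CARD('n)) = C1 * h powr (s + ?d - q)" by (simp add: C1_def)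
      have "(2 * K * h) powr (?d - (L - s - \<epsilon>)) = (2 * K) powr (?d - (L - s - \<epsilon>)) * h powr (?d - (L - s - \<epsilon>))"
        using K h by (simp add: powr_mult)
      moreover have "h powr (L - q - \<epsilon>) * h powr (?d - (L - s - \<epsilon>)) = h powr (s + ?d - q)"
        unfolding powr_add[symmetric] using q m_le by (simp add: of_nat_diff algebra_simps)
      ultimately have 2: "(A * h powr (L - q - \<epsilon>)) * (Cf * (2 * K * h) powr (?d - (L - s - \<epsilon>))) = C2 * h powr (s + ?d - q)"
      proof -
        assume e1: "(2 * K * h) powr (?d - (L - s - \<epsilon>)) = (2 * K) powr (?d - (L - s - \<epsilon>)) * h powr (?d - (L - s - \<epsilon>))"
          and e2: "h powr (L - q - \<epsilon>) * h powr (?d - (L - s - \<epsilon>)) = h powr (s + ?d - q)"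
        have "(A * h powr (L - q - \<epsilon>)) * (Cf * (2 * K * h) powr (?d - (L - s - \<epsilon>)))
          = C2 * (h powr (L - q - \<epsilon>) * h powr (?d - (L - s - \<epsilon>)))"
          unfolding e1 C2_def by (simp only: mult_ac)
        then show ?thesis unfolding e2 .
      qed
      have "h powr (real k0 + 1 - q) * h = h powr (real k0 + 2 - q)"
      proof -
        have "h powr (real k0 + 1 - q) * h powr 1 = h powr (real k0 + 1 - q + 1)" by (simp only: powr_add)
        then show ?thesis using h by (simp add: algebra_simps)
      qed
      also have "\<dots> \<le> h powr (s + ?d - q)" using h k0_bounds(2) by (intro powr_mono') auto
      finally have "C3 * (h powr (real k0 + 1 - q) * h) \<le> C3 * h powr (s + ?d - q)" using C(3) by (rule mult_left_mono)
      then have 3: "(A * h powr (real k0 + 1 - q)) * (?V * ?d * 2 * (max 1 (2 * r0)) ^ CARD('n) * (K * h)) \<le> C3 * h powr (s + ?d - q)"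
        by (simp add: C3_def mult_ac)
      show "(A * h powr (s + ?d - q)) * (?V * (r0 / 2) ^ CARD('n)) + (A * h powr (L - q - \<epsilon>)) * (Cf * (2 * K * h) powr (?d - (L - s - \<epsilon>)))
       + (A * h powr (real k0 + 1 - q)) * (?V * ?d * 2 * (max 1 (2 * r0)) ^ CARD('n) * (K * h)) \<le> (C1 + C2 + C3) * h powr (s + ?d - q)"
        unfolding 1 2 using 3 by (simp add: algebra_simps)
    qed
    finally show ?thesis .
  qed
  then show ?thesis using C by (intro exI[of _ "C1 + C2 + C3"]) auto
qed

text \<open>Square integrability at 0 means 2 (q + \<epsilon> - s) < d, which follows from
  \<open>m_lt\<close>. The factor h^(2 \<epsilon>) cancels the loss, so the power of
  \<open>h\<close> is as if no logarithm were present.\<close>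

lemma near_fun_L2:
  assumes K: "K > 0" and q: "q \<le> m" and A: "A \<ge> 0"
  shows "\<exists>C\<ge>0. \<forall>h>0. (\<integral>\<^sup>+y. ennreal ((near_fun K q A h y)\<^sup>2) \<partial>lborel) \<le> ennreal (C * h powr (2 * (s - q) + real CARD('n)))"
proof -
  let ?d = "real CARD('n)"
  define p where "p = - (2 * (s - q - \<epsilon>))"
  have p: "p < real CARD('n)"
  proof -
    have "real q \<le> real m" using q by simp
    then show ?thesis using m_lt unfolding p_def by (simp add: field_simps)
  qed
  obtain N where N: "N \<ge> 0" "\<And>R. R > 0 \<Longrightarrow> (\<integral>\<^sup>+x. ennreal (norm (x :: real^'n) powr (- p)) * indicator (cball 0 R) x \<partial>lborel) \<le> ennreal (N * R powr (?d - p))"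
    using nn_integral_norm_powr_near[OF p] by auto
  define C where "C = A\<^sup>2 * (N * (3 * K) powr (?d - p))"
  have "(\<integral>\<^sup>+y. ennreal ((near_fun K q A h y)\<^sup>2) \<partial>lborel) \<le> ennreal (C * h powr (2 * (s - q) + ?d))" if h: "h > 0" for h
  proof -
    have "(\<integral>\<^sup>+y. ennreal ((near_fun K q A h y)\<^sup>2) \<partial>lborel) = (\<integral>\<^sup>+y. ennreal (A\<^sup>2 * h powr (2 * \<epsilon>)) * (ennreal (norm y powr (- p)) * indicator (cball 0 (3 * K * h)) (y :: real^'n)) \<partial>lborel)"
    proof (rule nn_integral_cong)
      fix y :: "real^'n"
      have sq: "(t powr a)\<^sup>2 = t powr (2 * a)" for t a :: real
        by (simp add: power2_eq_square powr_add[symmetric])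
      show "ennreal ((near_fun K q A h y)\<^sup>2) = ennreal (A\<^sup>2 * h powr (2 * \<epsilon>)) * (ennreal (norm y powr (- p)) * indicator (cball 0 (3 * K * h)) y)"
        unfolding near_fun_def power_mult_distrib sq p_def
        by (auto simp: indicator_def ennreal_mult)
    qed
    also have "\<dots> = ennreal (A\<^sup>2 * h powr (2 * \<epsilon>)) * (\<integral>\<^sup>+y. ennreal (norm y powr (- p)) * indicator (cball 0 (3 * K * h)) (y :: real^'n) \<partial>lborel)"
      by (rule nn_integral_cmult) measurable
    also have "\<dots> \<le> ennreal (A\<^sup>2 * h powr (2 * \<epsilon>)) * ennreal (N * (3 * K * h) powr (?d - p))"
      using K h by (intro mult_left_mono N(2)) auto
    also have "\<dots> = ennreal (A\<^sup>2 * h powr (2 * \<epsilon>) * (N * (3 * K * h) powr (?d - p)))"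
      using N(1) by (intro ennreal_mult[symmetric]) auto
    also have "A\<^sup>2 * h powr (2 * \<epsilon>) * (N * (3 * K * h) powr (?d - p)) = C * (h powr (2 * \<epsilon>) * h powr (?d - p))"
      using K h by (simp add: C_def powr_mult mult_ac)
    also have "h powr (2 * \<epsilon>) * h powr (?d - p) = h powr (2 * (s - q) + ?d)"
      unfolding powr_add[symmetric] p_def by (simp add: algebra_simps)
    finally show ?thesis .
  qed
  then show ?thesis using N(1) by (intro exI[of _ C]) (auto simp: C_def)
qed

context
  fixes K \<Gamma> :: real and js :: "'n list"
  assumes K: "K > 0" and \<Gamma>: "\<Gamma> > 0" and js: "length js \<le> m"
begin

text \<open>Three ranges of \<open>norm (x - z)\<close>: below \<open>r0 / 2\<close> the split is
  used, near \<open>r0\<close> the shell bound, elsewhere the full Taylor expansion. The regularity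
  hypotheses, which turn \<open>Phi\<close> into true derivatives, hold for almost all
  \<open>x\<close> and \<open>z\<close>.\<close>

lemma pointwise_bound:
  "\<exists>A\<ge>0. \<forall>h \<Xi> \<alpha> x z. 0 < h \<longrightarrow> h \<le> 1 \<longrightarrow> 8 * (K * h) \<le> r0 \<longrightarrow> repro L \<Xi> \<alpha> z (K * h) \<Gamma> \<longrightarrow>
     x - z \<in> regular_set r0 \<longrightarrow> (\<forall>\<xi>\<in>\<Xi>. x - \<xi> \<in> regular_set r0) \<longrightarrow>
     \<bar>Phi js (x - z) - (\<Sum>\<xi>\<in>\<Xi>. \<alpha> \<xi> * Phi js (x - \<xi>))\<bar> \<le> majorant K (length js) A h (x - z) +
       indicator (ball 0 (2 * K * h)) (x - z) * (near_fun K (length js) A h (x - z) + (\<Sum>\<xi>\<in>\<Xi>. \<bar>\<alpha> \<xi>\<bar> * near_fun K (length js) A h (x - \<xi>)))"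
proof -
  let ?q = "length js" and ?d = "real CARD('n)"
  obtain A1 where A1: "A1 \<ge> 0" "\<And>h w \<Xi> \<alpha> x z. 0 < h \<Longrightarrow> h \<le> 1 \<Longrightarrow> 8 * (K * h) \<le> r0 \<Longrightarrow>
     deriv_bound L (ball 0 r0) (\<lambda>_. 1) (\<lambda>_. Cs * (1 + \<bar>ln h\<bar>)) w \<Longrightarrow> repro L \<Xi> \<alpha> z (K * h) \<Gamma> \<Longrightarrow> norm (x - z) < r0 / 2 \<Longrightarrow>
     \<bar>foldr partial js w (x - z) - (\<Sum>\<xi>\<in>\<Xi>. \<alpha> \<xi> * foldr partial js w (x - \<xi>))\<bar> \<le> A1 * h powr (s + ?d - ?q)"
    using smooth_part_bound[OF K \<Gamma> js] by blast
  obtain A2 where A2: "A2 \<ge> 0" "\<And>h g y. 0 < h \<Longrightarrow> 8 * (K * h) \<le> r0 \<Longrightarrow>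
     deriv_bound L (ball 0 r0 - {0}) norm (\<lambda>x. Cs * norm x powr s * (1 + \<bar>ln (norm x / h)\<bar>)) g \<Longrightarrow>
     y \<noteq> 0 \<Longrightarrow> norm y \<le> 3 * K * h \<Longrightarrow> \<bar>foldr partial js g y\<bar> \<le> near_fun K ?q A2 h y"
    using singular_near_bound[OF K \<Gamma> js] by blast
  obtain A3 where A3: "A3 \<ge> 0" "\<And>h g \<Xi> \<alpha> x z. 0 < h \<Longrightarrow> 8 * (K * h) \<le> r0 \<Longrightarrow>
     deriv_bound L (ball 0 r0 - {0}) norm (\<lambda>x. Cs * norm x powr s * (1 + \<bar>ln (norm x / h)\<bar>)) g \<Longrightarrow>
     repro L \<Xi> \<alpha> z (K * h) \<Gamma> \<Longrightarrow> norm (x - z) < r0 / 2 \<Longrightarrow> 2 * K * h \<le> norm (x - z) \<Longrightarrow>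
     \<bar>foldr partial js g (x - z) - (\<Sum>\<xi>\<in>\<Xi>. \<alpha> \<xi> * foldr partial js g (x - \<xi>))\<bar>
       \<le> A3 * h powr (L - ?q - \<epsilon>) * norm (x - z) powr (- (L - s - \<epsilon>))"
    using singular_far_bound[OF K \<Gamma> js] by blast
  obtain A4 where A4: "A4 \<ge> 0" "\<And>h \<Xi> \<alpha> x z. 0 < h \<Longrightarrow> h \<le> 1 \<Longrightarrow> 8 * (K * h) \<le> r0 \<Longrightarrow>
     repro L \<Xi> \<alpha> z (K * h) \<Gamma> \<Longrightarrow> r0 / 2 \<le> norm (x - z) \<Longrightarrow> K * h < \<bar>norm (x - z) - r0\<bar> \<Longrightarrow>
     \<bar>foldr partial js \<phi> (x - z) - (\<Sum>\<xi>\<in>\<Xi>. \<alpha> \<xi> * foldr partial js \<phi> (x - \<xi>))\<bar>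
       \<le> A4 * h powr (L - ?q - \<epsilon>) * norm (x - z) powr (- (L - s - \<epsilon>))"
    using outer_bound[OF K \<Gamma> js] by blast
  obtain A5 where A5: "A5 \<ge> 0" "\<And>h \<Xi> \<alpha> x z. 0 < h \<Longrightarrow> 8 * (K * h) \<le> r0 \<Longrightarrow>
     repro L \<Xi> \<alpha> z (K * h) \<Gamma> \<Longrightarrow> \<bar>norm (x - z) - r0\<bar> \<le> K * h \<Longrightarrow>
     x - z \<in> regular_set r0 \<Longrightarrow> (\<forall>\<xi>\<in>\<Xi>. x - \<xi> \<in> regular_set r0) \<Longrightarrow>
     \<bar>foldr partial js \<phi> (x - z) - (\<Sum>\<xi>\<in>\<Xi>. \<alpha> \<xi> * foldr partial js \<phi> (x - \<xi>))\<bar> \<le> A5 * h powr (real k0 + 1 - ?q)"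
    using shell_bound[OF K \<Gamma> js] by blast
  define A where "A = A1 + A2 + A3 + A4 + A5"
  have A: "A \<ge> 0" "A1 \<le> A" "A2 \<le> A" "A3 \<le> A" "A4 \<le> A" "A5 \<le> A" using A1(1) A2(1) A3(1) A4(1) A5(1) by (auto simp: A_def)
  have "\<bar>Phi js (x - z) - (\<Sum>\<xi>\<in>\<Xi>. \<alpha> \<xi> * Phi js (x - \<xi>))\<bar> \<le> majorant K ?q A h (x - z) +
       indicator (ball 0 (2 * K * h)) (x - z) * (near_fun K ?q A h (x - z) + (\<Sum>\<xi>\<in>\<Xi>. \<bar>\<alpha> \<xi>\<bar> * near_fun K ?q A h (x - \<xi>)))"
    (is "?L \<le> ?M + ?N")
    if h: "0 < h" "h \<le> 1" "8 * (K * h) \<le> r0" and rp: "repro L \<Xi> \<alpha> z (K * h) \<Gamma>"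
      and reg: "x - z \<in> regular_set r0" "\<forall>\<xi>\<in>\<Xi>. x - \<xi> \<in> regular_set r0" for h \<Xi> \<alpha> x z
  proof -
    let ?y = "x - z"
    have Kh: "K * h > 0" using K h by simp
    have eqL: "?L = \<bar>foldr partial js \<phi> (x - z) - (\<Sum>\<xi>\<in>\<Xi>. \<alpha> \<xi> * foldr partial js \<phi> (x - \<xi>))\<bar>"
      using reg by (simp add: Phi_regular)
    have N0: "0 \<le> ?N" using near_fun_nonneg[OF A(1)]
      by (intro mult_nonneg_nonneg add_nonneg_nonneg sum_nonneg) auto
    let ?M1 = "A * h powr (s + ?d - ?q) * indicator (ball 0 (r0 / 2)) ?y"
    let ?M2 = "A * h powr (L - ?q - \<epsilon>) * (norm ?y powr (- (L - s - \<epsilon>)) * indicator (- ball 0 (2 * K * h)) ?y)"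
    let ?M3 = "A * h powr (real k0 + 1 - ?q) * indicator {y. r0 - K * h \<le> norm y \<and> norm y \<le> r0 + K * h} ?y"
    have Meq: "?M = ?M1 + ?M2 + ?M3" by (simp add: majorant_def)
    have M0: "0 \<le> ?M1" "0 \<le> ?M2" "0 \<le> ?M3" using A(1) by (auto intro!: mult_nonneg_nonneg)
    consider "norm ?y < r0 / 2" | "r0 / 2 \<le> norm ?y" "K * h < \<bar>norm ?y - r0\<bar>" | "\<bar>norm ?y - r0\<bar> \<le> K * h" by linarith
    then show ?thesis
    proof cases
      case 1
      obtain w g where wg: "\<forall>x\<in>ball 0 r0 - {0}. \<phi> x = w x + g x" "deriv_bound L (ball 0 r0) (\<lambda>_. 1) (\<lambda>_. Cs * (1 + \<bar>ln h\<bar>)) w"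
        "deriv_bound L (ball 0 r0 - {0}) norm (\<lambda>x. Cs * norm x powr s * (1 + \<bar>ln (norm x / h)\<bar>)) g"
        using split[OF h(1)] by blast
      have fs: "foldr partial js \<phi> y = foldr partial js w y + foldr partial js g y" if "y \<in> regular_set r0" "norm y < r0" for y
        using that js m_le(1) by (intro foldr_split[OF wg(1) deriv_bound_Ck_on[OF wg(2)] deriv_bound_Ck_on[OF wg(3)]]) (auto simp: regular_set_def)
      have near: "norm (x - \<xi>) \<le> norm ?y + K * h" if "\<xi> \<in> \<Xi>" "\<alpha> \<xi> \<noteq> 0" for \<xi>
        using norm_segment_bounds(1)[OF reproD(3)[OF rp that], of 1 ?y] by simp
      have sums: "(\<Sum>\<xi>\<in>\<Xi>. \<alpha> \<xi> * foldr partial js \<phi> (x - \<xi>)) = (\<Sum>\<xi>\<in>\<Xi>. \<alpha> \<xi> * foldr partial js w (x - \<xi>)) + (\<Sum>\<xi>\<in>\<Xi>. \<alpha> \<xi> * foldr partial js g (x - \<xi>))"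
        unfolding sum.distrib[symmetric]
      proof (rule sum.cong[OF refl])
        fix \<xi> assume \<xi>: "\<xi> \<in> \<Xi>"
        show "\<alpha> \<xi> * foldr partial js \<phi> (x - \<xi>) = \<alpha> \<xi> * foldr partial js w (x - \<xi>) + \<alpha> \<xi> * foldr partial js g (x - \<xi>)"
        proof (cases "\<alpha> \<xi> = 0")
          case False
          \<comment> \<open>Nodes of nonzero weight lie within \<open>K * h \<le> r0 / 8\<close> of
            \<open>z\<close>, so the split is valid at \<open>x - \<xi>\<close> too.\<close>
          have "norm (x - \<xi>) < r0" using near[OF \<xi> False] 1 h Kh r0_pos by linarith
          then show ?thesis using fs[of "x - \<xi>"] reg \<xi> by (simp add: distrib_left)
        qed simp
      qed
      let ?w = "\<bar>foldr partial js w ?y - (\<Sum>\<xi>\<in>\<Xi>. \<alpha> \<xi> * foldr partial js w (x - \<xi>))\<bar>"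
      let ?g = "\<bar>foldr partial js g ?y - (\<Sum>\<xi>\<in>\<Xi>. \<alpha> \<xi> * foldr partial js g (x - \<xi>))\<bar>"
      have "?L \<le> ?w + ?g"
        unfolding eqL using sums fs[OF reg(1)] 1 r0_pos by linarith
      moreover have "?w \<le> ?M1"
      proof -
        have "?w \<le> A1 * h powr (s + ?d - ?q)" by (rule A1(2)[OF h wg(2) rp 1])
        also have "\<dots> \<le> A * h powr (s + ?d - ?q)" using A by (intro mult_right_mono) auto
        finally show ?thesis using 1 by simp
      qed
      moreover have "?g \<le> ?M2 + ?N"
      proof (cases "2 * K * h \<le> norm ?y")
        case True
        have "?g \<le> A3 * h powr (L - ?q - \<epsilon>) * norm (x - z) powr (- (L - s - \<epsilon>))" by (rule A3(2)[OF h(1,3) wg(3) rp 1 True])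
        also have "\<dots> \<le> A * h powr (L - ?q - \<epsilon>) * norm (x - z) powr (- (L - s - \<epsilon>))" using A by (intro mult_right_mono) auto
        finally have "?g \<le> ?M2" using True by simp
        then show ?thesis using N0 by linarith
      next
        case False
        have gb: "\<bar>foldr partial js g y\<bar> \<le> near_fun K ?q A h y" if "y \<in> regular_set r0" "norm y \<le> 3 * K * h" for y
          using A2(2)[OF h(1,3) wg(3) _ that(2)] near_fun_mono[OF A(3), of K ?q h y] that(1) by (force simp: regular_set_def)
        have "?g \<le> \<bar>foldr partial js g ?y\<bar> + \<bar>\<Sum>\<xi>\<in>\<Xi>. \<alpha> \<xi> * foldr partial js g (x - \<xi>)\<bar>" by (rule abs_triangle_ineq4)
        also have "\<dots> \<le> near_fun K ?q A h ?y + (\<Sum>\<xi>\<in>\<Xi>. \<bar>\<alpha> \<xi>\<bar> * near_fun K ?q A h (x - \<xi>))"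
        proof (rule add_mono)
          show "\<bar>foldr partial js g ?y\<bar> \<le> near_fun K ?q A h ?y" using False Kh by (intro gb reg(1)) simp
          show "\<bar>\<Sum>\<xi>\<in>\<Xi>. \<alpha> \<xi> * foldr partial js g (x - \<xi>)\<bar> \<le> (\<Sum>\<xi>\<in>\<Xi>. \<bar>\<alpha> \<xi>\<bar> * near_fun K ?q A h (x - \<xi>))"
          proof (rule order_trans[OF sum_abs sum_mono])
            fix \<xi> assume \<xi>: "\<xi> \<in> \<Xi>"
            show "\<bar>\<alpha> \<xi> * foldr partial js g (x - \<xi>)\<bar> \<le> \<bar>\<alpha> \<xi>\<bar> * near_fun K ?q A h (x - \<xi>)"
            proof (cases "\<alpha> \<xi> = 0")
              case nz: False
              have "norm (x - \<xi>) \<le> 3 * K * h" using near[OF \<xi> nz] False by simp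
              then have "\<bar>foldr partial js g (x - \<xi>)\<bar> \<le> near_fun K ?q A h (x - \<xi>)" using reg \<xi> by (intro gb) auto
              then show ?thesis by (simp add: abs_mult mult_left_mono)
            qed simp
          qed
        qed
        also have "\<dots> = ?N" using False by simp
        finally show ?thesis using M0 by linarith
      qed
      ultimately show ?thesis unfolding Meq using M0 by linarith
    next
      case 2
      have "?L \<le> A4 * h powr (L - ?q - \<epsilon>) * norm (x - z) powr (- (L - s - \<epsilon>))" unfolding eqL by (rule A4(2)[OF h rp 2])
      also have "\<dots> \<le> A * h powr (L - ?q - \<epsilon>) * norm (x - z) powr (- (L - s - \<epsilon>))" using A by (intro mult_right_mono) auto
      also have "\<dots> = ?M2" using 2 h Kh by simp
      finally show ?thesis unfolding Meq using M0 N0 by linarith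
    next
      case 3
      have "?L \<le> A5 * h powr (real k0 + 1 - ?q)" unfolding eqL by (rule A5(2)[OF h(1,3) rp 3 reg])
      also have "\<dots> \<le> A * h powr (real k0 + 1 - ?q)" using A by (intro mult_right_mono) auto
      also have "\<dots> = ?M3" using 3 by (simp add: abs_le_iff algebra_simps)
      finally show ?thesis unfolding Meq using M0 N0 by linarith
    qed
  qed
  then show ?thesis using A(1) by blast
qed

text \<open>The majorant is a convolution kernel and enters the Schur test with both factors
  \<open>sqrt M\<close>. In the near part \<open>av\<close> has squared norm O(h^d) in
  \<open>z\<close> and \<open>bv\<close> has squared norm O(h^(2(s-q)+d)) in \<open>x\<close>,
  uniformly in the other variable; both parts end with the power h^(2(s+d-q)).\<close>

lemma L2_estimate:
  "\<exists>C\<ge>0. \<forall>h \<nu> \<Xi> a r. 0 < h \<longrightarrow> h \<le> 1 \<longrightarrow> 8 * (K * h) \<le> r0 \<longrightarrow>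
     \<nu> \<in> borel_measurable borel \<longrightarrow> integrable lborel \<nu> \<longrightarrow> (\<forall>z. z \<notin> cball 0 r \<longrightarrow> \<nu> z = 0) \<longrightarrow> finite \<Xi> \<longrightarrow>
     (\<forall>\<xi>. a \<xi> \<in> borel_measurable borel) \<longrightarrow> (\<forall>z. (\<Sum>\<xi>\<in>\<Xi>. \<bar>a \<xi> z\<bar>) \<le> \<Gamma>) \<longrightarrow>
     (\<forall>z. \<nu> z \<noteq> 0 \<longrightarrow> repro L \<Xi> (\<lambda>\<xi>. a \<xi> z) z (K * h) \<Gamma>) \<longrightarrow>
     (\<integral>\<^sup>+x. ennreal ((conv_diff \<nu> \<Xi> (\<lambda>\<xi>. LINT z|lborel. a \<xi> z * \<nu> z) (Phi js) x)\<^sup>2) \<partial>lborel)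
       \<le> ennreal (C * h powr (2 * (s + real CARD('n) - length js))) * (\<integral>\<^sup>+z. ennreal ((\<nu> z)\<^sup>2) \<partial>lborel)"
proof -
  let ?q = "length js" and ?d = "real CARD('n)" and ?V = "unit_ball_vol (CARD('n))"
  obtain A where A: "A \<ge> 0" and pb: "\<And>h \<Xi> \<alpha> x z. 0 < h \<Longrightarrow> h \<le> 1 \<Longrightarrow> 8 * (K * h) \<le> r0 \<Longrightarrow> repro L \<Xi> \<alpha> z (K * h) \<Gamma> \<Longrightarrow>
     x - z \<in> regular_set r0 \<Longrightarrow> (\<forall>\<xi>\<in>\<Xi>. x - \<xi> \<in> regular_set r0) \<Longrightarrow>
     \<bar>Phi js (x - z) - (\<Sum>\<xi>\<in>\<Xi>. \<alpha> \<xi> * Phi js (x - \<xi>))\<bar> \<le> majorant K ?q A h (x - z) +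
       indicator (ball 0 (2 * K * h)) (x - z) * (near_fun K ?q A h (x - z) + (\<Sum>\<xi>\<in>\<Xi>. \<bar>\<alpha> \<xi>\<bar> * near_fun K ?q A h (x - \<xi>)))"
    using pointwise_bound by blast
  obtain C1 where C1: "C1 \<ge> 0" "\<And>h. 0 < h \<Longrightarrow> h \<le> 1 \<Longrightarrow> 8 * (K * h) \<le> r0 \<Longrightarrow>
    (\<integral>\<^sup>+y. ennreal (majorant K ?q A h y) \<partial>lborel) \<le> ennreal (C1 * h powr (s + ?d - ?q))"
    using majorant_integral[OF K js A] by blast
  obtain C2 where C2: "C2 \<ge> 0" "\<And>h. 0 < h \<Longrightarrow> (\<integral>\<^sup>+y. ennreal ((near_fun K ?q A h y)\<^sup>2) \<partial>lborel) \<le> ennreal (C2 * h powr (2 * (s - ?q) + ?d))"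
    using near_fun_L2[OF K js A] by blast
  define C3 where "C3 = (1 + \<Gamma>) * (?V * (2 * K) ^ CARD('n)) * ((1 + \<Gamma>) * C2)"
  define C where "C = 2 * C1\<^sup>2 + 2 * C3"
  have C3: "C3 \<ge> 0" using \<Gamma> K C2(1) by (simp add: C3_def)
  have "(\<integral>\<^sup>+x. ennreal ((conv_diff \<nu> \<Xi> (\<lambda>\<xi>. LINT z|lborel. a \<xi> z * \<nu> z) (Phi js) x)\<^sup>2) \<partial>lborel)
       \<le> ennreal (C * h powr (2 * (s + ?d - ?q))) * (\<integral>\<^sup>+z. ennreal ((\<nu> z)\<^sup>2) \<partial>lborel)"
    if h: "0 < h" "h \<le> 1" "8 * (K * h) \<le> r0" and \<nu>m[measurable]: "\<nu> \<in> borel_measurable borel" and \<nu>i: "integrable lborel \<nu>"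
      and \<nu>Z: "\<And>z. z \<notin> cball 0 r \<Longrightarrow> \<nu> z = 0" and fin: "finite \<Xi>" and am[measurable]: "\<And>\<xi>. a \<xi> \<in> borel_measurable borel"
      and a\<Gamma>: "\<And>z. (\<Sum>\<xi>\<in>\<Xi>. \<bar>a \<xi> z\<bar>) \<le> \<Gamma>" and rp: "\<And>z. \<nu> z \<noteq> 0 \<Longrightarrow> repro L \<Xi> (\<lambda>\<xi>. a \<xi> z) z (K * h) \<Gamma>"
    for h \<nu> \<Xi> a r
  proof -
    let ?P = "Phi js"
    have jsL: "length js \<le> L" using js m_le by simp
    have Pm[measurable]: "?P \<in> borel_measurable borel" by (rule Phi_measurable[OF jsL])
    define M where "M = majorant K ?q A h"
    define G where "G = near_fun K ?q A h"
    have [measurable]: "M \<in> borel_measurable borel" "G \<in> borel_measurable borel" by (simp_all add: M_def G_def)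
    have M0: "0 \<le> M y" and G0: "0 \<le> G y" for y using A by (simp_all add: M_def G_def majorant_nonneg near_fun_nonneg)
    let ?I = "indicator (ball 0 (2 * K * h)) :: real^'n \<Rightarrow> real"
    \<comment> \<open>By \<open>weighted_square_le\<close> the product of \<open>av\<close> and
      \<open>bv\<close> dominates the near part. The sum over nodes sits under the root in
      \<open>bv\<close>, where integration in \<open>x\<close> removes its dependence on the
      positions of the nodes.\<close>
    define av where "av x z = sqrt (1 + \<Gamma>) * ?I (x - z)" for x z
    define bv where "bv x z = sqrt ((G (x - z))\<^sup>2 + (\<Sum>\<xi>\<in>\<Xi>. \<bar>a \<xi> z\<bar> * (G (x - \<xi>))\<^sup>2))" for x z
    define E where "E = conv_diff \<nu> \<Xi> (\<lambda>\<xi>. LINT z|lborel. a \<xi> z * \<nu> z) ?P"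
    define I1 where "I1 x = (\<integral>\<^sup>+z. ennreal (\<bar>\<nu> z\<bar> * (sqrt (M (x - z)) * sqrt (M (x - z)))) \<partial>lborel)" for x
    define I2 where "I2 x = (\<integral>\<^sup>+z. ennreal (\<bar>\<nu> z\<bar> * (av x z * bv x z)) \<partial>lborel)" for x
    have bv_arg: "0 \<le> (G (x - z))\<^sup>2 + (\<Sum>\<xi>\<in>\<Xi>. \<bar>a \<xi> z\<bar> * (G (x - \<xi>))\<^sup>2)" for x z by (intro add_nonneg_nonneg sum_nonneg) auto
    have mav: "(\<lambda>(x, z). av x z) \<in> borel_measurable (borel \<Otimes>\<^sub>M borel)" unfolding av_def by measurable
    have mbv: "(\<lambda>(x, z). bv x z) \<in> borel_measurable (borel \<Otimes>\<^sub>M borel)" unfolding bv_def by measurable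
    have near: "?I (x - z) * (G (x - z) + (\<Sum>\<xi>\<in>\<Xi>. \<bar>a \<xi> z\<bar> * G (x - \<xi>))) \<le> av x z * bv x z" for x z
    proof -
      have "(G (x - z) + (\<Sum>\<xi>\<in>\<Xi>. \<bar>a \<xi> z\<bar> * G (x - \<xi>)))\<^sup>2 \<le> (1 + \<Gamma>) * ((G (x - z))\<^sup>2 + (\<Sum>\<xi>\<in>\<Xi>. \<bar>a \<xi> z\<bar> * (G (x - \<xi>))\<^sup>2))"
        by (rule weighted_square_le) (use a\<Gamma> \<Gamma> in auto)
      then have "G (x - z) + (\<Sum>\<xi>\<in>\<Xi>. \<bar>a \<xi> z\<bar> * G (x - \<xi>)) \<le> sqrt (1 + \<Gamma>) * bv x z"
        unfolding bv_def real_sqrt_mult[symmetric] by (rule real_le_rsqrt)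
      from mult_left_mono[OF this, of "?I (x - z)"] show ?thesis by (simp add: av_def mult_ac)
    qed
    have ai: "integrable lborel (\<lambda>z. a \<xi> z * \<nu> z)" if "\<xi> \<in> \<Xi>" for \<xi>
    proof (rule Bochner_Integration.integrable_bound[OF integrable_mult_right[OF \<nu>i, of \<Gamma>]])
      have "\<bar>a \<xi> z\<bar> \<le> \<Gamma>" for z
        using member_le_sum[of \<xi> \<Xi> "\<lambda>\<xi>. \<bar>a \<xi> z\<bar>"] that fin a\<Gamma>[of z] by auto
      then show "AE z in lborel. norm (a \<xi> z * \<nu> z) \<le> norm (\<Gamma> * \<nu> z)"
        using \<Gamma> by (intro AE_I2) (auto simp: abs_mult intro!: mult_right_mono)
    qed measurable
    have E_le: "AE x in lborel. ennreal \<bar>E x\<bar> \<le> I1 x + I2 x"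
    proof -
      have fin_reg: "AE x in lborel. \<forall>\<xi>\<in>\<Xi>. x - \<xi> \<in> regular_set r0"
      proof (rule AE_finite_allI[OF fin])
        fix \<xi> show "AE x in lborel. x - \<xi> \<in> regular_set r0"
          using AE_lborel_shift[OF AE_regular_set[of r0], of "- \<xi>"] by simp
      qed
      have ci: "AE x in lborel. integrable lborel (\<lambda>z. \<nu> z * ?P (x - z))"
        by (rule conv_integrable_AE[OF \<nu>m \<nu>i _ lint_Phi[OF js]]) (rule \<nu>Z)
      show ?thesis
        using fin_reg ci
      proof eventually_elim
        case (elim x)
        let ?k = "\<lambda>z. ?P (x - z) - (\<Sum>\<xi>\<in>\<Xi>. a \<xi> z * ?P (x - \<xi>))"
        have "E x = (LINT z|lborel. \<nu> z * ?P (x - z) - (\<Sum>\<xi>\<in>\<Xi>. (a \<xi> z * \<nu> z) * ?P (x - \<xi>)))"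
          unfolding E_def conv_diff_def using elim(2) ai
          by (subst Bochner_Integration.integral_diff) (auto intro!: Bochner_Integration.integrable_sum simp: Bochner_Integration.integral_sum)
        also have "\<dots> = (LINT z|lborel. \<nu> z * ?k z)"
          by (intro Bochner_Integration.integral_cong) (simp_all add: right_diff_distrib sum_distrib_left mult_ac)
        finally have "ennreal \<bar>E x\<bar> \<le> (\<integral>\<^sup>+z. ennreal \<bar>\<nu> z * ?k z\<bar> \<partial>lborel)"
          using abs_integral_le_nn_integral[of lborel "\<lambda>z. \<nu> z * ?k z"] by simp
        also have "\<dots> \<le> (\<integral>\<^sup>+z. ennreal (\<bar>\<nu> z\<bar> * (sqrt (M (x - z)) * sqrt (M (x - z)))) + ennreal (\<bar>\<nu> z\<bar> * (av x z * bv x z)) \<partial>lborel)"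
        proof (rule nn_integral_mono_AE)
          have bv0: "0 \<le> bv x z" "0 \<le> av x z" for z using bv_arg \<Gamma> by (auto simp: bv_def av_def)
          show "AE z in lborel. ennreal \<bar>\<nu> z * ?k z\<bar> \<le> ennreal (\<bar>\<nu> z\<bar> * (sqrt (M (x - z)) * sqrt (M (x - z)))) + ennreal (\<bar>\<nu> z\<bar> * (av x z * bv x z))"
            using AE_lborel_reflect[OF AE_regular_set[of r0], of x]
          proof eventually_elim
            fix z assume reg: "x - z \<in> regular_set r0"
            show "ennreal \<bar>\<nu> z * ?k z\<bar> \<le> ennreal (\<bar>\<nu> z\<bar> * (sqrt (M (x - z)) * sqrt (M (x - z)))) + ennreal (\<bar>\<nu> z\<bar> * (av x z * bv x z))"
            proof (cases "\<nu> z = 0")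
              case False
              have "\<bar>?k z\<bar> \<le> M (x - z) + ?I (x - z) * (G (x - z) + (\<Sum>\<xi>\<in>\<Xi>. \<bar>a \<xi> z\<bar> * G (x - \<xi>)))"
                unfolding M_def G_def by (rule pb[OF h rp[OF False] reg elim(1)])
              also have "\<dots> \<le> M (x - z) + av x z * bv x z" using near by simp
              finally have "\<bar>\<nu> z\<bar> * \<bar>?k z\<bar> \<le> \<bar>\<nu> z\<bar> * (M (x - z) + av x z * bv x z)" by (rule mult_left_mono) simp
              then have "\<bar>\<nu> z * ?k z\<bar> \<le> \<bar>\<nu> z\<bar> * (sqrt (M (x - z)) * sqrt (M (x - z))) + \<bar>\<nu> z\<bar> * (av x z * bv x z)"
                using M0 by (simp add: abs_mult distrib_left)
              then have "ennreal \<bar>\<nu> z * ?k z\<bar> \<le> ennreal (\<bar>\<nu> z\<bar> * (sqrt (M (x - z)) * sqrt (M (x - z))) + \<bar>\<nu> z\<bar> * (av x z * bv x z))"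
                by (rule ennreal_leI)
              then show ?thesis using M0 bv0 by (simp add: ennreal_plus)
            qed simp
          qed
        qed
        also have "\<dots> = I1 x + I2 x" unfolding I1_def I2_def av_def bv_def by (rule nn_integral_add) measurable
        finally show ?case .
      qed
    qed
    have m1[measurable]: "I1 \<in> borel_measurable borel" unfolding I1_def[abs_def] by measurable
    have m2[measurable]: "I2 \<in> borel_measurable borel" unfolding I2_def[abs_def] av_def bv_def by measurable
    let ?n2 = "\<integral>\<^sup>+z. ennreal ((\<nu> z)\<^sup>2) \<partial>lborel"
    have b1: "(\<integral>\<^sup>+x. (I1 x)\<^sup>2 \<partial>lborel) \<le> ennreal (C1 * h powr (s + ?d - ?q)) * ennreal (C1 * h powr (s + ?d - ?q)) * ?n2"
      unfolding I1_def
    proof (rule nn_integral_schur)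
      have eq: "ennreal ((sqrt (M y))\<^sup>2) = ennreal (M y)" for y using M0 by simp
      have le: "(\<integral>\<^sup>+y. ennreal (M y) \<partial>lborel) \<le> ennreal (C1 * h powr (s + ?d - ?q))" unfolding M_def by (rule C1(2)[OF h])
      show "(\<integral>\<^sup>+z. ennreal ((sqrt (M (x - z)))\<^sup>2) \<partial>lborel) \<le> ennreal (C1 * h powr (s + ?d - ?q))" for x
        unfolding eq using nn_integral_reflect[of "\<lambda>y. ennreal (M y)" x] le by simp
      show "(\<integral>\<^sup>+x. ennreal ((sqrt (M (x - z)))\<^sup>2) \<partial>lborel) \<le> ennreal (C1 * h powr (s + ?d - ?q))" for z
        unfolding eq using nn_integral_shift[of "\<lambda>y. ennreal (M y)" "- z"] le by simp
      show "(\<lambda>(x, z). sqrt (M (x - z))) \<in> borel_measurable (borel \<Otimes>\<^sub>M borel)" by measurable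
      then show "(\<lambda>(x, z). sqrt (M (x - z))) \<in> borel_measurable (borel \<Otimes>\<^sub>M borel)" .
    qed (use M0 in auto)
    have b2: "(\<integral>\<^sup>+x. (I2 x)\<^sup>2 \<partial>lborel) \<le> ennreal ((1 + \<Gamma>) * (?V * (2 * K * h) ^ CARD('n))) * ennreal ((1 + \<Gamma>) * (C2 * h powr (2 * (s - ?q) + ?d))) * ?n2"
      unfolding I2_def
    proof (rule nn_integral_schur[OF \<nu>m mav mbv])
      show "0 \<le> av x z" "0 \<le> bv x z" for x z using bv_arg \<Gamma> by (auto simp: bv_def av_def)
      fix x
      have "(\<integral>\<^sup>+z. ennreal ((av x z)\<^sup>2) \<partial>lborel) = (\<integral>\<^sup>+z. (\<lambda>y. ennreal (1 + \<Gamma>) * indicator (ball 0 (2 * K * h)) y) (x - z) \<partial>lborel)"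
        using \<Gamma> by (intro nn_integral_cong) (auto simp: av_def indicator_def power_mult_distrib)
      also have "\<dots> = (\<integral>\<^sup>+y. ennreal (1 + \<Gamma>) * indicator (ball 0 (2 * K * h)) (y :: real^'n) \<partial>lborel)"
        by (rule nn_integral_reflect) measurable
      also have "\<dots> = ennreal (1 + \<Gamma>) * emeasure lborel (ball (0 :: real^'n) (2 * K * h))"
        by (rule nn_integral_cmult_indicator) simp
      also have "\<dots> = ennreal ((1 + \<Gamma>) * (?V * (2 * K * h) ^ CARD('n)))"
        using K h \<Gamma> by (simp add: emeasure_ball ennreal_mult)
      finally show "(\<integral>\<^sup>+z. ennreal ((av x z)\<^sup>2) \<partial>lborel) \<le> ennreal ((1 + \<Gamma>) * (?V * (2 * K * h) ^ CARD('n)))" by simp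
    next
      fix z
      let ?g = "\<integral>\<^sup>+y. ennreal ((G y)\<^sup>2) \<partial>lborel"
      have sh: "(\<integral>\<^sup>+x. ennreal ((G (x - c))\<^sup>2) \<partial>lborel) = ?g" for c
        using nn_integral_shift[of "\<lambda>y. ennreal ((G y)\<^sup>2)" "- c"] by simp
      have "(\<integral>\<^sup>+x. ennreal ((bv x z)\<^sup>2) \<partial>lborel) = (\<integral>\<^sup>+x. ennreal ((G (x - z))\<^sup>2) + (\<Sum>\<xi>\<in>\<Xi>. ennreal \<bar>a \<xi> z\<bar> * ennreal ((G (x - \<xi>))\<^sup>2)) \<partial>lborel)"
      proof (rule nn_integral_cong)
        fix x
        have "(bv x z)\<^sup>2 = (G (x - z))\<^sup>2 + (\<Sum>\<xi>\<in>\<Xi>. \<bar>a \<xi> z\<bar> * (G (x - \<xi>))\<^sup>2)" unfolding bv_def by (rule real_sqrt_pow2[OF bv_arg])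
        then show "ennreal ((bv x z)\<^sup>2) = ennreal ((G (x - z))\<^sup>2) + (\<Sum>\<xi>\<in>\<Xi>. ennreal \<bar>a \<xi> z\<bar> * ennreal ((G (x - \<xi>))\<^sup>2))"
          by (simp add: ennreal_plus sum_nonneg ennreal_mult[symmetric] sum_ennreal)
      qed
      also have "\<dots> = ?g + (\<Sum>\<xi>\<in>\<Xi>. ennreal \<bar>a \<xi> z\<bar> * ?g)"
        by (subst nn_integral_add, measurable, subst nn_integral_sum, measurable) (simp add: nn_integral_cmult sh)
      also have "\<dots> = (1 + ennreal (\<Sum>\<xi>\<in>\<Xi>. \<bar>a \<xi> z\<bar>)) * ?g"
        by (simp add: sum_distrib_right[symmetric] distrib_right sum_ennreal)
      also have "\<dots> \<le> (1 + ennreal \<Gamma>) * ennreal (C2 * h powr (2 * (s - ?q) + ?d))"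
        using C2(2)[OF h(1)] by (intro mult_mono add_mono ennreal_leI a\<Gamma>) (auto simp: G_def)
      also have "\<dots> = ennreal ((1 + \<Gamma>) * (C2 * h powr (2 * (s - ?q) + ?d)))"
        using \<Gamma> C2(1) by (simp add: ennreal_mult ennreal_plus)
      finally show "(\<integral>\<^sup>+x. ennreal ((bv x z)\<^sup>2) \<partial>lborel) \<le> ennreal ((1 + \<Gamma>) * (C2 * h powr (2 * (s - ?q) + ?d)))" .
    qed
    have p1: "(C1 * h powr (s + ?d - ?q)) * (C1 * h powr (s + ?d - ?q)) = C1\<^sup>2 * h powr (2 * (s + ?d - ?q))"
    proof -
      have "h powr (s + ?d - ?q) * h powr (s + ?d - ?q) = h powr (2 * (s + ?d - ?q))" unfolding powr_add[symmetric] mult_2 ..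
      then show ?thesis by (simp only: power2_eq_square mult_ac)
    qed
    have p2: "((1 + \<Gamma>) * (?V * (2 * K * h) ^ CARD('n))) * ((1 + \<Gamma>) * (C2 * h powr (2 * (s - ?q) + ?d))) = C3 * h powr (2 * (s + ?d - ?q))"
    proof -
      have "h ^ CARD('n) * h powr (2 * (s - ?q) + ?d) = h powr (2 * (s + ?d - ?q))"
      proof -
        have "h ^ CARD('n) = h powr ?d" using h by (simp add: powr_realpow)
        then have "h ^ CARD('n) * h powr (2 * (s - ?q) + ?d) = h powr (?d + (2 * (s - ?q) + ?d))" by (simp only: powr_add)
        also have "?d + (2 * (s - ?q) + ?d) = 2 * (s + ?d - ?q)" by argo
        finally show ?thesis .
      qed
      then show ?thesis unfolding C3_def power_mult_distrib by (simp add: mult_ac)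
    qed
    have "(\<integral>\<^sup>+x. ennreal ((E x)\<^sup>2) \<partial>lborel) \<le> (\<integral>\<^sup>+x. 2 * (I1 x)\<^sup>2 + 2 * (I2 x)\<^sup>2 \<partial>lborel)"
    proof (rule nn_integral_mono_AE)
      show "AE x in lborel. ennreal ((E x)\<^sup>2) \<le> 2 * (I1 x)\<^sup>2 + 2 * (I2 x)\<^sup>2"
        using E_le
      proof eventually_elim
        fix x assume "ennreal \<bar>E x\<bar> \<le> I1 x + I2 x"
        then have "(ennreal \<bar>E x\<bar>)\<^sup>2 \<le> (I1 x + I2 x)\<^sup>2" by (rule power_mono) simp
        also have "\<dots> \<le> 2 * (I1 x)\<^sup>2 + 2 * (I2 x)\<^sup>2" by (rule ennreal_square_add_le)
        finally show "ennreal ((E x)\<^sup>2) \<le> 2 * (I1 x)\<^sup>2 + 2 * (I2 x)\<^sup>2" by (simp add: ennreal_power)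
      qed
    qed
    also have "\<dots> = 2 * (\<integral>\<^sup>+x. (I1 x)\<^sup>2 \<partial>lborel) + 2 * (\<integral>\<^sup>+x. (I2 x)\<^sup>2 \<partial>lborel)"
      by (subst nn_integral_add) (auto simp: nn_integral_cmult)
    also have "\<dots> \<le> 2 * (ennreal (C1\<^sup>2 * h powr (2 * (s + ?d - ?q))) * ?n2) + 2 * (ennreal (C3 * h powr (2 * (s + ?d - ?q))) * ?n2)"
    proof (intro add_mono mult_left_mono)
      show "(\<integral>\<^sup>+x. (I1 x)\<^sup>2 \<partial>lborel) \<le> ennreal (C1\<^sup>2 * h powr (2 * (s + ?d - ?q))) * ?n2"
        using b1 unfolding p1[symmetric] using C1(1) by (simp add: ennreal_mult)
      show "(\<integral>\<^sup>+x. (I2 x)\<^sup>2 \<partial>lborel) \<le> ennreal (C3 * h powr (2 * (s + ?d - ?q))) * ?n2"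
        using b2 unfolding p2[symmetric] using C2(1) \<Gamma> K h by (subst ennreal_mult) auto
    qed auto
    also have "\<dots> = ennreal (C * h powr (2 * (s + ?d - ?q))) * ?n2"
    proof -
      have "ennreal (C * h powr (2 * (s + ?d - ?q))) = 2 * ennreal (C1\<^sup>2 * h powr (2 * (s + ?d - ?q))) + 2 * ennreal (C3 * h powr (2 * (s + ?d - ?q)))"
        unfolding C_def distrib_right using C3 by (subst ennreal_plus) (auto simp: ennreal_mult mult.assoc)
      then show ?thesis by (simp add: distrib_right mult.assoc)
    qed
    finally show ?thesis unfolding E_def .
  qed
  moreover have "C \<ge> 0" using C3 by (simp add: C_def)
  ultimately show ?thesis by blast
qed

end

end

section \<open>Sobolev norms\<close>

text \<open>A nonempty open set is infinite, so some point of \<Omega> is missed by \<Xi>.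
  Positivity is what makes \<open>h\<close> usable as a scale, in quotients and in negative
  powers.\<close>

lemma fill_distance_pos:
  fixes \<Omega> :: "(real^'n::finite) set"
  assumes "open \<Omega>" "bounded \<Omega>" "finite \<Xi>" "\<Xi> \<noteq> {}" "\<Xi> \<subseteq> \<Omega>"
  shows "0 < fill_distance \<Xi> \<Omega>"
proof -
  obtain c where c: "c \<in> \<Xi>" using assms by blast
  have "infinite \<Omega>" using assms c by (metis finite_imp_not_open empty_iff subsetD)
  then have "\<Omega> - \<Xi> \<noteq> {}" using assms(3) by (metis Diff_eq_empty_iff finite_subset)
  then obtain x where x: "x \<in> \<Omega>" "x \<notin> \<Xi>" by blast
  have "closed \<Xi>" using assms(3) by (rule finite_imp_closed)
  then have pos: "0 < infdist x \<Xi>" using x(2) assms(4) by (simp add: infdist_pos_not_in_closed)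
  obtain B where B: "\<And>y. y \<in> \<Omega> \<Longrightarrow> dist c y \<le> B" using assms(2) unfolding bounded_any_center[where a = c] by blast
  have "bdd_above ((\<lambda>x. infdist x \<Xi>) ` \<Omega>)"
  proof (rule bdd_aboveI2)
    fix y assume "y \<in> \<Omega>"
    then show "infdist y \<Xi> \<le> B" using infdist_le[OF c, of y] B[of y] by (simp add: dist_commute)
  qed
  then have "infdist x \<Xi> \<le> fill_distance \<Xi> \<Omega>" unfolding fill_distance_def using x(1) by (intro cSUP_upper)
  then show ?thesis using pos by linarith
qed

text \<open>Replaces the data by Borel functions, as the product measure arguments require. All
  exceptional points are collected in one null set \<open>N\<close>, and everything is set to 0 off
  \<open>\<Omega> - N\<close>; on that set the new weights equal the old ones pointwise, so local
  reproduction survives.\<close>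

lemma borel_representatives:
  fixes \<Omega> :: "(real^'n::finite) set"
  assumes \<Omega>: "open \<Omega>" and fin: "finite \<Xi>" and \<nu>: "\<nu> \<in> borel_measurable lebesgue"
    and \<nu>Z: "AE x in lebesgue. x \<notin> \<Omega> \<longrightarrow> \<nu> x = 0" and a: "\<And>\<xi>. \<xi> \<in> \<Xi> \<Longrightarrow> a \<xi> \<in> borel_measurable (lebesgue_on \<Omega>)"
  shows "\<exists>\<Omega>' \<nu>' a'. \<Omega>' \<subseteq> \<Omega> \<and> \<nu>' \<in> borel_measurable borel \<and> (\<forall>\<xi>. a' \<xi> \<in> borel_measurable borel) \<and>
    (\<forall>z. z \<notin> \<Omega>' \<longrightarrow> \<nu>' z = (0 :: real) \<and> (\<forall>\<xi>. a' \<xi> z = (0 :: real))) \<and> (\<forall>z\<in>\<Omega>'. \<forall>\<xi>\<in>\<Xi>. a' \<xi> z = a \<xi> z) \<and>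
    (AE z in lebesgue. \<nu>' z = \<nu> z) \<and> (\<forall>\<xi>\<in>\<Xi>. AE z in lebesgue. a' \<xi> z * \<nu>' z = indicator \<Omega> z * (a \<xi> z * \<nu> z)) \<and>
    (\<forall>\<xi>\<in>\<Xi>. (\<lambda>z. indicator \<Omega> z * (a \<xi> z * \<nu> z)) \<in> borel_measurable lebesgue)"
proof -
  have \<Omega>b: "\<Omega> \<in> sets borel" using \<Omega> by (rule borel_open)
  have \<Omega>l: "\<Omega> \<in> sets lebesgue" using \<Omega>b by simp
  have al: "(\<lambda>z. indicator \<Omega> z *\<^sub>R a \<xi> z) \<in> borel_measurable lebesgue" if "\<xi> \<in> \<Xi>" for \<xi>
    using a[OF that] \<Omega>l by (simp add: borel_measurable_restrict_space_iff)
  obtain \<nu>1 where \<nu>1: "\<nu>1 \<in> borel_measurable lborel" "AE z in lborel. \<nu> z = \<nu>1 z"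
    using completion_ex_borel_measurable_real[OF \<nu>] by blast
  have "\<exists>g. g \<in> borel_measurable lborel \<and> (AE z in lborel. indicator \<Omega> z *\<^sub>R a \<xi> z = g z)" if "\<xi> \<in> \<Xi>" for \<xi>
    using completion_ex_borel_measurable_real[OF al[OF that]] by blast
  then obtain a1 where a1: "\<And>\<xi>. \<xi> \<in> \<Xi> \<Longrightarrow> a1 \<xi> \<in> borel_measurable lborel"
    "\<And>\<xi>. \<xi> \<in> \<Xi> \<Longrightarrow> AE z in lborel. indicator \<Omega> z *\<^sub>R a \<xi> z = a1 \<xi> z" by metis
  have ae1: "AE z in lborel. \<forall>\<xi>\<in>\<Xi>. indicator \<Omega> z *\<^sub>R a \<xi> z = a1 \<xi> z"
    by (rule AE_finite_allI[OF fin]) (rule a1(2))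
  have ae2: "AE z in lborel. z \<notin> \<Omega> \<longrightarrow> \<nu> z = 0" using \<nu>Z by (simp only: AE_completion_iff)
  have "AE z in lborel. \<nu> z = \<nu>1 z \<and> (\<forall>\<xi>\<in>\<Xi>. indicator \<Omega> z *\<^sub>R a \<xi> z = a1 \<xi> z) \<and> (z \<notin> \<Omega> \<longrightarrow> \<nu> z = 0)"
    using \<nu>1(2) ae1 ae2 by eventually_elim blast
  then obtain N where N: "{z \<in> space lborel. \<not> (\<nu> z = \<nu>1 z \<and> (\<forall>\<xi>\<in>\<Xi>. indicator \<Omega> z *\<^sub>R a \<xi> z = a1 \<xi> z) \<and> (z \<notin> \<Omega> \<longrightarrow> \<nu> z = 0))} \<subseteq> N"
    "emeasure lborel N = 0" "N \<in> sets lborel" by (rule AE_E)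
  have good: "\<nu> z = \<nu>1 z" "\<And>\<xi>. \<xi> \<in> \<Xi> \<Longrightarrow> indicator \<Omega> z *\<^sub>R a \<xi> z = a1 \<xi> z" "z \<notin> \<Omega> \<Longrightarrow> \<nu> z = 0" if "z \<notin> N" for z
    using N(1) that by auto
  have "AE z in lborel. z \<notin> N" using N by (intro AE_not_in) (auto simp: null_sets_def)
  then have aeN: "AE z in lebesgue. z \<notin> N" by (rule AE_completion)
  define \<Omega>' where "\<Omega>' = \<Omega> - N"
  define \<nu>' where "\<nu>' z = indicator \<Omega>' z * \<nu>1 z" for z
  define a' where "a' \<xi> z = (if \<xi> \<in> \<Xi> then indicator \<Omega>' z * a1 \<xi> z else 0)" for \<xi> z
  have \<Omega>'b: "\<Omega>' \<in> sets borel" using \<Omega>b N(3) by (simp add: \<Omega>'_def)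
  show ?thesis
  proof (intro exI conjI allI impI ballI)
    show "\<Omega>' \<subseteq> \<Omega>" by (auto simp: \<Omega>'_def)
    show "\<nu>' \<in> borel_measurable borel" unfolding \<nu>'_def[abs_def]
      using \<nu>1(1) \<Omega>'b by (intro borel_measurable_times borel_measurable_indicator) auto
    show "a' \<xi> \<in> borel_measurable borel" for \<xi>
    proof (cases "\<xi> \<in> \<Xi>")
      case True
      then show ?thesis unfolding a'_def[abs_def]
        using a1(1)[OF True] \<Omega>'b by (simp only: if_True) (intro borel_measurable_times borel_measurable_indicator; simp)
    qed (simp add: a'_def[abs_def])
    show "\<nu>' z = 0" if "z \<notin> \<Omega>'" for z using that by (simp add: \<nu>'_def)
    show "a' \<xi> z = 0" if "z \<notin> \<Omega>'" for z \<xi> using that by (simp add: a'_def)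
    show "a' \<xi> z = a \<xi> z" if "z \<in> \<Omega>'" "\<xi> \<in> \<Xi>" for z \<xi>
      using that good(2)[of z \<xi>] by (simp add: a'_def \<Omega>'_def)
    show "AE z in lebesgue. \<nu>' z = \<nu> z"
      using aeN
    proof eventually_elim
      fix z assume z: "z \<notin> N"
      show "\<nu>' z = \<nu> z" using good[OF z] z by (cases "z \<in> \<Omega>") (auto simp: \<nu>'_def \<Omega>'_def)
    qed
    show "AE z in lebesgue. a' \<xi> z * \<nu>' z = indicator \<Omega> z * (a \<xi> z * \<nu> z)" if "\<xi> \<in> \<Xi>" for \<xi>
      using aeN
    proof eventually_elim
      fix z assume z: "z \<notin> N"
      show "a' \<xi> z * \<nu>' z = indicator \<Omega> z * (a \<xi> z * \<nu> z)"
        using good[OF z] that z by (cases "z \<in> \<Omega>") (auto simp: \<nu>'_def a'_def \<Omega>'_def)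
    qed
    show "(\<lambda>z. indicator \<Omega> z * (a \<xi> z * \<nu> z)) \<in> borel_measurable lebesgue" if "\<xi> \<in> \<Xi>" for \<xi>
      using borel_measurable_times[OF al[OF that] \<nu>] by (simp add: mult.assoc)
  qed
qed

text \<open>Besides the change on a null set it passes from the completed measure to
  \<open>lborel\<close>, where the interpolation bound is available.\<close>

lemma slobodeckij_AE_cong:
  fixes g k :: "real^'n::finite \<Rightarrow> real"
  assumes "AE x in lebesgue. g x = k x"
  shows "slobodeckij r g = (\<integral>\<^sup>+x. \<integral>\<^sup>+y. ennreal ((k x - k y)\<^sup>2 / norm (x - y) powr (real CARD('n) + 2 * r)) \<partial>lborel \<partial>lborel)"
proof -
  have "slobodeckij r g = (\<integral>\<^sup>+x. \<integral>\<^sup>+y. ennreal ((k x - k y)\<^sup>2 / norm (x - y) powr (real CARD('n) + 2 * r)) \<partial>lebesgue \<partial>lebesgue)"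
    unfolding slobodeckij_def
  proof (rule nn_integral_cong_AE)
    show "AE x in lebesgue. (\<integral>\<^sup>+y. ennreal ((g x - g y)\<^sup>2 / norm (x - y) powr (real CARD('n) + 2 * r)) \<partial>lebesgue)
       = (\<integral>\<^sup>+y. ennreal ((k x - k y)\<^sup>2 / norm (x - y) powr (real CARD('n) + 2 * r)) \<partial>lebesgue)"
      using assms
    proof eventually_elim
      fix x assume x: "g x = k x"
      show "(\<integral>\<^sup>+y. ennreal ((g x - g y)\<^sup>2 / norm (x - y) powr (real CARD('n) + 2 * r)) \<partial>lebesgue)
       = (\<integral>\<^sup>+y. ennreal ((k x - k y)\<^sup>2 / norm (x - y) powr (real CARD('n) + 2 * r)) \<partial>lebesgue)"
        by (rule nn_integral_cong_AE) (use assms in eventually_elim, simp add: x)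
    qed
  qed
  then show ?thesis by (simp only: nn_integral_completion)
qed

lemma integrable_of_square_bounded_support:
  fixes \<nu> :: "real^'n::finite \<Rightarrow> real"
  assumes m: "\<nu> \<in> borel_measurable borel" and fin: "(\<integral>\<^sup>+z. ennreal ((\<nu> z)\<^sup>2) \<partial>lborel) < \<infinity>"
    and Z: "\<And>z. z \<notin> cball 0 R \<Longrightarrow> \<nu> z = 0"
  shows "integrable lborel \<nu>"
proof (rule integrableI_bounded)
  show "\<nu> \<in> borel_measurable lborel" using m by simp
  have [measurable]: "\<nu> \<in> borel_measurable borel" by (rule m)
  have "(\<integral>\<^sup>+z. ennreal (norm (\<nu> z)) \<partial>lborel) \<le> (\<integral>\<^sup>+z. indicator (cball 0 R) z + ennreal ((\<nu> z)\<^sup>2) \<partial>lborel)"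
  proof (rule nn_integral_mono)
    fix z
    show "ennreal (norm (\<nu> z)) \<le> indicator (cball 0 R) z + ennreal ((\<nu> z)\<^sup>2)"
    proof (cases "z \<in> cball 0 R")
      case True
      have "\<bar>\<nu> z\<bar> \<le> 1 + (\<nu> z)\<^sup>2"
        using sum_squares_bound[of "\<bar>\<nu> z\<bar>" 1] by simp
      then have "ennreal \<bar>\<nu> z\<bar> \<le> ennreal (1 + (\<nu> z)\<^sup>2)" by (rule ennreal_leI)
      then show ?thesis using True by (simp add: ennreal_plus)
    qed (simp add: Z)
  qed
  also have "\<dots> = emeasure lborel (cball (0 :: real^'n) R) + (\<integral>\<^sup>+z. ennreal ((\<nu> z)\<^sup>2) \<partial>lborel)"
    by (subst nn_integral_add) auto
  also have "\<dots> < \<infinity>"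
  proof -
    have "emeasure lborel (cball (0 :: real^'n) R) < \<infinity>" by (rule emeasure_bounded_finite) simp
    then show ?thesis using fin by simp
  qed
  finally show "(\<integral>\<^sup>+z. ennreal (norm (\<nu> z)) \<partial>lborel) < \<infinity>" .
qed

lemma L2_norm_of_AE_eq:
  fixes W u :: "real^'n::finite \<Rightarrow> real"
  assumes W: "W \<in> borel_measurable lebesgue" and ae: "AE x in lebesgue. W x = u x"
    and bd: "(\<integral>\<^sup>+x. ennreal ((u x)\<^sup>2) \<partial>lborel) \<le> ennreal B" and B: "B \<ge> 0"
  shows "square_integrable W" "(L2_norm W)\<^sup>2 \<le> B"
proof -
  have "(\<integral>\<^sup>+x. ennreal ((W x)\<^sup>2) \<partial>lebesgue) = (\<integral>\<^sup>+x. ennreal ((u x)\<^sup>2) \<partial>lebesgue)"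
    by (rule nn_integral_cong_AE) (use ae in eventually_elim, simp)
  also have "\<dots> = (\<integral>\<^sup>+x. ennreal ((u x)\<^sup>2) \<partial>lborel)" by (simp only: nn_integral_completion)
  finally have le: "(\<integral>\<^sup>+x. ennreal ((W x)\<^sup>2) \<partial>lebesgue) \<le> ennreal B" using bd by simp
  have m: "(\<lambda>x. (W x)\<^sup>2) \<in> borel_measurable lebesgue" using W by (rule borel_measurable_power)
  have "integrable lebesgue (\<lambda>x. (W x)\<^sup>2)"
  proof (rule integrableI_bounded[OF m])
    have "(\<integral>\<^sup>+x. ennreal (norm ((W x)\<^sup>2)) \<partial>lebesgue) \<le> ennreal B" using le by simp
    then show "(\<integral>\<^sup>+x. ennreal (norm ((W x)\<^sup>2)) \<partial>lebesgue) < \<infinity>" by (rule le_less_trans) simp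
  qed
  then show "square_integrable W" using W by (simp add: square_integrable_def)
  have "(L2_norm W)\<^sup>2 = (LINT x|lebesgue. (W x)\<^sup>2)" unfolding L2_norm_def by (intro real_sqrt_pow2 Bochner_Integration.integral_nonneg) simp
  also have "\<dots> = enn2real (\<integral>\<^sup>+x. ennreal ((W x)\<^sup>2) \<partial>lebesgue)" by (rule integral_eq_nn_integral[OF m]) simp
  also have "\<dots> \<le> enn2real (ennreal B)" using le by (intro enn2real_mono) auto
  also have "\<dots> = B" using B by simp
  finally show "(L2_norm W)\<^sup>2 \<le> B" .
qed

text \<open>As \<open>h \<le> 1\<close>, the orders up to \<sigma> also satisfy the bound with
  exponent \<open>e - \<sigma>\<close>. For fractional \<sigma> the seminorm concerns derivatives of
  order k, the integer part of \<sigma>, and is interpolated with order k + 1, which is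
  \<open>m\<close>; hence the bounds are assumed up to the ceiling of \<sigma>.\<close>

lemma sobolev_membership_and_norm:
  fixes u :: "'n::finite list \<Rightarrow> real^'n \<Rightarrow> real" and \<sigma> e D h Csl :: real
  assumes \<sigma>: "\<sigma> \<ge> 0" and m: "m = nat \<lceil>\<sigma>\<rceil>" and l: "\<And>js. length js \<le> m \<Longrightarrow> lint (u js)"
    and ld: "\<And>i js. length js < m \<Longrightarrow> line_deriv i (u js) (u (i # js))"
    and bd: "\<And>js. length js \<le> m \<Longrightarrow> (\<integral>\<^sup>+x. ennreal ((u js x)\<^sup>2) \<partial>lborel) \<le> ennreal (D * h powr (2 * (e - length js)))"
    and D: "D \<ge> 0" and h: "0 < h" "h \<le> 1" and Csl: "Csl \<ge> 0"
    and slob: "\<sigma> \<notin> \<int> \<Longrightarrow> \<forall>(g :: real^'n \<Rightarrow> real) G A h. g \<in> borel_measurable borel \<longrightarrow> (\<forall>i. G i \<in> borel_measurable borel) \<longrightarrow>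
    (\<forall>i. line_deriv i g (G i)) \<longrightarrow> 0 \<le> A \<longrightarrow> 0 < h \<longrightarrow>
    (\<integral>\<^sup>+x. ennreal ((g x)\<^sup>2) \<partial>lborel) \<le> ennreal (A\<^sup>2) \<longrightarrow>
    (\<forall>i. (\<integral>\<^sup>+x. ennreal ((G i x)\<^sup>2) \<partial>lborel) \<le> ennreal ((A / h)\<^sup>2)) \<longrightarrow>
    (\<integral>\<^sup>+x. \<integral>\<^sup>+y. ennreal ((g x - g y)\<^sup>2 / norm (x - y) powr (real CARD('n) + 2 * frac \<sigma>)) \<partial>lborel \<partial>lborel)
      \<le> ennreal (Csl * A\<^sup>2 * h powr (- 2 * frac \<sigma>))"
  shows "u [] \<in> sobolev_space \<sigma>"
    "sobolev_norm \<sigma> (u []) \<le> sqrt ((real (card {\<beta> :: 'n \<Rightarrow> nat. mdeg \<beta> \<le> nat \<lfloor>\<sigma>\<rfloor>}) + real (card {\<beta> :: 'n \<Rightarrow> nat. mdeg \<beta> = nat \<lfloor>\<sigma>\<rfloor>}) * Csl) * D) * h powr (e - \<sigma>)"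
proof -
  let ?k = "nat \<lfloor>\<sigma>\<rfloor>" and ?W = "\<lambda>\<beta>. weak_deriv \<beta> (u [])"
  let ?X = "D * h powr (2 * (e - \<sigma>))"
  have km: "?k \<le> m" unfolding m using \<sigma> by (intro nat_mono floor_le_ceiling)
  have rk: "real ?k \<le> \<sigma>" using \<sigma> by simp
  have wd: "is_weak_deriv \<beta> (u []) (u (rev (mlist \<beta>)))" if "mdeg \<beta> \<le> m" for \<beta>
    by (rule is_weak_deriv_chain[OF l ld that])
  have Wm: "?W \<beta> \<in> borel_measurable lebesgue" if "mdeg \<beta> \<le> m" for \<beta>
    using weak_deriv_AE_eq(2)[OF wd[OF that]] by (intro locally_integrable_measurable) (simp add: is_weak_deriv_def)
  have len: "length (rev (mlist \<beta>)) = mdeg \<beta>" for \<beta> :: "'n \<Rightarrow> nat" by (simp add: length_mlist)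
  have bd\<beta>: "(\<integral>\<^sup>+x. ennreal ((u (rev (mlist \<beta>)) x)\<^sup>2) \<partial>lborel) \<le> ennreal (D * h powr (2 * (e - mdeg \<beta>)))" if "mdeg \<beta> \<le> m" for \<beta>
    using bd[of "rev (mlist \<beta>)"] that unfolding len by simp
  have L2: "square_integrable (?W \<beta>)" "(L2_norm (?W \<beta>))\<^sup>2 \<le> D * h powr (2 * (e - mdeg \<beta>))" if "mdeg \<beta> \<le> m" for \<beta>
    using L2_norm_of_AE_eq[OF Wm[OF that] weak_deriv_AE_eq(1)[OF wd[OF that]] bd\<beta>[OF that]] D by auto
  have L2k: "(L2_norm (?W \<beta>))\<^sup>2 \<le> ?X" if "mdeg \<beta> \<le> ?k" for \<beta>
  proof -
    have "real (mdeg \<beta>) \<le> \<sigma>" using that rk by linarith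
    then have "D * h powr (2 * (e - mdeg \<beta>)) \<le> ?X" using h D by (intro mult_left_mono powr_mono') auto
    then show ?thesis using L2(2)[of \<beta>] that km by simp
  qed
  have sl: "slobodeckij (frac \<sigma>) (?W \<beta>) \<le> ennreal (Csl * ?X)" if s: "\<sigma> \<notin> \<int>" and \<beta>: "mdeg \<beta> = ?k" for \<beta>
  proof -
    have mk: "m = Suc ?k"
    proof -
      have "\<lceil>\<sigma>\<rceil> = \<lfloor>\<sigma>\<rfloor> + 1" using s by (simp add: ceiling_altdef) (metis Ints_of_int)
      then show ?thesis unfolding m using \<sigma> by (simp add: nat_add_distrib)
    qed
    \<comment> \<open>The bounds at orders k and k + 1 differ by exactly the factor 1/h that the
      interpolation asks for.\<close>
    define A where "A = sqrt D * h powr (e - ?k)"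
    have sq: "(t powr a)\<^sup>2 = t powr (2 * a)" for t a :: real
      by (simp add: power2_eq_square powr_add[symmetric])
    have A2: "A\<^sup>2 = D * h powr (2 * (e - ?k))" unfolding A_def power_mult_distrib sq using D by simp
    have Ah2: "(A / h)\<^sup>2 = D * h powr (2 * (e - Suc ?k))"
    proof -
      have "A / h = sqrt D * h powr (e - Suc ?k)"
      proof -
        have "h powr (e - Suc ?k) = h powr ((e - ?k) - 1)" by (rule arg_cong[of _ _ "(powr) h"]) simp
        also have "\<dots> = h powr (e - ?k) / h" using h by (simp add: powr_diff)
        finally show ?thesis by (simp add: A_def)
      qed
      then show ?thesis unfolding power_mult_distrib by (simp only: sq power_mult_distrib real_sqrt_pow2[OF D])
    qed
    let ?g = "u (rev (mlist \<beta>))" and ?G = "\<lambda>i. u (i # rev (mlist \<beta>))"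
    have "(\<integral>\<^sup>+x. \<integral>\<^sup>+y. ennreal ((?g x - ?g y)\<^sup>2 / norm (x - y) powr (real CARD('n) + 2 * frac \<sigma>)) \<partial>lborel \<partial>lborel) \<le> ennreal (Csl * A\<^sup>2 * h powr (- 2 * frac \<sigma>))"
    proof (rule slob[OF s, rule_format])
      show "?g \<in> borel_measurable borel" using \<beta> mk by (intro lintD(1) l) (simp add: length_mlist)
      show "?G i \<in> borel_measurable borel" for i using \<beta> mk by (intro lintD(1) l) (simp add: length_mlist)
      show "line_deriv i ?g (?G i)" for i using \<beta> mk by (intro ld) (simp add: length_mlist)
      show "0 \<le> A" using D by (simp add: A_def)
      show "0 < h" by (rule h)
      show "(\<integral>\<^sup>+x. ennreal ((?g x)\<^sup>2) \<partial>lborel) \<le> ennreal (A\<^sup>2)" unfolding A2 using bd\<beta>[of \<beta>] \<beta> mk by simp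
      show "(\<integral>\<^sup>+x. ennreal ((?G i x)\<^sup>2) \<partial>lborel) \<le> ennreal ((A / h)\<^sup>2)" for i
        unfolding Ah2 using bd[of "i # rev (mlist \<beta>)"] \<beta> mk by (simp add: length_mlist)
    qed
    also have "Csl * A\<^sup>2 * h powr (- 2 * frac \<sigma>) = Csl * ?X"
    proof -
      have "real ?k + frac \<sigma> = \<sigma>" using \<sigma> by (simp add: frac_def)
      then have "2 * (e - ?k) + - 2 * frac \<sigma> = 2 * (e - \<sigma>)" by argo
      then have "h powr (2 * (e - ?k)) * h powr (- 2 * frac \<sigma>) = h powr (2 * (e - \<sigma>))" by (simp only: powr_add[symmetric])
      then show ?thesis unfolding A2 by (simp add: mult.assoc)
    qed
    finally show ?thesis
      unfolding slobodeckij_AE_cong[OF weak_deriv_AE_eq(1)[OF wd[of \<beta>]], OF \<beta>[THEN eq_refl, THEN order_trans, OF km]] .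
  qed
  show "u [] \<in> sobolev_space \<sigma>"
    unfolding sobolev_space_def mem_Collect_eq
  proof (intro conjI allI impI)
    fix \<beta> :: "'n \<Rightarrow> nat" assume "mdeg \<beta> \<le> ?k"
    then have \<beta>: "mdeg \<beta> \<le> m" using km by simp
    show "\<exists>g. is_weak_deriv \<beta> (u []) g" using wd[OF \<beta>] by blast
    show "square_integrable (?W \<beta>)" using L2(1)[OF \<beta>] .
  next
    fix \<beta> :: "'n \<Rightarrow> nat" assume "\<sigma> \<notin> \<int>" "mdeg \<beta> = ?k"
    from sl[OF this] show "slobodeckij (frac \<sigma>) (?W \<beta>) < \<infinity>" by (rule le_less_trans) simp
  qed
  have X0: "0 \<le> ?X" using D by simp
  have s1: "(\<Sum>\<beta> | mdeg \<beta> \<le> ?k. (L2_norm (?W \<beta>))\<^sup>2) \<le> real (card {\<beta> :: 'n \<Rightarrow> nat. mdeg \<beta> \<le> ?k}) * ?X"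
    by (rule sum_bounded_above) (use L2k in auto)
  have s2: "(if \<sigma> \<in> \<int> then 0 else (\<Sum>\<beta> | mdeg \<beta> = ?k. enn2real (slobodeckij (frac \<sigma>) (?W \<beta>)))) \<le> real (card {\<beta> :: 'n \<Rightarrow> nat. mdeg \<beta> = ?k}) * (Csl * ?X)"
  proof (cases "\<sigma> \<in> \<int>")
    case True
    then show ?thesis using Csl X0 by (simp add: mult_nonneg_nonneg)
  next
    case False
    have "enn2real (slobodeckij (frac \<sigma>) (?W \<beta>)) \<le> Csl * ?X" if "mdeg \<beta> = ?k" for \<beta>
    proof -
      have "enn2real (slobodeckij (frac \<sigma>) (?W \<beta>)) \<le> enn2real (ennreal (Csl * ?X))"
        by (rule enn2real_mono[OF sl[OF False that]]) simp
      also have "\<dots> = Csl * ?X" using Csl X0 by (simp only: enn2real_ennreal mult_nonneg_nonneg)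
      finally show ?thesis .
    qed
    then have "(\<Sum>\<beta> | mdeg \<beta> = ?k. enn2real (slobodeckij (frac \<sigma>) (?W \<beta>))) \<le> real (card {\<beta> :: 'n \<Rightarrow> nat. mdeg \<beta> = ?k}) * (Csl * ?X)"
      by (intro sum_bounded_above) auto
    then show ?thesis using False by simp
  qed
  have "sobolev_norm \<sigma> (u []) \<le> sqrt (real (card {\<beta> :: 'n \<Rightarrow> nat. mdeg \<beta> \<le> ?k}) * ?X + real (card {\<beta> :: 'n \<Rightarrow> nat. mdeg \<beta> = ?k}) * (Csl * ?X))"
    unfolding sobolev_norm_def using s1 s2 by (intro real_sqrt_le_mono add_mono)
  also have "\<dots> = sqrt (((real (card {\<beta> :: 'n \<Rightarrow> nat. mdeg \<beta> \<le> ?k}) + real (card {\<beta> :: 'n \<Rightarrow> nat. mdeg \<beta> = ?k}) * Csl) * D) * h powr (2 * (e - \<sigma>)))"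
    by (rule arg_cong[of _ _ sqrt]) (simp add: algebra_simps)
  also have "\<dots> = sqrt ((real (card {\<beta> :: 'n \<Rightarrow> nat. mdeg \<beta> \<le> ?k}) + real (card {\<beta> :: 'n \<Rightarrow> nat. mdeg \<beta> = ?k}) * Csl) * D) * h powr (e - \<sigma>)"
  proof -
    have "h powr (2 * (e - \<sigma>)) = (h powr (e - \<sigma>))\<^sup>2" unfolding power2_eq_square powr_add[symmetric] by simp
    then have "sqrt (h powr (2 * (e - \<sigma>))) = h powr (e - \<sigma>)" by simp
    then show ?thesis by (simp add: real_sqrt_mult)
  qed
  finally show "sobolev_norm \<sigma> (u []) \<le> sqrt ((real (card {\<beta> :: 'n \<Rightarrow> nat. mdeg \<beta> \<le> nat \<lfloor>\<sigma>\<rfloor>}) + real (card {\<beta> :: 'n \<Rightarrow> nat. mdeg \<beta> = nat \<lfloor>\<sigma>\<rfloor>}) * Csl) * D) * h powr (e - \<sigma>)" .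
qed

section \<open>Passage from the L2 estimates to the Sobolev norm of the error\<close>

theorem theorem4p5:
  fixes \<phi> :: "real^'n::finite \<Rightarrow> real"
    and \<Omega> :: "(real^'n) set"
    and s K \<Gamma> \<sigma> :: real and L :: nat
  assumes "kernel_assumption \<phi> s L"
    and "open \<Omega>" "bounded \<Omega>" "lipschitz_boundary \<Omega>"
    and "K > 0" "\<Gamma> > 0"
    and "\<sigma> \<ge> 0" "real_of_int \<lceil>\<sigma>\<rceil> < s + real CARD('n) / 2"
  shows "\<exists>C>0. \<exists>h0>0. \<forall>\<Xi> a \<nu> p f.
    finite \<Xi> \<longrightarrow> \<Xi> \<noteq> {} \<longrightarrow> \<Xi> \<subseteq> \<Omega> \<longrightarrow> fill_distance \<Xi> \<Omega> \<le> h0 \<longrightarrow>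
    local_polynomial_reproduction L K \<Gamma> \<Xi> \<Omega> a \<longrightarrow>
    square_integrable \<nu> \<longrightarrow> (AE x in lebesgue. x \<notin> \<Omega> \<longrightarrow> \<nu> x = 0) \<longrightarrow>
    real_polynomial_function p \<longrightarrow> f = (\<lambda>x. convolution \<phi> \<nu> x + p x) \<longrightarrow>
      (\<lambda>x. f x - approximant \<phi> \<Xi> \<Omega> a \<nu> p x) \<in> sobolev_space \<sigma> \<and>
      sobolev_norm \<sigma> (\<lambda>x. f x - approximant \<phi> \<Xi> \<Omega> a \<nu> p x)
        \<le> C * fill_distance \<Xi> \<Omega> powr (s + real CARD('n) - \<sigma>) * L2_norm \<nu>"
proof -
  obtain r0 Cs CL where ker: "kernel \<phi> s r0 Cs CL L (nat \<lfloor>s + real CARD('n) - 1\<rfloor>)"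
    using kernel_assumption_imp_kernel[OF assms(1)] by blast
  define k0 where "k0 = nat \<lfloor>s + real CARD('n) - 1\<rfloor>"
  interpret kernel \<phi> s r0 Cs CL L k0 unfolding k0_def by (rule ker)
  define m where "m = nat \<lceil>\<sigma>\<rceil>"
  have "0 \<le> \<lceil>\<sigma>\<rceil>" using assms(7) by simp
  then have "real m = real_of_int \<lceil>\<sigma>\<rceil>" unfolding m_def by simp
  then have m: "real m < s + real CARD('n) / 2" using assms(8) by simp
  \<comment> \<open>Half of each available gap, so that both strict inequalities of
    \<open>kernel_order\<close> hold.\<close>
  define \<epsilon> where "\<epsilon> = min ((s + real CARD('n) / 2 - m) / 2) ((real L - s - real CARD('n)) / 2)"
  have \<epsilon>: "\<epsilon> > 0" "\<epsilon> < s + real CARD('n) / 2 - m" "\<epsilon> < real L - s - real CARD('n)"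
    using m L_gt unfolding \<epsilon>_def by (auto simp: min_less_iff_disj)
  interpret kernel_order \<phi> s r0 Cs CL L k0 m \<epsilon>
    by unfold_locales (use \<epsilon> in linarith)+
  \<comment> \<open>The constant of each word is fixed before \<open>h\<close>, the nodes, the
    weights and \<nu>, so its sum \<open>D\<close> over the finitely many words is uniform in all of
    them.\<close>
  define est where "est js C \<longleftrightarrow> (\<forall>h \<nu> \<Xi> a r. 0 < h \<longrightarrow> h \<le> 1 \<longrightarrow> 8 * (K * h) \<le> r0 \<longrightarrow>
     \<nu> \<in> borel_measurable borel \<longrightarrow> integrable lborel \<nu> \<longrightarrow> (\<forall>z. z \<notin> cball 0 r \<longrightarrow> \<nu> z = 0) \<longrightarrow> finite \<Xi> \<longrightarrow>
     (\<forall>\<xi>. a \<xi> \<in> borel_measurable borel) \<longrightarrow> (\<forall>z. (\<Sum>\<xi>\<in>\<Xi>. \<bar>a \<xi> z\<bar>) \<le> \<Gamma>) \<longrightarrow>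
     (\<forall>z. \<nu> z \<noteq> 0 \<longrightarrow> repro L \<Xi> (\<lambda>\<xi>. a \<xi> z) z (K * h) \<Gamma>) \<longrightarrow>
     (\<integral>\<^sup>+x. ennreal ((conv_diff \<nu> \<Xi> (\<lambda>\<xi>. LINT z|lborel. a \<xi> z * \<nu> z) (Phi js) x)\<^sup>2) \<partial>lborel)
       \<le> ennreal (C * h powr (2 * (s + real CARD('n) - length js))) * (\<integral>\<^sup>+z. ennreal ((\<nu> z)\<^sup>2) \<partial>lborel))" for js C
  have "\<exists>C\<ge>0. est js C" if "length js \<le> m" for js
    unfolding est_def by (rule L2_estimate[OF assms(5,6) that])
  then obtain Cf where Cf: "\<And>js. length js \<le> m \<Longrightarrow> 0 \<le> Cf js" "\<And>js. length js \<le> m \<Longrightarrow> est js (Cf js)" by metis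
  define D where "D = (\<Sum>js | length js \<le> m. Cf js)"
  have finJ: "finite {js :: 'n list. length js \<le> m}" using finite_lists_length_le[of "UNIV :: 'n set" m] by simp
  have D0: "D \<ge> 0" unfolding D_def using Cf(1) by (intro sum_nonneg) simp
  have DC: "Cf js \<le> D" if "length js \<le> m" for js
    unfolding D_def using that Cf(1) by (intro member_le_sum finJ) auto
  obtain Csl where Csl: "Csl \<ge> 0" and slob: "\<sigma> \<notin> \<int> \<Longrightarrow> \<forall>(g :: real^'n \<Rightarrow> real) G A h. g \<in> borel_measurable borel \<longrightarrow> (\<forall>i. G i \<in> borel_measurable borel) \<longrightarrow>
    (\<forall>i. line_deriv i g (G i)) \<longrightarrow> 0 \<le> A \<longrightarrow> 0 < h \<longrightarrow>
    (\<integral>\<^sup>+x. ennreal ((g x)\<^sup>2) \<partial>lborel) \<le> ennreal (A\<^sup>2) \<longrightarrow>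
    (\<forall>i. (\<integral>\<^sup>+x. ennreal ((G i x)\<^sup>2) \<partial>lborel) \<le> ennreal ((A / h)\<^sup>2)) \<longrightarrow>
    (\<integral>\<^sup>+x. \<integral>\<^sup>+y. ennreal ((g x - g y)\<^sup>2 / norm (x - y) powr (real CARD('n) + 2 * frac \<sigma>)) \<partial>lborel \<partial>lborel)
      \<le> ennreal (Csl * A\<^sup>2 * h powr (- 2 * frac \<sigma>))"
  proof (cases "\<sigma> \<in> \<int>")
    case True
    \<comment> \<open>For integer \<sigma> there is no seminorm to bound, and 0 serves as
      constant.\<close>
    then show ?thesis using that[of 0] by simp
  next
    case False
    have "0 < frac \<sigma>" "frac \<sigma> < 1" using False by (simp_all add: frac_gt_0_iff frac_lt_1)
    from slobodeckij_lborel_bound[OF this, where 'n = 'n] show ?thesis using that by blast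
  qed
  define N where "N = real (card {\<beta> :: 'n \<Rightarrow> nat. mdeg \<beta> \<le> nat \<lfloor>\<sigma>\<rfloor>}) + real (card {\<beta> :: 'n \<Rightarrow> nat. mdeg \<beta> = nat \<lfloor>\<sigma>\<rfloor>}) * Csl"
  have N0: "N \<ge> 0" using Csl by (simp add: N_def)
  \<comment> \<open>The summand 1 only ensures that \<open>C\<close> is positive.\<close>
  define C where "C = sqrt (N * D) + 1"
  \<comment> \<open>\<open>h \<le> 1\<close> lets lower orders be absorbed, and
    \<open>8 * (K * h) \<le> r0\<close> keeps the origin and the sphere apart at scale
    \<open>K * h\<close>.\<close>
  define h0 where "h0 = min 1 (r0 / (8 * K))"
  have "sqrt (N * D) \<ge> 0" using N0 D0 by simp
  then have C0: "C > 0" unfolding C_def by linarith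
  have h0: "h0 > 0" using r0_pos assms(5) by (simp add: h0_def)
  obtain R where R: "\<Omega> \<subseteq> cball 0 R" using bounded_subset_cball_0[OF assms(3)] by blast
  have main: "(\<lambda>x. f x - approximant \<phi> \<Xi> \<Omega> a \<nu> p x) \<in> sobolev_space \<sigma> \<and>
      sobolev_norm \<sigma> (\<lambda>x. f x - approximant \<phi> \<Xi> \<Omega> a \<nu> p x)
        \<le> C * fill_distance \<Xi> \<Omega> powr (s + real CARD('n) - \<sigma>) * L2_norm \<nu>"
    if fin: "finite \<Xi>" and ne: "\<Xi> \<noteq> {}" and sub: "\<Xi> \<subseteq> \<Omega>" and fd: "fill_distance \<Xi> \<Omega> \<le> h0"
      and lpr: "local_polynomial_reproduction L K \<Gamma> \<Xi> \<Omega> a" and sq: "square_integrable \<nu>"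
      and \<nu>Z: "AE x in lebesgue. x \<notin> \<Omega> \<longrightarrow> \<nu> x = 0" and f: "f = (\<lambda>x. convolution \<phi> \<nu> x + p x)"
    for \<Xi> a \<nu> p f
  proof -
    define h where "h = fill_distance \<Xi> \<Omega>"
    have hpos: "h > 0" unfolding h_def by (rule fill_distance_pos[OF assms(2,3) fin ne sub])
    have h1: "h \<le> 1" using fd by (simp add: h_def h0_def)
    have "h \<le> r0 / (8 * K)" using fd by (simp add: h_def h0_def)
    then have hr: "8 * (K * h) \<le> r0" using assms(5) by (simp add: field_simps)
    have \<nu>m: "\<nu> \<in> borel_measurable lebesgue" using sq by (simp add: square_integrable_def)
    have am: "\<And>\<xi>. \<xi> \<in> \<Xi> \<Longrightarrow> a \<xi> \<in> borel_measurable (lebesgue_on \<Omega>)"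
      using lpr by (simp add: local_polynomial_reproduction_def)
    obtain \<Omega>' \<nu>' a' where sub': "\<Omega>' \<subseteq> \<Omega>" and \<nu>'m: "\<nu>' \<in> borel_measurable borel" and a'm: "\<forall>\<xi>. a' \<xi> \<in> borel_measurable borel"
      and Z: "\<forall>z. z \<notin> \<Omega>' \<longrightarrow> \<nu>' z = 0 \<and> (\<forall>\<xi>. a' \<xi> z = 0)" and eqa: "\<forall>z\<in>\<Omega>'. \<forall>\<xi>\<in>\<Xi>. a' \<xi> z = a \<xi> z"
      and ae\<nu>: "AE z in lebesgue. \<nu>' z = \<nu> z" and aea: "\<forall>\<xi>\<in>\<Xi>. AE z in lebesgue. a' \<xi> z * \<nu>' z = indicator \<Omega> z * (a \<xi> z * \<nu> z)"
      and mprod: "\<forall>\<xi>\<in>\<Xi>. (\<lambda>z. indicator \<Omega> z * (a \<xi> z * \<nu> z)) \<in> borel_measurable lebesgue"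
      by (rule revcut_rl[OF borel_representatives[where a = a, OF assms(2) fin \<nu>m \<nu>Z]], erule am, elim exE conjE, rule that)
    have Zr: "\<nu>' z = 0" if "z \<notin> cball 0 R" for z
      using Z R sub' that by blast
    define V where "V = (L2_norm \<nu>)\<^sup>2"
    have V0: "V \<ge> 0" by (simp add: V_def)
    have n2: "(\<integral>\<^sup>+z. ennreal ((\<nu>' z)\<^sup>2) \<partial>lborel) = ennreal V"
    proof -
      have "(\<integral>\<^sup>+z. ennreal ((\<nu>' z)\<^sup>2) \<partial>lborel) = (\<integral>\<^sup>+z. ennreal ((\<nu>' z)\<^sup>2) \<partial>lebesgue)" by (simp only: nn_integral_completion)
      also have "\<dots> = (\<integral>\<^sup>+z. ennreal ((\<nu> z)\<^sup>2) \<partial>lebesgue)"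
        by (rule nn_integral_cong_AE) (use ae\<nu> in eventually_elim, simp)
      also have "\<dots> = ennreal (LINT z|lebesgue. (\<nu> z)\<^sup>2)"
        by (rule nn_integral_eq_integral) (use sq in \<open>auto simp: square_integrable_def\<close>)
      also have "(LINT z|lebesgue. (\<nu> z)\<^sup>2) = V"
        unfolding V_def L2_norm_def by (intro real_sqrt_pow2[symmetric] Bochner_Integration.integral_nonneg) simp
      finally show ?thesis .
    qed
    have \<nu>'i: "integrable lborel \<nu>'"
      by (rule integrable_of_square_bounded_support[OF \<nu>'m _ Zr]) (simp_all add: n2)
    define b where "b \<xi> = (LINT z|lborel. a' \<xi> z * \<nu>' z)" for \<xi>
    define u where "u js = conv_diff \<nu>' \<Xi> b (Phi js)" for js
    \<comment> \<open>Required for all \<open>z\<close>, not only in the domain; elsewhere the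
      weights are 0 and \<Gamma> is positive.\<close>
    have sum\<Gamma>: "(\<Sum>\<xi>\<in>\<Xi>. \<bar>a' \<xi> z\<bar>) \<le> \<Gamma>" for z
    proof (cases "z \<in> \<Omega>'")
      case True
      then have "(\<Sum>\<xi>\<in>\<Xi>. \<bar>a' \<xi> z\<bar>) = (\<Sum>\<xi>\<in>\<Xi>. \<bar>a \<xi> z\<bar>)" using eqa by (intro sum.cong) auto
      also have "\<dots> \<le> \<Gamma>" using lpr True sub' unfolding local_polynomial_reproduction_def by blast
      finally show ?thesis .
    next
      case False
      then show ?thesis using Z assms(6) by simp
    qed
    have rp: "repro L \<Xi> (\<lambda>\<xi>. a' \<xi> z) z (K * h) \<Gamma>" if "\<nu>' z \<noteq> 0" for z
    proof -
      have z': "z \<in> \<Omega>'" using Z that by blast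
      then have z: "z \<in> \<Omega>" using sub' by blast
      have l1: "\<forall>\<xi>\<in>\<Xi>. dist \<xi> z > K * h \<longrightarrow> a \<xi> z = 0"
        and l2: "\<forall>p. polynomial_deg_le L p \<longrightarrow> (\<Sum>\<xi>\<in>\<Xi>. a \<xi> z * p \<xi>) = p z"
        using lpr z unfolding local_polynomial_reproduction_def h_def by blast+
      show ?thesis
        unfolding repro_def
      proof (intro conjI ballI allI impI)
        show "finite \<Xi>" by (rule fin)
        show "(\<Sum>\<xi>\<in>\<Xi>. \<bar>a' \<xi> z\<bar>) \<le> \<Gamma>" by (rule sum\<Gamma>)
        show "norm (z - \<xi>) \<le> K * h" if \<xi>: "\<xi> \<in> \<Xi>" "a' \<xi> z \<noteq> 0" for \<xi>
        proof (rule ccontr)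
          assume "\<not> norm (z - \<xi>) \<le> K * h"
          then have "dist \<xi> z > K * h" by (simp add: dist_norm norm_minus_commute)
          then have "a' \<xi> z = 0" using l1 \<xi>(1) eqa z' by simp
          then show False using \<xi>(2) by contradiction
        qed
        fix p :: "real^'n \<Rightarrow> real" assume p: "polynomial_deg_le L p"
        have "(\<Sum>\<xi>\<in>\<Xi>. a' \<xi> z * p \<xi>) = (\<Sum>\<xi>\<in>\<Xi>. a \<xi> z * p \<xi>)" using eqa z' by (intro sum.cong) auto
        then show "(\<Sum>\<xi>\<in>\<Xi>. a' \<xi> z * p \<xi>) = p z" using l2 p by simp
      qed
    qed
    have lu: "lint (u js)" if "length js \<le> m" for js
      unfolding u_def by (rule lint_conv_diff[OF \<nu>'m \<nu>'i _ fin lint_Phi[OF that]]) (rule Zr)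
    have du: "line_deriv i (u js) (u (i # js))" if "length js < m" for i js
      unfolding u_def
      by (rule line_deriv_conv_diff[OF \<nu>'m \<nu>'i _ fin lint_Phi lint_Phi line_deriv_Phi[OF that]]) (use that Zr in auto)
    have bu: "(\<integral>\<^sup>+x. ennreal ((u js x)\<^sup>2) \<partial>lborel) \<le> ennreal ((D * V) * h powr (2 * (s + real CARD('n) - length js)))"
      if js: "length js \<le> m" for js
    proof -
      have "(\<integral>\<^sup>+x. ennreal ((u js x)\<^sup>2) \<partial>lborel) \<le> ennreal (Cf js * h powr (2 * (s + real CARD('n) - length js))) * (\<integral>\<^sup>+z. ennreal ((\<nu>' z)\<^sup>2) \<partial>lborel)"
        unfolding u_def b_def
      proof (rule Cf(2)[OF js, unfolded est_def, rule_format])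
        show "\<nu>' z = 0" if "z \<notin> cball 0 R" for z using that by (rule Zr)
        show "a' \<xi> \<in> borel_measurable borel" for \<xi> using a'm by simp
        show "(\<Sum>\<xi>\<in>\<Xi>. \<bar>a' \<xi> z\<bar>) \<le> \<Gamma>" for z by (rule sum\<Gamma>)
        show "repro L \<Xi> (\<lambda>\<xi>. a' \<xi> z) z (K * h) \<Gamma>" if "\<nu>' z \<noteq> 0" for z using that by (rule rp)
      qed (fact hpos h1 hr \<nu>'m \<nu>'i fin)+
      also have "\<dots> = ennreal (Cf js * h powr (2 * (s + real CARD('n) - length js)) * V)"
        unfolding n2 using Cf(1)[OF js] V0 by (intro ennreal_mult[symmetric]) auto
      also have "\<dots> \<le> ennreal ((D * V) * h powr (2 * (s + real CARD('n) - length js)))"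
      proof (rule ennreal_leI)
        have "Cf js * (V * h powr (2 * (s + real CARD('n) - length js))) \<le> D * (V * h powr (2 * (s + real CARD('n) - length js)))"
          using DC[OF js] V0 by (intro mult_right_mono) auto
        then show "Cf js * h powr (2 * (s + real CARD('n) - length js)) * V \<le> (D * V) * h powr (2 * (s + real CARD('n) - length js))"
          by (simp add: mult_ac)
      qed
      finally show ?thesis .
    qed
    \<comment> \<open>An identity at every point: the polynomial cancels, the data enter only
      through integrals, which do not notice the change of representatives, and
      \<open>Phi []\<close> is \<phi> itself.\<close>
    have Eq: "(\<lambda>x. f x - approximant \<phi> \<Xi> \<Omega> a \<nu> p x) = u []"
    proof
      fix x
      have \<phi>m: "(\<lambda>z. \<phi> (x - z)) \<in> borel_measurable borel"
        by (intro borel_measurable_continuous_onI continuous_on_compose2[OF cont] continuous_intros) auto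
      have "convolution \<phi> \<nu> x = (LINT z|lebesgue. \<nu>' z * \<phi> (x - z))"
        unfolding convolution_def
      proof (rule integral_cong_AE)
        show "(\<lambda>z. \<phi> (x - z) * \<nu> z) \<in> borel_measurable lebesgue"
          using \<phi>m by (intro borel_measurable_times \<nu>m measurable_completion) simp
        show "(\<lambda>z. \<nu>' z * \<phi> (x - z)) \<in> borel_measurable lebesgue"
          using \<phi>m \<nu>'m by (intro borel_measurable_times measurable_completion) simp_all
        show "AE z in lebesgue. \<phi> (x - z) * \<nu> z = \<nu>' z * \<phi> (x - z)"
          using ae\<nu> by eventually_elim simp
      qed
      also have "\<dots> = (LINT z|lborel. \<nu>' z * \<phi> (x - z))"
        using \<phi>m \<nu>'m by (intro integral_completion borel_measurable_times) simp_all
      finally have c: "convolution \<phi> \<nu> x = (LINT z|lborel. \<nu>' z * \<phi> (x - z))" .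
      have bb: "(LINT z:\<Omega>|lebesgue. a \<xi> z * \<nu> z) = b \<xi>" if \<xi>: "\<xi> \<in> \<Xi>" for \<xi>
      proof -
        have am': "(\<lambda>z. a' \<xi> z * \<nu>' z) \<in> borel_measurable lborel" using a'm \<nu>'m by (intro borel_measurable_times) simp_all
        have "(LINT z:\<Omega>|lebesgue. a \<xi> z * \<nu> z) = (LINT z|lebesgue. a' \<xi> z * \<nu>' z)"
          unfolding set_lebesgue_integral_def
        proof (rule integral_cong_AE)
          show "(\<lambda>z. indicator \<Omega> z *\<^sub>R (a \<xi> z * \<nu> z)) \<in> borel_measurable lebesgue" using mprod \<xi> by simp
          show "(\<lambda>z. a' \<xi> z * \<nu>' z) \<in> borel_measurable lebesgue" using am' by (rule measurable_completion)
          have "AE z in lebesgue. a' \<xi> z * \<nu>' z = indicator \<Omega> z * (a \<xi> z * \<nu> z)" using aea \<xi> by blast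
          then show "AE z in lebesgue. indicator \<Omega> z *\<^sub>R (a \<xi> z * \<nu> z) = a' \<xi> z * \<nu>' z"
            by eventually_elim simp
        qed
        also have "\<dots> = b \<xi>" unfolding b_def by (rule integral_completion[OF am'])
        finally show ?thesis .
      qed
      have "(\<Sum>\<xi>\<in>\<Xi>. (LINT z:\<Omega>|lebesgue. a \<xi> z * \<nu> z) * \<phi> (x - \<xi>)) = (\<Sum>\<xi>\<in>\<Xi>. b \<xi> * \<phi> (x - \<xi>))"
        by (intro sum.cong refl) (simp only: bb)
      then show "f x - approximant \<phi> \<Xi> \<Omega> a \<nu> p x = u [] x"
        unfolding f approximant_def u_def conv_diff_def c by (simp add: Phi_def)
    qed
    have DV: "0 \<le> D * V" using D0 V0 by simp
    note res = sobolev_membership_and_norm[OF assms(7) m_def lu du bu DV hpos h1 Csl slob]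
    have "sobolev_norm \<sigma> (u []) \<le> sqrt (N * (D * V)) * h powr (s + real CARD('n) - \<sigma>)"
      unfolding N_def by (rule res(2))
    also have "sqrt (N * (D * V)) = sqrt (N * D) * L2_norm \<nu>"
    proof -
      have "0 \<le> L2_norm \<nu>" unfolding L2_norm_def by (intro real_sqrt_ge_zero Bochner_Integration.integral_nonneg) simp
      then show ?thesis by (simp add: V_def real_sqrt_mult)
    qed
    also have "sqrt (N * D) * L2_norm \<nu> * h powr (s + real CARD('n) - \<sigma>) \<le> C * h powr (s + real CARD('n) - \<sigma>) * L2_norm \<nu>"
    proof -
      have "0 \<le> L2_norm \<nu>" unfolding L2_norm_def by (intro real_sqrt_ge_zero Bochner_Integration.integral_nonneg) simp
      then have "sqrt (N * D) * (L2_norm \<nu> * h powr (s + real CARD('n) - \<sigma>)) \<le> C * (L2_norm \<nu> * h powr (s + real CARD('n) - \<sigma>))"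
        unfolding C_def by (intro mult_right_mono) auto
      then show ?thesis by (simp add: mult_ac)
    qed
    finally have "sobolev_norm \<sigma> (u []) \<le> C * h powr (s + real CARD('n) - \<sigma>) * L2_norm \<nu>" .
    then show ?thesis unfolding Eq h_def using res(1) by simp
  qed
  show ?thesis
    by (intro exI[of _ C] exI[of _ h0] conjI C0 h0 allI impI main) auto
qed

end
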